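(* Let $\alpha\in(0,2)$ and let $f:\mathbb{R}\to\mathbb{R}$, $f\in L^\alpha(\mathbb{R})$, be positive semidefinite and not identically zero. Let $X(t)=\int_{\mathbb{R}}f(t-s)\,\Lambda(ds)$, $t\in\mathbb{R}$, be the associated $S\alpha S$ moving average. Let $\Delta_n>0$ with $\Delta_n\to0$ and $n\Delta_n\to\infty$; let $m_n$ be positive integers with $m_n\to\infty$, $m_n=o(n)$; let $\{W_n(m):|m|\le m_n\}$, $n\ge1$, be real weights and $\{a_n\}$ a deterministic sequence of positive numbers. Put $W_n^*=\max_{|m|\le m_n}W_n(m)$, $W_n^{(2)}=\sum_{|m|\le m_n}m^2W_n(m)$ and $\omega_f(\delta)=\sup_{|t-s|<\delta}|f(t)-f(s)|$. Assume that, as $n\to\infty$: (W1) $W_n(m)\ge0$; (W2) $\sum_{|m|\le m_n}W_n(m)=1$; (W3) $W_n^*\to0$; (W4) $W_n^{(2)}=o((n\Delta_n)^2)$; (A1) $a_n\to\infty$; (A2) $a_n^2W_n^*\to0$; (A3) $a_n^{3/4}=o((n\Delta_n)^{1/\alpha})$; (A4) $a_n^2\Delta_n\to0$; (A5) $a_n^2W_n^{(2)}=o((n\Delta_n)^2)$. Let $g=f/\|f\|_2$ and let $\tilde g$ be the estimator of $g$ defined in the context. Assume that one of the following two cases holds. Case 1 (compact support): $f$ is supported by $[-T,T]$ and $a_n\,\omega_f(\Delta_n)\to0$ as $n\to\infty$. In this case put $\widetilde{\|g\|}_\alpha=\bigl(\int_{-T}^{T}|\tilde g(t)|^\alpha dt\bigr)^{1/\alpha}$.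 Case 2 (non-compact support): for some $a>\max\{2,1/\alpha\}$, as $n\to\infty$, (F2$'$) $a_n\,\omega_f(\Delta_n)^{1-1/a}\to0$; (F3$'$) $f(t)=O(|t|^{-a})$ as $|t|\to\infty$; (F4$'$) $a_n^{3/4}=o\bigl(\omega_f(\Delta_n)^{1/(a\alpha)}(n\Delta_n)^{1/\alpha}\bigr)$; and $\{b_n\}$ is a deterministic sequence of positive numbers such that, as $n\to\infty$, (B1) $b_n\to\infty$; (B2) $b_n^{2/\alpha-1}a_n^2W_n^*\to0$; (B3) $b_n^{2/\alpha-1}a_n=o((n\Delta_n)^{1/\alpha})$; (B4) $b_n^{2/\alpha-1}a_n^4\Delta_n^2\to0$; (B5) $b_n^{2/\alpha-1}a_n^2W_n^{(2)}=o((n\Delta_n)^2)$; (B6) $b_n^{2/\alpha-1}a_n^2\,\omega_f(\Delta_n)^{2-2/a}\to0$; (B7) $b_n^{2/\alpha-1}\int_{\{|\lambda|>a_n\}}\hat g(\lambda)^2d\lambda\to0$. In this case put $\widetilde{\|g\|}_\alpha=\bigl(\int_{-b_n}^{b_n}|\tilde g(t)|^\alpha dt\bigr)^{1/\alpha}$. Let $\widetilde\sigma_{X(0)}$ be any weakly consistent estimator, based on $X(t_{1,n}),\dots,X(t_{n,n})$, of the scale parameter $\sigma_{X(0)}=\|f\|_\alpha$ of $X(0)$. Define $\widetilde{\|f\|}_2=\widetilde\sigma_{X(0)}/\widetilde{\|g\|}_\alpha$ and $\tilde f=\widetilde{\|f\|}_2\cdot\tilde g$. Then, as $n\to\infty$,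 $$\widetilde{\|f\|}_2\to\|f\|_2\quad\text{in probability}\qquad\text{and}\qquad\|\tilde f-f\|_2\to0\quad\text{in probability}.$$
   Context: $\Lambda$ is an independently scattered symmetric $\alpha$-stable ($S\alpha S$) random measure on $\mathbb{R}$ with Lebesgue control measure: values on disjoint bounded Borel sets are independent and $\mathsf{E}e^{iu\Lambda(B)}=e^{-|B||u|^\alpha}$. The scale parameter of an $S\alpha S$ variable $Y$ is the $\sigma\ge0$ with $\mathsf{E}e^{iuY}=e^{-\sigma^\alpha|u|^\alpha}$. The observations are $X(t_{k,n})$, $k=1,\dots,n$, with $t_{k,n}=k\Delta_n$. An estimator is weakly consistent if it converges in probability to the estimated quantity as $n\to\infty$. For $p>0$, $\|h\|_p=(\int_{\mathbb{R}}|h(t)|^pdt)^{1/p}$. The self-normalized periodogram is $$I_{n,X}(\lambda)=\frac{\bigl|\sum_{j=1}^nX(t_{j,n})e^{it_{j,n}\lambda}\bigr|^2}{\sum_{j=1}^nX(t_{j,n})^2},$$ and its smoothed version is $$I^s_{n,X}(\lambda)=\sum_{|m|\le m_n}W_n(m)\,I_{n,X}\Bigl(\lambda+\frac{m}{n\Delta_n}\Bigr).$$ The Fourier transform is $\hat g(\lambda)=\int_{\mathbb{R}}g(t)e^{-i\lambda t}dt$ (real-valued here, since a real positive semidefinite function is even). The estimator of $g$ is $$\tilde g(t)=\frac1{2\pi}\int_{-a_n}^{a_n}\sqrt{\Delta_nI^s_{n,X}(\lambda)}\,e^{it\lambda}\,d\lambda,\quad t\in\mathbb{R}.$$ A function $f$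 is positive semidefinite if $\sum_{i,j}f(t_i-t_j)z_i\overline{z_j}\ge0$ for all finite families $t_i\in\mathbb{R}$, $z_i\in\mathbb{C}$. *)

theory Defs
  imports "HOL-Probability.Probability" "HOL-Library.Landau_Symbols"
begin

section \<open>Deterministic notions\<close>

definition Lp_norm_on :: "real set \<Rightarrow> real \<Rightarrow> (real \<Rightarrow> 'b::{real_normed_vector}) \<Rightarrow> real" where
  "Lp_norm_on A p h = (LINT t:A|lborel. norm (h t) powr p) powr (1 / p)"

text \<open>
  The Bochner integral of a non-integrable function is 0, so \<open>Lp_norm p h\<close> is only
  meaningful together with \<open>in_Lp p h\<close>.
\<close>

abbreviation Lp_norm :: "real \<Rightarrow> (real \<Rightarrow> 'b::{real_normed_vector}) \<Rightarrow> real" where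
  "Lp_norm p h \<equiv> Lp_norm_on UNIV p h"

definition in_Lp :: "real \<Rightarrow> (real \<Rightarrow> 'b::{real_normed_vector}) \<Rightarrow> bool" where
  "in_Lp p h \<longleftrightarrow> h \<in> borel_measurable borel \<and> integrable lborel (\<lambda>t. norm (h t) powr p)"

text \<open>Membership in \<open>\<real>\<^sub>\<ge>\<^sub>0\<close> says that the complex double sum is real and nonnegative.\<close>

definition positive_semidefinite :: "(real \<Rightarrow> real) \<Rightarrow> bool" where
  "positive_semidefinite f \<longleftrightarrow>
     (\<forall>(N::nat) (t::nat \<Rightarrow> real) (z::nat \<Rightarrow> complex).
        (\<Sum>i<N. \<Sum>j<N. complex_of_real (f (t i - t j)) * z i * cnj (z j)) \<in> \<real>\<^sub>\<ge>\<^sub>0)"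

text \<open>
  For \<open>\<delta> > 0\<close> and bounded \<open>f\<close> (in particular for positive semidefinite \<open>f\<close>) the set below is
  nonempty and bounded, so this is a genuine supremum.
\<close>

definition modulus_of_continuity :: "(real \<Rightarrow> real) \<Rightarrow> real \<Rightarrow> real" where
  "modulus_of_continuity f \<delta> = Sup {\<bar>f t - f s\<bar> | t s. \<bar>t - s\<bar> < \<delta>}"

definition fourier :: "(real \<Rightarrow> real) \<Rightarrow> real \<Rightarrow> complex" where
  "fourier g u = (LINT t|lborel. complex_of_real (g t) * exp (- (\<i> * of_real (u * t))))"

definition max_weight :: "nat \<Rightarrow> (int \<Rightarrow> real) \<Rightarrow> real" where
  "max_weight m W = Max (W ` {- int m..int m})"

definition weight_second_moment :: "nat \<Rightarrow> (int \<Rightarrow> real) \<Rightarrow> real" where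
  "weight_second_moment m W = (\<Sum>k = - int m..int m. (of_int k)\<^sup>2 * W k)"


section \<open>Probabilistic notions\<close>

text \<open>
  Real random variables on \<open>M\<close>.  Only eventual measurability is required, so that the
  value of a sequence at index 0 plays no role.
\<close>

definition converges_in_probability ::
    "'w measure \<Rightarrow> (nat \<Rightarrow> 'w \<Rightarrow> real) \<Rightarrow> ('w \<Rightarrow> real) \<Rightarrow> bool" where
  "converges_in_probability M Y Z \<longleftrightarrow>
     (\<forall>\<^sub>F n in sequentially. Y n \<in> borel_measurable M) \<and> Z \<in> borel_measurable M \<and>
     (\<forall>\<epsilon>>0. (\<lambda>n. measure M {w \<in> space M. \<bar>Y n w - Z w\<bar> > \<epsilon>}) \<longlonglongrightarrow> 0)"

definition SaS_scale :: "'w measure \<Rightarrow> real \<Rightarrow> ('w \<Rightarrow> real) \<Rightarrow> real \<Rightarrow> bool" where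
  "SaS_scale M \<alpha> Y \<sigma> \<longleftrightarrow> Y \<in> borel_measurable M \<and> \<sigma> \<ge> 0 \<and>
     (\<forall>u. char (distr M borel Y) u = of_real (exp (- (\<sigma> powr \<alpha> * \<bar>u\<bar> powr \<alpha>))))"

text \<open>
  Control measure: Lebesgue.  \<open>\<Lambda>\<close> is only relevant on bounded Borel sets.  Finite families are
  covered by the sequences below, by appending empty sets.
\<close>

definition SaS_random_measure ::
    "'w measure \<Rightarrow> real \<Rightarrow> (real set \<Rightarrow> 'w \<Rightarrow> real) \<Rightarrow> bool" where
  "SaS_random_measure M \<alpha> \<Lambda> \<longleftrightarrow>
     (\<forall>B. B \<in> sets borel \<and> bounded B \<longrightarrow>
        \<Lambda> B \<in> borel_measurable M \<and>
        (\<forall>u. char (distr M borel (\<Lambda> B)) u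
               = of_real (exp (- (measure lborel B * \<bar>u\<bar> powr \<alpha>))))) \<and>
     (\<forall>B :: nat \<Rightarrow> real set.
        (\<forall>i. B i \<in> sets borel \<and> bounded (B i)) \<and> disjoint_family B \<longrightarrow>
        prob_space.indep_vars M (\<lambda>_. borel) (\<lambda>i. \<Lambda> (B i)) UNIV) \<and>
     (\<forall>B :: nat \<Rightarrow> real set.
        (\<forall>i. B i \<in> sets borel) \<and> bounded (\<Union>i. B i) \<and> disjoint_family B \<longrightarrow>
        (AE w in M. (\<lambda>i. \<Lambda> (B i) w) sums \<Lambda> (\<Union>i. B i) w))"

text \<open>
  The stochastic integral: for a simple function \<open>\<phi>\<close> of bounded support,
  \<open>\<integral>\<phi> d\<Lambda> = \<Sum>c\<noteq>0. c \<Lambda>({\<phi> = c})\<close>; for \<open>h\<close> in \<open>L\<^sup>\<alpha>\<close> it is the limit in probability of the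
  integrals of simple functions converging to \<open>h\<close> in \<open>L\<^sup>\<alpha>\<close>.  The integral is determined
  only up to almost sure equality, hence a relation.
\<close>

definition simple_stochastic_integral ::
    "(real set \<Rightarrow> 'w \<Rightarrow> real) \<Rightarrow> (real \<Rightarrow> real) \<Rightarrow> 'w \<Rightarrow> real" where
  "simple_stochastic_integral \<Lambda> \<phi> w = (\<Sum>c\<in>range \<phi> - {0}. c * \<Lambda> (\<phi> -` {c}) w)"

definition is_stochastic_integral ::
    "'w measure \<Rightarrow> real \<Rightarrow> (real set \<Rightarrow> 'w \<Rightarrow> real) \<Rightarrow> (real \<Rightarrow> real) \<Rightarrow> ('w \<Rightarrow> real) \<Rightarrow> bool" where
  "is_stochastic_integral M \<alpha> \<Lambda> h Y \<longleftrightarrow>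
     (\<exists>\<phi> :: nat \<Rightarrow> real \<Rightarrow> real.
        (\<forall>k. simple_function borel (\<phi> k) \<and> bounded {s. \<phi> k s \<noteq> 0}) \<and>
        (\<lambda>k. \<integral>\<^sup>+ s. ennreal (\<bar>\<phi> k s - h s\<bar> powr \<alpha>) \<partial>lborel) \<longlonglongrightarrow> 0 \<and>
        converges_in_probability M (\<lambda>k. simple_stochastic_integral \<Lambda> (\<phi> k)) Y)"


section \<open>Periodogram and estimators\<close>

text \<open>Below, \<open>x j\<close> stands for the observation at time \<open>j \<Delta>\<close>, for \<open>j = 1, \<dots>, n\<close>.\<close>

definition periodogram :: "real \<Rightarrow> nat \<Rightarrow> (nat \<Rightarrow> real) \<Rightarrow> real \<Rightarrow> real" where
  "periodogram \<Delta> n x u =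
     (cmod (\<Sum>j=1..n. of_real (x j) * exp (\<i> * of_real (real j * \<Delta> * u))))\<^sup>2 / (\<Sum>j=1..n. (x j)\<^sup>2)"

definition smoothed_periodogram ::
    "real \<Rightarrow> nat \<Rightarrow> nat \<Rightarrow> (int \<Rightarrow> real) \<Rightarrow> (nat \<Rightarrow> real) \<Rightarrow> real \<Rightarrow> real" where
  "smoothed_periodogram \<Delta> n m W x u =
     (\<Sum>k = - int m..int m. W k * periodogram \<Delta> n x (u + of_int k / (real n * \<Delta>)))"

text \<open>Complex-valued in general, since the weights need not be symmetric.\<close>

definition kernel_estimator ::
    "real \<Rightarrow> nat \<Rightarrow> nat \<Rightarrow> (int \<Rightarrow> real) \<Rightarrow> real \<Rightarrow> (nat \<Rightarrow> real) \<Rightarrow> real \<Rightarrow> complex" where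
  "kernel_estimator \<Delta> n m W a x t =
     of_real (1 / (2 * pi)) *
     (LINT u:{-a..a}|lborel.
        of_real (sqrt (\<Delta> * smoothed_periodogram \<Delta> n m W x u)) * exp (\<i> * of_real (t * u)))"

end

theory Submission
  imports Defs
begin

text \<open>
  Let \<open>\<xi>\<close> be the increments of \<open>\<Lambda>\<close> over the cells of the time grid and \<open>\<kappa>\<^sup>2 = \<Delta> \<Sum>X\<^sup>2 / \<Sum>\<xi>\<^sup>2\<close>.  Multiplying the
  periodogram by \<open>\<kappa>\<^sup>2\<close> replaces its normalization by the one with \<open>\<Sum>\<xi>\<^sup>2\<close>.  Up to an error that is a positive
  semidefinite quadratic form in stable integrals, \<open>\<Delta> \<kappa>\<^sup>2\<close> times the smoothed periodogram of \<open>X\<close> is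
  \<open>\<bar>FT f\<bar>\<^sup>2\<close> times the smoothed self-normalized periodogram of the i.i.d. noise \<open>\<xi>\<close>; the latter concentrates
  at 1 by an \<open>L\<^sup>2\<close> bound that needs no moments of \<open>\<xi>\<close>.  The quadratic forms have no expectation either; their
  tails are controlled by a weak-type inequality, with \<open>\<integral>Q\<^bsup>\<alpha>/2\<^esup>\<close> in the role of the expectation, whereas
  \<open>\<Sum>\<xi>\<^sup>2\<close> has exact order \<open>(n \<Delta>)\<^bsup>2/\<alpha>\<^esup>\<close>.  Since \<open>FT f \<ge> 0\<close>, Plancherel's identity shows that \<open>\<kappa>\<close> times the
  estimator of \<open>g\<close> converges to \<open>f\<close> in \<open>L\<^sup>2\<close>, and \<open>\<kappa>\<close> converges to the \<open>L\<^sup>2\<close> norm of \<open>f\<close>.  Hoelder's inequality on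
  \<open>[-c, c]\<close> carries this over to the \<open>\<alpha>\<close>-norms, and the random factor \<open>\<kappa>\<close> cancels in the final ratio.
\<close>

section \<open>Convergence in probability as convergence along a filter\<close>

text \<open>Bounds without moments rest on two symmetries: the law of the independent noise cells is
  invariant under sign changes and permutations. The self-normalized noise, whose squares sum to at
  most 1, therefore has vanishing odd mixed moments, and its even ones of order 2 and (2, 2) are
  O(1/n) and O(1/n^2). The error forms mix observations with noise cells, so their kernel at s is
  the error of a Riemann sum centred at s. Inside the observation interval this balances the modulus
  of continuity against the decay rate r, hence the exponent 1 - 1/r. Near the end points it decays
  like the power r - 1 of the distance; a free exponent \<theta> buys further decay at the price of
  a power of n \<Delta>, for the case that (r - 1) \<alpha> does not exceed 1. Hoelder's inequality
  on [-c, c] costs (2 c)^(2/\<alpha> - 1), so the squared L2 error of the rescaled estimator has to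
  vanish even after multiplication by a weight \<beta> of that order. The transform of f is
  nonnegative because averages of its Riemann sums over the grid are positive semidefinite double
  sums.\<close>

definition prob_filter :: "'w measure \<Rightarrow> (nat \<times> 'w) filter" where
  "prob_filter M = Abs_filter (\<lambda>P. \<exists>A. (\<forall>n. A n \<in> sets M) \<and> (\<lambda>n. measure M (A n)) \<longlonglongrightarrow> 0 \<and>
     (\<forall>\<^sub>F n in sequentially. \<forall>w\<in>space M - A n. P (n, w)))"

context prob_space
begin

text \<open>The filter lives on pairs of an index and an outcome. Only the exceptional sets have to
  be measurable, so limits in probability can be computed with the usual limit rules while
  measurability is settled for the final quantities.\<close>

lemma eventually_prob_filter:
  "eventually P (prob_filter M) \<longleftrightarrow> (\<exists>A. (\<forall>n. A n \<in> sets M) \<and> (\<lambda>n. prob (A n)) \<longlonglongrightarrow> 0 \<and>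
     (\<forall>\<^sub>F n in sequentially. \<forall>w\<in>space M - A n. P (n, w)))"
proof -
  let ?F = "\<lambda>P. \<exists>A. (\<forall>n. A n \<in> sets M) \<and> (\<lambda>n. prob (A n)) \<longlonglongrightarrow> 0 \<and>
     (\<forall>\<^sub>F n in sequentially. \<forall>w\<in>space M - A n. P (n, w))"
  have "is_filter ?F"
  proof
    show "?F (\<lambda>x. True)" by (rule exI[of _ "\<lambda>_. {}"]) auto
  next
    fix P Q assume "?F P" "?F Q"
    then obtain A B where A: "\<And>n. A n \<in> sets M" "(\<lambda>n. prob (A n)) \<longlonglongrightarrow> 0"
        "\<forall>\<^sub>F n in sequentially. \<forall>w\<in>space M - A n. P (n, w)"
      and B: "\<And>n. B n \<in> sets M" "(\<lambda>n. prob (B n)) \<longlonglongrightarrow> 0"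
        "\<forall>\<^sub>F n in sequentially. \<forall>w\<in>space M - B n. Q (n, w)" by blast
    have "(\<lambda>n. prob (A n \<union> B n)) \<longlonglongrightarrow> 0"
    proof (rule tendsto_sandwich[OF _ _ tendsto_const])
      show "(\<lambda>n. prob (A n) + prob (B n)) \<longlonglongrightarrow> 0"
        using tendsto_add[OF A(2) B(2)] by simp
    qed (use A(1) B(1) in \<open>auto intro!: always_eventually measure_Un_le\<close>)
    moreover have "\<forall>\<^sub>F n in sequentially. \<forall>w\<in>space M - (A n \<union> B n). P (n, w) \<and> Q (n, w)"
      using A(3) B(3) by eventually_elim auto
    ultimately show "?F (\<lambda>x. P x \<and> Q x)"
      using A(1) B(1) by (intro exI[of _ "\<lambda>n. A n \<union> B n"]) auto
  next
    fix P Q :: "nat \<times> 'a \<Rightarrow> bool" assume PQ: "\<forall>x. P x \<longrightarrow> Q x" and "?F P"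
    then obtain A where A: "\<And>n. A n \<in> sets M" "(\<lambda>n. prob (A n)) \<longlonglongrightarrow> 0"
        "\<forall>\<^sub>F n in sequentially. \<forall>w\<in>space M - A n. P (n, w)" by blast
    have "\<forall>\<^sub>F n in sequentially. \<forall>w\<in>space M - A n. Q (n, w)"
      using A(3) by eventually_elim (use PQ in auto)
    with A show "?F Q" by blast
  qed
  then show ?thesis
    unfolding prob_filter_def by (rule eventually_Abs_filter)
qed

lemma eventually_prob_filterI:
  assumes "\<And>n. A n \<in> sets M" "(\<lambda>n. prob (A n)) \<longlonglongrightarrow> 0"
    "\<forall>\<^sub>F n in sequentially. \<forall>w\<in>space M - A n. P (n, w)"
  shows "eventually P (prob_filter M)"
  using assms unfolding eventually_prob_filter by blast

lemma eventually_prob_filter_sequentially: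
  assumes "\<forall>\<^sub>F n in sequentially. \<forall>w\<in>space M. P (n, w)"
  shows "eventually P (prob_filter M)"
  by (rule eventually_prob_filterI[where A = "\<lambda>_. {}"]) (use assms in auto)

lemma filterlim_fst_prob_filter: "filterlim fst sequentially (prob_filter M)"
  unfolding filterlim_iff
proof safe
  fix P :: "nat \<Rightarrow> bool" assume "eventually P sequentially"
  then show "eventually (\<lambda>x. P (fst x)) (prob_filter M)"
    by (intro eventually_prob_filter_sequentially) (auto elim!: eventually_mono)
qed

lemma tendsto_prob_filter_sequentially:
  assumes "(x \<longlongrightarrow> c) sequentially"
  shows "((\<lambda>q. x (fst q)) \<longlongrightarrow> c) (prob_filter M)"
  using filterlim_compose[OF assms filterlim_fst_prob_filter] .

lemma tendsto_prob_filter_iff: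
  fixes Y :: "nat \<Rightarrow> 'a \<Rightarrow> real"
  assumes [measurable]: "\<forall>\<^sub>F n in sequentially. Y n \<in> borel_measurable M"
  shows "((\<lambda>q. Y (fst q) (snd q)) \<longlongrightarrow> c) (prob_filter M) \<longleftrightarrow>
    (\<forall>z>0. (\<lambda>n. prob {w \<in> space M. \<bar>Y n w - c\<bar> > z}) \<longlonglongrightarrow> 0)"
proof safe
  fix z :: real assume lim: "((\<lambda>q. Y (fst q) (snd q)) \<longlongrightarrow> c) (prob_filter M)" and "z > 0"
  from tendstoD[OF lim \<open>z > 0\<close>] obtain A where A: "\<And>n. A n \<in> sets M" "(\<lambda>n. prob (A n)) \<longlonglongrightarrow> 0"
      and ev: "\<forall>\<^sub>F n in sequentially. \<forall>w\<in>space M - A n. dist (Y n w) c < z"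
    unfolding eventually_prob_filter by auto
  show "(\<lambda>n. prob {w \<in> space M. \<bar>Y n w - c\<bar> > z}) \<longlonglongrightarrow> 0"
  proof (rule tendsto_sandwich[OF _ _ tendsto_const A(2)])
    show "\<forall>\<^sub>F n in sequentially. prob {w \<in> space M. \<bar>Y n w - c\<bar> > z} \<le> prob (A n)"
      using ev
    proof eventually_elim
      case (elim n)
      then show ?case
        by (intro finite_measure_mono A) (force simp: dist_real_def)
    qed
  qed auto
next
  assume *: "\<forall>z>0. (\<lambda>n. prob {w \<in> space M. \<bar>Y n w - c\<bar> > z}) \<longlonglongrightarrow> 0"
  show "((\<lambda>q. Y (fst q) (snd q)) \<longlongrightarrow> c) (prob_filter M)"
  proof (rule tendstoI)
    fix e :: real assume "e > 0"
    let ?A = "\<lambda>n. {w \<in> space M. \<bar>Y n w - c\<bar> > e/2}"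
    obtain N where N: "\<And>n. n \<ge> N \<Longrightarrow> Y n \<in> borel_measurable M"
      using assms unfolding eventually_sequentially by auto
    \<comment> \<open>Before \<open>N\<close> the events may fail to be measurable; the empty set
      stands in for them, which does not affect the limit.\<close>
    show "\<forall>\<^sub>F x in prob_filter M. dist (Y (fst x) (snd x)) c < e"
    proof (rule eventually_prob_filterI[where A = "\<lambda>n. if n \<ge> N then ?A n else {}"])
      fix n show "(if n \<ge> N then ?A n else {}) \<in> sets M"
      proof (cases "n \<ge> N")
        case True
        note [measurable] = N[OF True]
        have "?A n \<in> sets M" by measurable
        then show ?thesis using True by simp
      qed simp
    next
      have "(\<lambda>n. prob (?A n)) \<longlonglongrightarrow> 0" using *[rule_format, of "e/2"] \<open>e > 0\<close> by simp
      moreover have "\<forall>\<^sub>F n in sequentially. prob (?A n) = prob (if n \<ge> N then ?A n else {})"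
        by (rule eventually_mono[OF eventually_ge_at_top[of N]]) simp
      ultimately show "(\<lambda>n. prob (if n \<ge> N then ?A n else {})) \<longlonglongrightarrow> 0"
        by (rule Lim_transform_eventually)
    next
      show "\<forall>\<^sub>F n in sequentially. \<forall>w\<in>space M - (if n \<ge> N then ?A n else {}).
          dist (Y (fst (n, w)) (snd (n, w))) c < e"
        using eventually_ge_at_top[of N]
        by eventually_elim (use \<open>e > 0\<close> in \<open>auto simp: dist_real_def\<close>)
    qed
  qed
qed

lemma converges_in_probability_const_iff:
  "converges_in_probability M Y (\<lambda>_. c) \<longleftrightarrow>
     (\<forall>\<^sub>F n in sequentially. Y n \<in> borel_measurable M) \<and>
     ((\<lambda>q. Y (fst q) (snd q)) \<longlongrightarrow> c) (prob_filter M)"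
  unfolding converges_in_probability_def using tendsto_prob_filter_iff[of Y c] by auto

text \<open>Markov's inequality with the nonnegative integral, so that one bound yields both
  integrability and smallness.\<close>

lemma tendsto_prob_filter_Markov:
  fixes Y :: "nat \<Rightarrow> 'a \<Rightarrow> real"
  assumes Y: "\<forall>\<^sub>F n in sequentially. Y n \<in> borel_measurable M"
    and nonneg: "\<forall>\<^sub>F n in sequentially. \<forall>w\<in>space M. Y n w \<ge> 0"
    and le: "\<forall>\<^sub>F n in sequentially. (\<integral>\<^sup>+ w. ennreal (Y n w) \<partial>M) \<le> ennreal (e n)"
    and e: "e \<longlonglongrightarrow> 0"
  shows "((\<lambda>q. Y (fst q) (snd q)) \<longlongrightarrow> 0) (prob_filter M)"
  unfolding tendsto_prob_filter_iff[OF Y]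
proof safe
  fix z :: real assume "z > 0"
  show "(\<lambda>n. prob {w \<in> space M. \<bar>Y n w - 0\<bar> > z}) \<longlonglongrightarrow> 0"
  proof (rule tendsto_sandwich[OF _ _ tendsto_const])
    \<comment> \<open>\<open>ennreal\<close> turns a negative bound into 0; the maximum mirrors
      this.\<close>
    show "(\<lambda>n. max 0 (e n) / z) \<longlonglongrightarrow> 0"
      using e \<open>z > 0\<close> by (auto intro!: tendsto_eq_intros)
    show "\<forall>\<^sub>F n in sequentially. prob {w \<in> space M. \<bar>Y n w - 0\<bar> > z} \<le> max 0 (e n) / z"
      using Y nonneg le
    proof eventually_elim
      case (elim n)
      note [measurable] = elim(1)
      have "emeasure M {w \<in> space M. \<bar>Y n w - 0\<bar> > z}
          \<le> emeasure M {w \<in> space M. 1 \<le> ennreal (1/z) * ennreal (Y n w)}"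
      proof (rule emeasure_mono)
        show "{w \<in> space M. \<bar>Y n w - 0\<bar> > z} \<subseteq> {w \<in> space M. 1 \<le> ennreal (1/z) * ennreal (Y n w)}"
          using \<open>z > 0\<close> elim(2)
          by (auto simp: ennreal_mult[symmetric] ennreal_1[symmetric] simp del: ennreal_1 intro!: ennreal_leI)
      qed measurable
      also have "\<dots> \<le> ennreal (1/z) * (\<integral>\<^sup>+ w. ennreal (Y n w) * indicator (space M) w \<partial>M)"
        using nn_integral_Markov_inequality[where u = "\<lambda>w. ennreal (Y n w)" and A = "space M" and c = "ennreal (1/z)" and M = M]
        by simp
      also have "(\<integral>\<^sup>+ w. ennreal (Y n w) * indicator (space M) w \<partial>M) = (\<integral>\<^sup>+ w. ennreal (Y n w) \<partial>M)"
        by (intro nn_integral_cong) auto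
      also have "ennreal (1/z) * (\<integral>\<^sup>+ w. ennreal (Y n w) \<partial>M) \<le> ennreal (1/z) * ennreal (max 0 (e n))"
        using elim(3) by (intro mult_left_mono) (auto simp: max_def ennreal_neg)
      also have "\<dots> = ennreal (max 0 (e n) / z)"
        using \<open>z > 0\<close> by (subst ennreal_mult[symmetric]) auto
      finally show ?case
        using \<open>z > 0\<close> by (simp add: emeasure_eq_measure)
    qed
  qed auto
qed

text \<open>It suffices that the denominator stays away from 0 with probability close to 1. The
  event {D \<le> d} is discarded as a whole; it contains {D = 0}, where the quotient takes its
  default value.\<close>

lemma tendsto_prob_filter_divide:
  fixes Q D :: "nat \<Rightarrow> 'a \<Rightarrow> real"
  assumes Q: "\<forall>\<^sub>F n in sequentially. Q n \<in> borel_measurable M"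
    and D: "\<forall>\<^sub>F n in sequentially. D n \<in> borel_measurable M"
    and nonneg: "\<forall>\<^sub>F n in sequentially. \<forall>w\<in>space M. Q n w \<ge> 0 \<and> D n w \<ge> 0"
    and lim: "((\<lambda>q. Q (fst q) (snd q)) \<longlongrightarrow> 0) (prob_filter M)"
    and tight: "\<And>\<eta>. \<eta> > 0 \<Longrightarrow> \<exists>d>0. \<forall>\<^sub>F n in sequentially. prob {w\<in>space M. D n w \<le> d} \<le> \<eta>"
  shows "((\<lambda>q. Q (fst q) (snd q) / D (fst q) (snd q)) \<longlongrightarrow> 0) (prob_filter M)"
proof -
  have meas: "\<forall>\<^sub>F n in sequentially. (\<lambda>w. Q n w / D n w) \<in> borel_measurable M"
    using Q D by eventually_elim measurable
  have "(\<lambda>n. prob {w \<in> space M. \<bar>Q n w / D n w - 0\<bar> > z}) \<longlonglongrightarrow> 0" if "z > 0" for z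
  proof (rule LIMSEQ_I)
    fix r :: real assume "r > 0"
    obtain d where d: "d > 0" "\<forall>\<^sub>F n in sequentially. prob {w\<in>space M. D n w \<le> d} \<le> r/2"
      using tight[of "r/2"] \<open>r > 0\<close> by auto
    have "(\<lambda>n. prob {w \<in> space M. \<bar>Q n w - 0\<bar> > z * d}) \<longlonglongrightarrow> 0"
      using lim tendsto_prob_filter_iff[OF Q, of 0] \<open>z > 0\<close> d by auto
    then have "\<forall>\<^sub>F n in sequentially. prob {w \<in> space M. \<bar>Q n w - 0\<bar> > z * d} < r/2"
      using \<open>r > 0\<close> by (intro order_tendstoD(2)[of _ 0]) auto
    with d(2) Q D nonneg have "\<forall>\<^sub>F n in sequentially. prob {w \<in> space M. \<bar>Q n w / D n w - 0\<bar> > z} < r"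
    proof eventually_elim
      case (elim n)
      note [measurable] = elim(2,3)
      have "prob {w \<in> space M. \<bar>Q n w / D n w - 0\<bar> > z} \<le>
          prob ({w \<in> space M. \<bar>Q n w - 0\<bar> > z * d} \<union> {w\<in>space M. D n w \<le> d})"
      proof (rule finite_measure_mono)
        show "{w \<in> space M. \<bar>Q n w / D n w - 0\<bar> > z}
            \<subseteq> {w \<in> space M. \<bar>Q n w - 0\<bar> > z * d} \<union> {w\<in>space M. D n w \<le> d}"
        proof safe
          fix w assume w: "w \<in> space M" "z < \<bar>Q n w / D n w - 0\<bar>" "\<not> D n w \<le> d"
          then have "D n w > 0" using d by auto
          with w elim(4) have "z * D n w < Q n w" by (auto simp: field_simps abs_of_nonneg)
          moreover have "z * d < z * D n w" using w \<open>z > 0\<close> by auto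
          ultimately show "\<bar>Q n w - 0\<bar> > z * d" by auto
        qed
      qed measurable
      also have "\<dots> \<le> prob {w \<in> space M. \<bar>Q n w - 0\<bar> > z * d} + prob {w\<in>space M. D n w \<le> d}"
        by (intro measure_Un_le) measurable
      finally show ?case using elim by auto
    qed
    then show "\<exists>no. \<forall>n\<ge>no. norm (prob {w \<in> space M. \<bar>Q n w / D n w - 0\<bar> > z} - 0) < r"
      unfolding eventually_sequentially by auto
  qed
  then show ?thesis
    using tendsto_prob_filter_iff[OF meas, of 0] by auto
qed

lemma eventually_prob_filter_pos:
  fixes D :: "nat \<Rightarrow> 'a \<Rightarrow> real"
  assumes D: "\<forall>\<^sub>F n in sequentially. D n \<in> borel_measurable M"
    and tight: "\<And>\<eta>. \<eta> > 0 \<Longrightarrow> \<exists>d>0. \<forall>\<^sub>F n in sequentially. prob {w\<in>space M. D n w \<le> d} \<le> \<eta>"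
  shows "\<forall>\<^sub>F q in prob_filter M. D (fst q) (snd q) > 0"
proof -
  obtain N where N: "\<And>n. n \<ge> N \<Longrightarrow> D n \<in> borel_measurable M"
    using D unfolding eventually_sequentially by auto
  let ?A = "\<lambda>n. if n \<ge> N then {w\<in>space M. D n w \<le> 0} else {}"
  show ?thesis
  proof (rule eventually_prob_filterI[where A = ?A])
    fix n show "?A n \<in> sets M"
    proof (cases "n \<ge> N")
      case True
      note [measurable] = N[OF True]
      have "{w\<in>space M. D n w \<le> 0} \<in> sets M" by measurable
      then show ?thesis using True by simp
    qed simp
  next
    show "(\<lambda>n. prob (?A n)) \<longlonglongrightarrow> 0"
    proof (rule LIMSEQ_I)
      fix r :: real assume "r > 0"
      obtain d where d: "d > 0" "\<forall>\<^sub>F n in sequentially. prob {w\<in>space M. D n w \<le> d} \<le> r/2"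
        using tight[of "r/2"] \<open>r > 0\<close> by auto
      have "\<forall>\<^sub>F n in sequentially. prob (?A n) < r"
        using d(2) eventually_ge_at_top[of N]
      proof eventually_elim
        case (elim n)
        note [measurable] = N[OF elim(2)]
        have "prob (?A n) \<le> prob {w\<in>space M. D n w \<le> d}"
          using d(1) elim(2) by (intro finite_measure_mono) auto
        then show ?case using elim(1) \<open>r > 0\<close> by linarith
      qed
      then show "\<exists>no. \<forall>n\<ge>no. norm (prob (?A n) - 0) < r"
        unfolding eventually_sequentially by auto
    qed
  next
    show "\<forall>\<^sub>F n in sequentially. \<forall>w\<in>space M - ?A n. 0 < D (fst (n, w)) (snd (n, w))"
      using eventually_ge_at_top[of N] by eventually_elim auto
  qed
qed

end

section \<open>Symmetric stable variables\<close>

text \<open>\<open>b\<close> is the \<open>\<alpha>\<close>-th power of the scale.\<close>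

definition SaS_var :: "'w measure \<Rightarrow> real \<Rightarrow> real \<Rightarrow> ('w \<Rightarrow> real) \<Rightarrow> bool" where
  "SaS_var M \<alpha> b Z \<longleftrightarrow> Z \<in> borel_measurable M \<and> b \<ge> 0 \<and>
     (\<forall>u. char (distr M borel Z) u = of_real (exp (- (b * \<bar>u\<bar> powr \<alpha>))))"

lemma exp_minus_le_inverse:
  fixes z :: real assumes "z \<ge> 0"
  shows "exp (- z) \<le> 1 / (1 + z)"
  using exp_ge_add_one_self[of z] assms by (simp add: exp_minus field_simps)

text \<open>Links truncated squares to Laplace transforms: for z = (v Z)^2 the mean of the right
  side is computed by \<open>SaS_var_gauss\<close>. Both sides are compared with 3 z / (2 +
  z).\<close>

lemma min_le_one_minus_exp:
  fixes z :: real assumes "z \<ge> 0"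
  shows "min 1 z \<le> 3 * (1 - exp (- (z / 2)))"
proof -
  have "exp (- (z/2)) \<le> 1 / (1 + z/2)"
    using exp_minus_le_inverse[of "z/2"] assms by simp
  then have "z / (2 + z) \<le> 1 - exp (- (z/2))"
    using assms by (simp add: field_simps)
  then have "3 * (z / (2 + z)) \<le> 3 * (1 - exp (- (z / 2)))" by (rule mult_left_mono) simp
  moreover have "min 1 z \<le> 3 * (z / (2 + z))"
  proof (cases "z \<le> 1")
    case True
    then have "z * z \<le> z * 1" using assms by (intro mult_left_mono) auto
    then show ?thesis using True assms by (simp add: field_simps)
  next
    case False
    then show ?thesis using assms by (simp add: field_simps)
  qed
  ultimately show ?thesis by (rule order.trans[rotated])
qed

lemma abs_powr_le_one_plus_square:
  fixes x :: real assumes "0 < \<alpha>" "\<alpha> \<le> 2"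
  shows "\<bar>x\<bar> powr \<alpha> \<le> 1 + x\<^sup>2"
proof (cases "\<bar>x\<bar> \<le> 1")
  case True
  then have "\<bar>x\<bar> powr \<alpha> \<le> 1" using assms by (intro powr_le1) auto
  then show ?thesis by (smt (verit) zero_le_power2)
next
  case False
  then have "\<bar>x\<bar> powr \<alpha> \<le> \<bar>x\<bar> powr 2" using assms by (intro powr_mono) auto
  then show ?thesis using False by simp
qed

context prob_space
begin

text \<open>exp(-y^2/2) is the characteristic function of the standard normal law at y. Writing it
  as a Gaussian average of exp(i v Z x) and exchanging the integrals leaves the characteristic
  function of Z, through which a stable law is given.\<close>

lemma SaS_var_gauss:
  assumes "SaS_var M \<alpha> b Z"
  shows "expectation (\<lambda>w. exp (- ((v * Z w)\<^sup>2 / 2))) =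
    (LINT x|std_normal_distribution. exp (- (b * \<bar>v * x\<bar> powr \<alpha>)))"
proof -
  have [measurable]: "Z \<in> borel_measurable M" and
    ch: "\<And>u. char (distr M borel Z) u = of_real (exp (- (b * \<bar>u\<bar> powr \<alpha>)))"
    using assms by (auto simp: SaS_var_def)
  interpret N: real_distribution std_normal_distribution by (rule real_dist_normal_dist)
  interpret P: pair_prob_space M std_normal_distribution ..
  have int: "integrable (M \<Otimes>\<^sub>M std_normal_distribution) (\<lambda>(w, x). iexp (v * Z w * x))"
    by (intro P.integrable_const_bound[where B = 1] AE_I2) (auto split: prod.split)
  have "complex_of_real (expectation (\<lambda>w. exp (- ((v * Z w)\<^sup>2 / 2)))) =
      expectation (\<lambda>w. complex_of_real (exp (- ((v * Z w)\<^sup>2 / 2))))"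
    by (rule integral_complex_of_real[symmetric])
  also have "\<dots> = expectation (\<lambda>w. char std_normal_distribution (v * Z w))"
    by (simp add: char_std_normal_distribution)
  also have "\<dots> = expectation (\<lambda>w. LINT x|std_normal_distribution. iexp (v * Z w * x))"
    by (simp add: char_def)
  also have "\<dots> = (LINT x|std_normal_distribution. expectation (\<lambda>w. iexp (v * Z w * x)))"
    by (rule P.Fubini_integral[symmetric]) (use int in simp)
  also have "\<dots> = (LINT x|std_normal_distribution. char (distr M borel Z) (v * x))"
    by (intro Bochner_Integration.integral_cong refl) (simp add: char_def integral_distr mult_ac)
  also have "\<dots> = complex_of_real (LINT x|std_normal_distribution. exp (- (b * \<bar>v * x\<bar> powr \<alpha>)))"
    unfolding ch by (rule integral_complex_of_real)
  finally show ?thesis unfolding of_real_eq_iff .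
qed

text \<open>A usable second moment bound although Z may have infinite variance. The constant 6 is
  the 3 of \<open>min_le_one_minus_exp\<close> times 2, the Gaussian mean of 1 + x^2.\<close>

lemma SaS_var_min_square:
  assumes Z: "SaS_var M \<alpha> b Z" and \<alpha>: "0 < \<alpha>" "\<alpha> < 2"
  shows "expectation (\<lambda>w. min 1 ((v * Z w)\<^sup>2)) \<le> 6 * b * \<bar>v\<bar> powr \<alpha>"
proof -
  have [measurable]: "Z \<in> borel_measurable M" and b: "b \<ge> 0"
    using Z by (auto simp: SaS_var_def)
  interpret N: real_distribution std_normal_distribution by (rule real_dist_normal_dist)
  have int2: "integrable std_normal_distribution (\<lambda>x. x\<^sup>2)"
    by (rule integrable_std_normal_distribution_moment)
  have E2: "(LINT x|std_normal_distribution. x\<^sup>2) = 1"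
    using std_normal_distribution_even_moments[of 1] by simp
  have int_exp: "integrable M (\<lambda>w. exp (- ((v * Z w)\<^sup>2 / 2)))"
    by (intro integrable_const_bound[where B = 1] AE_I2) auto
  let ?e1 = "\<lambda>x. b * \<bar>v * x\<bar> powr \<alpha>"
  have int_exp': "integrable std_normal_distribution (\<lambda>x. exp (- (?e1 x)))"
    using b by (intro N.integrable_const_bound[where B = 1] AE_I2) auto
  have "expectation (\<lambda>w. min 1 ((v * Z w)\<^sup>2))
      \<le> expectation (\<lambda>w. 3 * (1 - exp (- ((v * Z w)\<^sup>2 / 2))))"
  proof (rule integral_mono)
    show "integrable M (\<lambda>w. min 1 ((v * Z w)\<^sup>2))"
      by (intro integrable_const_bound[where B = 1] AE_I2) auto
    show "integrable M (\<lambda>w. 3 * (1 - exp (- ((v * Z w)\<^sup>2 / 2))))"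
      using int_exp by auto
  qed (rule min_le_one_minus_exp, simp)
  also have "\<dots> = 3 * (1 - expectation (\<lambda>w. exp (- ((v * Z w)\<^sup>2 / 2))))"
    using int_exp by (simp add: prob_space)
  also have "\<dots> = 3 * (1 - (LINT x|std_normal_distribution. exp (- (?e1 x))))"
    using SaS_var_gauss[OF Z] by simp
  also have "1 - (LINT x|std_normal_distribution. exp (- (?e1 x))) =
      (LINT x|std_normal_distribution. 1 - exp (- (?e1 x)))"
    using int_exp' N.prob_space by simp
  also have "\<dots> \<le> (LINT x|std_normal_distribution. b * \<bar>v\<bar> powr \<alpha> * (1 + x\<^sup>2))"
  proof (rule integral_mono)
    fix x :: real
    have "1 - exp (- (?e1 x)) \<le> b * \<bar>v * x\<bar> powr \<alpha>"
      using exp_ge_add_one_self[of "- (?e1 x)"] by linarith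
    also have "\<dots> = b * \<bar>v\<bar> powr \<alpha> * \<bar>x\<bar> powr \<alpha>"
      by (simp add: abs_mult powr_mult)
    also have "\<dots> \<le> b * \<bar>v\<bar> powr \<alpha> * (1 + x\<^sup>2)"
      using b \<alpha> by (intro mult_left_mono abs_powr_le_one_plus_square) auto
    finally show "1 - exp (- (?e1 x)) \<le> b * \<bar>v\<bar> powr \<alpha> * (1 + x\<^sup>2)" .
  qed (use int_exp' int2 in auto)
  also have "\<dots> = b * \<bar>v\<bar> powr \<alpha> * 2"
    using int2 E2 N.prob_space by simp
  finally show ?thesis by simp
qed

text \<open>The polynomial x^2 - x^4/4 lies below the minimum of 1 and |x|^\<alpha> and has Gaussian
  mean 1 - 3/4. The other factor 1/2 in the constant 1/8 comes from the inequality min 1 z / 2 \<le>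
  1 - exp(-z).\<close>

lemma SaS_var_gauss_le:
  assumes Z: "SaS_var M \<alpha> b Z" and \<alpha>: "0 < \<alpha>" "\<alpha> < 2" and small: "b * \<bar>v\<bar> powr \<alpha> \<le> 1"
  shows "expectation (\<lambda>w. exp (- ((v * Z w)\<^sup>2 / 2))) \<le> 1 - b * \<bar>v\<bar> powr \<alpha> / 8"
proof -
  have [measurable]: "Z \<in> borel_measurable M" and b: "b \<ge> 0"
    using Z by (auto simp: SaS_var_def)
  interpret N: real_distribution std_normal_distribution by (rule real_dist_normal_dist)
  have int: "integrable std_normal_distribution (\<lambda>x. x\<^sup>2)" "integrable std_normal_distribution (\<lambda>x. x^4)"
    by (rule integrable_std_normal_distribution_moment)+
  have E2: "(LINT x|std_normal_distribution. x\<^sup>2) = 1"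
    using std_normal_distribution_even_moments[of 1] by simp
  have E4: "(LINT x|std_normal_distribution. x^4) = 3"
    using std_normal_distribution_even_moments[of 2] by (simp add: fact_numeral)
  have int_exp': "integrable std_normal_distribution (\<lambda>x. exp (- (b * \<bar>v * x\<bar> powr \<alpha>)))"
    using b by (intro N.integrable_const_bound[where B = 1] AE_I2) auto
  let ?q = "b * \<bar>v\<bar> powr \<alpha>"
  have q: "?q \<ge> 0" using b by auto
  have "?q / 8 = (LINT x|std_normal_distribution. ?q / 2 * (x\<^sup>2 - x^4 / 4))"
    using int E2 E4 by simp
  also have "\<dots> \<le> (LINT x|std_normal_distribution. 1 - exp (- (b * \<bar>v * x\<bar> powr \<alpha>)))"
  proof (rule integral_mono)
    fix x :: real
    define y where "y = \<bar>x\<bar> powr \<alpha>"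
    have y: "y \<ge> 0" unfolding y_def by simp
    have "x\<^sup>2 - x^4/4 \<le> min 1 y"
    proof (cases "\<bar>x\<bar> \<le> 1")
      case True
      have "\<bar>x\<bar> powr 2 \<le> y" unfolding y_def by (rule powr_mono') (use True \<alpha> in auto)
      moreover have "x\<^sup>2 - x^4/4 \<le> \<bar>x\<bar> powr 2" by (cases "x = 0") auto
      moreover have "x\<^sup>2 - x^4/4 \<le> 1"
        using zero_le_power2[of "x\<^sup>2 - 2"] by (simp add: power2_eq_square power4_eq_xxxx algebra_simps)
      ultimately show ?thesis by linarith
    next
      case False
      then have "y \<ge> 1" unfolding y_def using \<alpha> by (auto intro!: ge_one_powr_ge_zero)
      moreover have "x\<^sup>2 - x^4/4 \<le> 1"
        using zero_le_power2[of "x\<^sup>2 - 2"] by (simp add: power2_eq_square power4_eq_xxxx algebra_simps)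
      ultimately show ?thesis by auto
    qed
    then have "?q / 2 * (x\<^sup>2 - x^4 / 4) \<le> ?q / 2 * min 1 y"
      using q by (intro mult_left_mono) auto
    also have "\<dots> \<le> min 1 (?q * y) / 2"
    proof -
      have "?q * min 1 y \<le> ?q * y" "?q * min 1 y \<le> ?q * 1" using q by (intro mult_left_mono; simp)+
      then show ?thesis using small by simp
    qed
    also have "\<dots> \<le> 1 - exp (- (?q * y))"
    proof -
      have "exp (- (?q * y)) \<le> 1 / (1 + ?q * y)"
        using exp_minus_le_inverse[of "?q * y"] q y by simp
      also have "\<dots> \<le> 1 - min 1 (?q * y) / 2"
      proof -
        define z where "z = ?q * y"
        have z: "z \<ge> 0" unfolding z_def using q y by simp
        have "1 / (1 + z) \<le> 1 - min 1 z / 2"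
        proof (cases "z \<le> 1")
          case True
          then have "1 \<le> (1 - z/2) * (1 + z)"
            using z mult_left_mono[of z 1 z] by (simp add: algebra_simps)
          then show ?thesis using z True by (simp add: divide_le_eq)
        next
          case False then show ?thesis by (simp add: field_simps)
        qed
        then show ?thesis unfolding z_def .
      qed
      finally show ?thesis by linarith
    qed
    also have "?q * y = b * \<bar>v * x\<bar> powr \<alpha>"
      unfolding y_def by (simp add: abs_mult powr_mult)
    finally show "?q / 2 * (x\<^sup>2 - x^4 / 4) \<le> 1 - exp (- (b * \<bar>v * x\<bar> powr \<alpha>))" .
  qed (use int int_exp' in auto)
  also have "\<dots> = 1 - (LINT x|std_normal_distribution. exp (- (b * \<bar>v * x\<bar> powr \<alpha>)))"
    using int_exp' N.prob_space by simp
  finally show ?thesis using SaS_var_gauss[OF Z, of v] by simp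
qed

text \<open>A Chernoff bound for small values: independence factorizes the Laplace transform of the
  sum of squares. It shows that the sum is at least of order (n b)^(2/\<alpha>) in probability,
  which is what a random denominator has to satisfy.\<close>

lemma SaS_sum_squares_lower_tail:
  fixes Z :: "'i \<Rightarrow> 'a \<Rightarrow> real"
  assumes indep: "indep_vars (\<lambda>_. borel) Z I" and I: "finite I" "card I = n" "n > 0"
    and Z: "\<And>i. i \<in> I \<Longrightarrow> SaS_var M \<alpha> b (Z i)" and b: "b > 0"
    and \<alpha>: "0 < \<alpha>" "\<alpha> < 2" and K: "K > 0" "K powr (\<alpha>/2) \<le> n"
  shows "prob {w\<in>space M. (\<Sum>i\<in>I. (Z i w)\<^sup>2) / (n * b) powr (2/\<alpha>) \<le> 1 / K} \<le> 2 * exp (- (K powr (\<alpha>/2) / 8))"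
proof -
  have [measurable]: "\<And>i. i \<in> I \<Longrightarrow> Z i \<in> borel_measurable M" using Z by (auto simp: SaS_var_def)
  \<comment> \<open>Chosen such that b v^\<alpha> = K^(\<alpha>/2) / n, whence n factors multiply to
    exp(- K^(\<alpha>/2) / 8), and such that v^2 times the sum is at most 1 on the event in
    question, where the product is then at least exp(-1/2).\<close>
  define v where "v = K powr (1/2) * (n * b) powr (- 1/\<alpha>)"
  have nb: "real n * b > 0" using I b by auto
  have v: "v > 0" unfolding v_def using K I b by simp
  have va: "\<bar>v\<bar> powr \<alpha> = K powr (\<alpha>/2) / (n * b)"
  proof -
    have "\<bar>v\<bar> powr \<alpha> = v powr \<alpha>" using v by simp
    also have "\<dots> = K powr (1/2 * \<alpha>) * (n * b) powr (- 1/\<alpha> * \<alpha>)"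
      unfolding v_def using nb K by (simp add: powr_mult powr_powr)
    also have "- 1/\<alpha> * \<alpha> = - 1" using \<alpha> by simp
    also have "(n * b) powr - 1 = 1 / (n * b)" using nb by (simp add: powr_minus field_simps)
    finally show ?thesis by simp
  qed
  have v2: "v\<^sup>2 = K / (n * b) powr (2/\<alpha>)"
  proof -
    have "v\<^sup>2 = v powr 2" using v by simp
    also have "\<dots> = K powr 1 * (n * b) powr (- (2/\<alpha>))"
      unfolding v_def using nb K by (simp add: powr_mult powr_powr)
    finally show ?thesis using K by (simp add: powr_minus field_simps)
  qed
  have bv: "b * \<bar>v\<bar> powr \<alpha> = K powr (\<alpha>/2) / n"
    unfolding va using b I by simp
  have small: "b * \<bar>v\<bar> powr \<alpha> \<le> 1" unfolding bv using K I by simp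
  let ?f = "\<lambda>i w. exp (- ((v * Z i w)\<^sup>2 / 2))"
  have "expectation (\<lambda>w. \<Prod>i\<in>I. ?f i w) = (\<Prod>i\<in>I. expectation (?f i))"
  proof (rule indep_vars_lebesgue_integral)
    show "indep_vars (\<lambda>_. borel) ?f I"
      by (rule indep_vars_compose2[OF indep, of "\<lambda>i x. exp (- ((v * x)\<^sup>2 / 2))"]) auto
    show "integrable M (?f i)" if "i \<in> I" for i
      using that by (intro integrable_const_bound[where B = 1] AE_I2) auto
  qed (use I in auto)
  also have "\<dots> \<le> (\<Prod>i\<in>I. exp (- (b * \<bar>v\<bar> powr \<alpha> / 8)))"
  proof (rule prod_mono, safe)
    fix i assume "i \<in> I"
    show "expectation (?f i) \<ge> 0" by (intro integral_nonneg_AE AE_I2) auto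
    have "expectation (?f i) \<le> 1 - b * \<bar>v\<bar> powr \<alpha> / 8"
      using SaS_var_gauss_le[OF Z[OF \<open>i \<in> I\<close>] \<alpha> small] .
    also have "\<dots> \<le> exp (- (b * \<bar>v\<bar> powr \<alpha> / 8))"
      using exp_ge_add_one_self[of "- (b * \<bar>v\<bar> powr \<alpha> / 8)"] by linarith
    finally show "expectation (?f i) \<le> exp (- (b * \<bar>v\<bar> powr \<alpha> / 8))" .
  qed
  also have "\<dots> = exp (- (K powr (\<alpha>/2) / 8))"
    unfolding bv prod_constant I(2) exp_of_nat_mult[symmetric] using I by simp
  finally have E: "expectation (\<lambda>w. \<Prod>i\<in>I. ?f i w) \<le> exp (- (K powr (\<alpha>/2) / 8))" .
  have prod_eq: "(\<Prod>i\<in>I. ?f i w) = exp (- (v\<^sup>2 * (\<Sum>i\<in>I. (Z i w)\<^sup>2) / 2))" for w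
    by (simp add: exp_sum[OF I(1), symmetric] sum_negf sum_divide_distrib sum_distrib_left power_mult_distrib)
  have int: "integrable M (\<lambda>w. \<Prod>i\<in>I. ?f i w)"
    unfolding prod_eq by (intro integrable_const_bound[where B = 1] AE_I2) (auto intro!: mult_nonneg_nonneg sum_nonneg)
  let ?A = "{w\<in>space M. (\<Sum>i\<in>I. (Z i w)\<^sup>2) / (n * b) powr (2/\<alpha>) \<le> 1 / K}"
  have A: "?A \<in> sets M" by measurable
  have "exp (- 1/2) * prob ?A = expectation (\<lambda>w. exp (- 1/2) * indicator ?A w)"
    by simp
  also have "\<dots> \<le> expectation (\<lambda>w. \<Prod>i\<in>I. ?f i w)"
  proof (rule integral_mono[OF _ int])
    fix w assume "w \<in> space M"
    show "exp (- 1/2) * indicator ?A w \<le> (\<Prod>i\<in>I. ?f i w)"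
    proof (cases "w \<in> ?A")
      case True
      then have "v\<^sup>2 * (\<Sum>i\<in>I. (Z i w)\<^sup>2) \<le> 1" using K unfolding v2 by (simp add: field_simps)
      then show ?thesis unfolding prod_eq using True by simp
    next
      case False then show ?thesis unfolding prod_eq by simp
    qed
  qed (use A in \<open>auto simp: emeasure_eq_measure\<close>)
  finally have "exp (- 1/2) * prob ?A \<le> exp (- (K powr (\<alpha>/2) / 8))" using E by linarith
  then have "prob ?A \<le> exp (1/2) * exp (- (K powr (\<alpha>/2) / 8))"
    by (simp add: exp_minus field_simps)
  also have "\<dots> \<le> 2 * exp (- (K powr (\<alpha>/2) / 8))"
  proof (rule mult_right_mono)
    have "exp (1/2::real) \<le> 1 + 1/2 + (1/2)\<^sup>2" by (rule exp_bound) auto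
    then show "exp (1/2::real) \<le> 2" by (simp add: power2_eq_square)
  qed auto
  finally show ?thesis .
qed

section \<open>Symmetry of stable laws\<close>

lemma SaS_var_distr_eq:
  assumes "SaS_var M \<alpha> b Z" "SaS_var M \<alpha> b Z'"
  shows "distr M borel Z = distr M borel Z'"
  using assms
  by (intro Levy_uniqueness) (auto simp: SaS_var_def intro!: real_distribution_distr ext)

lemma SaS_var_uminus:
  assumes "SaS_var M \<alpha> b Z"
  shows "SaS_var M \<alpha> b (\<lambda>w. - Z w)"
proof -
  have [measurable]: "Z \<in> borel_measurable M" using assms by (auto simp: SaS_var_def)
  have "char (distr M borel (\<lambda>w. - Z w)) u = char (distr M borel Z) (- u)" for u
    by (simp add: char_def integral_distr)
  with assms show ?thesis by (auto simp: SaS_var_def)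
qed

text \<open>The law is symmetric, so the mean equals its own negative. A non-integrable
  \<open>g\<close> is covered by the default value 0 of the integral.\<close>

lemma SaS_var_odd_expectation:
  fixes g :: "real \<Rightarrow> real"
  assumes Z: "SaS_var M \<alpha> b Z" and [measurable]: "g \<in> borel_measurable borel" and odd: "\<And>x. g (- x) = - g x"
  shows "expectation (\<lambda>w. g (Z w)) = 0"
proof -
  have [measurable]: "Z \<in> borel_measurable M" using assms by (auto simp: SaS_var_def)
  have "expectation (\<lambda>w. g (Z w)) = (LINT x|distr M borel Z. g x)"
    by (simp add: integral_distr)
  also have "\<dots> = (LINT x|distr M borel (\<lambda>w. - Z w). g x)"
    using SaS_var_distr_eq[OF Z SaS_var_uminus[OF Z]] by simp
  also have "\<dots> = expectation (\<lambda>w. - g (Z w))"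
    by (simp add: integral_distr odd)
  finally show ?thesis by simp
qed

end

section \<open>Elementary inequalities for powers\<close>

text \<open>Division by the sum reduces the claim to z \<le> z^p on [0, 1].\<close>

lemma powr_add_le:
  fixes x y p :: real assumes "0 < p" "p \<le> 1" "x \<ge> 0" "y \<ge> 0"
  shows "(x + y) powr p \<le> x powr p + y powr p"
proof (cases "x + y = 0")
  case True then show ?thesis using assms by simp
next
  case False
  define s where "s = x + y"
  have s: "s > 0" using False assms unfolding s_def by auto
  have *: "z / s \<le> (z / s) powr p" if "0 \<le> z" "z \<le> s" for z
    using powr_mono'[of p 1 "z/s"] that s assms by simp
  have "1 = x / s + y / s" unfolding s_def using False by (simp add: add_divide_distrib[symmetric])
  also have "\<dots> \<le> (x / s) powr p + (y / s) powr p"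
    using * assms unfolding s_def by (intro add_mono) auto
  also have "\<dots> = (x powr p + y powr p) / s powr p"
    using assms s by (simp add: powr_divide add_divide_distrib)
  finally show ?thesis using s unfolding s_def by (simp add: field_simps)
qed

lemma powr_sum_le:
  fixes g :: "'i \<Rightarrow> real"
  assumes "finite I" "0 < p" "p \<le> 1" "\<And>i. i \<in> I \<Longrightarrow> g i \<ge> 0"
  shows "(\<Sum>i\<in>I. g i) powr p \<le> (\<Sum>i\<in>I. g i powr p)"
  using assms(1,4)
proof (induction I)
  case (insert i I)
  have "(\<Sum>i\<in>insert i I. g i) powr p \<le> g i powr p + (\<Sum>i\<in>I. g i) powr p"
    using insert assms(2,3) by (auto intro!: powr_add_le sum_nonneg)
  also have "\<dots> \<le> g i powr p + (\<Sum>i\<in>I. g i powr p)" using insert by auto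
  finally show ?case using insert by simp
qed auto

text \<open>Replaces the triangle inequality of the \<alpha>-norm, which fails for \<alpha> < 1.
  Either x - y is small against y, and |x| \<le> (1 + d) |y| with (1 + d)^\<alpha> = 1 + \<epsilon>,
  or |y| is less than |x - y| / d and x is bounded by the difference alone.\<close>

lemma norm_powr_le_near:
  fixes \<alpha> \<epsilon> :: real assumes "\<alpha> > 0" "\<epsilon> > 0"
  obtains C where "C \<ge> 0"
    "\<And>x y :: 'b::real_normed_vector. norm x powr \<alpha> \<le> (1 + \<epsilon>) * norm y powr \<alpha> + C * norm (x - y) powr \<alpha>"
proof -
  define d where "d = (1 + \<epsilon>) powr (1 / \<alpha>) - 1"
  have "(1 + \<epsilon>) powr (1/\<alpha>) > 1" using assms by (intro gr_one_powr) auto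
  then have d: "d > 0" unfolding d_def by simp
  have d2: "(1 + d) powr \<alpha> = 1 + \<epsilon>" unfolding d_def using assms by (simp add: powr_powr)
  show ?thesis
  proof (rule that[of "(1 + 1/d) powr \<alpha>"])
    fix x y :: 'b
    have tri: "norm x \<le> norm y + norm (x - y)" by (metis add.commute norm_triangle_sub)
    show "norm x powr \<alpha> \<le> (1 + \<epsilon>) * norm y powr \<alpha> + (1 + 1/d) powr \<alpha> * norm (x - y) powr \<alpha>"
    proof (cases "norm (x - y) \<le> d * norm y")
      case True
      then have "norm x \<le> (1 + d) * norm y" using tri by (simp add: algebra_simps)
      then have "norm x powr \<alpha> \<le> ((1 + d) * norm y) powr \<alpha>" using assms by (intro powr_mono2) auto
      also have "\<dots> = (1 + \<epsilon>) * norm y powr \<alpha>" using d d2 by (simp add: powr_mult)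
      finally show ?thesis by (simp add: add_increasing2)
    next
      case False
      have "d * norm x \<le> d * (norm y + norm (x - y))" using tri d by (intro mult_left_mono) auto
      with False have "norm x \<le> (1 + 1/d) * norm (x - y)" using d by (simp add: field_simps)
      then have "norm x powr \<alpha> \<le> ((1 + 1/d) * norm (x - y)) powr \<alpha>" using assms by (intro powr_mono2) auto
      also have "\<dots> = (1 + 1/d) powr \<alpha> * norm (x - y) powr \<alpha>" using d by (simp add: powr_mult)
      finally show ?thesis using assms by (simp add: add_increasing)
    qed
  qed simp
qed

text \<open>Companion of the previous estimate: A and B stand for integrals of \<alpha>-th powers, D
  for that of the difference. Boundedness of B is first transferred to A, so that the factor 1 +
  \<epsilon> becomes an additive error in both directions.\<close>

lemma tendsto_of_near:
  fixes A B D :: "'q \<Rightarrow> real"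
  assumes near: "\<And>\<epsilon>. \<epsilon> > 0 \<Longrightarrow> \<exists>C\<ge>0. \<forall>\<^sub>F q in F. A q \<le> (1+\<epsilon>) * B q + C * D q \<and> B q \<le> (1+\<epsilon>) * A q + C * D q"
    and D: "(D \<longlongrightarrow> 0) F" and B: "(B \<longlongrightarrow> b) F"
  shows "(A \<longlongrightarrow> b) F"
proof -
  have "((\<lambda>q. A q - B q) \<longlongrightarrow> 0) F"
  proof (rule tendstoI)
    fix e :: real assume "e > 0"
    define \<beta> where "\<beta> = \<bar>b\<bar> + 1"
    have \<beta>: "\<beta> > 0" unfolding \<beta>_def by simp
    \<comment> \<open>\<open>\<beta>\<close> eventually bounds B; each of the two one-sided errors
      below is then less than \<epsilon> (6 \<beta> + 6).\<close>
    define \<epsilon> where "\<epsilon> = min 1 (e / (6 * \<beta> + 6))"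
    have "\<epsilon> \<le> e / (6 * \<beta> + 6)" unfolding \<epsilon>_def by simp
    then have "\<epsilon> * (6 * \<beta> + 6) \<le> e" using \<beta> by (simp add: pos_le_divide_eq)
    then have \<epsilon>: "\<epsilon> > 0" "\<epsilon> \<le> 1" "\<epsilon> * (6 * \<beta> + 6) \<le> e"
      using \<open>e > 0\<close> \<beta> by (simp_all add: \<epsilon>_def)
    obtain C where C: "C \<ge> 0" "\<forall>\<^sub>F q in F. A q \<le> (1+\<epsilon>) * B q + C * D q \<and> B q \<le> (1+\<epsilon>) * A q + C * D q"
      using near[OF \<epsilon>(1)] by auto
    have "((\<lambda>q. C * D q) \<longlongrightarrow> 0) F" using D by (auto intro!: tendsto_eq_intros)
    from tendstoD[OF this, of "\<epsilon>"] \<epsilon> have 1: "\<forall>\<^sub>F q in F. \<bar>C * D q\<bar> < \<epsilon>" by auto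
    have 2: "\<forall>\<^sub>F q in F. \<bar>B q - b\<bar> < 1" using tendstoD[OF B, of 1] by (simp add: dist_real_def)
    show "\<forall>\<^sub>F q in F. dist (A q - B q) 0 < e"
      using C(2) 1 2
    proof eventually_elim
      case (elim q)
      have Bb: "\<bar>B q\<bar> \<le> \<beta>" using elim(3) unfolding \<beta>_def by linarith
      then have eB: "\<epsilon> * B q \<le> \<epsilon> * \<beta>" using \<epsilon> by (intro mult_left_mono) auto
      then have up: "A q - B q \<le> \<epsilon> * \<beta> + \<epsilon>" using elim(1,2) by (auto simp: algebra_simps)
      have "\<epsilon> * \<beta> \<le> 1 * \<beta>" using \<epsilon> \<beta> by (intro mult_right_mono) auto
      then have "A q \<le> 2 * \<beta> + 1" using up Bb \<epsilon> by linarith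
      then have "\<epsilon> * A q \<le> \<epsilon> * (2 * \<beta> + 1)" using \<epsilon> by (intro mult_left_mono) auto
      then have low: "B q - A q \<le> \<epsilon> * (2 * \<beta> + 1) + \<epsilon>" using elim(1,2) by (auto simp: algebra_simps)
      have "\<epsilon> * \<beta> > 0" using \<epsilon> \<beta> by simp
      then have "\<bar>A q - B q\<bar> < \<epsilon> * (6 * \<beta> + 6)" using up low \<epsilon>(1) by (auto simp: algebra_simps abs_le_iff)
      then show ?case using \<epsilon>(3) by simp
    qed
  qed
  from tendsto_add[OF this B] show ?thesis by simp
qed

section \<open>Stable random measures\<close>

lemma (in prob_space) indep_vars_reindex:
  assumes inj: "inj_on e I" and ind: "indep_vars M' X (e ` I)"
  shows "indep_vars (\<lambda>i. M' (e i)) (\<lambda>i. X (e i)) I"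
  unfolding indep_vars_def2
proof (intro conjI ballI)
  show "random_variable (M' (e i)) (X (e i))" if "i \<in> I" for i
    using ind that by (auto simp: indep_vars_def)
  have *: "indep_sets (\<lambda>i. {X i -` A \<inter> space M |A. A \<in> sets (M' i)}) (e ` I)"
    using ind by (auto simp: indep_vars_def2)
  show "indep_sets (\<lambda>i. {X (e i) -` A \<inter> space M |A. A \<in> sets (M' (e i))}) I"
  proof (rule indep_setsI)
    show "{X (e i) -` A \<inter> space M |A. A \<in> sets (M' (e i))} \<subseteq> events" if "i \<in> I" for i
      using * that unfolding indep_sets_def by blast
    fix A J assume J: "J \<noteq> {}" "J \<subseteq> I" "finite J"
      and A: "\<forall>j\<in>J. A j \<in> {X (e j) -` A \<inter> space M |A. A \<in> sets (M' (e j))}"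
    have inj': "inj_on e J" using inj J inj_on_subset by blast
    let ?A = "\<lambda>k. A (the_inv_into J e k)"
    have "prob (\<Inter>k\<in>e ` J. ?A k) = (\<Prod>k\<in>e ` J. prob (?A k))"
      by (rule indep_setsD[OF *]) (use J A the_inv_into_f_f[OF inj'] in auto)
    then show "prob (\<Inter>j\<in>J. A j) = (\<Prod>j\<in>J. prob (A j))"
      by (simp add: prod.reindex[OF inj'] the_inv_into_f_f[OF inj'])
  qed
qed

locale stable_random_measure = prob_space M for M :: "'w measure" +
  fixes \<alpha> :: real and \<Lambda> :: "real set \<Rightarrow> 'w \<Rightarrow> real"
  assumes alpha: "0 < \<alpha>" "\<alpha> < 2" and SaS: "SaS_random_measure M \<alpha> \<Lambda>"
begin

lemma Lambda_var:
  assumes "B \<in> sets borel" "bounded B"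
  shows "SaS_var M \<alpha> (measure lborel B) (\<Lambda> B)"
  using SaS assms by (auto simp: SaS_random_measure_def SaS_var_def)

lemma Lambda_measurable [measurable]:
  assumes "B \<in> sets borel" "bounded B"
  shows "\<Lambda> B \<in> borel_measurable M"
  using Lambda_var[OF assms] by (simp add: SaS_var_def)

text \<open>The constant sequence of empty sets is disjoint, and a convergent series with equal
  terms has terms 0.\<close>

lemma Lambda_empty: "AE w in M. \<Lambda> {} w = 0"
proof -
  have "AE w in M. (\<lambda>i::nat. \<Lambda> {} w) sums \<Lambda> {} w"
    using SaS[unfolded SaS_random_measure_def, THEN conjunct2, THEN conjunct2, THEN spec, of "\<lambda>_. {}"]
    by (auto simp: disjoint_family_on_def)
  then show ?thesis
  proof eventually_elim
    case (elim w)
    then have "(\<lambda>i::nat. \<Lambda> {} w) \<longlonglongrightarrow> 0" by (auto simp: sums_iff intro: summable_LIMSEQ_zero)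
    then show ?case by (simp add: LIMSEQ_const_iff)
  qed
qed

lemma Lambda_finite_Union:
  assumes I: "finite I" and B: "\<And>i. i \<in> I \<Longrightarrow> B i \<in> sets borel \<and> bounded (B i)"
    and disj: "disjoint_family_on B I"
  shows "AE w in M. \<Lambda> (\<Union>i\<in>I. B i) w = (\<Sum>i\<in>I. \<Lambda> (B i) w)"
proof -
  obtain e where e: "bij_betw e {..<card I} I"
    using ex_bij_betw_nat_finite[OF I] by (auto simp: atLeast0LessThan)
  \<comment> \<open>Padding with empty sets turns the finite family into a sequence;
    \<open>Lambda_empty\<close> makes the additional terms vanish.\<close>
  define B' where "B' k = (if k < card I then B (e k) else {})" for k
  have eI: "e k \<in> I" if "k < card I" for k using e that by (auto simp: bij_betw_def)
  have U: "(\<Union>k. B' k) = (\<Union>i\<in>I. B i)"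
    using e unfolding B'_def bij_betw_def by (auto split: if_splits) (metis imageE lessThan_iff)
  have "disjoint_family B'"
  proof (unfold disjoint_family_on_def, intro ballI impI)
    fix k l :: nat assume "k \<noteq> l"
    show "B' k \<inter> B' l = {}"
    proof (cases "k < card I \<and> l < card I")
      case True
      then have "e k \<noteq> e l" using e \<open>k \<noteq> l\<close> by (auto simp: bij_betw_def inj_on_def)
      then show ?thesis using True disj eI by (simp add: disjoint_family_on_def B'_def)
    qed (auto simp: B'_def)
  qed
  moreover have "bounded (\<Union>k. B' k)" unfolding U using B I by auto
  moreover have "\<And>k. B' k \<in> sets borel" using B eI unfolding B'_def by auto
  ultimately have "AE w in M. (\<lambda>k. \<Lambda> (B' k) w) sums \<Lambda> (\<Union>k. B' k) w"
    using SaS unfolding SaS_random_measure_def by blast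
  with Lambda_empty show ?thesis
  proof eventually_elim
    case (elim w)
    have "(\<lambda>k. \<Lambda> (B' k) w) sums (\<Sum>k<card I. \<Lambda> (B' k) w)"
      by (rule sums_finite) (use elim(1) in \<open>auto simp: B'_def\<close>)
    with elim(2) have "\<Lambda> (\<Union>i\<in>I. B i) w = (\<Sum>k<card I. \<Lambda> (B' k) w)"
      unfolding U using sums_unique2 by blast
    also have "\<dots> = (\<Sum>k<card I. \<Lambda> (B (e k)) w)" by (simp add: B'_def)
    also have "\<dots> = (\<Sum>i\<in>I. \<Lambda> (B i) w)" by (rule sum.reindex_bij_betw[OF e])
    finally show ?case .
  qed
qed

lemma Lambda_indep:
  assumes I: "finite I" and B: "\<And>i. i \<in> I \<Longrightarrow> B i \<in> sets borel \<and> bounded (B i)"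
    and disj: "disjoint_family_on B I"
  shows "indep_vars (\<lambda>_. borel) (\<lambda>i. \<Lambda> (B i)) I"
proof -
  obtain e :: "'a \<Rightarrow> nat" where e: "inj_on e I"
    using finite_imp_inj_to_nat_seg[OF I] by auto
  \<comment> \<open>Independence is given for families indexed by all natural numbers, so the index
    set is injected into them and empty sets fill the gaps.\<close>
  define B' where "B' k = (if k \<in> e ` I then B (the_inv_into I e k) else {})" for k
  have eq: "B' (e i) = B i" if "i \<in> I" for i
    using that by (simp add: B'_def the_inv_into_f_f[OF e])
  have B'_empty: "B' k = {}" if "k \<notin> e ` I" for k using that by (simp add: B'_def)
  have "disjoint_family B'"
  proof (unfold disjoint_family_on_def, intro ballI impI)
    fix k l :: nat assume "k \<noteq> l"
    show "B' k \<inter> B' l = {}"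
    proof (cases "k \<in> e ` I \<and> l \<in> e ` I")
      case True
      then obtain i j where "i \<in> I" "j \<in> I" "k = e i" "l = e j" by auto
      moreover from this \<open>k \<noteq> l\<close> have "i \<noteq> j" by auto
      ultimately show ?thesis using disj by (simp add: eq disjoint_family_on_def)
    qed (use B'_empty in auto)
  qed
  moreover have "B' k \<in> sets borel \<and> bounded (B' k)" for k
    using B B'_empty eq by (cases "k \<in> e ` I") auto
  ultimately have "indep_vars (\<lambda>_. borel) (\<lambda>k. \<Lambda> (B' k)) UNIV"
    using SaS unfolding SaS_random_measure_def by blast
  then have "indep_vars (\<lambda>_. borel) (\<lambda>k. \<Lambda> (B' k)) (e ` I)"
    by (rule indep_vars_subset) auto
  from indep_vars_reindex[OF e this] have "indep_vars (\<lambda>_. borel) (\<lambda>i. \<Lambda> (B' (e i))) I" .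
  then show ?thesis
    by (rule indep_vars_cong[THEN iffD1, rotated 3]) (auto simp: eq)
qed

lemma simple_stochastic_integral_measurable:
  assumes "simple_function borel \<phi>" "bounded {s. \<phi> s \<noteq> 0}"
  shows "simple_stochastic_integral \<Lambda> \<phi> \<in> borel_measurable M"
  unfolding simple_stochastic_integral_def
proof (rule borel_measurable_sum, rule borel_measurable_times)
  fix c assume c: "c \<in> range \<phi> - {0}"
  have "\<phi> -` {c} \<in> sets borel"
    using assms c by (auto simp: simple_function_def)
  moreover have "bounded (\<phi> -` {c})"
    using assms c by (auto intro: bounded_subset)
  ultimately show "\<Lambda> (\<phi> -` {c}) \<in> borel_measurable M" by simp
qed simp

text \<open>Finitely many simple functions are constant where the vector of their values is fixed,
  so their integrals are linear combinations of the same independent variables. The value vectors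
  serve as their own index set. The last clause evaluates integrals of functions of the value vector
  cell by cell.\<close>

lemma simple_integral_refinement:
  fixes \<phi> :: "'i \<Rightarrow> real \<Rightarrow> real"
  assumes I: "finite I" and simple: "\<forall>i\<in>I. simple_function borel (\<phi> i) \<and> bounded {s. \<phi> i s \<noteq> 0}"
  shows "\<exists>V B. finite V \<and> disjoint_family_on B V \<and> (\<forall>v\<in>V. B v \<in> sets borel \<and> bounded (B v)) \<and>
    (AE w in M. \<forall>i\<in>I. simple_stochastic_integral \<Lambda> (\<phi> i) w = (\<Sum>v\<in>V. v i * \<Lambda> (B v) w)) \<and>
    (\<forall>G :: ('i \<Rightarrow> real) \<Rightarrow> ennreal. G (\<lambda>i\<in>I. 0) = 0 \<longrightarrow>
       (\<integral>\<^sup>+ s. G (\<lambda>i\<in>I. \<phi> i s) \<partial>lborel) = (\<Sum>v\<in>V. G v * emeasure lborel (B v)))"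
proof -
  note \<phi> = bspec[OF simple]
  define \<Phi> where "\<Phi> s = (\<lambda>i\<in>I. \<phi> i s)" for s
  have fin: "finite (range (\<phi> i))" if "i \<in> I" for i
    using \<phi>[OF that] by (auto simp: simple_function_def)
  have meas[measurable]: "\<phi> i \<in> borel_measurable borel" if "i \<in> I" for i
    using \<phi>[OF that] by (auto intro: borel_measurable_simple_function)
  have "finite (range \<Phi>)"
  proof (rule finite_subset)
    show "range \<Phi> \<subseteq> PiE I (\<lambda>i. range (\<phi> i))" by (auto simp: \<Phi>_def)
    show "finite (PiE I (\<lambda>i. range (\<phi> i)))" using I fin by (intro finite_PiE) auto
  qed
  \<comment> \<open>The zero vector is left out because its cell is unbounded; this is why
    \<open>G\<close> has to vanish there.\<close>
  define V where "V = range \<Phi> - {\<lambda>i\<in>I. 0}"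
  define B where "B v = {s. \<Phi> s = v}" for v
  have V: "finite V" using \<open>finite (range \<Phi>)\<close> by (simp add: V_def)
  have disj: "disjoint_family_on B V" by (auto simp: disjoint_family_on_def B_def)
  have Bv: "B v \<in> sets borel \<and> bounded (B v)" if v: "v \<in> V" for v
  proof
    have "v \<in> extensional I" using v by (auto simp: V_def \<Phi>_def)
    then have B_eq: "B v = {s\<in>space borel. \<forall>i\<in>I. \<phi> i s = v i}"
      by (auto simp: B_def \<Phi>_def restrict_def fun_eq_iff extensional_def)
    show "B v \<in> sets borel" unfolding B_eq using I by measurable
    have "\<exists>i\<in>I. v i \<noteq> 0"
    proof (rule ccontr)
      assume "\<not> ?thesis"
      then have "v = (\<lambda>i\<in>I. 0)" using \<open>v \<in> extensional I\<close> by (auto simp: fun_eq_iff extensional_def)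
      with v show False by (simp add: V_def)
    qed
    then obtain i where "i \<in> I" "v i \<noteq> 0" by blast
    then have "B v \<subseteq> {s. \<phi> i s \<noteq> 0}" unfolding B_eq by auto
    then show "bounded (B v)" using \<phi>[OF \<open>i \<in> I\<close>] bounded_subset by blast
  qed
  have "AE w in M. simple_stochastic_integral \<Lambda> (\<phi> i) w = (\<Sum>v\<in>V. v i * \<Lambda> (B v) w)" if i: "i \<in> I" for i
  proof -
    let ?T = "range (\<phi> i) - {0}" and ?S = "{v\<in>V. v i \<noteq> 0}"
    have Phi_i: "\<Phi> s i = \<phi> i s" for s using i by (simp add: \<Phi>_def)
    have vimage: "\<phi> i -` {c} = (\<Union>v\<in>{v\<in>?S. v i = c}. B v)" if "c \<in> ?T" for c
    proof -
      have "\<Phi> s \<in> V" if "\<phi> i s \<noteq> 0" for s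
        using that i by (auto simp: V_def \<Phi>_def restrict_def fun_eq_iff)
      then show ?thesis using that Phi_i by (auto simp: B_def V_def) (metis Phi_i)
    qed
    have "AE w in M. \<forall>c\<in>?T. \<Lambda> (\<phi> i -` {c}) w = (\<Sum>v\<in>{v\<in>?S. v i = c}. \<Lambda> (B v) w)"
    proof (rule AE_finite_allI)
      show "finite ?T" using fin[OF i] by simp
      fix c assume c: "c \<in> ?T"
      show "AE w in M. \<Lambda> (\<phi> i -` {c}) w = (\<Sum>v\<in>{v\<in>?S. v i = c}. \<Lambda> (B v) w)"
        unfolding vimage[OF c]
        by (rule Lambda_finite_Union) (use V Bv disj in \<open>auto simp: disjoint_family_on_def\<close>)
    qed
    then show ?thesis
    proof eventually_elim
      case (elim w)
      have "simple_stochastic_integral \<Lambda> (\<phi> i) w = (\<Sum>c\<in>?T. \<Sum>v\<in>{v\<in>?S. v i = c}. v i * \<Lambda> (B v) w)"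
        unfolding simple_stochastic_integral_def using elim by (intro sum.cong) (auto simp: sum_distrib_left)
      also have "\<dots> = (\<Sum>v\<in>?S. v i * \<Lambda> (B v) w)"
        by (rule sum.group) (use V fin[OF i] in \<open>auto simp: V_def Phi_i\<close>)
      also have "\<dots> = (\<Sum>v\<in>V. v i * \<Lambda> (B v) w)"
        by (rule sum.mono_neutral_left) (use V in auto)
      finally show ?case .
    qed
  qed
  then have AE: "AE w in M. \<forall>i\<in>I. simple_stochastic_integral \<Lambda> (\<phi> i) w = (\<Sum>v\<in>V. v i * \<Lambda> (B v) w)"
    by (intro AE_finite_allI I)
  have "(\<integral>\<^sup>+ s. G (\<Phi> s) \<partial>lborel) = (\<Sum>v\<in>V. G v * emeasure lborel (B v))"
    if G: "G (\<lambda>i\<in>I. 0) = 0" for G :: "('i \<Rightarrow> real) \<Rightarrow> ennreal"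
  proof -
    have "G (\<Phi> s) = (\<Sum>v\<in>V. G v * indicator (B v) s)" for s
    proof (cases "\<Phi> s \<in> V")
      case True
      have "(\<Sum>v\<in>V. G v * indicator (B v) s) = (\<Sum>v\<in>V. if v = \<Phi> s then G v else 0)"
        by (intro sum.cong) (auto simp: B_def indicator_def)
      then show ?thesis using True V by simp
    next
      case False
      then have "\<Phi> s = (\<lambda>i\<in>I. 0)" by (auto simp: V_def)
      moreover have "(\<Sum>v\<in>V. G v * indicator (B v) s) = 0"
        using False by (intro sum.neutral) (auto simp: B_def indicator_def)
      ultimately show ?thesis using G by simp
    qed
    then have "(\<integral>\<^sup>+ s. G (\<Phi> s) \<partial>lborel) = (\<integral>\<^sup>+ s. (\<Sum>v\<in>V. G v * indicator (B v) s) \<partial>lborel)" by simp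
    also have "\<dots> = (\<Sum>v\<in>V. \<integral>\<^sup>+ s. G v * indicator (B v) s \<partial>lborel)"
    proof (rule nn_integral_sum)
      fix v assume "v \<in> V"
      then have [measurable]: "B v \<in> sets borel" using Bv by simp
      show "(\<lambda>s. G v * indicator (B v) s) \<in> borel_measurable lborel" by measurable
    qed
    also have "\<dots> = (\<Sum>v\<in>V. G v * emeasure lborel (B v))"
      using Bv by (intro sum.cong nn_integral_cmult_indicator) auto
    finally show ?thesis .
  qed
  with V disj Bv AE show ?thesis unfolding \<Phi>_def by (intro exI[of _ V] exI[of _ B] conjI) auto
qed

end

section \<open>Quadratic functionals of stable integrals\<close>

locale psd_form =
  fixes I :: "'i set" and K :: "'i \<Rightarrow> 'i \<Rightarrow> real"
  assumes finite_index: "finite I" and psd: "\<And>y. (\<Sum>i\<in>I. \<Sum>j\<in>I. K i j * y i * y j) \<ge> 0"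
begin

definition Bil :: "('i \<Rightarrow> real) \<Rightarrow> ('i \<Rightarrow> real) \<Rightarrow> real" where
  "Bil y z = (\<Sum>i\<in>I. \<Sum>j\<in>I. K i j * y i * z j)"

definition Q :: "('i \<Rightarrow> real) \<Rightarrow> real" where
  "Q y = Bil y y"

lemma Q_nonneg: "Q y \<ge> 0"
  using psd[of y] by (simp add: Q_def Bil_def)

lemma Q_cong: "(\<And>i. i \<in> I \<Longrightarrow> y i = z i) \<Longrightarrow> Q y = Q z"
  unfolding Q_def Bil_def by (intro sum.cong) auto

lemma Q_restrict [simp]: "Q (restrict y I) = Q y"
  by (rule Q_cong) simp

lemma Q_zero [simp]: "Q (\<lambda>i. 0) = 0"
  by (simp add: Q_def Bil_def)

text \<open>The parallelogram identity; dropping the nonnegative form of the difference leaves a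
  triangle inequality with factor 2.\<close>

lemma Q_add_le: "Q (\<lambda>i. y i + z i) \<le> 2 * Q y + 2 * Q z"
proof -
  have "Q (\<lambda>i. y i + z i) + Q (\<lambda>i. y i - z i) = 2 * Q y + 2 * Q z"
    unfolding Q_def Bil_def
    by (simp add: sum.distrib[symmetric] sum_distrib_left algebra_simps)
  then show ?thesis using Q_nonneg[of "\<lambda>i. y i - z i"] by linarith
qed

lemma Q_sum: 
  assumes "finite V"
  shows "Q (\<lambda>i. \<Sum>v\<in>V. v i * c v) = (\<Sum>v\<in>V. \<Sum>u\<in>V. Bil v u * (c v * c u))"
proof -
  have "Q (\<lambda>i. \<Sum>v\<in>V. v i * c v) = (\<Sum>i\<in>I. \<Sum>j\<in>I. \<Sum>v\<in>V. \<Sum>u\<in>V. K i j * v i * u j * (c v * c u))"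
    unfolding Q_def Bil_def
    by (simp add: sum_product sum_distrib_left sum_distrib_right algebra_simps)
  also have "\<dots> = (\<Sum>i\<in>I. \<Sum>v\<in>V. \<Sum>u\<in>V. \<Sum>j\<in>I. K i j * v i * u j * (c v * c u))"
    by (subst sum.swap[of _ V I], subst sum.swap[of _ V I], rule refl)
  also have "\<dots> = (\<Sum>v\<in>V. \<Sum>u\<in>V. \<Sum>i\<in>I. \<Sum>j\<in>I. K i j * v i * u j * (c v * c u))"
    by (subst sum.swap[of _ V I], subst sum.swap[of _ V I], rule refl)
  finally show ?thesis by (simp add: Bil_def sum_distrib_right)
qed

definition Kbound :: real where "Kbound = (\<Sum>i\<in>I. \<Sum>j\<in>I. \<bar>K i j\<bar>)"

lemma Kbound_nonneg: "Kbound \<ge> 0"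
  unfolding Kbound_def by (intro sum_nonneg) auto

lemma Q_le_Kbound: "Q y \<le> Kbound * (\<Sum>i\<in>I. (y i)\<^sup>2)"
proof -
  let ?S = "\<Sum>i\<in>I. (y i)\<^sup>2"
  have "K i j * y i * y j \<le> \<bar>K i j\<bar> * ?S" if "i \<in> I" "j \<in> I" for i j
  proof -
    have "(y i)\<^sup>2 \<le> ?S" "(y j)\<^sup>2 \<le> ?S"
      using that finite_index by (auto intro: member_le_sum)
    then have "\<bar>y i * y j\<bar> \<le> ?S"
      using sum_squares_ge_zero zero_le_power2[of "\<bar>y i\<bar> - \<bar>y j\<bar>"]
      by (simp add: power2_diff abs_mult)
    then have "\<bar>K i j\<bar> * \<bar>y i * y j\<bar> \<le> \<bar>K i j\<bar> * ?S" by (intro mult_left_mono) auto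
    then show ?thesis by (simp add: abs_mult[symmetric] mult.assoc abs_le_iff)
  qed
  then show ?thesis unfolding Q_def Bil_def Kbound_def sum_distrib_right
    by (intro sum_mono) auto
qed

end

locale stable_psd_form = stable_random_measure M \<alpha> \<Lambda> + psd_form I K
  for M :: "'w measure" and \<alpha> \<Lambda> and I :: "'i set" and K
begin

text \<open>
  Each summand is truncated where its own contribution exceeds \<open>x\<close>; the truncated variables are
  still symmetric and independent, so that no cross terms appear in the mean of \<open>Q\<close>.
\<close>

lemma Q_cells_aux:
  assumes V: "finite V" "disjoint_family_on B V" "\<And>v. v \<in> V \<Longrightarrow> B v \<in> sets borel \<and> bounded (B v)"
    and x: "x > 0" and u: "\<And>v. v \<in> V \<Longrightarrow> u v > 0 \<and> Q v \<le> (u v)\<^sup>2"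
  shows "expectation (\<lambda>w. min 1 (Q (\<lambda>i. \<Sum>v\<in>V. v i * \<Lambda> (B v) w) / x\<^sup>2))
    \<le> (\<Sum>v\<in>V. 6 * measure lborel (B v) * (u v / x) powr \<alpha>)"
proof -
  have [measurable]: "\<And>v. v \<in> V \<Longrightarrow> \<Lambda> (B v) \<in> borel_measurable M" using V(3) Lambda_measurable by blast
  have var: "\<And>v. v \<in> V \<Longrightarrow> SaS_var M \<alpha> (measure lborel (B v)) (\<Lambda> (B v))"
    using V(3) Lambda_var by blast
  \<comment> \<open>\<open>u v\<close> majorizes the root of Q at the vector v, so |z|
    \<open>u v\<close> measures what a single cell can contribute.\<close>
  define g where "g v z = (if \<bar>z\<bar> * u v \<le> x then z else 0)" for v z
  have [measurable]: "g v \<in> borel_measurable borel" for v unfolding g_def by measurable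
  let ?z = "\<lambda>v w. g v (\<Lambda> (B v) w)"
  have g_bound: "\<bar>g v z\<bar> \<le> x / u v" if "v \<in> V" for v z
    using u[OF that] x by (auto simp: g_def field_simps)
  have int_z: "integrable M (?z v)" if "v \<in> V" for v
    using g_bound[OF that] that by (intro integrable_const_bound[where B = "x / u v"] AE_I2) auto
  have int_zz: "integrable M (\<lambda>w. ?z v w * ?z v' w)" if "v \<in> V" "v' \<in> V" for v v'
    using mult_mono[OF g_bound[OF that(1)] g_bound[OF that(2)]] that u[of v] x
    by (intro integrable_const_bound[where B = "(x / u v) * (x / u v')"] AE_I2) (auto simp: abs_mult)
  \<comment> \<open>Independence and oddness: every truncated variable has mean 0.\<close>
  have E_zz: "expectation (\<lambda>w. ?z v w * ?z v' w) = 0" if "v \<in> V" "v' \<in> V" "v \<noteq> v'" for v v'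
  proof -
    have "indep_vars (\<lambda>_. borel) (\<lambda>v w. ?z v w) V"
      by (rule indep_vars_compose2[OF Lambda_indep[OF V(1) V(3) V(2)]]) auto
    then have "indep_vars (\<lambda>_. borel) (\<lambda>v w. ?z v w) {v, v'}"
      by (rule indep_vars_subset) (use that in auto)
    from indep_vars_lebesgue_integral[OF _ this] have
      "expectation (\<lambda>w. \<Prod>v\<in>{v,v'}. ?z v w) = (\<Prod>v\<in>{v,v'}. expectation (?z v))"
      using that int_z by auto
    moreover have "expectation (?z v) = 0"
      by (rule SaS_var_odd_expectation[OF var[OF that(1)]]) (auto simp: g_def)
    ultimately show ?thesis using that by simp
  qed
  let ?b = "\<lambda>v w. if \<bar>\<Lambda> (B v) w\<bar> * u v > x then 1 else 0::real"
  let ?Y = "\<lambda>w i. \<Sum>v\<in>V. v i * \<Lambda> (B v) w"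
  let ?Z = "\<lambda>w i. \<Sum>v\<in>V. v i * ?z v w"
  have int_b: "integrable M (?b v)" if "v \<in> V" for v
    using that by (intro integrable_const_bound[where B = 1] AE_I2) auto
  have QZ: "Q (?Z w) = (\<Sum>v\<in>V. \<Sum>v'\<in>V. Bil v v' * (?z v w * ?z v' w))" for w
    using V by (intro Q_sum) auto
  have int_QZ: "integrable M (\<lambda>w. Q (?Z w))"
    unfolding QZ using int_zz by (intro Bochner_Integration.integrable_sum integrable_mult_right) auto
  let ?e1 = "\<Sum>v\<in>V. Q v * expectation (\<lambda>w. (?z v w)\<^sup>2)"
  have E_QZ: "expectation (\<lambda>w. Q (?Z w)) = ?e1"
  proof -
    have "expectation (\<lambda>w. Q (?Z w)) = (\<Sum>v\<in>V. \<Sum>v'\<in>V. Bil v v' * expectation (\<lambda>w. ?z v w * ?z v' w))"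
      unfolding QZ using int_zz by (simp add: Bochner_Integration.integral_sum)
    also have "\<dots> = (\<Sum>v\<in>V. \<Sum>v'\<in>V. if v' = v then Bil v v * expectation (\<lambda>w. ?z v w * ?z v w) else 0)"
      using E_zz by (intro sum.cong refl) auto
    also have "\<dots> = ?e1"
      using V(1) by (simp add: Q_def power2_eq_square)
    finally show ?thesis .
  qed
  \<comment> \<open>Either some cell exceeds its threshold, which \<open>?b\<close> counts, or
    nothing is truncated and Q of the truncated sum is the original value.\<close>
  have "expectation (\<lambda>w. min 1 (Q (?Y w) / x\<^sup>2)) \<le> expectation (\<lambda>w. (\<Sum>v\<in>V. ?b v w) + Q (?Z w) / x\<^sup>2)"
  proof (rule integral_mono)
    show "integrable M (\<lambda>w. min 1 (Q (?Y w) / x\<^sup>2))"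
      unfolding Q_def Bil_def using psd by (intro integrable_const_bound[where B = 1] AE_I2) auto
    show "integrable M (\<lambda>w. (\<Sum>v\<in>V. ?b v w) + Q (?Z w) / x\<^sup>2)"
      using int_b int_QZ by (intro Bochner_Integration.integrable_add Bochner_Integration.integrable_sum) auto
    fix w
    show "min 1 (Q (?Y w) / x\<^sup>2) \<le> (\<Sum>v\<in>V. ?b v w) + Q (?Z w) / x\<^sup>2"
    proof (cases "\<exists>v\<in>V. \<bar>\<Lambda> (B v) w\<bar> * u v > x")
      case True
      then obtain v where "v \<in> V" "\<bar>\<Lambda> (B v) w\<bar> * u v > x" by auto
      then have "1 \<le> (\<Sum>v\<in>V. ?b v w)"
        using member_le_sum[of v V "\<lambda>v. ?b v w"] V(1) by auto
      moreover have "Q (?Z w) / x\<^sup>2 \<ge> 0" using Q_nonneg by simp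
      ultimately show ?thesis by linarith
    next
      case False
      then have "?Z w = ?Y w" by (intro ext sum.cong) (auto simp: g_def)
      moreover have "(\<Sum>v\<in>V. ?b v w) \<ge> 0" by (intro sum_nonneg) auto
      ultimately show ?thesis by simp
    qed
  qed
  also have "\<dots> = (\<Sum>v\<in>V. expectation (?b v)) + ?e1 / x\<^sup>2"
    using int_b int_QZ E_QZ by (subst Bochner_Integration.integral_add) (auto simp: Bochner_Integration.integral_sum)
  also have "\<dots> \<le> (\<Sum>v\<in>V. expectation (?b v)) + (\<Sum>v\<in>V. (u v)\<^sup>2 * expectation (\<lambda>w. (?z v w)\<^sup>2)) / x\<^sup>2"
    using u by (intro add_left_mono divide_right_mono sum_mono mult_right_mono integral_nonneg_AE AE_I2) auto
  also have "\<dots> = (\<Sum>v\<in>V. expectation (\<lambda>w. ?b v w + (u v)\<^sup>2 * (?z v w)\<^sup>2 / x\<^sup>2))"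
    unfolding sum_divide_distrib sum.distrib[symmetric] using int_b int_zz
    by (intro sum.cong refl) (simp add: power2_eq_square)
  \<comment> \<open>Per cell, the indicator of the exceedance and the truncated square add up to one
    truncated square, to which \<open>SaS_var_min_square\<close> applies.\<close>
  also have "\<dots> = (\<Sum>v\<in>V. expectation (\<lambda>w. min 1 ((u v / x * \<Lambda> (B v) w)\<^sup>2)))"
  proof (intro sum.cong refl Bochner_Integration.integral_cong)
    fix v w assume v: "v \<in> V"
    have sq: "(u v / x * \<Lambda> (B v) w)\<^sup>2 = (\<bar>\<Lambda> (B v) w\<bar> * u v / x)\<^sup>2"
      by (simp add: power_mult_distrib power_divide)
    show "?b v w + (u v)\<^sup>2 * (?z v w)\<^sup>2 / x\<^sup>2 = min 1 ((u v / x * \<Lambda> (B v) w)\<^sup>2)"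
    proof (cases "\<bar>\<Lambda> (B v) w\<bar> * u v > x")
      case True
      then have "1 \<le> \<bar>\<Lambda> (B v) w\<bar> * u v / x" using x by simp
      then have "1 \<le> (\<bar>\<Lambda> (B v) w\<bar> * u v / x)\<^sup>2" by (rule one_le_power)
      then show ?thesis using True unfolding sq by (simp add: g_def)
    next
      case False
      then have "\<bar>\<Lambda> (B v) w\<bar> * u v / x \<le> 1" using x by simp
      then have "(\<bar>\<Lambda> (B v) w\<bar> * u v / x)\<^sup>2 \<le> 1"
        using u[OF v] x by (intro power_le_one) auto
      then show ?thesis using False unfolding sq by (simp add: g_def power_mult_distrib power_divide mult.commute)
    qed
  qed
  also have "\<dots> \<le> (\<Sum>v\<in>V. 6 * measure lborel (B v) * (u v / x) powr \<alpha>)"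
  proof (rule sum_mono)
    fix v assume "v \<in> V"
    from SaS_var_min_square[OF var[OF this] alpha, of "u v / x"] u[OF this] x
    show "expectation (\<lambda>w. min 1 ((u v / x * \<Lambda> (B v) w)\<^sup>2)) \<le> 6 * measure lborel (B v) * (u v / x) powr \<alpha>"
      by simp
  qed
  finally show ?thesis .
qed

text \<open>The majorant sqrt (Q v) + \<eta> is positive even where Q vanishes; letting \<eta> tend
  to 0 removes it.\<close>

lemma Q_cells:
  assumes V: "finite V" "disjoint_family_on B V" "\<And>v. v \<in> V \<Longrightarrow> B v \<in> sets borel \<and> bounded (B v)"
    and x: "x > 0"
  shows "expectation (\<lambda>w. min 1 (Q (\<lambda>i. \<Sum>v\<in>V. v i * \<Lambda> (B v) w) / x\<^sup>2))
    \<le> 6 / x powr \<alpha> * (\<Sum>v\<in>V. Q v powr (\<alpha>/2) * measure lborel (B v))"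
proof -
  let ?E = "expectation (\<lambda>w. min 1 (Q (\<lambda>i. \<Sum>v\<in>V. v i * \<Lambda> (B v) w) / x\<^sup>2))"
  let ?h = "\<lambda>\<eta>. \<Sum>v\<in>V. 6 * measure lborel (B v) * ((sqrt (Q v) + \<eta>) / x) powr \<alpha>"
  have "(?h \<longlongrightarrow> ?h 0) (at_right 0)"
  proof (intro tendsto_sum tendsto_mult tendsto_const)
    fix v
    show "((\<lambda>\<eta>. ((sqrt (Q v) + \<eta>) / x) powr \<alpha>) \<longlongrightarrow> ((sqrt (Q v) + 0) / x) powr \<alpha>) (at_right 0)"
    proof (rule tendsto_powr2)
      show "((\<lambda>\<eta>. (sqrt (Q v) + \<eta>) / x) \<longlongrightarrow> (sqrt (Q v) + 0) / x) (at_right 0)"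
        using x by (intro tendsto_intros) auto
      show "\<forall>\<^sub>F \<eta> in at_right 0. 0 \<le> (sqrt (Q v) + \<eta>) / x"
        using eventually_at_right_less[of 0] by eventually_elim (use x Q_nonneg in auto)
    qed (use alpha in auto)
  qed
  moreover have "\<forall>\<^sub>F \<eta> in at_right 0. ?E \<le> ?h \<eta>"
    using eventually_at_right_less[of 0]
  proof eventually_elim
    case (elim \<eta>)
    show ?case
    proof (rule Q_cells_aux[OF V x])
      fix v
      have "(sqrt (Q v))\<^sup>2 \<le> (sqrt (Q v) + \<eta>)\<^sup>2"
        using elim by (intro power_mono) (auto intro: Q_nonneg)
      then show "0 < sqrt (Q v) + \<eta> \<and> Q v \<le> (sqrt (Q v) + \<eta>)\<^sup>2"
        using elim Q_nonneg[of v] by (auto intro: add_nonneg_pos)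
    qed auto
  qed
  ultimately have "?E \<le> ?h 0" by (rule tendsto_lowerbound) auto
  also have "?h 0 = 6 / x powr \<alpha> * (\<Sum>v\<in>V. Q v powr (\<alpha>/2) * measure lborel (B v))"
    unfolding sum_distrib_left
    using x Q_nonneg by (intro sum.cong refl) (simp add: powr_divide powr_half_sqrt[symmetric] powr_powr)
  finally show ?thesis .
qed

text \<open>The integral of Q^(\<alpha>/2) of the kernels is exactly the sum over cells in
  \<open>Q_cells\<close>, by the last clause of the refinement.\<close>

lemma Q_simple:
  assumes \<phi>: "\<forall>i\<in>I. simple_function borel (\<phi> i) \<and> bounded {s. \<phi> i s \<noteq> 0}"
    and x: "x > 0"
  shows "ennreal (expectation (\<lambda>w. min 1 (Q (\<lambda>i. simple_stochastic_integral \<Lambda> (\<phi> i) w) / x\<^sup>2)))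
    \<le> ennreal (6 / x powr \<alpha>) * (\<integral>\<^sup>+ s. ennreal (Q (\<lambda>i. \<phi> i s) powr (\<alpha>/2)) \<partial>lborel)"
proof -
  obtain V B where V: "finite V" "disjoint_family_on B V" "\<forall>v\<in>V. B v \<in> sets borel \<and> bounded (B v)"
    and AE: "AE w in M. \<forall>i\<in>I. simple_stochastic_integral \<Lambda> (\<phi> i) w = (\<Sum>v\<in>V. v i * \<Lambda> (B v) w)"
    and int: "\<forall>G :: ('i \<Rightarrow> real) \<Rightarrow> ennreal. G (\<lambda>i\<in>I. 0) = 0 \<longrightarrow>
       (\<integral>\<^sup>+ s. G (\<lambda>i\<in>I. \<phi> i s) \<partial>lborel) = (\<Sum>v\<in>V. G v * emeasure lborel (B v))"
    using simple_integral_refinement[OF finite_index \<phi>] by (elim exE conjE) (rule that)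
  have [measurable]: "\<And>v. v \<in> V \<Longrightarrow> \<Lambda> (B v) \<in> borel_measurable M" using V(3) Lambda_measurable by blast
  have ssi[measurable]: "simple_stochastic_integral \<Lambda> (\<phi> i) \<in> borel_measurable M" if "i \<in> I" for i
    by (rule simple_stochastic_integral_measurable) (use \<phi> that in auto)
  have em: "emeasure lborel (B v) = ennreal (measure lborel (B v))" if "v \<in> V" for v
    using V(3) that emeasure_bounded_finite[of "B v"] by (intro emeasure_eq_ennreal_measure) auto
  let ?e1 = "\<Sum>v\<in>V. Q v powr (\<alpha>/2) * measure lborel (B v)"
  let ?e2 = "\<lambda>w. min 1 (Q (\<lambda>i. simple_stochastic_integral \<Lambda> (\<phi> i) w) / x\<^sup>2)"
  have "expectation ?e2
      = expectation (\<lambda>w. min 1 (Q (\<lambda>i. \<Sum>v\<in>V. v i * \<Lambda> (B v) w) / x\<^sup>2))"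
  proof (rule integral_cong_AE)
    show "AE w in M. min 1 (Q (\<lambda>i. simple_stochastic_integral \<Lambda> (\<phi> i) w) / x\<^sup>2) =
        min 1 (Q (\<lambda>i. \<Sum>v\<in>V. v i * \<Lambda> (B v) w) / x\<^sup>2)"
      using AE
    proof eventually_elim
      case (elim w)
      have "Q (\<lambda>i. simple_stochastic_integral \<Lambda> (\<phi> i) w) = Q (\<lambda>i. \<Sum>v\<in>V. v i * \<Lambda> (B v) w)"
        by (rule Q_cong) (use elim in simp)
      then show ?case by simp
    qed
    show "?e2 \<in> borel_measurable M"
      unfolding Q_def Bil_def by measurable
    show "(\<lambda>w. min 1 (Q (\<lambda>i. \<Sum>v\<in>V. v i * \<Lambda> (B v) w) / x\<^sup>2)) \<in> borel_measurable M"
      unfolding Q_def Bil_def by measurable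
  qed
  also have "\<dots> \<le> 6 / x powr \<alpha> * ?e1"
    by (rule Q_cells[OF V(1,2) _ x]) (use V(3) in blast)
  finally have le: "expectation ?e2
      \<le> 6 / x powr \<alpha> * ?e1" .
  have "ennreal (expectation ?e2)
      \<le> ennreal (6 / x powr \<alpha>) * ennreal ?e1"
  proof -
    have "ennreal (6 / x powr \<alpha> * ?e1)
        = ennreal (6 / x powr \<alpha>) * ennreal ?e1"
      by (rule ennreal_mult) (auto intro!: sum_nonneg)
    then show ?thesis using ennreal_leI[OF le] by simp
  qed
  also have "ennreal ?e1
      = (\<Sum>v\<in>V. ennreal (Q v powr (\<alpha>/2)) * emeasure lborel (B v))"
  proof -
    have "ennreal (Q v powr (\<alpha>/2) * measure lborel (B v)) = ennreal (Q v powr (\<alpha>/2)) * emeasure lborel (B v)"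
      if "v \<in> V" for v
      unfolding em[OF that] by (rule ennreal_mult) auto
    then show ?thesis by (subst sum_ennreal[symmetric]) auto
  qed
  also have "\<dots> = (\<integral>\<^sup>+ s. ennreal (Q (\<lambda>i\<in>I. \<phi> i s) powr (\<alpha>/2)) \<partial>lborel)"
    by (rule int[rule_format, symmetric]) simp
  finally show ?thesis by simp
qed

end

text \<open>All kernels are approximated by simple functions along a common index k, and the bound
  passes to the limit. The constant 48 consists of the 6 of \<open>Q_cells\<close>, a factor 4 for
  halving the threshold x, and a factor 2 from \<open>Q_add_le\<close> applied to the
  kernels.\<close>

lemma (in stable_psd_form) Q_weak_type:
  assumes h: "\<And>i. i \<in> I \<Longrightarrow> h i \<in> borel_measurable borel"
    and Y: "\<And>i. i \<in> I \<Longrightarrow> is_stochastic_integral M \<alpha> \<Lambda> (h i) (Y i)"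
    and x: "x > 0" and b: "b \<ge> 0" "(\<integral>\<^sup>+ s. ennreal (Q (\<lambda>i. h i s) powr (\<alpha>/2)) \<partial>lborel) \<le> ennreal b"
  shows "prob {w\<in>space M. Q (\<lambda>i. Y i w) > x\<^sup>2} \<le> 48 * b / x powr \<alpha>"
proof -
  have "\<forall>i\<in>I. \<exists>\<phi> :: nat \<Rightarrow> real \<Rightarrow> real.
        (\<forall>k. simple_function borel (\<phi> k) \<and> bounded {s. \<phi> k s \<noteq> 0}) \<and>
        (\<lambda>k. \<integral>\<^sup>+ s. ennreal (\<bar>\<phi> k s - h i s\<bar> powr \<alpha>) \<partial>lborel) \<longlonglongrightarrow> 0 \<and>
        converges_in_probability M (\<lambda>k. simple_stochastic_integral \<Lambda> (\<phi> k)) (Y i)"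
    using Y unfolding is_stochastic_integral_def by blast
  from bchoice[OF this] obtain \<phi> :: "_ \<Rightarrow> nat \<Rightarrow> real \<Rightarrow> real" where
    \<phi>: "\<And>i k. i \<in> I \<Longrightarrow> simple_function borel (\<phi> i k) \<and> bounded {s. \<phi> i k s \<noteq> 0}"
    and lim: "\<And>i. i \<in> I \<Longrightarrow> (\<lambda>k. \<integral>\<^sup>+ s. ennreal (\<bar>\<phi> i k s - h i s\<bar> powr \<alpha>) \<partial>lborel) \<longlonglongrightarrow> 0"
    and conv: "\<And>i. i \<in> I \<Longrightarrow> converges_in_probability M (\<lambda>k. simple_stochastic_integral \<Lambda> (\<phi> i k)) (Y i)"
    by blast
  have Y_meas[measurable]: "Y i \<in> borel_measurable M" if "i \<in> I" for i
    using conv[OF that] by (simp add: converges_in_probability_def)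
  have \<phi>_meas[measurable]: "\<phi> i k \<in> borel_measurable borel" if "i \<in> I" for i k
    using \<phi>[OF that] by (auto intro: borel_measurable_simple_function)
  note h[measurable]
  have [measurable]: "(\<lambda>s. Q (\<lambda>i. h i s)) \<in> borel_measurable borel"
    unfolding Q_def Bil_def by measurable
  define J where "J i k = simple_stochastic_integral \<Lambda> (\<phi> i k)" for i k
  have J_meas[measurable]: "J i k \<in> borel_measurable M" if "i \<in> I" for i k
    unfolding J_def by (rule simple_stochastic_integral_measurable) (use \<phi>[OF that] in auto)
  \<comment> \<open>If every J is within \<eta> of its Y, the form of the difference is at most
    (x/2)^2. The summand 1 keeps the denominator positive.\<close>
  define \<eta> where "\<eta> = x / (2 * sqrt (Kbound * card I + 1))"
  have pos: "Kbound * card I + 1 > 0" using Kbound_nonneg by (simp add: add_nonneg_pos)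
  have \<eta>: "\<eta> > 0" unfolding \<eta>_def using x pos by simp
  have \<eta>2: "Kbound * card I * \<eta>\<^sup>2 \<le> (x/2)\<^sup>2"
  proof -
    have "Kbound * card I * \<eta>\<^sup>2 = (x/2)\<^sup>2 * (Kbound * card I / (Kbound * card I + 1))"
      unfolding \<eta>_def using pos by (simp add: power_divide power_mult_distrib)
    also have "\<dots> \<le> (x/2)\<^sup>2 * 1"
      using pos by (intro mult_left_mono) (auto simp: divide_le_eq)
    finally show ?thesis by simp
  qed
  define C where "C k = (\<Sum>i\<in>I. prob {w\<in>space M. \<bar>J i k w - Y i w\<bar> > \<eta>})" for k
  have C_lim: "C \<longlonglongrightarrow> 0"
    unfolding C_def J_def using conv \<eta> by (intro tendsto_null_sum) (auto simp: converges_in_probability_def)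
  \<comment> \<open>Price, in the integral of Q^(\<alpha>/2), of passing from the kernels to simple
    functions.\<close>
  define R where "R k = ennreal (2 * Kbound powr (\<alpha>/2)) * (\<Sum>i\<in>I. \<integral>\<^sup>+ s. ennreal (\<bar>\<phi> i k s - h i s\<bar> powr \<alpha>) \<partial>lborel)" for k
  have R_lim: "R \<longlonglongrightarrow> 0"
  proof -
    have "(\<lambda>k. \<Sum>i\<in>I. \<integral>\<^sup>+ s. ennreal (\<bar>\<phi> i k s - h i s\<bar> powr \<alpha>) \<partial>lborel) \<longlonglongrightarrow> 0"
      using lim by (intro tendsto_null_sum) auto
    from ennreal_tendsto_cmult[OF _ this, of "ennreal (2 * Kbound powr (\<alpha>/2))"]
    show ?thesis unfolding R_def by (simp add: ennreal_less_top)
  qed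
  let ?e1 = "\<lambda>k s. \<Sum>i\<in>I. ennreal (\<bar>\<phi> i k s - h i s\<bar> powr \<alpha>)"
  let ?e2 = "\<lambda>k s. \<Sum>i\<in>I. \<bar>\<phi> i k s - h i s\<bar> powr \<alpha>"
  let ?e3 = "\<lambda>s. Q (\<lambda>i. h i s) powr (\<alpha>/2)"
  have int_le: "(\<integral>\<^sup>+ s. ennreal (Q (\<lambda>i. \<phi> i k s) powr (\<alpha>/2)) \<partial>lborel) \<le> 2 * ennreal b + R k" for k
  proof -
    have pw: "Q (\<lambda>i. \<phi> i k s) powr (\<alpha>/2) \<le>
        2 * Q (\<lambda>i. h i s) powr (\<alpha>/2) + 2 * Kbound powr (\<alpha>/2) * (?e2 k s)" for s
    proof -
      let ?d = "\<lambda>i. \<phi> i k s - h i s"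
      have two: "(2 * q) powr (\<alpha>/2) \<le> 2 * q powr (\<alpha>/2)" if "q \<ge> 0" for q :: real
      proof -
        have "2 powr (\<alpha>/2) \<le> 2 powr (1::real)" using alpha by (intro powr_mono) auto
        then show ?thesis using that by (simp add: powr_mult mult_right_mono)
      qed
      have "Q (\<lambda>i. \<phi> i k s) \<le> 2 * Q (\<lambda>i. h i s) + 2 * Q ?d"
        using Q_add_le[of "\<lambda>i. h i s" ?d] by simp
      then have "Q (\<lambda>i. \<phi> i k s) powr (\<alpha>/2) \<le> (2 * Q (\<lambda>i. h i s) + 2 * Q ?d) powr (\<alpha>/2)"
        using alpha Q_nonneg by (intro powr_mono2) auto
      also have "\<dots> \<le> (2 * Q (\<lambda>i. h i s)) powr (\<alpha>/2) + (2 * Q ?d) powr (\<alpha>/2)"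
        using alpha Q_nonneg by (intro powr_add_le) auto
      also have "\<dots> \<le> 2 * Q (\<lambda>i. h i s) powr (\<alpha>/2) + 2 * Q ?d powr (\<alpha>/2)"
        using Q_nonneg by (intro add_mono two) auto
      also have "Q ?d powr (\<alpha>/2) \<le> (Kbound * (\<Sum>i\<in>I. (?d i)\<^sup>2)) powr (\<alpha>/2)"
        using alpha Q_nonneg by (intro powr_mono2 Q_le_Kbound) auto
      also have "\<dots> = Kbound powr (\<alpha>/2) * (\<Sum>i\<in>I. (?d i)\<^sup>2) powr (\<alpha>/2)"
        by (rule powr_mult)
      also have "(\<Sum>i\<in>I. (?d i)\<^sup>2) powr (\<alpha>/2) \<le> (\<Sum>i\<in>I. ((?d i)\<^sup>2) powr (\<alpha>/2))"
        using alpha finite_index by (intro powr_sum_le) auto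
      also have "\<dots> = (\<Sum>i\<in>I. \<bar>?d i\<bar> powr \<alpha>)"
      proof (intro sum.cong refl)
        fix i
        have "((?d i)\<^sup>2) powr (\<alpha>/2) = (\<bar>?d i\<bar> powr 2) powr (\<alpha>/2)" by simp
        also have "\<dots> = \<bar>?d i\<bar> powr \<alpha>" by (subst powr_powr) simp
        finally show "((?d i)\<^sup>2) powr (\<alpha>/2) = \<bar>?d i\<bar> powr \<alpha>" .
      qed
      finally show ?thesis by (simp add: mult_left_mono)
    qed
    have "(\<integral>\<^sup>+ s. ennreal (Q (\<lambda>i. \<phi> i k s) powr (\<alpha>/2)) \<partial>lborel)
        \<le> (\<integral>\<^sup>+ s. 2 * ennreal (?e3 s) +
             ennreal (2 * Kbound powr (\<alpha>/2)) * (?e1 k s) \<partial>lborel)"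
    proof (rule nn_integral_mono)
      fix s
      have "ennreal (Q (\<lambda>i. \<phi> i k s) powr (\<alpha>/2)) \<le> ennreal (2 * Q (\<lambda>i. h i s) powr (\<alpha>/2)
          + 2 * Kbound powr (\<alpha>/2) * (?e2 k s))"
        by (rule ennreal_leI[OF pw])
      also have "\<dots> = ennreal (2 * Q (\<lambda>i. h i s) powr (\<alpha>/2))
          + ennreal (2 * Kbound powr (\<alpha>/2) * (?e2 k s))"
        by (rule ennreal_plus) (auto intro!: mult_nonneg_nonneg sum_nonneg)
      also have "ennreal (2 * Q (\<lambda>i. h i s) powr (\<alpha>/2)) = 2 * ennreal (?e3 s)"
        by (subst ennreal_mult) auto
      also have "ennreal (2 * Kbound powr (\<alpha>/2) * (?e2 k s)) =
          ennreal (2 * Kbound powr (\<alpha>/2)) * ennreal (?e2 k s)"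
        by (rule ennreal_mult) (auto intro!: sum_nonneg)
      also have "ennreal (?e2 k s) = (?e1 k s)"
        by (rule sum_ennreal[symmetric]) auto
      finally show "ennreal (Q (\<lambda>i. \<phi> i k s) powr (\<alpha>/2)) \<le> 2 * ennreal (?e3 s) +
             ennreal (2 * Kbound powr (\<alpha>/2)) * (?e1 k s)" .
    qed
    also have "\<dots> = (\<integral>\<^sup>+ s. 2 * ennreal (?e3 s) \<partial>lborel) +
          (\<integral>\<^sup>+ s. ennreal (2 * Kbound powr (\<alpha>/2)) * (?e1 k s) \<partial>lborel)"
      by (rule nn_integral_add) measurable
    also have "(\<integral>\<^sup>+ s. 2 * ennreal (?e3 s) \<partial>lborel) =
        2 * (\<integral>\<^sup>+ s. ennreal (?e3 s) \<partial>lborel)"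
      by (rule nn_integral_cmult) measurable
    also have "(\<integral>\<^sup>+ s. ennreal (2 * Kbound powr (\<alpha>/2)) * (?e1 k s) \<partial>lborel) =
        ennreal (2 * Kbound powr (\<alpha>/2)) * (\<integral>\<^sup>+ s. (?e1 k s) \<partial>lborel)"
      by (rule nn_integral_cmult) measurable
    also have "(\<integral>\<^sup>+ s. (?e1 k s) \<partial>lborel) =
        (\<Sum>i\<in>I. \<integral>\<^sup>+ s. ennreal (\<bar>\<phi> i k s - h i s\<bar> powr \<alpha>) \<partial>lborel)"
      by (rule nn_integral_sum) measurable
    also have "2 * (\<integral>\<^sup>+ s. ennreal (?e3 s) \<partial>lborel) \<le> 2 * ennreal b"
      using b by (intro mult_left_mono) auto
    finally show ?thesis unfolding R_def by simp
  qed
  let ?B = "\<lambda>k. {w\<in>space M. Q (\<lambda>i. J i k w) > (x/2)\<^sup>2}"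
  let ?U = "\<lambda>k. \<Union>i\<in>I. {w\<in>space M. \<bar>J i k w - Y i w\<bar> > \<eta>}"
  let ?P = "prob {w\<in>space M. Q (\<lambda>i. Y i w) > x\<^sup>2}"
  have meas_Q[measurable]: "(\<lambda>w. Q (\<lambda>i. J i k w)) \<in> borel_measurable M"
     "(\<lambda>w. Q (\<lambda>i. Y i w)) \<in> borel_measurable M"
     "(\<lambda>w. Q (\<lambda>i. Y i w - J i k w)) \<in> borel_measurable M" for k
    unfolding Q_def Bil_def by measurable
  have P_le: "?P \<le> prob (?B k) + C k" for k
  proof -
    have "?P \<le> prob (?B k \<union> ?U k)"
    proof (rule finite_measure_mono)
      show "{w\<in>space M. Q (\<lambda>i. Y i w) > x\<^sup>2} \<subseteq>
        ?B k \<union> ?U k"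
      proof (rule subsetI, rule ccontr)
        fix w assume w: "w \<in> {w\<in>space M. Q (\<lambda>i. Y i w) > x\<^sup>2}"
          and n: "w \<notin> ?B k \<union> ?U k"
        have QJ: "Q (\<lambda>i. J i k w) \<le> (x/2)\<^sup>2" using w n by auto
        have d: "\<bar>J i k w - Y i w\<bar> \<le> \<eta>" if "i \<in> I" for i using w n that by force
        have "Q (\<lambda>i. Y i w - J i k w) \<le> Kbound * (\<Sum>i\<in>I. (Y i w - J i k w)\<^sup>2)" by (rule Q_le_Kbound)
        also have "\<dots> \<le> Kbound * (\<Sum>i\<in>I. \<eta>\<^sup>2)"
        proof (intro mult_left_mono sum_mono Kbound_nonneg)
          fix i assume "i \<in> I"
          have "\<bar>Y i w - J i k w\<bar>\<^sup>2 \<le> \<eta>\<^sup>2" using d[OF \<open>i \<in> I\<close>] by (intro power_mono) (auto simp: abs_minus_commute)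
          then show "(Y i w - J i k w)\<^sup>2 \<le> \<eta>\<^sup>2" by simp
        qed
        also have "\<dots> = Kbound * card I * \<eta>\<^sup>2" by simp
        also have "\<dots> \<le> (x/2)\<^sup>2" by (rule \<eta>2)
        finally have "Q (\<lambda>i. J i k w + (Y i w - J i k w)) \<le> 2 * (x/2)\<^sup>2 + 2 * (x/2)\<^sup>2"
          using Q_add_le[of "\<lambda>i. J i k w" "\<lambda>i. Y i w - J i k w"] QJ by linarith
        also have "\<dots> = x\<^sup>2" by (simp add: power_divide)
        finally show False using w by simp
      qed
      show "?B k \<union> ?U k \<in> sets M"
        using finite_index by (intro sets.Un sets.finite_UN) measurable
    qed
    also have "\<dots> \<le> prob (?B k) + prob (?U k)"
      using finite_index by (intro measure_Un_le sets.finite_UN) measurable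
    also have "prob (?U k) \<le> C k"
      unfolding C_def using finite_index by (intro measure_UNION_le) measurable
    finally show ?thesis by simp
  qed
  have QJ_le: "prob (?B k) \<le> 24 / x powr \<alpha> * (2 * b + e)"
    if "R k \<le> ennreal e" "e \<ge> 0" for k e
  proof -
    have "prob (?B k) =
        expectation (indicator (?B k))" by simp
    also have "\<dots> \<le> expectation (\<lambda>w. min 1 (Q (\<lambda>i. J i k w) / (x/2)\<^sup>2))"
    proof (rule integral_mono)
      have "?B k \<in> sets M" by measurable
      then show "integrable M (indicat_real (?B k))"
        by (simp add: emeasure_eq_measure)
      show "integrable M (\<lambda>w. min 1 (Q (\<lambda>i. J i k w) / (x/2)\<^sup>2))"
        using Q_nonneg by (intro integrable_const_bound[where B = 1] AE_I2) auto
      fix w show "indicat_real (?B k) w \<le> min 1 (Q (\<lambda>i. J i k w) / (x/2)\<^sup>2)"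
        using x Q_nonneg[of "\<lambda>i. J i k w"] by (auto simp: indicator_def)
    qed
    finally have "ennreal (prob (?B k)) \<le> ennreal (expectation (\<lambda>w. min 1 (Q (\<lambda>i. J i k w) / (x/2)\<^sup>2)))"
      by (rule ennreal_leI)
    also have "\<dots> \<le> ennreal (6 / (x/2) powr \<alpha>) * (\<integral>\<^sup>+ s. ennreal (Q (\<lambda>i. \<phi> i k s) powr (\<alpha>/2)) \<partial>lborel)"
      unfolding J_def by (rule Q_simple) (use \<phi> x in auto)
    also have "\<dots> \<le> ennreal (6 / (x/2) powr \<alpha>) * (2 * ennreal b + R k)"
      by (intro mult_left_mono int_le) auto
    also have "\<dots> \<le> ennreal (6 / (x/2) powr \<alpha>) * (2 * ennreal b + ennreal e)"
      by (intro mult_left_mono add_left_mono that) auto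
    also have "2 * ennreal b + ennreal e = ennreal (2 * b + e)"
      using b that by (simp add: ennreal_mult)
    also have "ennreal (6 / (x/2) powr \<alpha>) * ennreal (2 * b + e) = ennreal (6 / (x/2) powr \<alpha> * (2 * b + e))"
      using b that by (intro ennreal_mult[symmetric]) auto
    finally have "prob (?B k) \<le> 6 / (x/2) powr \<alpha> * (2 * b + e)"
      using b that by (subst (asm) ennreal_le_iff) auto
    also have "\<dots> \<le> 24 / x powr \<alpha> * (2 * b + e)"
    proof (rule mult_right_mono)
      have "2 powr \<alpha> \<le> 2 powr 2" using alpha by (intro powr_mono) auto
      then show "6 / (x/2) powr \<alpha> \<le> 24 / x powr \<alpha>" using x by (simp add: powr_divide divide_right_mono)
    qed (use b that in auto)
    finally show ?thesis .
  qed
  \<comment> \<open>For a given e one index k makes both error terms small; afterwards e tends to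
    0.\<close>
  have "?P \<le> 24 / x powr \<alpha> * (2 * b + e) + e" if e: "e > 0" for e
  proof -
    have "\<forall>\<^sub>F k in sequentially. R k < ennreal e" using R_lim e by (intro order_tendstoD(2)[OF R_lim]) auto
    moreover have "\<forall>\<^sub>F k in sequentially. C k < e" using C_lim e by (rule order_tendstoD(2))
    ultimately have "\<forall>\<^sub>F k in sequentially. R k < ennreal e \<and> C k < e" by eventually_elim auto
    then obtain k where k: "R k \<le> ennreal e" "C k < e"
      using eventually_happens[of _ sequentially] by (auto dest: less_imp_le)
    show ?thesis using P_le[of k] QJ_le[OF k(1)] e k(2) by linarith
  qed
  then have "\<forall>\<^sub>F e in at_right 0. ?P \<le> 24 / x powr \<alpha> * (2 * b + e) + e"
    using eventually_at_right_less[of "0::real"] by (auto elim!: eventually_mono)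
  moreover have "((\<lambda>e. 24 / x powr \<alpha> * (2 * b + e) + e) \<longlongrightarrow> 24 / x powr \<alpha> * (2 * b + 0) + 0) (at_right 0)"
    by (intro tendsto_intros)
  ultimately have "?P \<le> 24 / x powr \<alpha> * (2 * b + 0) + 0"
    by (intro tendsto_lowerbound[where F = "at_right 0" and f = "\<lambda>e. 24 / x powr \<alpha> * (2 * b + e) + e"]) auto
  then show ?thesis by simp
qed

section \<open>The law of a stable integral\<close>

context stable_random_measure
begin

text \<open>A single function is a family indexed by the unit type. Independence over the cells
  multiplies the characteristic functions.\<close>

lemma SaS_var_simple_stochastic_integral:
  assumes \<phi>: "simple_function borel \<phi>" "bounded {s. \<phi> s \<noteq> 0}"
  shows "SaS_var M \<alpha> (LINT s|lborel. \<bar>\<phi> s\<bar> powr \<alpha>) (simple_stochastic_integral \<Lambda> \<phi>)"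
proof -
  obtain V B where V: "finite V" "disjoint_family_on B V" "\<forall>v\<in>V. B v \<in> sets borel \<and> bounded (B v)"
    and AE: "AE w in M. \<forall>i\<in>{()}. simple_stochastic_integral \<Lambda> \<phi> w = (\<Sum>v\<in>V. v i * \<Lambda> (B v) w)"
    and int: "\<forall>G :: (unit \<Rightarrow> real) \<Rightarrow> ennreal. G (\<lambda>i\<in>{()}. 0) = 0 \<longrightarrow>
       (\<integral>\<^sup>+ s. G (\<lambda>i\<in>{()}. \<phi> s) \<partial>lborel) = (\<Sum>v\<in>V. G v * emeasure lborel (B v))"
  proof -
    have "finite {()}" "\<forall>i\<in>{()}. simple_function borel \<phi> \<and> bounded {s. \<phi> s \<noteq> 0}"
      using \<phi> by auto
    from simple_integral_refinement[of "{()}" "\<lambda>_. \<phi>", OF this] show ?thesis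
      by (elim exE conjE) (rule that)
  qed
  have [measurable]: "\<Lambda> (B v) \<in> borel_measurable M" if "v \<in> V" for v
    by (rule Lambda_measurable) (use V(3) that in auto)
  have [measurable]: "simple_stochastic_integral \<Lambda> \<phi> \<in> borel_measurable M"
    by (rule simple_stochastic_integral_measurable[OF \<phi>])
  have [measurable]: "\<phi> \<in> borel_measurable borel"
    using \<phi> by (auto intro: borel_measurable_simple_function)
  have em: "emeasure lborel (B v) = ennreal (measure lborel (B v))" if "v \<in> V" for v
    using V(3) that emeasure_bounded_finite[of "B v"] by (intro emeasure_eq_ennreal_measure) auto
  have distr: "distr M borel (simple_stochastic_integral \<Lambda> \<phi>) = distr M borel (\<lambda>w. \<Sum>v\<in>V. v () * \<Lambda> (B v) w)"
    by (rule distr_cong_AE) (use AE in auto)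
  have "(\<integral>\<^sup>+ s. ennreal (\<bar>\<phi> s\<bar> powr \<alpha>) \<partial>lborel) = (\<Sum>v\<in>V. ennreal (\<bar>v ()\<bar> powr \<alpha>) * emeasure lborel (B v))"
    using int[rule_format, of "\<lambda>v. ennreal (\<bar>v ()\<bar> powr \<alpha>)"] by simp
  also have "\<dots> = (\<Sum>v\<in>V. ennreal (\<bar>v ()\<bar> powr \<alpha> * measure lborel (B v)))"
    by (intro sum.cong refl) (simp add: em ennreal_mult)
  also have "\<dots> = ennreal (\<Sum>v\<in>V. \<bar>v ()\<bar> powr \<alpha> * measure lborel (B v))"
    by (rule sum_ennreal) auto
  finally have b: "(LINT s|lborel. \<bar>\<phi> s\<bar> powr \<alpha>) = (\<Sum>v\<in>V. \<bar>v ()\<bar> powr \<alpha> * measure lborel (B v))"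
    by (subst integral_eq_nn_integral) (auto intro!: sum_nonneg enn2real_ennreal)
  have "char (distr M borel (simple_stochastic_integral \<Lambda> \<phi>)) u
      = of_real (exp (- ((LINT s|lborel. \<bar>\<phi> s\<bar> powr \<alpha>) * \<bar>u\<bar> powr \<alpha>)))" for u
  proof -
    have ind: "indep_vars (\<lambda>_. borel) (\<lambda>v w. v () * \<Lambda> (B v) w) V"
      by (rule indep_vars_compose2[OF Lambda_indep[OF V(1) _ V(2)], of "\<lambda>v x. v () * x"]) (use V(3) in auto)
    have "char (distr M borel (simple_stochastic_integral \<Lambda> \<phi>)) u =
        (\<Prod>v\<in>V. char (distr M borel (\<lambda>w. v () * \<Lambda> (B v) w)) u)"
      unfolding distr by (rule char_distr_sum[OF ind])
    also have "\<dots> = (\<Prod>v\<in>V. of_real (exp (- (\<bar>v ()\<bar> powr \<alpha> * measure lborel (B v) * \<bar>u\<bar> powr \<alpha>))))"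
    proof (intro prod.cong refl)
      fix v assume v: "v \<in> V"
      have "char (distr M borel (\<lambda>w. v () * \<Lambda> (B v) w)) u = char (distr M borel (\<Lambda> (B v))) (u * v ())"
        using v by (simp add: char_def integral_distr mult_ac)
      also have "\<dots> = of_real (exp (- (measure lborel (B v) * \<bar>u * v ()\<bar> powr \<alpha>)))"
        using Lambda_var[of "B v"] V(3) v by (simp add: SaS_var_def)
      finally show "char (distr M borel (\<lambda>w. v () * \<Lambda> (B v) w)) u =
          of_real (exp (- (\<bar>v ()\<bar> powr \<alpha> * measure lborel (B v) * \<bar>u\<bar> powr \<alpha>)))"
        by (simp add: abs_mult powr_mult mult_ac)
    qed
    also have "\<dots> = of_real (exp (- ((LINT s|lborel. \<bar>\<phi> s\<bar> powr \<alpha>) * \<bar>u\<bar> powr \<alpha>)))"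
      unfolding b of_real_prod[symmetric] exp_sum[OF V(1), symmetric]
      by (simp add: sum_negf sum_distrib_right)
    finally show ?thesis .
  qed
  then show ?thesis unfolding SaS_var_def by (auto intro!: integral_nonneg_AE)
qed

lemma char_tendsto_of_converges:
  assumes conv: "converges_in_probability M Y Z" and Ym: "\<And>k. Y k \<in> borel_measurable M"
  shows "(\<lambda>k. char (distr M borel (Y k)) u) \<longlonglongrightarrow> char (distr M borel Z) u"
proof (rule LIMSEQ_I)
  have [measurable]: "Z \<in> borel_measurable M" using conv by (simp add: converges_in_probability_def)
  note Ym[measurable]
  fix r :: real assume r: "r > 0"
  \<comment> \<open>Outside the event that Y k and Z differ by more than e, the exponentials differ
    by at most |u| e \<le> r/4; on it, by at most 2.\<close>
  define e where "e = r / (4 * (\<bar>u\<bar> + 1))"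
  have e: "e > 0" "\<bar>u\<bar> * e \<le> r / 4" using r by (auto simp: e_def field_simps add_nonneg_pos mult_left_mono)
  have "(\<lambda>k. prob {w \<in> space M. \<bar>Y k w - Z w\<bar> > e}) \<longlonglongrightarrow> 0"
    using conv e by (simp add: converges_in_probability_def)
  then have "\<forall>\<^sub>F k in sequentially. prob {w \<in> space M. \<bar>Y k w - Z w\<bar> > e} < r / 4"
    using r by (intro order_tendstoD(2)) auto
  then have "\<forall>\<^sub>F k in sequentially. norm (char (distr M borel (Y k)) u - char (distr M borel Z) u) < r"
  proof eventually_elim
    case (elim k)
    let ?A = "{w \<in> space M. \<bar>Y k w - Z w\<bar> > e}"
    have A: "?A \<in> sets M" by measurable
    have int: "integrable M (\<lambda>w. iexp (u * Y k w))" "integrable M (\<lambda>w. iexp (u * Z w))"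
      by (intro integrable_const_bound[where B = 1] AE_I2; simp)+
    have "char (distr M borel (Y k)) u - char (distr M borel Z) u = (CLINT w|M. iexp (u * Y k w) - iexp (u * Z w))"
      using int by (simp add: char_def integral_distr)
    also have "norm \<dots> \<le> expectation (\<lambda>w. norm (iexp (u * Y k w) - iexp (u * Z w)))"
      by (rule integral_norm_bound)
    also have "\<dots> \<le> expectation (\<lambda>w. r / 4 + 2 * indicator ?A w)"
    proof (rule integral_mono)
      show "integrable M (\<lambda>w. norm (iexp (u * Y k w) - iexp (u * Z w)))"
        using int by (intro integrable_norm Bochner_Integration.integrable_diff)
      show "integrable M (\<lambda>w. r / 4 + 2 * indicator ?A w)"
        using A by (simp add: emeasure_eq_measure)
      fix w assume w: "w \<in> space M"
      show "norm (iexp (u * Y k w) - iexp (u * Z w)) \<le> r / 4 + 2 * indicator ?A w"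
      proof (cases "w \<in> ?A")
        case True
        have "norm (iexp (u * Y k w) - iexp (u * Z w)) \<le> norm (iexp (u * Y k w)) + norm (iexp (u * Z w))"
          by (rule norm_triangle_ineq4)
        then show ?thesis using True r by simp
      next
        case False
        have "iexp (u * Y k w) - iexp (u * Z w) = iexp (u * Z w) * (iexp (u * (Y k w - Z w)) - 1)"
          by (simp add: algebra_simps exp_add[symmetric])
        then have "norm (iexp (u * Y k w) - iexp (u * Z w)) = norm (iexp (u * (Y k w - Z w)) - 1)"
          by (simp add: norm_mult)
        also have "\<dots> \<le> \<bar>u * (Y k w - Z w)\<bar>"
          using iexp_approx1[of "u * (Y k w - Z w)" 0] by simp
        also have "\<dots> = \<bar>u\<bar> * \<bar>Y k w - Z w\<bar>" by (rule abs_mult)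
        also have "\<dots> \<le> \<bar>u\<bar> * e" using False w by (intro mult_left_mono) auto
        finally show ?thesis using False e by simp
      qed
    qed
    also have "\<dots> = r / 4 + 2 * prob ?A" using A by (simp add: prob_space emeasure_eq_measure)
    also have "\<dots> < r" using elim r by linarith
    finally show ?case .
  qed
  then show "\<exists>no. \<forall>k\<ge>no. norm (char (distr M borel (Y k)) u - char (distr M borel Z) u) < r"
    by (simp add: eventually_sequentially)
qed

text \<open>Characteristic functions converge along the approximating simple functions, and so do
  the scales: the integrals of the \<alpha>-th powers converge by \<open>norm_powr_le_near\<close>,
  for \<alpha> below 1 as well as above.\<close>

lemma SaS_var_stochastic_integral:
  assumes Y: "is_stochastic_integral M \<alpha> \<Lambda> h Y" and h: "in_Lp \<alpha> h"
  shows "SaS_var M \<alpha> (LINT s|lborel. \<bar>h s\<bar> powr \<alpha>) Y"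
proof -
  have [measurable]: "h \<in> borel_measurable borel" and hi: "integrable lborel (\<lambda>s. \<bar>h s\<bar> powr \<alpha>)"
    using h by (auto simp: in_Lp_def)
  obtain \<phi> :: "nat \<Rightarrow> real \<Rightarrow> real" where \<phi>: "\<And>k. simple_function borel (\<phi> k)" "\<And>k. bounded {s. \<phi> k s \<noteq> 0}"
    and lim: "(\<lambda>k. \<integral>\<^sup>+ s. ennreal (\<bar>\<phi> k s - h s\<bar> powr \<alpha>) \<partial>lborel) \<longlonglongrightarrow> 0"
    and conv: "converges_in_probability M (\<lambda>k. simple_stochastic_integral \<Lambda> (\<phi> k)) Y"
    using Y unfolding is_stochastic_integral_def by blast
  have [measurable]: "Y \<in> borel_measurable M" using conv by (simp add: converges_in_probability_def)
  have [measurable]: "\<phi> k \<in> borel_measurable borel" for k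
    using \<phi> by (auto intro: borel_measurable_simple_function)
  define D where "D k = (LINT s|lborel. \<bar>\<phi> k s - h s\<bar> powr \<alpha>)" for k
  define A where "A k = (LINT s|lborel. \<bar>\<phi> k s\<bar> powr \<alpha>)" for k
  define b where "b = (LINT s|lborel. \<bar>h s\<bar> powr \<alpha>)"
  have "(\<lambda>k. enn2real (\<integral>\<^sup>+ s. ennreal (\<bar>\<phi> k s - h s\<bar> powr \<alpha>) \<partial>lborel)) \<longlonglongrightarrow> enn2real 0"
    using tendsto_enn2real[of "\<lambda>k. \<integral>\<^sup>+ s. ennreal (\<bar>\<phi> k s - h s\<bar> powr \<alpha>) \<partial>lborel" 0 sequentially] lim
    by simp
  then have D: "D \<longlonglongrightarrow> 0" unfolding D_def by (subst integral_eq_nn_integral) auto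
  have "\<forall>\<^sub>F k in sequentially. (\<integral>\<^sup>+ s. ennreal (\<bar>\<phi> k s - h s\<bar> powr \<alpha>) \<partial>lborel) < 1"
    using lim by (rule order_tendstoD(2)) auto
  then have ev: "\<forall>\<^sub>F k in sequentially. integrable lborel (\<lambda>s. \<bar>\<phi> k s - h s\<bar> powr \<alpha>)"
  proof eventually_elim
    case (elim k)
    then show ?case
      by (intro integrableI_nonneg) (auto intro: order.strict_trans)
  qed
  have near: "\<exists>C\<ge>0. \<forall>\<^sub>F k in sequentially. A k \<le> (1+\<epsilon>) * b + C * D k \<and> b \<le> (1+\<epsilon>) * A k + C * D k"
    if "\<epsilon> > 0" for \<epsilon>
  proof -
    obtain C where C: "C \<ge> 0"
      "\<And>x y :: real. norm x powr \<alpha> \<le> (1 + \<epsilon>) * norm y powr \<alpha> + C * norm (x - y) powr \<alpha>"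
      using norm_powr_le_near[OF alpha(1) \<open>\<epsilon> > 0\<close>] by blast
    show ?thesis
    proof (intro exI[of _ C] conjI C(1))
      show "\<forall>\<^sub>F k in sequentially. A k \<le> (1+\<epsilon>) * b + C * D k \<and> b \<le> (1+\<epsilon>) * A k + C * D k"
        using ev
      proof eventually_elim
        case (elim k)
        have pw1: "\<bar>\<phi> k s\<bar> powr \<alpha> \<le> (1+\<epsilon>) * \<bar>h s\<bar> powr \<alpha> + C * \<bar>\<phi> k s - h s\<bar> powr \<alpha>"
          and pw2: "\<bar>h s\<bar> powr \<alpha> \<le> (1+\<epsilon>) * \<bar>\<phi> k s\<bar> powr \<alpha> + C * \<bar>\<phi> k s - h s\<bar> powr \<alpha>" for s
          using C(2)[of "\<phi> k s" "h s"] C(2)[of "h s" "\<phi> k s"] by (simp_all add: abs_minus_commute)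
        have bound: "integrable lborel (\<lambda>s. (1+\<epsilon>) * \<bar>h s\<bar> powr \<alpha> + C * \<bar>\<phi> k s - h s\<bar> powr \<alpha>)"
          using hi elim by auto
        have iA: "integrable lborel (\<lambda>s. \<bar>\<phi> k s\<bar> powr \<alpha>)"
        proof (rule Bochner_Integration.integrable_bound[OF bound])
          show "AE s in lborel. norm (\<bar>\<phi> k s\<bar> powr \<alpha>) \<le> norm ((1+\<epsilon>) * \<bar>h s\<bar> powr \<alpha> + C * \<bar>\<phi> k s - h s\<bar> powr \<alpha>)"
            by (rule AE_I2) (unfold real_norm_def abs_of_nonneg[OF powr_ge_zero], rule order.trans[OF pw1 abs_ge_self])
        qed measurable
        have "A k \<le> (LINT s|lborel. (1+\<epsilon>) * \<bar>h s\<bar> powr \<alpha> + C * \<bar>\<phi> k s - h s\<bar> powr \<alpha>)"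
          unfolding A_def by (rule integral_mono[OF iA bound pw1])
        also have "\<dots> = (1+\<epsilon>) * b + C * D k" unfolding b_def D_def using hi elim by simp
        finally have 1: "A k \<le> (1+\<epsilon>) * b + C * D k" .
        have "b \<le> (LINT s|lborel. (1+\<epsilon>) * \<bar>\<phi> k s\<bar> powr \<alpha> + C * \<bar>\<phi> k s - h s\<bar> powr \<alpha>)"
          unfolding b_def by (rule integral_mono[OF hi _ pw2]) (use iA elim in auto)
        also have "\<dots> = (1+\<epsilon>) * A k + C * D k" unfolding A_def D_def using iA elim by simp
        finally show ?case using 1 by simp
      qed
    qed
  qed
  have "A \<longlonglongrightarrow> b"
    by (rule tendsto_of_near[where B = "\<lambda>_. b" and D = D]) (use near D in auto)
  have ch: "char (distr M borel Y) u = of_real (exp (- (b * \<bar>u\<bar> powr \<alpha>)))" for u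
  proof (rule LIMSEQ_unique)
    show "(\<lambda>k. char (distr M borel (simple_stochastic_integral \<Lambda> (\<phi> k))) u) \<longlonglongrightarrow> char (distr M borel Y) u"
      by (rule char_tendsto_of_converges[OF conv simple_stochastic_integral_measurable[OF \<phi>]])
    have "(\<lambda>k. of_real (exp (- (A k * \<bar>u\<bar> powr \<alpha>)))) \<longlonglongrightarrow> complex_of_real (exp (- (b * \<bar>u\<bar> powr \<alpha>)))"
      using \<open>A \<longlonglongrightarrow> b\<close> by (intro tendsto_intros)
    then show "(\<lambda>k. char (distr M borel (simple_stochastic_integral \<Lambda> (\<phi> k))) u)
        \<longlonglongrightarrow> complex_of_real (exp (- (b * \<bar>u\<bar> powr \<alpha>)))"
      using SaS_var_simple_stochastic_integral[OF \<phi>] by (simp add: SaS_var_def A_def)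
  qed
  then show ?thesis unfolding SaS_var_def b_def by (auto intro!: integral_nonneg_AE)
qed

text \<open>The characteristic function at 1 determines the scale. This identifies the limit of the
  given scale estimator with the \<alpha>-norm of f.\<close>

lemma SaS_scale_unique:
  assumes "SaS_var M \<alpha> b Y" "SaS_scale M \<alpha> Y \<sigma>"
  shows "\<sigma> = b powr (1/\<alpha>)"
proof -
  have "char (distr M borel Y) 1 = complex_of_real (exp (- (b * \<bar>1\<bar> powr \<alpha>)))"
    using assms(1) unfolding SaS_var_def by blast
  moreover have "char (distr M borel Y) 1 = complex_of_real (exp (- (\<sigma> powr \<alpha> * \<bar>1\<bar> powr \<alpha>)))"
    using assms(2) unfolding SaS_scale_def by blast
  ultimately have "exp (- (\<sigma> powr \<alpha> * \<bar>1\<bar> powr \<alpha>)) = exp (- (b * \<bar>1\<bar> powr \<alpha>))"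
    by (metis of_real_eq_iff)
  then have "\<sigma> powr \<alpha> = b" by simp
  moreover have "\<sigma> \<ge> 0" using assms by (simp add: SaS_scale_def)
  ultimately show ?thesis using alpha by (auto simp: powr_powr)
qed

end

section \<open>Self-normalized sums\<close>

text \<open>A vanishing vector is sent to 0, since division by 0 gives 0.\<close>

definition self_norm :: "'i set \<Rightarrow> ('i \<Rightarrow> real) \<Rightarrow> 'i \<Rightarrow> real" where
  "self_norm I x i = x i / sqrt (\<Sum>j\<in>I. (x j)\<^sup>2)"

lemma self_norm_restrict:
  "i \<in> I \<Longrightarrow> self_norm I (restrict x I) i = self_norm I x i"
  by (simp add: self_norm_def)

text \<open>The normalizer is unchanged by sign changes and permutations, so these act on the ratios
  as they do on the coordinates.\<close>

lemma self_norm_flip: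
  "self_norm I (\<lambda>j. if j = k then - x j else x j) i = (if i = k then - self_norm I x i else self_norm I x i)"
proof -
  have "(\<Sum>j\<in>I. (if j = k then - x j else x j)\<^sup>2) = (\<Sum>j\<in>I. (x j)\<^sup>2)"
    by (intro sum.cong) auto
  then show ?thesis by (simp add: self_norm_def)
qed

lemma self_norm_permute:
  assumes "\<pi> permutes I"
  shows "self_norm I (\<lambda>j. x (\<pi> j)) i = self_norm I x (\<pi> i)"
  using sum.permute[OF assms, of "\<lambda>j. (x j)\<^sup>2"] by (simp add: self_norm_def o_def)

lemma sum_self_norm_squares:
  assumes "finite I"
  shows "(\<Sum>i\<in>I. (self_norm I x i)\<^sup>2) \<le> 1" "(\<Sum>j\<in>I. (x j)\<^sup>2) > 0 \<Longrightarrow> (\<Sum>i\<in>I. (self_norm I x i)\<^sup>2) = 1"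
proof -
  have *: "(\<Sum>i\<in>I. (self_norm I x i)\<^sup>2) = (\<Sum>i\<in>I. (x i)\<^sup>2) / (\<Sum>i\<in>I. (x i)\<^sup>2)"
    by (simp add: self_norm_def power_divide sum_divide_distrib[symmetric] sum_nonneg)
  show "(\<Sum>i\<in>I. (self_norm I x i)\<^sup>2) \<le> 1" unfolding * by simp
  show "(\<Sum>j\<in>I. (x j)\<^sup>2) > 0 \<Longrightarrow> (\<Sum>i\<in>I. (self_norm I x i)\<^sup>2) = 1" unfolding * by simp
qed

lemma abs_self_norm_le_1:
  assumes "finite I" "i \<in> I"
  shows "\<bar>self_norm I x i\<bar> \<le> 1"
proof -
  have "(self_norm I x i)\<^sup>2 \<le> (\<Sum>i\<in>I. (self_norm I x i)\<^sup>2)"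
    using assms by (intro member_le_sum) auto
  also have "\<dots> \<le> 1" by (rule sum_self_norm_squares(1)[OF assms(1)])
  finally show ?thesis by (simp add: abs_square_le_1)
qed

text \<open>The joint law of independent variables is the product of the marginals. This carries
  sign changes and permutations of the variables over to expectations of arbitrary measurable
  functionals.\<close>

lemma (in prob_space) indep_vars_expectation_eq:
  fixes X Y :: "'i \<Rightarrow> 'a \<Rightarrow> real" and F :: "('i \<Rightarrow> real) \<Rightarrow> real"
  assumes X: "indep_vars (\<lambda>_. borel) X I" and Y: "indep_vars (\<lambda>_. borel) Y I" and I: "I \<noteq> {}"
    and distr: "\<And>i. i \<in> I \<Longrightarrow> distr M borel (X i) = distr M borel (Y i)"
    and F[measurable]: "F \<in> borel_measurable (\<Pi>\<^sub>M i\<in>I. borel)"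
  shows "expectation (\<lambda>w. F (\<lambda>i\<in>I. X i w)) = expectation (\<lambda>w. F (\<lambda>i\<in>I. Y i w))"
proof -
  have [measurable]: "X i \<in> borel_measurable M" "Y i \<in> borel_measurable M" if "i \<in> I" for i
    using X Y that by (auto simp: indep_vars_def)
  have "expectation (\<lambda>w. F (\<lambda>i\<in>I. X i w)) = integral\<^sup>L (distr M (\<Pi>\<^sub>M i\<in>I. borel) (\<lambda>w. \<lambda>i\<in>I. X i w)) F"
    by (subst integral_distr) auto
  also have "distr M (\<Pi>\<^sub>M i\<in>I. borel) (\<lambda>w. \<lambda>i\<in>I. X i w) = (\<Pi>\<^sub>M i\<in>I. distr M borel (X i))"
    using indep_vars_iff_distr_eq_PiM'[OF I, where M' = "\<lambda>_. borel" and X = X] X by auto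
  also have "\<dots> = (\<Pi>\<^sub>M i\<in>I. distr M borel (Y i))"
    by (intro PiM_cong refl) (use distr in auto)
  also have "\<dots> = distr M (\<Pi>\<^sub>M i\<in>I. borel) (\<lambda>w. \<lambda>i\<in>I. Y i w)"
    using indep_vars_iff_distr_eq_PiM'[OF I, where M' = "\<lambda>_. borel" and X = Y] Y by auto
  also have "integral\<^sup>L (distr M (\<Pi>\<^sub>M i\<in>I. borel) (\<lambda>w. \<lambda>i\<in>I. Y i w)) F = expectation (\<lambda>w. F (\<lambda>i\<in>I. Y i w))"
    by (subst integral_distr) auto
  finally show ?thesis .
qed

locale iid_SaS = prob_space M for M :: "'w measure" +
  fixes \<alpha> b :: real and I :: "'i set" and Z :: "'i \<Rightarrow> 'w \<Rightarrow> real"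
  assumes finite_I: "finite I" and indep: "indep_vars (\<lambda>_. borel) Z I"
    and var: "\<And>i. i \<in> I \<Longrightarrow> SaS_var M \<alpha> b (Z i)"
begin

definition r :: "'i \<Rightarrow> 'w \<Rightarrow> real" where "r i w = self_norm I (\<lambda>i. Z i w) i"

lemma zeta_measurable [measurable]: "i \<in> I \<Longrightarrow> Z i \<in> borel_measurable M"
  using var by (auto simp: SaS_var_def)

lemma r_measurable [measurable]: "i \<in> I \<Longrightarrow> r i \<in> borel_measurable M"
  unfolding r_def self_norm_def by measurable

lemma abs_r_le_1: "i \<in> I \<Longrightarrow> \<bar>r i w\<bar> \<le> 1"
  unfolding r_def by (rule abs_self_norm_le_1[OF finite_I])

lemma sum_r_squares: "(\<Sum>i\<in>I. (r i w)\<^sup>2) \<le> 1" "(\<Sum>j\<in>I. (Z j w)\<^sup>2) > 0 \<Longrightarrow> (\<Sum>i\<in>I. (r i w)\<^sup>2) = 1"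
  unfolding r_def using sum_self_norm_squares[OF finite_I] by auto

lemma self_norm_measurable [measurable]:
  "i \<in> I \<Longrightarrow> (\<lambda>x. self_norm I x i) \<in> borel_measurable (\<Pi>\<^sub>M i\<in>I. borel)"
  unfolding self_norm_def by measurable

lemma flip_expectation:
  fixes F :: "('i \<Rightarrow> real) \<Rightarrow> real"
  assumes k: "k \<in> I" and F[measurable]: "F \<in> borel_measurable (\<Pi>\<^sub>M i\<in>I. borel)"
  shows "expectation (\<lambda>w. F (\<lambda>i\<in>I. Z i w)) = expectation (\<lambda>w. F (\<lambda>i\<in>I. if i = k then - Z i w else Z i w))"
proof (rule indep_vars_expectation_eq[OF indep, where F = F and Y = "\<lambda>i w. if i = k then - Z i w else Z i w"])
  show "indep_vars (\<lambda>_. borel) (\<lambda>i w. if i = k then - Z i w else Z i w) I"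
    by (rule indep_vars_compose2[OF indep, of "\<lambda>i x. if i = k then - x else x"]) auto
  show "distr M borel (Z i) = distr M borel (\<lambda>w. if i = k then - Z i w else Z i w)" if "i \<in> I" for i
    using SaS_var_distr_eq[OF var[OF that] SaS_var_uminus[OF var[OF that]]] by (cases "i = k") simp_all
qed (use k F in auto)

lemma permute_expectation:
  fixes F :: "('i \<Rightarrow> real) \<Rightarrow> real"
  assumes \<pi>: "\<pi> permutes I" and I: "I \<noteq> {}" and F[measurable]: "F \<in> borel_measurable (\<Pi>\<^sub>M i\<in>I. borel)"
  shows "expectation (\<lambda>w. F (\<lambda>i\<in>I. Z i w)) = expectation (\<lambda>w. F (\<lambda>i\<in>I. Z (\<pi> i) w))"
proof (rule indep_vars_expectation_eq[OF indep, where F = F and Y = "\<lambda>i. Z (\<pi> i)"])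
  show "indep_vars (\<lambda>_. borel) (\<lambda>i. Z (\<pi> i)) I"
    by (rule indep_vars_reindex) (simp_all add: permutes_inj_on[OF \<pi>] permutes_image[OF \<pi>] indep)
  show "distr M borel (Z i) = distr M borel (Z (\<pi> i))" if "i \<in> I" for i
    using var that permutes_in_image[OF \<pi>] by (intro SaS_var_distr_eq) auto
qed (use I F in auto)

text \<open>Flipping the sign of the i-th variable preserves the joint law and negates every product
  in which the index i occurs exactly once.\<close>

lemma expectation_odd:
  assumes "i \<in> I" "j \<in> I" "k \<in> I" "l \<in> I" "j \<noteq> i" "k \<noteq> i" "l \<noteq> i"
  shows "expectation (\<lambda>w. r i w * r j w * (r k w * r l w)) = 0" "expectation (\<lambda>w. r i w * r j w) = 0"
proof -
  let ?F = "\<lambda>x. self_norm I x i * self_norm I x j * (self_norm I x k * self_norm I x l)"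
  have "expectation (\<lambda>w. ?F (\<lambda>i\<in>I. Z i w)) = expectation (\<lambda>w. ?F (\<lambda>j\<in>I. if j = i then - Z j w else Z j w))"
    by (rule flip_expectation[where F = ?F]) (use assms in measurable)
  also have "\<dots> = - expectation (\<lambda>w. ?F (\<lambda>i\<in>I. Z i w))"
    using assms by (simp add: self_norm_restrict self_norm_flip)
  finally show "expectation (\<lambda>w. r i w * r j w * (r k w * r l w)) = 0"
    using assms by (simp add: self_norm_restrict r_def)
  let ?F = "\<lambda>x. self_norm I x i * self_norm I x j"
  have "expectation (\<lambda>w. ?F (\<lambda>i\<in>I. Z i w)) = expectation (\<lambda>w. ?F (\<lambda>j\<in>I. if j = i then - Z j w else Z j w))"
    by (rule flip_expectation[where F = ?F]) (use assms in measurable)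
  also have "\<dots> = - expectation (\<lambda>w. ?F (\<lambda>i\<in>I. Z i w))"
    using assms by (simp add: self_norm_restrict self_norm_flip)
  finally show "expectation (\<lambda>w. r i w * r j w) = 0"
    using assms by (simp add: self_norm_restrict r_def)
qed

lemma abs_rr_le_1: "i \<in> I \<Longrightarrow> j \<in> I \<Longrightarrow> \<bar>r i w * r j w\<bar> \<le> 1"
  unfolding abs_mult by (intro mult_le_one abs_r_le_1) auto

lemma integrable_rr: "i \<in> I \<Longrightarrow> j \<in> I \<Longrightarrow> integrable M (\<lambda>w. r i w * r j w)"
  using abs_rr_le_1 by (intro integrable_const_bound[where B = 1] AE_I2) auto

lemma integrable_rrrr:
  assumes "i \<in> I" "j \<in> I" "k \<in> I" "l \<in> I"
  shows "integrable M (\<lambda>w. r i w * r j w * (r k w * r l w))"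
proof (intro integrable_const_bound[where B = 1] AE_I2)
  fix w
  show "norm (r i w * r j w * (r k w * r l w)) \<le> 1"
    unfolding real_norm_def abs_mult[of "r i w * r j w"] using assms by (intro mult_le_one abs_rr_le_1) auto
qed (use assms in measurable)

text \<open>Exchangeability makes the means for all indices equal, and their sum is at most
  1.\<close>

lemma expectation_r_square:
  assumes i: "i \<in> I"
  shows "expectation (\<lambda>w. (r i w)\<^sup>2) \<le> 1 / card I"
proof -
  have eq: "expectation (\<lambda>w. (r j w)\<^sup>2) = expectation (\<lambda>w. (r i w)\<^sup>2)" if j: "j \<in> I" for j
  proof -
    let ?F = "\<lambda>x. (self_norm I x j)\<^sup>2"
    have \<pi>: "Transposition.transpose i j permutes I" using i j by (intro permutes_swap_id) auto
    have "expectation (\<lambda>w. ?F (\<lambda>i\<in>I. Z i w)) = expectation (\<lambda>w. ?F (\<lambda>k\<in>I. Z (Transposition.transpose i j k) w))"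
      by (rule permute_expectation[OF \<pi>, where F = ?F]) (use i j in auto)
    then show ?thesis using i j
      by (simp add: self_norm_restrict r_def self_norm_permute[OF \<pi>, of "\<lambda>j. Z j _"])
  qed
  have "card I * expectation (\<lambda>w. (r i w)\<^sup>2) = (\<Sum>j\<in>I. expectation (\<lambda>w. (r j w)\<^sup>2))"
    using eq by simp
  also have "\<dots> = expectation (\<lambda>w. \<Sum>j\<in>I. (r j w)\<^sup>2)"
    using integrable_rr by (subst Bochner_Integration.integral_sum) (auto simp: power2_eq_square)
  also have "\<dots> \<le> expectation (\<lambda>w. 1)"
    using integrable_rr sum_r_squares(1)
    by (intro integral_mono Bochner_Integration.integrable_sum) (auto simp: power2_eq_square)
  finally have "card I * expectation (\<lambda>w. (r i w)\<^sup>2) \<le> 1" by (simp add: prob_space)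
  moreover have "card I > 0" using i finite_I by (auto simp: card_gt_0_iff)
  ultimately show ?thesis by (simp add: field_simps)
qed

definition offdiag :: "('i \<times> 'i) set" where "offdiag = {p \<in> I \<times> I. fst p \<noteq> snd p}"

lemma finite_offdiag: "finite offdiag"
  unfolding offdiag_def using finite_I by auto

lemma card_offdiag: "card offdiag = card I * (card I - 1)"
proof -
  have "offdiag = I \<times> I - (\<lambda>i. (i, i)) ` I" unfolding offdiag_def by auto
  then have "card offdiag = card (I \<times> I) - card ((\<lambda>i. (i, i)) ` I)"
    using finite_I by (simp add: card_Diff_subset image_subset_iff)
  also have "card ((\<lambda>i. (i, i)) ` I) = card I" by (rule card_image) (auto simp: inj_on_def)
  finally show ?thesis by (simp add: card_cartesian_product diff_mult_distrib2)
qed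

text \<open>Exchangeability once more, now for ordered pairs of distinct indices. The sum over all
  pairs is the square of a sum that is at most 1.\<close>

lemma expectation_rr_square:
  assumes p: "p \<in> offdiag"
  shows "expectation (\<lambda>w. (r (fst p) w * r (snd p) w)\<^sup>2) \<le> 1 / (card I * (card I - 1))"
proof -
  let ?e = "\<lambda>q. expectation (\<lambda>w. (r (fst q) w * r (snd q) w)\<^sup>2)"
  have mem: "fst q \<in> I" "snd q \<in> I" "fst q \<noteq> snd q" if "q \<in> offdiag" for q
    using that by (auto simp: offdiag_def)
  have int: "integrable M (\<lambda>w. (r (fst q) w * r (snd q) w)\<^sup>2)" if "q \<in> offdiag" for q
    using integrable_rrrr mem[OF that] by (simp add: power2_eq_square)
  have eq: "?e q = ?e p" if q: "q \<in> offdiag" for q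
  proof -
    define i j k l where "i = fst q" "j = snd q" "k = fst p" "l = snd p"
    note ijkl = mem[OF p] mem[OF q]
    \<comment> \<open>The first transposition sends i to k, the second one the image of j to l. The
      second fixes k, since that image and l both differ from k.\<close>
    define \<pi> where "\<pi> = Transposition.transpose (Transposition.transpose i k j) l \<circ> Transposition.transpose i k"
    have tj: "Transposition.transpose i k j \<in> I" using ijkl by (auto simp: i_j_k_l_def Transposition.transpose_def)
    have \<pi>: "\<pi> permutes I" unfolding \<pi>_def
      by (intro permutes_compose permutes_swap_id) (use ijkl tj in \<open>auto simp: i_j_k_l_def\<close>)
    have 1: "\<pi> i = k" "\<pi> j = l" using ijkl by (auto simp: \<pi>_def i_j_k_l_def Transposition.transpose_def)
    let ?F = "\<lambda>x. (self_norm I x i * self_norm I x j)\<^sup>2"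
    have "expectation (\<lambda>w. ?F (\<lambda>i\<in>I. Z i w)) = expectation (\<lambda>w. ?F (\<lambda>i\<in>I. Z (\<pi> i) w))"
      by (rule permute_expectation[OF \<pi>, where F = ?F]) (use ijkl in \<open>auto simp: i_j_k_l_def\<close>)
    then show ?thesis using ijkl 1
      by (simp add: self_norm_restrict r_def self_norm_permute[OF \<pi>, of "\<lambda>j. Z j _"] i_j_k_l_def)
  qed
  have "card offdiag * ?e p = (\<Sum>q\<in>offdiag. ?e q)" using eq by simp
  also have "\<dots> = expectation (\<lambda>w. \<Sum>q\<in>offdiag. (r (fst q) w * r (snd q) w)\<^sup>2)"
    using int by (subst Bochner_Integration.integral_sum) auto
  also have "\<dots> \<le> expectation (\<lambda>w. 1)"
  proof (rule integral_mono)
    fix w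
    have "(\<Sum>q\<in>offdiag. (r (fst q) w * r (snd q) w)\<^sup>2) \<le> (\<Sum>q\<in>I\<times>I. (r (fst q) w * r (snd q) w)\<^sup>2)"
      using finite_I by (intro sum_mono2) (auto simp: offdiag_def)
    also have "\<dots> = (\<Sum>i\<in>I. (r i w)\<^sup>2) * (\<Sum>i\<in>I. (r i w)\<^sup>2)"
      by (simp add: sum_product sum.cartesian_product power_mult_distrib case_prod_unfold)
    also have "\<dots> \<le> 1 * 1"
      using sum_r_squares(1) by (intro mult_mono) (auto intro: sum_nonneg)
    finally show "(\<Sum>q\<in>offdiag. (r (fst q) w * r (snd q) w)\<^sup>2) \<le> 1" by simp
  qed (use int in auto)
  finally have "card offdiag * ?e p \<le> 1" by (simp add: prob_space)
  moreover have "card offdiag > 0" using p finite_offdiag by (auto simp: card_gt_0_iff)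
  ultimately have "?e p \<le> 1 / card offdiag" by (simp add: field_simps)
  also have "real (card offdiag) = card I * (card I - 1)" by (simp only: card_offdiag of_nat_mult)
  finally show ?thesis by simp
qed

text \<open>When the square is expanded, two pairs interact only if they consist of the same two
  indices; the two orders give the factor 2. Variances are thus controlled through ratios that are
  bounded by 1.\<close>

lemma expectation_offdiag_form:
  fixes B :: "'i \<times> 'i \<Rightarrow> real"
  assumes sym: "\<And>i j. B (i, j) = B (j, i)"
  shows "expectation (\<lambda>w. (\<Sum>p\<in>offdiag. B p * (r (fst p) w * r (snd p) w))\<^sup>2)
    \<le> 2 / (card I * (card I - 1)) * (\<Sum>p\<in>offdiag. (B p)\<^sup>2)"
proof -
  let ?R = "\<lambda>p w. r (fst p) w * r (snd p) w"
  have mem: "fst q \<in> I" "snd q \<in> I" "fst q \<noteq> snd q" if "q \<in> offdiag" for q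
    using that by (auto simp: offdiag_def)
  have int: "integrable M (\<lambda>w. ?R p w * ?R q w)" if "p \<in> offdiag" "q \<in> offdiag" for p q
    using integrable_rrrr mem[OF that(1)] mem[OF that(2)] by simp
  have zero: "expectation (\<lambda>w. ?R p w * ?R q w) = 0"
    if p: "p \<in> offdiag" and q: "q \<in> offdiag" and ne: "q \<noteq> p" "q \<noteq> prod.swap p" for p q
  proof (cases "fst p \<noteq> fst q \<and> fst p \<noteq> snd q")
    case True
    then show ?thesis using expectation_odd(1)[of "fst p" "snd p" "fst q" "snd q"] mem[OF p] mem[OF q] by auto
  next
    case False
    then have "snd p \<noteq> fst q \<and> snd p \<noteq> snd q"
      using mem[OF p] mem[OF q] ne by (cases p; cases q) auto
    then show ?thesis using expectation_odd(1)[of "snd p" "fst p" "fst q" "snd q"] mem[OF p] mem[OF q]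
      by (auto simp: mult_ac)
  qed
  have swap: "prod.swap p \<in> offdiag" "prod.swap p \<noteq> p" if "p \<in> offdiag" for p
    using mem[OF that] that by (cases p; auto simp: offdiag_def)+
  have "expectation (\<lambda>w. (\<Sum>p\<in>offdiag. B p * ?R p w)\<^sup>2) =
      expectation (\<lambda>w. \<Sum>p\<in>offdiag. \<Sum>q\<in>offdiag. B p * B q * (?R p w * ?R q w))"
    by (simp add: power2_eq_square sum_product mult_ac)
  also have "\<dots> = (\<Sum>p\<in>offdiag. \<Sum>q\<in>offdiag. B p * B q * expectation (\<lambda>w. ?R p w * ?R q w))"
    using int by (subst Bochner_Integration.integral_sum Bochner_Integration.integral_mult_right; auto)+
  also have "\<dots> = (\<Sum>p\<in>offdiag. \<Sum>q\<in>{p, prod.swap p}. B p * B q * expectation (\<lambda>w. ?R p w * ?R q w))"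
    using swap finite_offdiag zero by (intro sum.cong refl sum.mono_neutral_right) auto
  also have "\<dots> = (\<Sum>p\<in>offdiag. 2 * (B p)\<^sup>2 * expectation (\<lambda>w. (?R p w)\<^sup>2))"
  proof (intro sum.cong refl)
    fix p assume p: "p \<in> offdiag"
    have "B (prod.swap p) = B p" using sym by (cases p) auto
    then show "(\<Sum>q\<in>{p, prod.swap p}. B p * B q * expectation (\<lambda>w. ?R p w * ?R q w)) =
        2 * (B p)\<^sup>2 * expectation (\<lambda>w. (?R p w)\<^sup>2)"
      using swap(2)[OF p] by (simp add: power2_eq_square mult_ac)
  qed
  also have "\<dots> \<le> (\<Sum>p\<in>offdiag. 2 * (B p)\<^sup>2 * (1 / (card I * (card I - 1))))"
    by (intro sum_mono mult_left_mono expectation_rr_square) auto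
  also have "\<dots> = 2 / (card I * (card I - 1)) * (\<Sum>p\<in>offdiag. (B p)\<^sup>2)"
    by (simp add: sum_distrib_left sum_divide_distrib)
  finally show ?thesis .
qed

end

section \<open>The smoothed periodogram of stable noise\<close>

lemma sum_inverse_squares_le: "(\<Sum>j=1..n. 1 / (real j)\<^sup>2) \<le> 2"
proof -
  have "(\<Sum>j=1..n. 1 / (real j)\<^sup>2) \<le> 2 - 1 / real n" if "n \<ge> 1" for n :: nat
    using that
  proof (induction n rule: nat_induct_at_least)
    case (Suc n)
    then have n: "real n > 0" by simp
    have "1 / (real (Suc n))\<^sup>2 \<le> 1 / (real n * real (Suc n))"
      using n by (intro divide_left_mono) (auto simp: power2_eq_square)
    also have "\<dots> = 1 / real n - 1 / real (Suc n)"
      using n by (simp add: field_simps)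
    finally show ?case using Suc by simp
  qed simp
  from this[of n] show ?thesis by (cases "n \<ge> 1") (auto intro: order.trans)
qed

text \<open>A geometric sum: its numerator has modulus at most 2, and |cis t - 1| \<ge> |t| / 2 for
  |t| \<le> 1, so the modulus of the sum is at most 4 / |t|.\<close>

lemma norm_sum_cis_le:
  fixes t :: real
  assumes "\<bar>t\<bar> \<le> 1" "t \<noteq> 0"
  shows "(norm (\<Sum>p=1..n. cis (real p * t)))\<^sup>2 \<le> 16 / t\<^sup>2"
proof -
  have "norm (iexp t - (\<Sum>k\<le>1. (\<i> * t) ^ k / fact k)) \<le> \<bar>t\<bar> ^ Suc 1 / fact (Suc 1)"
    by (rule iexp_approx1)
  then have "norm (cis t - 1 - \<i> * t) \<le> t\<^sup>2 / 2"
    by (simp add: cis_conv_exp power2_eq_square abs_mult_self diff_diff_eq)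
  moreover have "norm (\<i> * complex_of_real t) \<le> norm (cis t - 1) + norm (cis t - 1 - \<i> * t)"
    by (metis norm_minus_commute norm_triangle_sub add.commute)
  moreover have "t\<^sup>2 \<le> \<bar>t\<bar>" 
    using assms mult_left_mono[of "\<bar>t\<bar>" 1 "\<bar>t\<bar>"] by (simp add: power2_eq_square)
  ultimately have ge: "norm (cis t - 1) \<ge> \<bar>t\<bar> / 2" by (simp add: norm_mult)
  let ?e1 = "\<Sum>p=1..n. cis (real p * t)"
  have "(cis t - 1) * ?e1 = cis (real (Suc n) * t) - cis t"
  proof (induction n)
    case (Suc n)
    have "(cis t - 1) * (\<Sum>p=1..Suc n. cis (real p * t)) =
       (cis (real (Suc n) * t) - cis t) + (cis t - 1) * cis (real (Suc n) * t)"
      using Suc by (simp add: algebra_simps)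
    also have "cis t * cis (real (Suc n) * t) = cis (real (Suc (Suc n)) * t)"
      by (simp add: cis_mult algebra_simps)
    then have "(cis t - 1) * cis (real (Suc n) * t) = cis (real (Suc (Suc n)) * t) - cis (real (Suc n) * t)"
      by (simp add: algebra_simps)
    finally show ?case by simp
  qed simp
  then have "norm (cis t - 1) * norm ?e1 = norm (cis (real (Suc n) * t) - cis t)"
    by (metis norm_mult)
  also have "\<dots> \<le> 2"
    using norm_triangle_ineq4[of "cis (real (Suc n) * t)" "cis t"] by simp
  finally have "\<bar>t\<bar> / 2 * norm ?e1 \<le> 2"
    using mult_right_mono[OF ge, of "norm ?e1"] by simp
  then have "norm ?e1 \<le> 4 / \<bar>t\<bar>"
    using assms by (simp add: field_simps)
  then have "(norm ?e1)\<^sup>2 \<le> (4 / \<bar>t\<bar>)\<^sup>2"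
    by (intro power_mono) auto
  then show ?thesis by (simp add: power_divide)
qed

lemma sum_cos_eq_norm:
  fixes t :: real
  shows "(\<Sum>p\<in>P. \<Sum>q\<in>P. c p * c q * cos ((real p - real q) * t)) = (norm (\<Sum>p\<in>P. of_real (c p) * cis (real p * t)))\<^sup>2"
proof -
  have "(\<Sum>p\<in>P. \<Sum>q\<in>P. c p * c q * cos ((real p - real q) * t)) =
     (\<Sum>p\<in>P. c p * cos (real p * t))\<^sup>2 + (\<Sum>p\<in>P. c p * sin (real p * t))\<^sup>2"
    by (simp add: power2_eq_square sum_product sum.distrib[symmetric] left_diff_distrib cos_diff algebra_simps)
  also have "\<dots> = (norm (\<Sum>p\<in>P. of_real (c p) * cis (real p * t)))\<^sup>2"
    by (simp add: cmod_power2)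
  finally show ?thesis .
qed

text \<open>The right side is the squared cosine average plus the squared sine average. It depends
  on differences of frequencies only, so that a common shift drops out.\<close>

lemma weighted_cos_le:
  fixes W :: "int \<Rightarrow> real"
  assumes W: "\<And>k. k \<in> K \<Longrightarrow> W k \<ge> 0"
  shows "(\<Sum>k\<in>K. W k * cos (d * \<theta> k))\<^sup>2 \<le> (\<Sum>k\<in>K. \<Sum>l\<in>K. W k * W l * cos (d * (\<theta> k - \<theta> l)))"
proof -
  have "(\<Sum>k\<in>K. \<Sum>l\<in>K. W k * W l * cos (d * (\<theta> k - \<theta> l))) =
     (\<Sum>k\<in>K. W k * cos (d * \<theta> k))\<^sup>2 + (\<Sum>k\<in>K. W k * sin (d * \<theta> k))\<^sup>2"
    by (simp add: power2_eq_square sum_product sum.distrib[symmetric] right_diff_distrib cos_diff algebra_simps)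
  then show ?thesis by simp
qed

lemma sum_inverse_square_distances:
  fixes k :: int
  assumes k: "k \<in> {- int m..int m}"
  shows "(\<Sum>l\<in>{- int m..int m} - {k}. 1 / (real_of_int (k - l))\<^sup>2) \<le> 4"
proof -
  let ?g = "\<lambda>j::nat. 1 / (real j)\<^sup>2"
  have lower: "(\<Sum>l\<in>{- int m..<k}. 1 / (real_of_int (k - l))\<^sup>2) \<le> 2"
  proof -
    have "(\<Sum>l\<in>{- int m..<k}. 1 / (real_of_int (k - l))\<^sup>2) = (\<Sum>j\<in>{1..nat (k + int m)}. ?g j)"
      by (rule sum.reindex_bij_witness[of _ "\<lambda>j. k - int j" "\<lambda>l. nat (k - l)"]) auto
    then show ?thesis using sum_inverse_squares_le by simp
  qed
  have upper: "(\<Sum>l\<in>{k<..int m}. 1 / (real_of_int (k - l))\<^sup>2) \<le> 2"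
  proof -
    have "(\<Sum>l\<in>{k<..int m}. 1 / (real_of_int (k - l))\<^sup>2) = (\<Sum>j\<in>{1..nat (int m - k)}. ?g j)"
      by (rule sum.reindex_bij_witness[of _ "\<lambda>j. k + int j" "\<lambda>l. nat (l - k)"])
         (auto simp: power2_commute)
    then show ?thesis using sum_inverse_squares_le by simp
  qed
  have eq: "{- int m..int m} - {k} = {- int m..<k} \<union> {k<..int m}" using k by auto
  have "(\<Sum>l\<in>{- int m..int m} - {k}. 1 / (real_of_int (k - l))\<^sup>2) =
     (\<Sum>l\<in>{- int m..<k}. 1 / (real_of_int (k - l))\<^sup>2) + (\<Sum>l\<in>{k<..int m}. 1 / (real_of_int (k - l))\<^sup>2)"
    unfolding eq by (rule sum.union_disjoint) auto
  with lower upper show ?thesis by simp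
qed

text \<open>The terms with k = l contribute n^2 w, the others at most 16 n^2 w / (k - l)^2 each,
  whose sum is at most 64 n^2 w; hence 65. The condition 2 m \<le> n keeps |k - l| / n within the
  range of \<open>norm_sum_cis_le\<close>.\<close>

lemma sum_weighted_cos_squares:
  fixes W :: "int \<Rightarrow> real"
  assumes W: "\<And>k. k \<in> {- int m..int m} \<Longrightarrow> 0 \<le> W k \<and> W k \<le> w" and sumW: "(\<Sum>k=- int m..int m. W k) = 1"
    and n: "2 * m \<le> n" "n \<ge> 1"
  shows "(\<Sum>p=1..n. \<Sum>q=1..n. (\<Sum>k=- int m..int m. W k * cos ((real p - real q) * (x + of_int k / n)))\<^sup>2)
    \<le> 65 * (real n)\<^sup>2 * w"
proof -
  let ?K = "{- int m..int m}" and ?P = "{1..n}"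
  let ?N = "\<lambda>t. (norm (\<Sum>p\<in>?P. cis (real p * t)))\<^sup>2"
  have "(\<Sum>p\<in>?P. \<Sum>q\<in>?P. (\<Sum>k\<in>?K. W k * cos ((real p - real q) * (x + of_int k / n)))\<^sup>2)
     \<le> (\<Sum>p\<in>?P. \<Sum>q\<in>?P. \<Sum>k\<in>?K. \<Sum>l\<in>?K. W k * W l * cos ((real p - real q) * ((x + of_int k / n) - (x + of_int l / n))))"
    using W by (intro sum_mono weighted_cos_le) auto
  also have "\<dots> = (\<Sum>p\<in>?P. \<Sum>k\<in>?K. \<Sum>q\<in>?P. \<Sum>l\<in>?K. W k * W l * cos ((real p - real q) * (of_int (k - l) / n)))"
    by (subst sum.swap[of _ ?K ?P]) (simp add: diff_divide_distrib)
  also have "\<dots> = (\<Sum>k\<in>?K. \<Sum>p\<in>?P. \<Sum>l\<in>?K. \<Sum>q\<in>?P. W k * W l * cos ((real p - real q) * (of_int (k - l) / n)))"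
    by (subst sum.swap[of _ ?K ?P], subst sum.swap[of _ ?K ?P], rule refl)
  also have "\<dots> = (\<Sum>k\<in>?K. \<Sum>l\<in>?K. \<Sum>p\<in>?P. \<Sum>q\<in>?P. W k * W l * cos ((real p - real q) * (of_int (k - l) / n)))"
    by (subst sum.swap[of _ ?K ?P], rule refl)
  also have "\<dots> = (\<Sum>k\<in>?K. W k * (\<Sum>l\<in>?K. W l * ?N (of_int (k - l) / n)))"
  proof -
    have "(\<Sum>p\<in>?P. \<Sum>q\<in>?P. W k * W l * cos ((real p - real q) * (of_int (k - l) / n)))
        = W k * (W l * ?N (of_int (k - l) / n))" for k l
    proof -
      have "(\<Sum>p\<in>?P. \<Sum>q\<in>?P. cos ((real p - real q) * (of_int (k - l) / n))) = ?N (of_int (k - l) / n)"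
        using sum_cos_eq_norm[of "\<lambda>_. 1" "of_int (k - l) / n" ?P] by simp
      then show ?thesis by (simp only: sum_distrib_left[symmetric] mult.assoc)
    qed
    then show ?thesis by (simp only: sum_distrib_left)
  qed
  also have "\<dots> \<le> (\<Sum>k\<in>?K. W k * (65 * (real n)\<^sup>2 * w))"
  proof (intro sum_mono mult_left_mono)
    fix k assume k: "k \<in> ?K"
    show "W k \<ge> 0" using W k by auto
    have w: "w \<ge> 0" using W k by (meson order.trans)
    have bound0: "?N (of_int (k - k) / n) \<le> (real n)\<^sup>2" by (simp add: sum_norm_le)
    have bound: "?N (of_int (k - l) / n) \<le> 16 * (real n)\<^sup>2 * (1 / (real_of_int (k - l))\<^sup>2)" if l: "l \<in> ?K - {k}" for l
    proof -
      have "\<bar>k - l\<bar> \<le> int n" using k l n by auto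
      then have "\<bar>real_of_int (k - l)\<bar> \<le> real n" by linarith
      then have "\<bar>real_of_int (k - l) / n\<bar> \<le> 1" using n by (simp add: divide_le_eq)
      then have "?N (of_int (k - l) / n) \<le> 16 / (of_int (k - l) / n)\<^sup>2"
        by (rule norm_sum_cis_le) (use l n in auto)
      then show ?thesis by (simp add: power_divide)
    qed
    have "(\<Sum>l\<in>?K. W l * ?N (of_int (k - l) / n)) =
        W k * ?N (of_int (k - k) / n) + (\<Sum>l\<in>?K - {k}. W l * ?N (of_int (k - l) / n))"
      using k by (subst sum.remove[of _ k]) auto
    also have "\<dots> \<le> w * (real n)\<^sup>2 + (\<Sum>l\<in>?K - {k}. w * (16 * (real n)\<^sup>2 * (1 / (real_of_int (k - l))\<^sup>2)))"
      using W k w bound bound0 by (intro add_mono sum_mono mult_mono) auto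
    also have "(\<Sum>l\<in>?K - {k}. w * (16 * (real n)\<^sup>2 * (1 / (real_of_int (k - l))\<^sup>2))) =
        w * (16 * (real n)\<^sup>2) * (\<Sum>l\<in>?K - {k}. 1 / (real_of_int (k - l))\<^sup>2)"
      by (simp add: sum_distrib_left mult.assoc)
    also have "\<dots> \<le> w * (16 * (real n)\<^sup>2) * 4"
      using w k by (intro mult_left_mono sum_inverse_square_distances) auto
    finally show "(\<Sum>l\<in>?K. W l * ?N (of_int (k - l) / n)) \<le> 65 * (real n)\<^sup>2 * w"
      by (simp add: algebra_simps)
  qed
  also have "\<dots> = 65 * (real n)\<^sup>2 * w"
    using sumW by (simp add: sum_distrib_right[symmetric])
  finally show ?thesis .
qed

text \<open>The double sum separates the diagonal, a sum of squared ratios, from the oscillating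
  part. For a vanishing sample both sides are 0 by division by 0.\<close>

lemma periodogram_eq_self_norm:
  "periodogram dt n x u = (\<Sum>p=1..n. \<Sum>q=1..n. self_norm {1..n} x p * self_norm {1..n} x q * cos ((real p - real q) * (dt * u)))"
proof -
  let ?D = "\<Sum>j=1..n. (x j)\<^sup>2"
  have D: "?D \<ge> 0" by (intro sum_nonneg) auto
  have "(\<Sum>j=1..n. of_real (x j) * exp (\<i> * of_real (real j * dt * u))) = (\<Sum>j=1..n. of_real (x j) * cis (real j * (dt * u)))"
    by (simp add: cis_conv_exp mult_ac)
  then have "periodogram dt n x u = (\<Sum>p=1..n. \<Sum>q=1..n. x p * x q * cos ((real p - real q) * (dt * u))) / ?D"
    by (simp add: periodogram_def sum_cos_eq_norm)
  also have "\<dots> = (\<Sum>p=1..n. \<Sum>q=1..n. self_norm {1..n} x p * self_norm {1..n} x q * cos ((real p - real q) * (dt * u)))"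
    using D by (simp add: sum_divide_distrib self_norm_def)
  finally show ?thesis .
qed

locale iid_SaS_seq = iid_SaS M \<alpha> b "{1..n}" Z for M :: "'w measure" and \<alpha> b :: real and n :: nat and Z :: "nat \<Rightarrow> 'w \<Rightarrow> real" +
  assumes n_ge_2: "n \<ge> 2"
begin

lemma sum_split_offdiag:
  "(\<Sum>p=1..n. \<Sum>q=1..n. h p q) = (\<Sum>p=1..n. h p p) + (\<Sum>p\<in>offdiag. h (fst p) (snd p))" for h :: "nat \<Rightarrow> nat \<Rightarrow> real"
proof -
  have "(\<Sum>p=1..n. \<Sum>q=1..n. h p q) = (\<Sum>p\<in>{1..n}\<times>{1..n}. h (fst p) (snd p))"
    by (simp add: sum.cartesian_product case_prod_unfold)
  also have "{1..n}\<times>{1..n} = (\<lambda>p. (p, p)) ` {1..n} \<union> offdiag" unfolding offdiag_def by auto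
  also have "(\<Sum>p\<in>\<dots>. h (fst p) (snd p)) = (\<Sum>p\<in>(\<lambda>p. (p, p)) ` {1..n}. h (fst p) (snd p)) + (\<Sum>p\<in>offdiag. h (fst p) (snd p))"
    unfolding offdiag_def by (rule sum.union_disjoint) auto
  also have "(\<Sum>p\<in>(\<lambda>p. (p, p)) ` {1..n}. h (fst p) (snd p)) = (\<Sum>p=1..n. h p p)"
    by (subst sum.reindex) (auto simp: inj_on_def)
  finally show ?thesis .
qed

lemma expectation_periodogram_le: "expectation (\<lambda>w. periodogram dt n (\<lambda>j. Z j w) u) \<le> 1"
proof -
  let ?B = "\<lambda>p q. cos ((real p - real q) * (dt * u))"
  have eq: "periodogram dt n (\<lambda>j. Z j w) u = (\<Sum>p=1..n. (r p w)\<^sup>2) + (\<Sum>p\<in>offdiag. ?B (fst p) (snd p) * (r (fst p) w * r (snd p) w))" for w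
    unfolding periodogram_eq_self_norm r_def[symmetric]
    by (subst sum_split_offdiag) (simp add: power2_eq_square mult_ac)
  have int: "integrable M (\<lambda>w. r (fst p) w * r (snd p) w)" "expectation (\<lambda>w. r (fst p) w * r (snd p) w) = 0"
    if "p \<in> offdiag" for p
    using that integrable_rr expectation_odd(2)[of "fst p" "snd p" "snd p" "snd p"] unfolding offdiag_def by auto
  have int2: "integrable M (\<lambda>w. (r p w)\<^sup>2)" if "p \<in> {1..n}" for p
    using integrable_rr[OF that that] by (simp add: power2_eq_square)
  let ?e1 = "\<lambda>w. \<Sum>p\<in>offdiag. ?B (fst p) (snd p) * (r (fst p) w * r (snd p) w)"
  have "expectation (\<lambda>w. periodogram dt n (\<lambda>j. Z j w) u) = expectation (\<lambda>w. \<Sum>p=1..n. (r p w)\<^sup>2)"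
  proof -
    have "expectation ?e1 =
        (\<Sum>p\<in>offdiag. expectation (\<lambda>w. ?B (fst p) (snd p) * (r (fst p) w * r (snd p) w)))"
      using int by (intro Bochner_Integration.integral_sum integrable_mult_right)
    also have "\<dots> = 0"
      using int by (intro sum.neutral ballI) (simp only: Bochner_Integration.integral_mult_right_zero mult_zero_right)
    finally have 0: "expectation ?e1 = 0" .
    have "expectation (\<lambda>w. periodogram dt n (\<lambda>j. Z j w) u) = expectation (\<lambda>w. \<Sum>p=1..n. (r p w)\<^sup>2) +
        expectation ?e1"
      unfolding eq using int int2
      by (intro Bochner_Integration.integral_add Bochner_Integration.integrable_sum integrable_mult_right)
    then show ?thesis unfolding 0 by simp
  qed
  also have "\<dots> \<le> expectation (\<lambda>w. 1)"
    using int2 sum_r_squares(1) by (intro integral_mono) auto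
  finally show ?thesis by (simp add: prob_space)
qed

text \<open>Centring at the sum of the squared ratios rather than at 1 removes the diagonal exactly,
  also on the event that the noise vanishes. The constant is 2 times 65 times the bound 2 for n / (n
  - 1).\<close>

lemma expectation_smoothed_periodogram:
  fixes W :: "int \<Rightarrow> real"
  assumes W: "\<And>k. k \<in> {- int m..int m} \<Longrightarrow> 0 \<le> W k \<and> W k \<le> w" and sumW: "(\<Sum>k=- int m..int m. W k) = 1"
    and m: "2 * m \<le> n" and dt: "dt > 0"
  shows "expectation (\<lambda>w. (smoothed_periodogram dt n m W (\<lambda>j. Z j w) u - (\<Sum>j=1..n. (r j w)\<^sup>2))\<^sup>2) \<le> 260 * w"
proof -
  let ?K = "{- int m..int m}"
  define B where "B p = (\<Sum>k\<in>?K. W k * cos ((real (fst p) - real (snd p)) * (dt * u + of_int k / n)))" for p :: "nat \<times> nat"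
  have w: "w \<ge> 0" using W[of 0] by auto
  have eq: "smoothed_periodogram dt n m W (\<lambda>j. Z j w) u - (\<Sum>j=1..n. (r j w)\<^sup>2)
     = (\<Sum>p\<in>offdiag. B p * (r (fst p) w * r (snd p) w))" for w
  proof -
    have "periodogram dt n (\<lambda>j. Z j w) (u + of_int k / (real n * dt)) = (\<Sum>p=1..n. (r p w)\<^sup>2) +
        (\<Sum>p\<in>offdiag. cos ((real (fst p) - real (snd p)) * (dt * u + of_int k / n)) * (r (fst p) w * r (snd p) w))" for k :: int
    proof -
      have arg: "dt * (u + of_int k / (real n * dt)) = dt * u + of_int k / n"
        using dt n_ge_2 by (simp add: field_simps)
      show ?thesis
        unfolding periodogram_eq_self_norm r_def[symmetric] arg
        by (subst sum_split_offdiag) (simp add: power2_eq_square mult_ac)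
    qed
    then have "smoothed_periodogram dt n m W (\<lambda>j. Z j w) u = (\<Sum>k\<in>?K. W k) * (\<Sum>p=1..n. (r p w)\<^sup>2) +
        (\<Sum>k\<in>?K. \<Sum>p\<in>offdiag. W k * cos ((real (fst p) - real (snd p)) * (dt * u + of_int k / n)) * (r (fst p) w * r (snd p) w))"
    proof -
      assume *: "\<And>k. periodogram dt n (\<lambda>j. Z j w) (u + of_int k / (real n * dt)) = (\<Sum>p=1..n. (r p w)\<^sup>2) +
        (\<Sum>p\<in>offdiag. cos ((real (fst p) - real (snd p)) * (dt * u + of_int k / n)) * (r (fst p) w * r (snd p) w))"
      define R where "R = (\<Sum>p=1..n. (r p w)\<^sup>2)"
      show ?thesis
        unfolding smoothed_periodogram_def * R_def[symmetric]
        by (simp only: distrib_left sum.distrib sum_distrib_left sum_distrib_right mult.assoc)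
    qed
    then show ?thesis
      unfolding sumW B_def sum_distrib_right by (subst sum.swap) simp
  qed
  have "(\<Sum>p\<in>offdiag. (B p)\<^sup>2) \<le> (\<Sum>p\<in>{1..n}\<times>{1..n}. (B p)\<^sup>2)"
    unfolding offdiag_def by (intro sum_mono2) auto
  also have "\<dots> = (\<Sum>p=1..n. \<Sum>q=1..n. (\<Sum>k=- int m..int m. W k * cos ((real p - real q) * (dt * u + of_int k / n)))\<^sup>2)"
    by (simp add: sum.cartesian_product case_prod_unfold B_def)
  also have "\<dots> \<le> 65 * (real n)\<^sup>2 * w"
    by (rule sum_weighted_cos_squares[OF W sumW m]) (use n_ge_2 in auto)
  finally have S: "(\<Sum>p\<in>offdiag. (B p)\<^sup>2) \<le> 65 * (real n)\<^sup>2 * w" .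
  have "expectation (\<lambda>w. (smoothed_periodogram dt n m W (\<lambda>j. Z j w) u - (\<Sum>j=1..n. (r j w)\<^sup>2))\<^sup>2)
      = expectation (\<lambda>w. (\<Sum>p\<in>offdiag. B p * (r (fst p) w * r (snd p) w))\<^sup>2)"
    using eq by simp
  also have "\<dots> \<le> 2 / (card {1..n} * (card {1..n} - 1)) * (\<Sum>p\<in>offdiag. (B p)\<^sup>2)"
  proof (rule expectation_offdiag_form)
    fix i j
    have "cos ((real i - real j) * t) = cos ((real j - real i) * t)" for t
      by (metis cos_minus minus_diff_eq minus_mult_left)
    then show "B (i, j) = B (j, i)" by (simp add: B_def)
  qed
  also have "\<dots> \<le> 2 / (card {1..n} * (card {1..n} - 1)) * (65 * (real n)\<^sup>2 * w)"
    by (rule mult_left_mono[OF S]) simp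
  also have "2 / (card {1..n} * (card {1..n} - 1)) * (65 * (real n)\<^sup>2 * w) = 130 * w * (n / (n - 1))"
    using n_ge_2 by (simp add: power2_eq_square field_simps)
  also have "\<dots> \<le> 130 * w * 2"
    using n_ge_2 w by (intro mult_left_mono) (auto simp: field_simps of_nat_diff)
  finally show ?thesis by simp
qed

end

section \<open>Riemann sums of decaying functions\<close>

text \<open>The sign of the exponent is that of the periodogram and opposite to that of
  \<open>fourier\<close>; for a real function the two transforms are complex conjugates.\<close>

definition FT :: "(real \<Rightarrow> real) \<Rightarrow> real \<Rightarrow> complex" where
  "FT h u = (LINT x|lborel. of_real (h x) * cis (x * u))"

lemma cis_measurable [measurable (raw)]:
  "g \<in> borel_measurable M \<Longrightarrow> (\<lambda>x. cis (g x)) \<in> borel_measurable M"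
  unfolding cis_conv_exp by measurable

text \<open>The summand 1 lets one majorant express boundedness near 0 and polynomial decay at
  infinity.\<close>

definition envelope :: "real \<Rightarrow> real \<Rightarrow> real" where
  "envelope p x = (1 + \<bar>x\<bar>) powr (- p)"

lemma envelope_measurable [measurable]: "envelope p \<in> borel_measurable borel"
  unfolding envelope_def by measurable

lemma envelope_nonneg [simp]: "envelope p x \<ge> 0"
  by (simp add: envelope_def)

lemma envelope_antimono:
  assumes "p \<ge> 0" "\<bar>x\<bar> \<le> \<bar>y\<bar>"
  shows "envelope p y \<le> envelope p x"
  unfolding envelope_def using assms by (intro powr_mono2') auto

lemma nn_integral_envelope_tail:
  assumes p: "p > 1" and d: "d \<ge> 0"
  shows "(\<integral>\<^sup>+ x. ennreal (envelope p x) * indicator {x. \<bar>x\<bar> \<ge> d} x \<partial>lborel) \<le> ennreal (2 / (p - 1) * (1 + d) powr (1 - p))"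
proof -
  let ?f = "\<lambda>x::real. (1 + \<bar>x\<bar>) powr (- p)"
  let ?F = "\<lambda>x::real. - ((1 + x) powr (1 - p)) / (p - 1)"
  let ?e1 = "\<integral>\<^sup>+ x. ennreal (envelope p x) * indicator {d..} x \<partial>lborel"
  have half: "?e1 = ennreal ((1 + d) powr (1 - p) / (p - 1))"
  proof -
    have "?e1 = ennreal (0 - ?F d)"
    proof (rule nn_integral_FTC_atLeast)
      fix x :: real assume x: "d \<le> x"
      have "(?F has_real_derivative - ((1 - p) * (1 + x) powr (1 - p - 1)) / (p - 1)) (at x)"
        using x d p by (auto intro!: derivative_eq_intros)
      moreover have "- ((1 - p) * (1 + x) powr (1 - p - 1)) / (p - 1) = envelope p x"
        using x d p by (simp add: envelope_def field_simps)
      ultimately show "(?F has_real_derivative envelope p x) (at x)" by simp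
    next
      have "((\<lambda>x. (1 + x) powr (1 - p)) \<longlongrightarrow> 0) at_top"
        using p by (intro tendsto_neg_powr filterlim_tendsto_add_at_top[OF tendsto_const filterlim_ident]) auto
      from tendsto_divide[OF tendsto_minus[OF this] tendsto_const, of "p - 1"]
      show "(?F \<longlongrightarrow> 0) at_top" using p by simp
    qed auto
    then show ?thesis by simp
  qed
  have half': "(\<integral>\<^sup>+ x. ennreal (envelope p x) * indicator {..-d} x \<partial>lborel) = ennreal ((1 + d) powr (1 - p) / (p - 1))"
  proof -
    have "(\<integral>\<^sup>+ x. ennreal (envelope p x) * indicator {..-d} x \<partial>lborel) =
        (\<integral>\<^sup>+ x. ennreal (envelope p (0 + (-1) * x)) * indicator {..-d} (0 + (-1) * x) \<partial>lborel)"
      by (subst nn_integral_real_affine[of _ "-1" 0]) auto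
    also have "\<dots> = ?e1"
      by (intro nn_integral_cong) (auto simp: envelope_def indicator_def)
    finally show ?thesis using half by simp
  qed
  have "(\<integral>\<^sup>+ x. ennreal (envelope p x) * indicator {x. \<bar>x\<bar> \<ge> d} x \<partial>lborel) \<le>
      (\<integral>\<^sup>+ x. ennreal (envelope p x) * indicator {d..} x + ennreal (envelope p x) * indicator {..-d} x \<partial>lborel)"
    by (intro nn_integral_mono) (auto simp: indicator_def)
  also have "\<dots> = ennreal ((1 + d) powr (1 - p) / (p - 1)) + ennreal ((1 + d) powr (1 - p) / (p - 1))"
    by (subst nn_integral_add) (auto simp: half half')
  also have "\<dots> = ennreal (2 / (p - 1) * (1 + d) powr (1 - p))"
    using p by (subst ennreal_plus[symmetric]) auto
  finally show ?thesis .
qed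

lemma nn_integral_envelope:
  assumes "p > 1"
  shows "(\<integral>\<^sup>+ x. ennreal (envelope p x) \<partial>lborel) \<le> ennreal (2 / (p - 1))"
  using nn_integral_envelope_tail[OF assms, of 0] by simp

lemma nn_integral_shift:
  assumes [measurable]: "f \<in> borel_measurable borel"
  shows "(\<integral>\<^sup>+ x. f (x - s) \<partial>lborel) = (\<integral>\<^sup>+ x. f (x :: real) \<partial>lborel)"
  using nn_integral_real_affine[of f 1 "- s"] by simp

lemma norm_cis_diff_le: "norm (cis a - cis b) \<le> \<bar>a - b\<bar>"
proof -
  have "cis a - cis b = cis b * (iexp (a - b) - 1)"
    unfolding cis_conv_exp by (simp add: algebra_simps exp_add[symmetric])
  then have "norm (cis a - cis b) = norm (iexp (a - b) - 1)" by (simp add: norm_mult)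
  also have "\<dots> \<le> \<bar>a - b\<bar>" using iexp_approx1[of "a - b" 0] by simp
  finally show ?thesis .
qed

text \<open>Rounding up sends the cell ((k - 1) dt, k dt] to its right end point, the time that the
  noise on this cell carries in the discrete transform.\<close>

definition grid :: "real \<Rightarrow> real \<Rightarrow> real" where
  "grid dt t = dt * of_int \<lceil>t / dt\<rceil>"

lemma grid_bounds:
  assumes "dt > 0"
  shows "t \<le> grid dt t" "grid dt t < t + dt"
proof -
  have 1: "t / dt \<le> of_int \<lceil>t / dt\<rceil>" and 2: "of_int \<lceil>t / dt\<rceil> < t / dt + 1" by linarith+
  show "t \<le> grid dt t"
    using mult_right_mono[OF 1, of dt] assms by (simp add: grid_def mult.commute)
  show "grid dt t < t + dt"
  proof -
    have "(t / dt + 1) * dt = t + dt" using assms by (simp add: field_simps)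
    then show ?thesis using mult_strict_right_mono[OF 2 assms] by (simp add: grid_def mult.commute)
  qed
qed

lemma grid_eq:
  assumes "dt > 0" "t \<in> {real j * dt <.. real (Suc j) * dt}"
  shows "grid dt t = real (Suc j) * dt"
proof -
  have "\<lceil>t / dt\<rceil> = int (Suc j)"
    using assms by (intro ceiling_unique) (auto simp: field_simps)
  then show ?thesis by (simp add: grid_def)
qed

text \<open>A Riemann sum is the exact integral of a step function, so its error becomes the
  integral of a difference.\<close>

lemma has_integral_grid:
  fixes \<phi> :: "real \<Rightarrow> 'b::{banach, second_countable_topology}"
  assumes dt: "dt > 0"
  shows "has_bochner_integral lborel (\<lambda>t. indicator {0<..real n * dt} t *\<^sub>R \<phi> (grid dt t)) (dt *\<^sub>R (\<Sum>j=1..n. \<phi> (real j * dt)))"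
proof (induction n)
  case 0
  show ?case by (simp add: has_bochner_integral_zero)
next
  case (Suc n)
  let ?A = "{real n * dt<..real (Suc n) * dt}"
  have "has_bochner_integral lborel (indicator ?A :: real \<Rightarrow> real) (measure lborel ?A)"
    by (rule has_bochner_integral_real_indicator) (use dt in \<open>auto simp: algebra_simps\<close>)
  moreover have "measure lborel ?A = dt" using dt by (simp add: algebra_simps)
  ultimately have "has_bochner_integral lborel (\<lambda>t. indicator ?A t *\<^sub>R \<phi> (real (Suc n) * dt)) (dt *\<^sub>R \<phi> (real (Suc n) * dt))"
    by (intro has_bochner_integral_scaleR_left) auto
  from has_bochner_integral_add[OF Suc this]
  have "has_bochner_integral lborel (\<lambda>t. indicator {0<..real n * dt} t *\<^sub>R \<phi> (grid dt t) + indicator ?A t *\<^sub>R \<phi> (real (Suc n) * dt))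
     (dt *\<^sub>R (\<Sum>j=1..Suc n. \<phi> (real j * dt)))"
    by (simp add: scaleR_right_distrib)
  moreover have "indicator {0<..real n * dt} t *\<^sub>R \<phi> (grid dt t) + indicator ?A t *\<^sub>R \<phi> (real (Suc n) * dt)
      = indicator {0<..real (Suc n) * dt} t *\<^sub>R \<phi> (grid dt t)" for t
  proof (cases "t \<in> ?A")
    case True
    then have "t \<notin> {0<..real n * dt}" "t \<in> {0<..real (Suc n) * dt}"
      using dt by (auto intro: order.strict_trans1[of 0 "real n * dt"])
    then show ?thesis using True grid_eq[OF dt True] by simp
  next
    case False
    then have "t \<in> {0<..real n * dt} \<longleftrightarrow> t \<in> {0<..real (Suc n) * dt}"
      using dt by (auto simp: algebra_simps)
    then show ?thesis using False by (simp add: indicator_def)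
  qed
  ultimately show ?case by simp
qed

text \<open>Source of the exponent 1 - 1/p: the bound w is used on [-d0, d0] and the decay outside.
  At d0 = w^(-1/p) both parts are of order w^(1 - 1/p).\<close>

lemma nn_integral_min_envelope:
  assumes p: "p > 1" and w: "w \<ge> 0" and A: "A \<ge> 0"
  shows "(\<integral>\<^sup>+ x. ennreal (min w (A * envelope p x)) \<partial>lborel) \<le> ennreal ((2 + 2 * A / (p - 1)) * w powr (1 - 1/p))"
proof (cases "w = 0")
  case True
  have "min w (A * envelope p x) = 0" for x using True A by (simp add: min_def mult_nonneg_nonneg)
  then show ?thesis by simp
next
  case False
  then have w: "w > 0" using assms by simp
  define d0 where "d0 = w powr (- 1/p)"
  have d0: "d0 > 0" using w by (simp add: d0_def)
  have "(\<integral>\<^sup>+ x. ennreal (min w (A * envelope p x)) \<partial>lborel) \<le>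
     (\<integral>\<^sup>+ x. ennreal w * indicator {-d0..d0} x + ennreal A * (ennreal (envelope p x) * indicator {x. \<bar>x\<bar> \<ge> d0} x) \<partial>lborel)"
  proof (rule nn_integral_mono)
    fix x
    show "ennreal (min w (A * envelope p x)) \<le> ennreal w * indicator {-d0..d0} x + ennreal A * (ennreal (envelope p x) * indicator {x. \<bar>x\<bar> \<ge> d0} x)"
    proof (cases "x \<in> {-d0..d0}")
      case True
      have "ennreal (min w (A * envelope p x)) \<le> ennreal w" by (intro ennreal_leI) auto
      then show ?thesis using True by (simp add: add_increasing2)
    next
      case False
      then have "\<bar>x\<bar> \<ge> d0" by auto
      moreover have "ennreal (min w (A * envelope p x)) \<le> ennreal A * ennreal (envelope p x)"
        using A by (subst ennreal_mult[symmetric]) (auto intro!: ennreal_leI)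
      ultimately show ?thesis using False by simp
    qed
  qed
  also have "\<dots> = ennreal w * ennreal (2 * d0) + ennreal A * (\<integral>\<^sup>+ x. ennreal (envelope p x) * indicator {x. \<bar>x\<bar> \<ge> d0} x \<partial>lborel)"
    using d0 by (subst nn_integral_add) (auto simp: nn_integral_cmult nn_integral_cmult_indicator)
  also have "\<dots> \<le> ennreal w * ennreal (2 * d0) + ennreal A * ennreal (2 / (p - 1) * (1 + d0) powr (1 - p))"
    using d0 p by (intro add_left_mono mult_left_mono nn_integral_envelope_tail) auto
  also have "\<dots> = ennreal (w * (2 * d0) + A * (2 / (p - 1) * (1 + d0) powr (1 - p)))"
  proof -
    have "ennreal w * ennreal (2 * d0) = ennreal (w * (2 * d0))"
      "ennreal A * ennreal (2 / (p - 1) * (1 + d0) powr (1 - p)) = ennreal (A * (2 / (p - 1) * (1 + d0) powr (1 - p)))"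
      using w d0 A p by (intro ennreal_mult[symmetric]; simp)+
    then show ?thesis using w d0 A p by (subst ennreal_plus) (auto simp del: ennreal_plus)
  qed
  also have "\<dots> \<le> ennreal ((2 + 2 * A / (p - 1)) * w powr (1 - 1/p))"
  proof (rule ennreal_leI)
    have 1: "w * d0 = w powr (1 - 1/p)"
      using w by (simp add: d0_def powr_mult_base)
    have "(1 + d0) powr (1 - p) \<le> d0 powr (1 - p)" using d0 p by (intro powr_mono2') auto
    also have "d0 powr (1 - p) = w powr (1 - 1/p)"
    proof -
      have "- 1/p * (1 - p) = 1 - 1/p" using p by (simp add: field_simps)
      then show ?thesis unfolding d0_def powr_powr by simp
    qed
    finally have 2: "A * (2 / (p - 1) * (1 + d0) powr (1 - p)) \<le> A * (2 / (p - 1) * w powr (1 - 1/p))"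
      using A p by (intro mult_left_mono) auto
    have "w * (2 * d0) + A * (2 / (p - 1) * (1 + d0) powr (1 - p)) \<le> 2 * w powr (1 - 1/p) + A * (2 / (p - 1) * w powr (1 - 1/p))"
      using 1 2 by (intro add_mono) auto
    also have "\<dots> = (2 + 2 * A / (p - 1)) * w powr (1 - 1/p)" by (simp add: algebra_simps)
    finally show "w * (2 * d0) + A * (2 / (p - 1) * (1 + d0) powr (1 - p)) \<le> (2 + 2 * A / (p - 1)) * w powr (1 - 1/p)" .
  qed
  finally show ?thesis .
qed

text \<open>Distance to the end points 0 and N of the observation interval: seen from outside the
  distance to the interval, from inside that to its complement.\<close>

definition edge_dist :: "real \<Rightarrow> real \<Rightarrow> real" where
  "edge_dist N s = min \<bar>s\<bar> \<bar>s - N\<bar>"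

text \<open>The mass across the boundary is of order (1 + d)^(1 - r). The factor N^q buys the
  additional decay (1 + d)^(-q): for 1 + d \<le> 2 N because (1 + d)^q is at most 2 N^q, and farther
  away because the mass is at most N times the largest value of the envelope.\<close>

lemma nn_integral_envelope_across:
  assumes r: "r > 1" and N: "N \<ge> 1" and q: "0 \<le> q" "q \<le> 1"
    and A: "A = (if s \<in> {0<..N} then - {0<..N} else {0<..N})"
  shows "(\<integral>\<^sup>+ t. ennreal (envelope r (t - s)) * indicator A t \<partial>lborel)
    \<le> ennreal ((4 / (r - 1) + 1) * N powr q * envelope (r - 1 + q) (edge_dist N s))"
proof -
  define d where "d = edge_dist N s"
  have d: "d \<ge> 0" by (simp add: d_def edge_dist_def)
  have [measurable]: "A \<in> sets borel" unfolding A by auto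
  have far: "\<bar>t - s\<bar> \<ge> d" if "t \<in> A" for t
    using that N by (auto simp: A d_def edge_dist_def split: if_splits)
  let ?e1 = "\<integral>\<^sup>+ t. ennreal (envelope r (t - s)) * indicator A t \<partial>lborel"
  have tail: "?e1 \<le> ennreal (2 / (r - 1) * (1 + d) powr (1 - r))"
  proof -
    have "?e1 \<le>
        (\<integral>\<^sup>+ t. ennreal (envelope r (t - s)) * indicator {x. \<bar>x\<bar> \<ge> d} (t - s) \<partial>lborel)"
      using far by (intro nn_integral_mono) (auto simp: indicator_def)
    also have "\<dots> = (\<integral>\<^sup>+ x. ennreal (envelope r x) * indicator {x. \<bar>x\<bar> \<ge> d} x \<partial>lborel)"
      by (rule nn_integral_shift) measurable
    also have "\<dots> \<le> ennreal (2 / (r - 1) * (1 + d) powr (1 - r))"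
      by (rule nn_integral_envelope_tail[OF r d])
    finally show ?thesis .
  qed
  have env: "envelope (r - 1 + q) d = (1 + d) powr (1 - r - q)" using d by (simp add: envelope_def algebra_simps)
  show ?thesis
  proof (cases "1 + d \<le> 2 * N")
    case True
    have "(1 + d) powr (1 - r) = (1 + d) powr (1 - r - q) * (1 + d) powr q"
      using d by (simp add: powr_add[symmetric])
    also have "\<dots> \<le> (1 + d) powr (1 - r - q) * (2 * N powr q)"
    proof (rule mult_left_mono)
      have "(1 + d) powr q \<le> (2 * N) powr q" using True d q by (intro powr_mono2) auto
      also have "\<dots> = 2 powr q * N powr q" by (simp add: powr_mult)
      also have "\<dots> \<le> 2 * N powr q" using powr_mono[of q 1 2] q by (intro mult_right_mono) auto
      finally show "(1 + d) powr q \<le> 2 * N powr q" .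
    qed auto
    finally have "2 / (r - 1) * (1 + d) powr (1 - r) \<le> 2 / (r - 1) * ((1 + d) powr (1 - r - q) * (2 * N powr q))"
      using r by (intro mult_left_mono) auto
    also have "\<dots> = 4 / (r - 1) * N powr q * (1 + d) powr (1 - r - q)" by (simp add: mult_ac)
    also have "\<dots> \<le> (4 / (r - 1) + 1) * N powr q * (1 + d) powr (1 - r - q)"
      by (intro mult_right_mono) auto
    finally show ?thesis using tail unfolding d_def[symmetric] env
      by (meson ennreal_leI order.trans)
  next
    case False
    \<comment> \<open>Points of the interval have d \<le> N, so s lies outside and the far side is
      the interval itself, of length N.\<close>
    have A0: "A = {0<..N}"
    proof (rule ccontr)
      assume "A \<noteq> {0<..N}"
      then have "s \<in> {0<..N}" using A by (auto split: if_splits)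
      then have "d \<le> N" by (auto simp: d_def edge_dist_def)
      then show False using False N by auto
    qed
    have "?e1 \<le> (\<integral>\<^sup>+ t. ennreal (envelope r d) * indicator A t \<partial>lborel)"
    proof (rule nn_integral_mono)
      fix t
      show "ennreal (envelope r (t - s)) * indicator A t \<le> ennreal (envelope r d) * indicator A t"
        using far[of t] d r by (auto simp: indicator_def intro!: ennreal_leI envelope_antimono)
    qed
    also have "\<dots> = ennreal (envelope r d) * ennreal N"
      using N by (subst nn_integral_cmult_indicator) (auto simp: A0)
    also have "\<dots> = ennreal (envelope r d * N)" using N by (simp add: ennreal_mult)
    also have "\<dots> \<le> ennreal ((4 / (r - 1) + 1) * N powr q * (1 + d) powr (1 - r - q))"
    proof (rule ennreal_leI)
      have "envelope r d = (1 + d) powr (1 - r - q) * (1 + d) powr (q - 1)"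
        using d by (simp add: envelope_def powr_add[symmetric])
      also have "\<dots> \<le> (1 + d) powr (1 - r - q) * N powr (q - 1)"
        using False N q d by (intro mult_left_mono powr_mono2') auto
      finally have "envelope r d * N \<le> (1 + d) powr (1 - r - q) * N powr (q - 1) * N"
        using N by (intro mult_right_mono) auto
      also have "\<dots> = 1 * N powr q * (1 + d) powr (1 - r - q)"
        using N powr_mult_base[of N "q - 1"] by (simp add: mult_ac)
      also have "\<dots> \<le> (4 / (r - 1) + 1) * N powr q * (1 + d) powr (1 - r - q)"
        using r by (intro mult_right_mono) auto
      finally show "envelope r d * N \<le> (4 / (r - 1) + 1) * N powr q * (1 + d) powr (1 - r - q)" .
    qed
    finally show ?thesis unfolding d_def[symmetric] env .
  qed
qed

text \<open>A generous common majorant of the constants in the estimates below, so that they can be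
  added without tracking each one.\<close>

definition riemann_const :: "real \<Rightarrow> real \<Rightarrow> real" where
  "riemann_const C r = 2 + 2 powr (r + 2) * C * (4 / (r - 1) + 1)"

lemma norm_diff_add_le: "norm (a - b + c :: complex) \<le> norm a + norm b + norm c"
  using norm_triangle_ineq[of "a - b" c] norm_triangle_ineq4[of a b] by linarith

locale decaying =
  fixes h :: "real \<Rightarrow> real" and C r :: real
  assumes h_measurable [measurable]: "h \<in> borel_measurable borel"
    and r: "r > 1" and decay: "\<And>x. \<bar>h x\<bar> \<le> C * envelope r x"
begin

lemma C_nonneg: "C \<ge> 0"
  using decay[of 0] by (simp add: envelope_def)

lemma nn_integral_abs: "(\<integral>\<^sup>+ x. ennreal \<bar>h x\<bar> \<partial>lborel) \<le> ennreal (2 * C / (r - 1))"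
proof -
  have "(\<integral>\<^sup>+ x. ennreal \<bar>h x\<bar> \<partial>lborel) \<le> (\<integral>\<^sup>+ x. ennreal C * ennreal (envelope r x) \<partial>lborel)"
    using C_nonneg decay by (intro nn_integral_mono) (auto simp: ennreal_mult[symmetric] intro!: ennreal_leI)
  also have "\<dots> = ennreal C * (\<integral>\<^sup>+ x. ennreal (envelope r x) \<partial>lborel)"
    by (rule nn_integral_cmult) measurable
  also have "\<dots> \<le> ennreal C * ennreal (2 / (r - 1))"
    by (intro mult_left_mono nn_integral_envelope r) auto
  also have "\<dots> = ennreal (2 * C / (r - 1))"
    using C_nonneg r by (subst ennreal_mult[symmetric]) (auto simp: mult.commute)
  finally show ?thesis .
qed

lemma integrable_h: "integrable lborel h"
  by (rule integrableI_bounded) (auto intro: order.strict_trans1[OF nn_integral_abs])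

lemma integrable_FT: "integrable lborel (\<lambda>x. of_real (h x) * cis (x * u))"
proof -
  have [measurable]: "(\<lambda>x. cis (x * u)) \<in> borel_measurable borel"
    unfolding cis_conv_exp by measurable
  show ?thesis
    by (rule Bochner_Integration.integrable_bound[OF integrable_h]) (auto simp: norm_mult)
qed

lemma norm_FT_le: "norm (FT h u) \<le> 2 * C / (r - 1)"
proof -
  have "ennreal (norm (FT h u)) \<le> (\<integral>\<^sup>+ x. norm (of_real (h x) * cis (x * u)) \<partial>lborel)"
    unfolding FT_def by (rule integral_norm_bound_ennreal[OF integrable_FT])
  also have "\<dots> = (\<integral>\<^sup>+ x. ennreal \<bar>h x\<bar> \<partial>lborel)" by (simp add: norm_mult)
  also have "\<dots> \<le> ennreal (2 * C / (r - 1))" by (rule nn_integral_abs)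
  finally show ?thesis using C_nonneg r by (subst (asm) ennreal_le_iff) auto
qed

text \<open>Moving t by at most 1 changes 1 + |t - s| by a factor of at most 2.\<close>

lemma envelope_grid:
  assumes dt: "0 < dt" "dt \<le> 1"
  shows "envelope r (grid dt t - s) \<le> 2 powr r * envelope r (t - s)"
proof -
  define a b c where "a = \<bar>t - s\<bar>" "b = \<bar>t - grid dt t\<bar>" "c = \<bar>grid dt t - s\<bar>"
  have "b \<le> 1" using grid_bounds[OF dt(1), of t] dt by (auto simp: a_b_c_def)
  moreover have "a \<le> b + c"
    using abs_triangle_ineq[of "t - grid dt t" "grid dt t - s"] by (simp add: a_b_c_def)
  moreover have "c \<ge> 0" by (simp add: a_b_c_def)
  ultimately have "1 + a \<le> 2 * (1 + c)" by simp
  then have "1 + \<bar>t - s\<bar> \<le> 2 * (1 + \<bar>grid dt t - s\<bar>)" unfolding a_b_c_def .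
  then have "(2 * (1 + \<bar>grid dt t - s\<bar>)) powr (- r) \<le> (1 + \<bar>t - s\<bar>) powr (- r)"
    using r by (intro powr_mono2') auto
  also have "(2 * (1 + \<bar>grid dt t - s\<bar>)) powr (- r) = 2 powr (- r) * envelope r (grid dt t - s)"
    unfolding envelope_def by (rule powr_mult)
  finally show ?thesis by (simp add: powr_minus envelope_def field_simps)
qed

lemma sum_abs_le:
  assumes dt: "0 < dt" "dt \<le> 1"
  shows "ennreal (dt * (\<Sum>j=1..n. \<bar>h (real j * dt - s)\<bar>)) \<le>
    ennreal (2 powr r * C) * (\<integral>\<^sup>+ t. ennreal (envelope r (t - s)) * indicator {0<..real n * dt} t \<partial>lborel)"
proof -
  have hb: "has_bochner_integral lborel (\<lambda>t. indicator {0<..real n * dt} t *\<^sub>R \<bar>h (grid dt t - s)\<bar>) (dt *\<^sub>R (\<Sum>j=1..n. \<bar>h (real j * dt - s)\<bar>))"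
    by (rule has_integral_grid[OF dt(1), of n "\<lambda>x. \<bar>h (x - s)\<bar>"])
  have "ennreal (dt * (\<Sum>j=1..n. \<bar>h (real j * dt - s)\<bar>)) = (\<integral>\<^sup>+ t. ennreal (indicator {0<..real n * dt} t *\<^sub>R \<bar>h (grid dt t - s)\<bar>) \<partial>lborel)"
    using hb by (subst nn_integral_eq_integral) (auto simp: has_bochner_integral_iff)
  also have "\<dots> \<le> (\<integral>\<^sup>+ t. ennreal (2 powr r * C) * (ennreal (envelope r (t - s)) * indicator {0<..real n * dt} t) \<partial>lborel)"
  proof (rule nn_integral_mono)
    fix t
    have "\<bar>h (grid dt t - s)\<bar> \<le> C * envelope r (grid dt t - s)" by (rule decay)
    also have "\<dots> \<le> C * (2 powr r * envelope r (t - s))"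
      by (intro mult_left_mono envelope_grid dt C_nonneg)
    finally have "\<bar>h (grid dt t - s)\<bar> \<le> 2 powr r * C * envelope r (t - s)" by (simp add: mult_ac)
    then show "ennreal (indicator {0<..real n * dt} t *\<^sub>R \<bar>h (grid dt t - s)\<bar>) \<le>
      ennreal (2 powr r * C) * (ennreal (envelope r (t - s)) * indicator {0<..real n * dt} t)"
      using C_nonneg by (auto simp: indicator_def ennreal_mult[symmetric] intro!: ennreal_leI)
  qed
  also have "\<dots> = ennreal (2 powr r * C) * (\<integral>\<^sup>+ t. ennreal (envelope r (t - s)) * indicator {0<..real n * dt} t \<partial>lborel)"
    by (rule nn_integral_cmult) measurable
  finally show ?thesis .
qed

lemma sum_abs_bounded:
  assumes dt: "0 < dt" "dt \<le> 1"
  shows "dt * (\<Sum>j=1..n. \<bar>h (real j * dt - s)\<bar>) \<le> riemann_const C r"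
proof -
  have "(\<integral>\<^sup>+ t. ennreal (envelope r (t - s)) * indicator {0<..real n * dt} t \<partial>lborel) \<le> (\<integral>\<^sup>+ t. ennreal (envelope r (t - s)) \<partial>lborel)"
    by (intro nn_integral_mono) (auto simp: indicator_def)
  also have "\<dots> = (\<integral>\<^sup>+ x. ennreal (envelope r x) \<partial>lborel)" by (rule nn_integral_shift) measurable
  also have "\<dots> \<le> ennreal (2 / (r - 1))" by (rule nn_integral_envelope[OF r])
  finally have le: "(\<integral>\<^sup>+ t. ennreal (envelope r (t - s)) * indicator {0<..real n * dt} t \<partial>lborel) \<le> ennreal (2 / (r - 1))" .
  have "ennreal (dt * (\<Sum>j=1..n. \<bar>h (real j * dt - s)\<bar>)) \<le> ennreal (2 powr r * C) * ennreal (2 / (r - 1))"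
    by (rule order.trans[OF sum_abs_le[OF dt] mult_left_mono[OF le]]) simp
  also have "\<dots> = ennreal (2 powr r * C * (2 / (r - 1)))"
    using C_nonneg r by (intro ennreal_mult[symmetric]) auto
  also have "\<dots> \<le> ennreal (riemann_const C r)"
  proof (rule ennreal_leI)
    have "2 powr r * C * (2 / (r - 1)) \<le> 2 powr (r + 2) * C * (4 / (r - 1) + 1)"
    proof (intro mult_mono mult_right_mono powr_mono)
      have "2 / (r - 1) \<le> 4 / (r - 1)" using r by (intro divide_right_mono) auto
      then show "2 / (r - 1) \<le> 4 / (r - 1) + 1" by simp
    qed (use C_nonneg r in auto)
    then show "2 powr r * C * (2 / (r - 1)) \<le> riemann_const C r" unfolding riemann_const_def by simp
  qed
  finally show ?thesis using C_nonneg r by (subst (asm) ennreal_le_iff) (auto simp: riemann_const_def)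
qed

text \<open>The error has two sources: moving the argument of h within a cell, bounded by the
  smaller of w and a multiple of the envelope, and moving the phase, bounded by dt |u| |h|.
  Integration turns the first into w^(1 - 1/r).\<close>

lemma riemann_sum_window:
  assumes dt: "0 < dt" "dt \<le> 1" and w: "w \<ge> 0" "\<And>x y. \<bar>x - y\<bar> < dt \<Longrightarrow> \<bar>h x - h y\<bar> \<le> w"
  shows "norm (of_real dt * (\<Sum>j=1..n. of_real (h (real j * dt - s)) * cis (real j * dt * u)) -
      (LINT t|lborel. indicator {0<..real n * dt} t *\<^sub>R (of_real (h (t - s)) * cis (t * u))))
    \<le> (2 + 2 * (2 powr (r + 1) * C) / (r - 1)) * w powr (1 - 1/r) + 2 * C / (r - 1) * (dt * \<bar>u\<bar>)"
proof -
  let ?I = "{0<..real n * dt}"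
  let ?a = "\<lambda>t. of_real (h (grid dt t - s)) * cis (grid dt t * u)"
  let ?b = "\<lambda>t. of_real (h (t - s)) * cis (t * u)"
  have [measurable]: "(\<lambda>t. cis (g t)) \<in> borel_measurable borel" if "g \<in> borel_measurable borel" for g :: "real \<Rightarrow> real"
    using that unfolding cis_conv_exp by measurable
  let ?e1 = "\<Sum>j=1..n. of_real (h (real j * dt - s)) * cis (real j * dt * u)"
  have hb: "has_bochner_integral lborel (\<lambda>t. indicator ?I t *\<^sub>R ?a t) (dt *\<^sub>R ?e1)"
    by (rule has_integral_grid[OF dt(1), of n "\<lambda>x. of_real (h (x - s)) * cis (x * u)"])
  let ?e2 = "\<integral>\<^sup>+ t. ennreal \<bar>h (t - s)\<bar> \<partial>lborel"
  let ?e3 = "\<integral>\<^sup>+ x. ennreal \<bar>h x\<bar> \<partial>lborel"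
  have int_b0: "integrable lborel ?b"
  proof -
    have "?e2 = ?e3"
      by (rule nn_integral_shift) measurable
    then show ?thesis
      by (intro integrableI_bounded) (auto simp: norm_mult intro: order.strict_trans1[OF nn_integral_abs])
  qed
  have int_b: "integrable lborel (\<lambda>t. indicator ?I t *\<^sub>R ?b t)"
    by (rule Bochner_Integration.integrable_bound[OF int_b0]) (auto simp: indicator_def)
  have int_ab: "integrable lborel (\<lambda>t. indicator ?I t *\<^sub>R ?a t - indicator ?I t *\<^sub>R ?b t)"
    using hb int_b by (intro Bochner_Integration.integrable_diff) (auto simp: has_bochner_integral_iff)
  have "of_real dt * ?e1 - (LINT t|lborel. indicator ?I t *\<^sub>R ?b t)
      = (LINT t|lborel. indicator ?I t *\<^sub>R ?a t - indicator ?I t *\<^sub>R ?b t)"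
    using hb int_b by (subst Bochner_Integration.integral_diff) (auto simp: has_bochner_integral_iff scaleR_conv_of_real)
  then have "ennreal (norm (of_real dt * ?e1 - (LINT t|lborel. indicator ?I t *\<^sub>R ?b t)))
      \<le> (\<integral>\<^sup>+ t. norm (indicator ?I t *\<^sub>R ?a t - indicator ?I t *\<^sub>R ?b t) \<partial>lborel)"
    using integral_norm_bound_ennreal[OF int_ab] by simp
  also have "\<dots> \<le> (\<integral>\<^sup>+ t. ennreal (min w (2 powr (r + 1) * C * envelope r (t - s))) + ennreal (dt * \<bar>u\<bar>) * ennreal \<bar>h (t - s)\<bar> \<partial>lborel)"
  proof (rule nn_integral_mono)
    fix t
    have g: "\<bar>grid dt t - t\<bar> \<le> dt" "\<bar>(grid dt t - s) - (t - s)\<bar> < dt" using grid_bounds[OF dt(1), of t] dt by auto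
    have "norm (indicator ?I t *\<^sub>R ?a t - indicator ?I t *\<^sub>R ?b t) \<le> norm (?a t - ?b t)"
      by (auto simp: indicator_def)
    also have "?a t - ?b t = of_real (h (grid dt t - s) - h (t - s)) * cis (grid dt t * u) +
         of_real (h (t - s)) * (cis (grid dt t * u) - cis (t * u))"
      by (simp add: algebra_simps)
    also have "norm \<dots> \<le> \<bar>h (grid dt t - s) - h (t - s)\<bar> + \<bar>h (t - s)\<bar> * norm (cis (grid dt t * u) - cis (t * u))"
      by (rule order.trans[OF norm_triangle_ineq]) (simp only: norm_mult norm_of_real norm_cis mult_1_right order.refl)
    also have "\<dots> \<le> min w (2 powr (r + 1) * C * envelope r (t - s)) + \<bar>h (t - s)\<bar> * (dt * \<bar>u\<bar>)"
    proof (intro add_mono mult_left_mono min.boundedI)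
      show "\<bar>h (grid dt t - s) - h (t - s)\<bar> \<le> w" by (rule w(2)[OF g(2)])
      have "\<bar>h (grid dt t - s) - h (t - s)\<bar> \<le> \<bar>h (grid dt t - s)\<bar> + \<bar>h (t - s)\<bar>" by simp
      also have "\<dots> \<le> C * envelope r (grid dt t - s) + C * envelope r (t - s)"
        by (intro add_mono decay)
      also have "\<dots> \<le> C * (2 powr r * envelope r (t - s)) + C * (2 powr r * envelope r (t - s))"
      proof (intro add_mono mult_left_mono envelope_grid dt C_nonneg)
        have "1 \<le> 2 powr r" using r by (intro ge_one_powr_ge_zero) auto
        then show "envelope r (t - s) \<le> 2 powr r * envelope r (t - s)"
          using mult_right_mono[of 1 "2 powr r" "envelope r (t - s)"] by simp
      qed
      finally show "\<bar>h (grid dt t - s) - h (t - s)\<bar> \<le> 2 powr (r + 1) * C * envelope r (t - s)"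
        by (simp add: powr_add mult_ac)
      have "norm (cis (grid dt t * u) - cis (t * u)) \<le> \<bar>grid dt t * u - t * u\<bar>" by (rule norm_cis_diff_le)
      also have "\<dots> = \<bar>grid dt t - t\<bar> * \<bar>u\<bar>" by (simp add: abs_mult[symmetric] algebra_simps)
      also have "\<dots> \<le> dt * \<bar>u\<bar>" using g by (intro mult_right_mono) auto
      finally show "norm (cis (grid dt t * u) - cis (t * u)) \<le> dt * \<bar>u\<bar>" .
    qed auto
    finally have "ennreal (norm (indicator ?I t *\<^sub>R ?a t - indicator ?I t *\<^sub>R ?b t)) \<le>
       ennreal (min w (2 powr (r + 1) * C * envelope r (t - s)) + \<bar>h (t - s)\<bar> * (dt * \<bar>u\<bar>))"
      by (rule ennreal_leI)
    also have "\<dots> = ennreal (min w (2 powr (r + 1) * C * envelope r (t - s))) + ennreal (\<bar>h (t - s)\<bar> * (dt * \<bar>u\<bar>))"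
      using w C_nonneg dt by (intro ennreal_plus) auto
    also have "ennreal (\<bar>h (t - s)\<bar> * (dt * \<bar>u\<bar>)) = ennreal (dt * \<bar>u\<bar>) * ennreal \<bar>h (t - s)\<bar>"
      using dt by (subst ennreal_mult) (auto simp: mult.commute)
    finally show "ennreal (norm (indicator ?I t *\<^sub>R ?a t - indicator ?I t *\<^sub>R ?b t)) \<le>
       ennreal (min w (2 powr (r + 1) * C * envelope r (t - s))) + ennreal (dt * \<bar>u\<bar>) * ennreal \<bar>h (t - s)\<bar>" .
  qed
  also have "\<dots> = (\<integral>\<^sup>+ t. ennreal (min w (2 powr (r + 1) * C * envelope r (t - s))) \<partial>lborel)
      + ennreal (dt * \<bar>u\<bar>) * ?e2"
    by (subst nn_integral_add) (auto simp: nn_integral_cmult)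
  also have "(\<integral>\<^sup>+ t. ennreal (min w (2 powr (r + 1) * C * envelope r (t - s))) \<partial>lborel)
      = (\<integral>\<^sup>+ x. ennreal (min w (2 powr (r + 1) * C * envelope r x)) \<partial>lborel)"
    by (rule nn_integral_shift) measurable
  also have "?e2 = ?e3"
    by (rule nn_integral_shift) measurable
  also have "(\<integral>\<^sup>+ x. ennreal (min w (2 powr (r + 1) * C * envelope r x)) \<partial>lborel) + ennreal (dt * \<bar>u\<bar>) * ?e3
      \<le> ennreal ((2 + 2 * (2 powr (r + 1) * C) / (r - 1)) * w powr (1 - 1/r)) + ennreal (dt * \<bar>u\<bar>) * ennreal (2 * C / (r - 1))"
    using C_nonneg by (intro add_mono mult_left_mono nn_integral_abs nn_integral_min_envelope r w) auto
  also have "\<dots> = ennreal ((2 + 2 * (2 powr (r + 1) * C) / (r - 1)) * w powr (1 - 1/r) + 2 * C / (r - 1) * (dt * \<bar>u\<bar>))"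
  proof -
    have "ennreal (dt * \<bar>u\<bar>) * ennreal (2 * C / (r - 1)) = ennreal (2 * C / (r - 1) * (dt * \<bar>u\<bar>))"
      using C_nonneg r dt by (subst ennreal_mult[symmetric]) (auto simp: mult.commute)
    then show ?thesis using C_nonneg r dt by (subst ennreal_plus) auto
  qed
  finally show ?thesis using C_nonneg r dt by (subst (asm) ennreal_le_iff) auto
qed

text \<open>For s in the interval the sum approximates the full transform with phase
  \<open>grid dt s\<close>, the phase of the noise cell that contains s. Besides the error of
  \<open>riemann_sum_window\<close> this costs the mass outside the interval and a shift of phase by
  less than a cell. For s outside the interval the whole sum is an edge term.\<close>

lemma riemann_sum:
  assumes dt: "0 < dt" "dt \<le> 1" and w: "w \<ge> 0" "\<And>x y. \<bar>x - y\<bar> < dt \<Longrightarrow> \<bar>h x - h y\<bar> \<le> w"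
    and N: "real n * dt \<ge> 1" and \<theta>: "0 \<le> \<theta>" "\<theta> \<le> 1"
  shows "norm (of_real dt * (\<Sum>j=1..n. of_real (h (real j * dt - s)) * cis (real j * dt * u)) -
      indicator {0<..real n * dt} s *\<^sub>R (FT h u * cis (grid dt s * u)))
    \<le> riemann_const C r * (indicator {0<..real n * dt} s * (w powr (1 - 1/r) + dt * \<bar>u\<bar>) +
       (real n * dt) powr \<theta> * envelope (r - 1 + \<theta>) (edge_dist (real n * dt) s))"
proof -
  define N where "N = real n * dt"
  let ?I = "{0<..N}"
  let ?S = "of_real dt * (\<Sum>j=1..n. of_real (h (real j * dt - s)) * cis (real j * dt * u))"
  let ?b = "\<lambda>t. of_real (h (t - s)) * cis (t * u)"
  let ?E = "N powr \<theta> * envelope (r - 1 + \<theta>) (edge_dist N s)"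
  define K where "K = 4 / (r - 1) + 1"
  have K: "K \<ge> 0" unfolding K_def using r by simp
  have N1: "N \<ge> 1" using N by (simp add: N_def)
  have [measurable]: "(\<lambda>t. cis (g t)) \<in> borel_measurable borel" if "g \<in> borel_measurable borel" for g :: "real \<Rightarrow> real"
    using that unfolding cis_conv_exp by measurable
  have c_le: "2 powr r * C * K \<le> riemann_const C r" "C * K \<le> riemann_const C r"
    "2 + 2 * (2 powr (r + 1) * C) / (r - 1) \<le> riemann_const C r"
    "4 * C / (r - 1) \<le> riemann_const C r"
  proof -
    have p: "2 powr (r + 2) = 4 * 2 powr r" "2 powr (r + 1) = 2 * 2 powr r" by (simp_all add: powr_add)
    have p1: "1 \<le> 2 powr r" using r by (intro ge_one_powr_ge_zero) auto
    have CK: "C * K \<ge> 0" using C_nonneg K by simp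
    have CK': "C * K \<le> 2 powr r * (C * K)" using mult_right_mono[OF p1 CK] by simp
    have RC: "riemann_const C r = 2 + 4 * (2 powr r * (C * K))" by (simp add: riemann_const_def p K_def)
    show "2 powr r * C * K \<le> riemann_const C r" "C * K \<le> riemann_const C r"
    proof -
      define X where "X = 2 powr r * (C * K)"
      have "0 \<le> X" "C * K \<le> X" using CK CK' by (simp_all add: X_def)
      then show "2 powr r * C * K \<le> riemann_const C r" "C * K \<le> riemann_const C r"
        unfolding RC mult.assoc X_def[symmetric] by linarith+
    qed
    have "4 * C / (r - 1) \<le> C * K" using C_nonneg by (simp add: K_def distrib_left mult.commute)
    then have "2 powr r * (4 * C / (r - 1)) \<le> 2 powr r * (C * K)" by (intro mult_left_mono) auto
    then show "2 + 2 * (2 powr (r + 1) * C) / (r - 1) \<le> riemann_const C r" 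
    proof -
      assume le: "2 powr r * (4 * C / (r - 1)) \<le> 2 powr r * (C * K)"
      have "2 * (2 powr (r + 1) * C) / (r - 1) = 2 powr r * (4 * C / (r - 1))" by (simp add: p)
      moreover have "0 \<le> 2 powr r * (C * K)" using CK by simp
      ultimately show ?thesis using le unfolding RC by linarith
    qed
    show "4 * C / (r - 1) \<le> riemann_const C r" using \<open>4 * C / (r - 1) \<le> C * K\<close> CK CK' unfolding RC by linarith
  qed
  have E: "?E \<ge> 0" by simp
  let ?e1 = "LINT t|lborel. indicator (- ?I) t *\<^sub>R ?b t"
  let ?e2 = "FT h u * cis (s * u) - FT h u * cis (grid dt s * u)"
  let ?e3 = "LINT t|lborel. indicator ?I t *\<^sub>R ?b t"
  show ?thesis
  proof (cases "s \<in> ?I")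
    case False
    have "ennreal (norm ?S) \<le> ennreal (dt * (\<Sum>j=1..n. \<bar>h (real j * dt - s)\<bar>))"
    proof (rule ennreal_leI)
      have "norm ?S = dt * norm (\<Sum>j=1..n. of_real (h (real j * dt - s)) * cis (real j * dt * u))"
        using dt by (simp add: norm_mult)
      also have "\<dots> \<le> dt * (\<Sum>j=1..n. norm (of_real (h (real j * dt - s)) * cis (real j * dt * u)))"
        using dt by (intro mult_left_mono norm_sum) auto
      finally show "norm ?S \<le> dt * (\<Sum>j=1..n. \<bar>h (real j * dt - s)\<bar>)" by (simp add: norm_mult)
    qed
    also have "\<dots> \<le> ennreal (2 powr r * C) * (\<integral>\<^sup>+ t. ennreal (envelope r (t - s)) * indicator ?I t \<partial>lborel)"
      unfolding N_def by (rule sum_abs_le[OF dt])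
    also have "\<dots> \<le> ennreal (2 powr r * C) * ennreal ((4 / (r - 1) + 1) * N powr \<theta> * envelope (r - 1 + \<theta>) (edge_dist N s))"
      using False by (intro mult_left_mono nn_integral_envelope_across r N1 \<theta>) auto
    also have "\<dots> = ennreal (2 powr r * C * K * ?E)"
      using C_nonneg r K by (subst ennreal_mult[symmetric]) (auto simp: K_def mult_ac)
    finally have "norm ?S \<le> 2 powr r * C * K * ?E" using C_nonneg K by (subst (asm) ennreal_le_iff) auto
    also have "\<dots> \<le> riemann_const C r * ?E" using c_le E by (intro mult_right_mono) auto
    finally show ?thesis using False unfolding N_def[symmetric] by simp
  next
    case True
    have int_b: "integrable lborel ?b"
    proof -
      have "(\<integral>\<^sup>+ t. ennreal \<bar>h (t - s)\<bar> \<partial>lborel) = (\<integral>\<^sup>+ x. ennreal \<bar>h x\<bar> \<partial>lborel)"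
        by (rule nn_integral_shift) measurable
      then show ?thesis
        by (intro integrableI_bounded) (auto simp: norm_mult intro: order.strict_trans1[OF nn_integral_abs])
    qed
    have int_bI: "integrable lborel (\<lambda>t. indicator A t *\<^sub>R ?b t)" if "A \<in> sets borel" for A
      using that by (intro Bochner_Integration.integrable_bound[OF int_b]) (auto simp: indicator_def)
    have full: "FT h u * cis (s * u) = (LINT t|lborel. ?b t)"
    proof -
      have "(LINT t|lborel. ?b t) = (LINT x|lborel. ?b (s + 1 * x))"
        by (subst lborel_integral_real_affine[where c = 1 and t = s]) auto
      also have "\<dots> = (LINT x|lborel. (of_real (h x) * cis (x * u)) * cis (s * u))"
        by (intro Bochner_Integration.integral_cong) (auto simp: cis_mult algebra_simps)
      also have "\<dots> = FT h u * cis (s * u)"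
        unfolding FT_def by (rule integral_mult_left_zero)
      finally show ?thesis by simp
    qed
    have split: "(LINT t|lborel. ?b t) = ?e3 + ?e1"
      by (subst Bochner_Integration.integral_add[symmetric, OF int_bI int_bI])
         (auto intro!: Bochner_Integration.integral_cong simp: indicator_def)
    have out: "norm ?e1 \<le> C * K * ?E"
    proof -
      have "ennreal (norm ?e1) \<le> (\<integral>\<^sup>+ t. norm (indicator (- ?I) t *\<^sub>R ?b t) \<partial>lborel)"
        by (rule integral_norm_bound_ennreal[OF int_bI]) auto
      also have "\<dots> \<le> (\<integral>\<^sup>+ t. ennreal C * (ennreal (envelope r (t - s)) * indicator (- ?I) t) \<partial>lborel)"
        using decay C_nonneg
        by (intro nn_integral_mono) (auto simp: indicator_def norm_mult ennreal_mult[symmetric] intro!: ennreal_leI)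
      also have "\<dots> = ennreal C * (\<integral>\<^sup>+ t. ennreal (envelope r (t - s)) * indicator (- ?I) t \<partial>lborel)"
        by (rule nn_integral_cmult) measurable
      also have "\<dots> \<le> ennreal C * ennreal ((4 / (r - 1) + 1) * N powr \<theta> * envelope (r - 1 + \<theta>) (edge_dist N s))"
        using True by (intro mult_left_mono nn_integral_envelope_across r N1 \<theta>) auto
      also have "\<dots> = ennreal (C * K * ?E)"
        using C_nonneg r K by (subst ennreal_mult[symmetric]) (auto simp: K_def mult_ac)
      finally show ?thesis using C_nonneg K by (subst (asm) ennreal_le_iff) auto
    qed
    have phase: "norm ?e2 \<le> 2 * C / (r - 1) * (dt * \<bar>u\<bar>)"
    proof -
      have "norm ?e2 = norm (FT h u) * norm (cis (s * u) - cis (grid dt s * u))"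
        by (simp add: norm_mult[symmetric] right_diff_distrib)
      also have "\<dots> \<le> 2 * C / (r - 1) * (dt * \<bar>u\<bar>)"
      proof (intro mult_mono norm_FT_le)
        have "norm (cis (s * u) - cis (grid dt s * u)) \<le> \<bar>s * u - grid dt s * u\<bar>" by (rule norm_cis_diff_le)
        also have "\<dots> = \<bar>s - grid dt s\<bar> * \<bar>u\<bar>" by (simp add: abs_mult[symmetric] algebra_simps)
        also have "\<dots> \<le> dt * \<bar>u\<bar>" using grid_bounds[OF dt(1), of s] by (intro mult_right_mono) auto
        finally show "norm (cis (s * u) - cis (grid dt s * u)) \<le> dt * \<bar>u\<bar>" .
      qed (use C_nonneg r in auto)
      finally show ?thesis .
    qed
    have win: "norm (?S - ?e3) \<le>
      (2 + 2 * (2 powr (r + 1) * C) / (r - 1)) * w powr (1 - 1/r) + 2 * C / (r - 1) * (dt * \<bar>u\<bar>)"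
      unfolding N_def by (rule riemann_sum_window[OF dt w])
    have eq: "?S - FT h u * cis (grid dt s * u) = (?S - ?e3)
       - ?e1 + ?e2"
      unfolding full split by simp
    have "norm (?S - FT h u * cis (grid dt s * u)) \<le> norm (?S - ?e3) + norm ?e1
       + norm ?e2"
      unfolding eq by (rule norm_diff_add_le)
    also have "\<dots> \<le> (2 + 2 * (2 powr (r + 1) * C) / (r - 1)) * w powr (1 - 1/r) + 4 * C / (r - 1) * (dt * \<bar>u\<bar>) + C * K * ?E"
    proof -
      have "4 * C / (r - 1) * (dt * \<bar>u\<bar>) = 2 * C / (r - 1) * (dt * \<bar>u\<bar>) + 2 * C / (r - 1) * (dt * \<bar>u\<bar>)"
        by (simp add: distrib_right[symmetric] add_divide_distrib[symmetric])
      then show ?thesis using win out phase by linarith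
    qed
    also have "\<dots> \<le> riemann_const C r * w powr (1 - 1/r) + riemann_const C r * (dt * \<bar>u\<bar>) + riemann_const C r * ?E"
      by (intro add_mono mult_right_mono c_le) (use dt E in auto)
    finally show ?thesis using True unfolding N_def[symmetric] by (simp add: algebra_simps)
  qed
qed

end

section \<open>Plancherel's identity\<close>

lemma cnj_measurable [measurable (raw)]:
  "f \<in> borel_measurable M \<Longrightarrow> (\<lambda>x. cnj (f x)) \<in> borel_measurable M"
  by (rule measurable_compose[OF _ borel_measurable_continuous_onI]) (auto intro: continuous_intros)

lemma FT_integrable:
  assumes "integrable lborel h"
  shows "integrable lborel (\<lambda>x. of_real (h x) * cis (x * u))"
proof -
  have [measurable]: "h \<in> borel_measurable borel" using assms by auto
  show ?thesis by (rule Bochner_Integration.integrable_bound[OF assms]) (auto simp: norm_mult)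
qed

lemma FT_measurable [measurable]:
  assumes [measurable]: "h \<in> borel_measurable borel"
  shows "FT h \<in> borel_measurable borel"
  unfolding FT_def by measurable

lemma norm_FT_le_integral:
  assumes "integrable lborel h"
  shows "norm (FT h u) \<le> (LINT x|lborel. \<bar>h x\<bar>)"
  unfolding FT_def using integral_norm_bound[of lborel "\<lambda>x. of_real (h x) * cis (x * u)"]
  by (simp add: norm_mult)

text \<open>A majorant that depends on x alone is integrable on the product because the other factor
  is a probability space.\<close>

lemma (in prob_space) Fubini_dominated:
  fixes F :: "real \<Rightarrow> 'a \<Rightarrow> complex"
  assumes h: "integrable lborel h"
    and F[measurable]: "(\<lambda>(x, v). F x v) \<in> borel_measurable (lborel \<Otimes>\<^sub>M M)"
    and le: "\<And>x v. norm (F x v) \<le> B * \<bar>h x\<bar>"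
  shows "(LINT v|M. LINT x|lborel. F x v) = (LINT x|lborel. LINT v|M. F x v)"
proof -
  interpret P: pair_sigma_finite lborel M ..
  have B: "norm (F x v) \<le> norm (B * \<bar>h x\<bar>)" for x v
    using le[of x v] by (metis abs_ge_self order.trans real_norm_def)
  have nn: "0 \<le> B * \<bar>h x\<bar>" for x by (rule order.trans[OF norm_ge_zero le[of x undefined]])
  have [measurable]: "h \<in> borel_measurable borel" using h by auto
  have int: "integrable (lborel \<Otimes>\<^sub>M M) (\<lambda>(x, v). F x v)"
  proof (rule P.Fubini_integrable)
    show "AE x in lborel. integrable M (\<lambda>v. case (x, v) of (x, v) \<Rightarrow> F x v)"
      using le by (intro AE_I2) (auto intro!: integrable_const_bound)
    show "integrable lborel (\<lambda>x. LINT v|M. norm (case (x, v) of (x, v) \<Rightarrow> F x v))"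
    proof (rule Bochner_Integration.integrable_bound)
      show "integrable lborel (\<lambda>x. B * \<bar>h x\<bar>)" using h by auto
      show "AE x in lborel. norm (LINT v|M. norm (case (x, v) of (x, v) \<Rightarrow> F x v)) \<le> norm (B * \<bar>h x\<bar>)"
      proof (rule AE_I2)
        fix x
        have "(LINT v|M. norm (F x v)) \<le> (LINT v|M. B * \<bar>h x\<bar>)"
          using le nn by (intro integral_mono integrable_norm integrable_const_bound[where B = "B * \<bar>h x\<bar>"]) auto
        also have "\<dots> = B * \<bar>h x\<bar>" by (simp add: prob_space)
        finally show "norm (LINT v|M. norm (case (x, v) of (x, v) \<Rightarrow> F x v)) \<le> norm (B * \<bar>h x\<bar>)"
          using nn[of x] by (simp add: integral_nonneg_AE)
      qed
    qed measurable
  qed measurable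
  show ?thesis by (rule P.Fubini_integral[OF int])
qed

text \<open>Plancherel's identity with Gaussian damping: averaging over a normal variable divided by
  e makes Fubini's theorem applicable, and the normal characteristic function turns into a mollifier
  of width e on the right.\<close>

lemma nn_integral_FT_gauss:
  assumes h: "integrable lborel h" and e: "e > 0"
  shows "(\<integral>\<^sup>+ u. ennreal ((norm (FT h u))\<^sup>2 * std_normal_density (e * u)) \<partial>lborel) =
    ennreal (sqrt (2 * pi) * (LINT x|lborel. h x * (LINT z|std_normal_distribution. h (x - e * z))))"
proof -
  interpret N: real_distribution std_normal_distribution by (rule real_dist_normal_dist)
  have [measurable]: "h \<in> borel_measurable borel" using h by auto
  let ?b = "LINT x|lborel. \<bar>h x\<bar>"
  let ?e1 = "\<lambda>x. LINT z|std_normal_distribution. h (x - e * z)"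
  have inner: "(LINT v|std_normal_distribution. cis (x * (v / e)) * cnj (FT h (v / e))) =
      of_real (e * sqrt (2 * pi) * (?e1 x))" for x
  proof -
    have "(LINT v|std_normal_distribution. cis (x * (v / e)) * cnj (FT h (v / e))) =
       (LINT v|std_normal_distribution. LINT y|lborel. of_real (h y) * cis ((x - y) / e * v))"
    proof (rule Bochner_Integration.integral_cong[OF refl])
      fix v
      have "cnj (FT h (v / e)) = (LINT y|lborel. cnj (of_real (h y) * cis (y * (v / e))))"
        unfolding FT_def by (rule Bochner_Integration.integral_cnj[symmetric])
      then have "cis (x * (v / e)) * cnj (FT h (v / e)) = (LINT y|lborel. cis (x * (v / e)) * cnj (of_real (h y) * cis (y * (v / e))))"
        by simp
      also have "\<dots> = (LINT y|lborel. of_real (h y) * cis ((x - y) / e * v))"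
        by (intro Bochner_Integration.integral_cong refl)
           (simp add: cis_cnj cis_mult field_simps diff_divide_distrib)
      finally show "cis (x * (v / e)) * cnj (FT h (v / e)) = (LINT y|lborel. of_real (h y) * cis ((x - y) / e * v))" .
    qed
    also have "\<dots> = (LINT y|lborel. LINT v|std_normal_distribution. of_real (h y) * cis ((x - y) / e * v))"
      by (rule N.Fubini_dominated[OF h, where B = 1]) (auto simp: norm_mult)
    also have "\<dots> = (LINT y|lborel. of_real (h y * exp (- (((x - y) / e)\<^sup>2) / 2)))"
    proof (intro Bochner_Integration.integral_cong refl)
      fix y
      have "(LINT v|std_normal_distribution. cis ((x - y) / e * v)) = char std_normal_distribution ((x - y) / e)"
        by (simp add: char_def cis_conv_exp)
      then show "(LINT v|std_normal_distribution. of_real (h y) * cis ((x - y) / e * v)) = of_real (h y * exp (- (((x - y) / e)\<^sup>2) / 2))"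
        unfolding char_std_normal_distribution by simp
    qed
    also have "\<dots> = of_real (LINT y|lborel. h y * exp (- (((x - y) / e)\<^sup>2) / 2))"
      by (rule integral_complex_of_real)
    \<comment> \<open>The substitution y = x - e z turns the Gaussian factor into a multiple of the
      normal density in z.\<close>
    also have "(LINT y|lborel. h y * exp (- (((x - y) / e)\<^sup>2) / 2)) =
        \<bar>- e\<bar> *\<^sub>R (LINT z|lborel. h (x + (- e) * z) * exp (- (((x - (x + (- e) * z)) / e)\<^sup>2) / 2))"
      by (rule lborel_integral_real_affine) (use e in simp)
    also have "\<dots> = e * (LINT z|lborel. sqrt (2 * pi) * (std_normal_density z *\<^sub>R h (x - e * z)))"
      using e by (auto intro!: Bochner_Integration.integral_cong simp: std_normal_density_def)
    also have "\<dots> = e * sqrt (2 * pi) * (?e1 x)"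
      by (subst integral_density) auto
    finally show ?thesis .
  qed
  let ?e2 = "LINT v|std_normal_distribution. (norm (FT h (v / e)))\<^sup>2"
  have "complex_of_real ?e2 =
      (LINT v|std_normal_distribution. FT h (v / e) * cnj (FT h (v / e)))"
    by (simp add: complex_norm_square[symmetric] integral_complex_of_real[symmetric] del: integral_complex_of_real of_real_power)
  also have "\<dots> = (LINT v|std_normal_distribution. LINT x|lborel. of_real (h x) * (cis (x * (v / e)) * cnj (FT h (v / e))))"
    unfolding FT_def[of h "_ / e"] integral_mult_left_zero[symmetric] by (simp add: mult.assoc)
  also have "\<dots> = (LINT x|lborel. LINT v|std_normal_distribution. of_real (h x) * (cis (x * (v / e)) * cnj (FT h (v / e))))"
  proof (rule N.Fubini_dominated[OF h, where B = ?b])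
    fix x v
    show "norm (complex_of_real (h x) * (cis (x * (v / e)) * cnj (FT h (v / e)))) \<le> ?b * \<bar>h x\<bar>"
      using norm_FT_le_integral[OF h, of "v / e"] by (simp add: norm_mult mult.commute mult_left_mono)
  qed measurable
  also have "\<dots> = (LINT x|lborel. of_real (h x * (e * sqrt (2 * pi) * (?e1 x))))"
    by (simp only: integral_mult_right_zero inner of_real_mult)
  also have "\<dots> = of_real (LINT x|lborel. h x * (e * sqrt (2 * pi) * (?e1 x)))"
    by (rule integral_complex_of_real)
  finally have "?e2 =
      (LINT x|lborel. h x * (e * sqrt (2 * pi) * (?e1 x)))"
    unfolding of_real_eq_iff .
  also have "\<dots> = e * (sqrt (2 * pi) * (LINT x|lborel. h x * (?e1 x)))"
    by (simp add: mult.left_commute[of "h _"] mult.assoc)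
  finally have main: "?e2 =
      e * (sqrt (2 * pi) * (LINT x|lborel. h x * (?e1 x)))" .
  have int: "integrable std_normal_distribution (\<lambda>v. (norm (FT h (v / e)))\<^sup>2)"
    using norm_FT_le_integral[OF h] by (intro N.integrable_const_bound[where B = "?b\<^sup>2"] AE_I2) (auto intro: power_mono)
  have "ennreal (e * (sqrt (2 * pi) * (LINT x|lborel. h x * (?e1 x)))) =
      (\<integral>\<^sup>+ v. ennreal ((norm (FT h (v / e)))\<^sup>2) \<partial>std_normal_distribution)"
    unfolding main[symmetric] using int by (intro nn_integral_eq_integral[symmetric]) auto
  also have "\<dots> = (\<integral>\<^sup>+ v. ennreal (std_normal_density v) * ennreal ((norm (FT h (v / e)))\<^sup>2) \<partial>lborel)"
    by (rule nn_integral_density) measurable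
  also have "\<dots> = \<bar>e\<bar> * (\<integral>\<^sup>+ u. ennreal (std_normal_density (0 + e * u)) * ennreal ((norm (FT h ((0 + e * u) / e)))\<^sup>2) \<partial>lborel)"
    by (rule nn_integral_real_affine) (use e in auto)
  also have "\<dots> = ennreal e * (\<integral>\<^sup>+ u. ennreal ((norm (FT h u))\<^sup>2 * std_normal_density (e * u)) \<partial>lborel)"
    using e by (simp add: ennreal_mult'' mult.commute)
  finally have eq: "ennreal e * (\<integral>\<^sup>+ u. ennreal ((norm (FT h u))\<^sup>2 * std_normal_density (e * u)) \<partial>lborel) =
      ennreal e * ennreal (sqrt (2 * pi) * (LINT x|lborel. h x * (?e1 x)))"
    using e by (simp add: ennreal_mult')
  then show ?thesis
    using e by (simp add: ennreal_mult_cancel_left)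
qed

text \<open>As the damping is removed, the left side converges monotonically and the right side by
  dominated convergence at points of continuity. Continuity almost everywhere is the form that suits
  functions cut off at the ends of a band.\<close>

theorem nn_integral_FT_square:
  assumes h: "integrable lborel h" and B: "\<And>x. \<bar>h x\<bar> \<le> B" and cont: "AE x in lborel. isCont h x"
  shows "(\<integral>\<^sup>+ u. ennreal ((norm (FT h u))\<^sup>2) \<partial>lborel) = ennreal (2 * pi * (LINT x|lborel. (h x)\<^sup>2))"
proof -
  interpret N: real_distribution std_normal_distribution by (rule real_dist_normal_dist)
  have [measurable]: "h \<in> borel_measurable borel" using h by auto
  have B0: "0 \<le> B" by (rule order.trans[OF abs_ge_zero B[of 0]])
  define e where "e k = inverse (real (Suc k))" for k
  have e: "e k > 0" for k by (simp add: e_def)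
  have e_lim: "e \<longlonglongrightarrow> 0" unfolding e_def by (rule LIMSEQ_inverse_real_of_nat)
  have e_dec: "e l \<le> e k" if "k \<le> l" for k l using that by (simp add: e_def le_imp_inverse_le)
  let ?e1 = "\<lambda>x k. LINT z|std_normal_distribution. h (x - e k * z)"
  let ?R = "\<lambda>k. LINT x|lborel. h x * (?e1 x k)"
  have R: "?R \<longlonglongrightarrow> (LINT x|lborel. (h x)\<^sup>2)"
  proof (rule integral_dominated_convergence[where w = "\<lambda>x. \<bar>h x\<bar> * B"])
    show "AE x in lborel. (\<lambda>k. h x * (?e1 x k)) \<longlonglongrightarrow> (h x)\<^sup>2"
      using cont
    proof eventually_elim
      case (elim x)
      have "(\<lambda>k. LINT z|std_normal_distribution. h (x - e k * z)) \<longlonglongrightarrow> (LINT z|std_normal_distribution. h x)"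
      proof (rule integral_dominated_convergence[where w = "\<lambda>_. B"])
        show "AE z in std_normal_distribution. (\<lambda>k. h (x - e k * z)) \<longlonglongrightarrow> h x"
        proof (rule AE_I2)
          fix z
          have "(\<lambda>k. x - e k * z) \<longlonglongrightarrow> x - 0 * z" by (intro tendsto_intros e_lim)
          then show "(\<lambda>k. h (x - e k * z)) \<longlonglongrightarrow> h x"
            using elim by (auto intro: isCont_tendsto_compose)
        qed
      qed (use B in auto)
      then have "(\<lambda>k. LINT z|std_normal_distribution. h (x - e k * z)) \<longlonglongrightarrow> h x"
        using N.prob_space by simp
      from tendsto_mult[OF tendsto_const this, of "h x"] show ?case by (simp add: power2_eq_square)
    qed
    fix k
    have "norm (?e1 x k) \<le> B" for x
    proof -
      have "norm (?e1 x k) \<le> (LINT z|std_normal_distribution. norm (h (x - e k * z)))"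
        by (rule integral_norm_bound)
      also have "\<dots> \<le> (LINT z|std_normal_distribution. B)"
        using B B0 by (intro integral_mono integrable_norm N.integrable_const_bound[where B = B]) auto
      finally show ?thesis using N.prob_space by simp
    qed
    then show "AE x in lborel. norm (h x * (?e1 x k)) \<le> \<bar>h x\<bar> * B"
      using B0 by (intro AE_I2) (auto simp: abs_mult mult_left_mono)
  qed (use h in auto)
  let ?e2 = "\<lambda>u k. (norm (FT h u))\<^sup>2 * std_normal_density (e k * u)"
  have "(\<lambda>k. \<integral>\<^sup>+ u. ennreal (?e2 u k) \<partial>lborel)
      \<longlonglongrightarrow> (\<integral>\<^sup>+ u. ennreal ((norm (FT h u))\<^sup>2 * std_normal_density 0) \<partial>lborel)"
  proof (rule nn_integral_LIMSEQ)
    show "incseq (\<lambda>k u. ennreal (?e2 u k))"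
    proof (rule incseq_SucI, rule le_funI, rule ennreal_leI, rule mult_left_mono)
      fix k u
      have "(e (Suc k) * u)\<^sup>2 \<le> (e k * u)\<^sup>2"
        unfolding power_mult_distrib using e_dec[of k "Suc k"] e[of "Suc k"] by (intro mult_right_mono power_mono) auto
      then show "std_normal_density (e k * u) \<le> std_normal_density (e (Suc k) * u)"
        unfolding std_normal_density_def by (intro mult_left_mono) auto
    qed simp
    fix u
    have "(\<lambda>k. std_normal_density (e k * u)) \<longlonglongrightarrow> std_normal_density (0 * u)"
      unfolding std_normal_density_def by (intro tendsto_intros e_lim) auto
    then show "(\<lambda>k. ennreal (?e2 u k)) \<longlonglongrightarrow> ennreal ((norm (FT h u))\<^sup>2 * std_normal_density 0)"
      by (intro tendsto_ennrealI tendsto_intros) simp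
  qed measurable
  moreover have "(\<lambda>k. \<integral>\<^sup>+ u. ennreal (?e2 u k) \<partial>lborel)
      \<longlonglongrightarrow> ennreal (sqrt (2 * pi) * (LINT x|lborel. (h x)\<^sup>2))"
    unfolding nn_integral_FT_gauss[OF h e] by (intro tendsto_ennrealI tendsto_intros R)
  ultimately have eq: "(\<integral>\<^sup>+ u. ennreal ((norm (FT h u))\<^sup>2 * std_normal_density 0) \<partial>lborel) = ennreal (sqrt (2 * pi) * (LINT x|lborel. (h x)\<^sup>2))"
    using LIMSEQ_unique by blast
  have "(\<integral>\<^sup>+ u. ennreal ((norm (FT h u))\<^sup>2) \<partial>lborel) =
      (\<integral>\<^sup>+ u. ennreal (sqrt (2 * pi)) * ennreal ((norm (FT h u))\<^sup>2 * std_normal_density 0) \<partial>lborel)"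
    by (intro nn_integral_cong) (simp add: ennreal_mult'[symmetric] std_normal_density_def)
  also have "\<dots> = ennreal (sqrt (2 * pi)) * ennreal (sqrt (2 * pi) * (LINT x|lborel. (h x)\<^sup>2))"
    by (subst nn_integral_cmult) (auto simp: eq)
  also have "\<dots> = ennreal (2 * pi * (LINT x|lborel. (h x)\<^sup>2))"
    by (simp add: ennreal_mult'[symmetric] mult.assoc[symmetric])
  finally show ?thesis .
qed

lemma integrable_square_of_bounded:
  fixes h :: "real \<Rightarrow> real"
  assumes h: "integrable lborel h" and B: "\<And>x. \<bar>h x\<bar> \<le> B"
  shows "integrable lborel (\<lambda>x. (h x)\<^sup>2)"
proof -
  have [measurable]: "h \<in> borel_measurable borel" using h by auto
  have "integrable lborel (\<lambda>x. B * h x)" using h by simp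
  then show ?thesis
  proof (rule Bochner_Integration.integrable_bound)
    show "AE x in lborel. norm ((h x)\<^sup>2) \<le> norm (B * h x)"
    proof (rule AE_I2)
      fix x
      have "\<bar>h x\<bar> * \<bar>h x\<bar> \<le> \<bar>B\<bar> * \<bar>h x\<bar>"
        using B[of x] by (intro mult_right_mono) auto
      then show "norm ((h x)\<^sup>2) \<le> norm (B * h x)" by (simp add: power2_eq_square abs_mult)
    qed
  qed measurable
qed

lemma FT_square_integral:
  assumes h: "integrable lborel h" and B: "\<And>x. \<bar>h x\<bar> \<le> B" and cont: "AE x in lborel. isCont h x"
  shows "integrable lborel (\<lambda>u. (norm (FT h u))\<^sup>2)"
    and "(LINT u|lborel. (norm (FT h u))\<^sup>2) = 2 * pi * (LINT x|lborel. (h x)\<^sup>2)"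
proof -
  have [measurable]: "h \<in> borel_measurable borel" using h by auto
  have eq: "(\<integral>\<^sup>+ u. ennreal ((norm (FT h u))\<^sup>2) \<partial>lborel) = ennreal (2 * pi * (LINT x|lborel. (h x)\<^sup>2))"
    by (rule nn_integral_FT_square[OF h B cont])
  show "integrable lborel (\<lambda>u. (norm (FT h u))\<^sup>2)"
    by (rule integrableI_nonneg) (use eq in auto)
  show "(LINT u|lborel. (norm (FT h u))\<^sup>2) = 2 * pi * (LINT x|lborel. (h x)\<^sup>2)"
    using eq by (subst integral_eq_nn_integral) auto
qed

lemma integral_mult_FT_swap:
  assumes g: "integrable lborel g" and \<phi>: "integrable lborel \<phi>"
  shows "(LINT t|lborel. of_real (g t) * FT \<phi> t) = (LINT u|lborel. of_real (\<phi> u) * FT g u)"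
proof -
  have [measurable]: "g \<in> borel_measurable borel" "\<phi> \<in> borel_measurable borel" using g \<phi> by auto
  let ?F = "\<lambda>t u. complex_of_real (g t) * (of_real (\<phi> u) * cis (u * t))"
  have int: "integrable (lborel \<Otimes>\<^sub>M lborel) (\<lambda>(t, u). ?F t u)"
  proof (rule lborel_pair.Fubini_integrable)
    show "AE t in lborel. integrable lborel (\<lambda>u. case (t, u) of (t, u) \<Rightarrow> ?F t u)"
      using FT_integrable[OF \<phi>] by (intro AE_I2) simp
    have "(\<lambda>t. LINT u|lborel. norm (case (t, u) of (t, u) \<Rightarrow> ?F t u)) = (\<lambda>t. \<bar>g t\<bar> * (LINT u|lborel. \<bar>\<phi> u\<bar>))"
      by (simp add: norm_mult)
    then show "integrable lborel (\<lambda>t. LINT u|lborel. norm (case (t, u) of (t, u) \<Rightarrow> ?F t u))"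
      using g by simp
  qed measurable
  have "(LINT t|lborel. of_real (g t) * FT \<phi> t) = (LINT t|lborel. LINT u|lborel. ?F t u)"
    unfolding FT_def by (simp only: integral_mult_right_zero)
  also have "\<dots> = (LINT u|lborel. LINT t|lborel. ?F t u)"
    by (rule lborel_pair.Fubini_integral[OF int, symmetric])
  also have "\<dots> = (LINT u|lborel. LINT t|lborel. of_real (\<phi> u) * (of_real (g t) * cis (t * u)))"
    by (simp add: mult_ac)
  also have "\<dots> = (LINT u|lborel. of_real (\<phi> u) * FT g u)"
    unfolding FT_def by (simp only: integral_mult_right_zero)
  finally show ?thesis .
qed

lemma integral_linear_combination:
  fixes A B C :: "real \<Rightarrow> real"
  assumes "integrable lborel A" "integrable lborel B" "integrable lborel C"
  shows "(LINT x|lborel. c * A x - d * B x + C x) = c * (LINT x|lborel. A x) - d * (LINT x|lborel. B x) + (LINT x|lborel. C x)"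
  using assms by simp

text \<open>The square is expanded: Plancherel's identity treats the two pure terms, and
  \<open>integral_mult_FT_swap\<close> the mixed one, which is an inner product of \<phi> and G
  because the transform of g is real. The three terms then recombine on the frequency side.\<close>

theorem FT_L2_distance:
  assumes \<phi>: "integrable lborel \<phi>" "\<And>x. \<bar>\<phi> x\<bar> \<le> B\<phi>" "AE x in lborel. isCont \<phi> x"
    and g: "integrable lborel g" "\<And>x. \<bar>g x\<bar> \<le> Bg" "AE x in lborel. isCont g x"
    and G: "\<And>u. FT g u = of_real (G u)"
  shows "integrable lborel (\<lambda>t. (norm (FT \<phi> t / (2 * pi) - g t))\<^sup>2)"
    and "integrable lborel (\<lambda>u. (\<phi> u - G u)\<^sup>2)"
    and "(LINT t|lborel. (norm (FT \<phi> t / (2 * pi) - g t))\<^sup>2) = 1 / (2 * pi) * (LINT u|lborel. (\<phi> u - G u)\<^sup>2)"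
proof -
  have [measurable]: "g \<in> borel_measurable borel" "\<phi> \<in> borel_measurable borel" using g \<phi> by auto
  have G_eq: "G u = Re (FT g u)" for u using G by simp
  have [measurable]: "G \<in> borel_measurable borel" unfolding G_eq by measurable
  have norm_G: "(norm (FT g u))\<^sup>2 = (G u)\<^sup>2" for u using G by simp
  have expand: "(norm (FT \<phi> t / (2 * pi) - g t))\<^sup>2 =
      1 / (4 * pi\<^sup>2) * (norm (FT \<phi> t))\<^sup>2 - 1 / pi * Re (of_real (g t) * FT \<phi> t) + (g t)\<^sup>2" for t
  proof -
    have "(norm (FT \<phi> t / (2 * pi) - g t))\<^sup>2 = (Re (FT \<phi> t) / (2 * pi) - g t)\<^sup>2 + (Im (FT \<phi> t) / (2 * pi))\<^sup>2"
      by (simp add: cmod_power2)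
    also have "\<dots> = 1 / (4 * pi\<^sup>2) * ((Re (FT \<phi> t))\<^sup>2 + (Im (FT \<phi> t))\<^sup>2) - 1 / pi * (g t * Re (FT \<phi> t)) + (g t)\<^sup>2"
      by (simp add: power2_eq_square field_simps)
    finally show ?thesis by (simp add: cmod_power2)
  qed
  have i1: "integrable lborel (\<lambda>t. (norm (FT \<phi> t))\<^sup>2)" by (rule FT_square_integral(1)[OF \<phi>])
  have i2: "integrable lborel (\<lambda>t. of_real (g t) * FT \<phi> t)"
  proof (rule Bochner_Integration.integrable_bound)
    show "integrable lborel (\<lambda>t. (LINT x|lborel. \<bar>\<phi> x\<bar>) * g t)" using g by simp
    show "AE t in lborel. norm (of_real (g t) * FT \<phi> t) \<le> norm ((LINT x|lborel. \<bar>\<phi> x\<bar>) * g t)"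
      using norm_FT_le_integral[OF \<phi>(1)]
      by (intro AE_I2) (auto simp: norm_mult abs_mult mult.commute abs_of_nonneg integral_nonneg_AE intro!: mult_left_mono)
  qed measurable
  have i2': "integrable lborel (\<lambda>t. Re (of_real (g t) * FT \<phi> t))" using i2 by (rule integrable_Re)
  have i3: "integrable lborel (\<lambda>t. (g t)\<^sup>2)" by (rule integrable_square_of_bounded[OF g(1,2)])
  have j1: "integrable lborel (\<lambda>t. (\<phi> t)\<^sup>2)" by (rule integrable_square_of_bounded[OF \<phi>(1,2)])
  have j2: "integrable lborel (\<lambda>t. \<phi> t * G t)"
  proof (rule Bochner_Integration.integrable_bound)
    show "integrable lborel (\<lambda>t. (LINT x|lborel. \<bar>g x\<bar>) * \<phi> t)" using \<phi> by simp
    show "AE t in lborel. norm (\<phi> t * G t) \<le> norm ((LINT x|lborel. \<bar>g x\<bar>) * \<phi> t)"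
    proof (rule AE_I2)
      fix t
      have "\<bar>G t\<bar> \<le> (LINT x|lborel. \<bar>g x\<bar>)" using norm_FT_le_integral[OF g(1), of t] G[of t] by simp
      then have "\<bar>\<phi> t\<bar> * \<bar>G t\<bar> \<le> \<bar>\<phi> t\<bar> * \<bar>LINT x|lborel. \<bar>g x\<bar>\<bar>" by (intro mult_left_mono) auto
      then show "norm (\<phi> t * G t) \<le> norm ((LINT x|lborel. \<bar>g x\<bar>) * \<phi> t)" by (simp add: abs_mult mult.commute)
    qed
  qed measurable
  have j3: "integrable lborel (\<lambda>t. (G t)\<^sup>2)" using FT_square_integral(1)[OF g] unfolding norm_G .
  let ?e1 = "LINT t|lborel. Re (of_real (g t) * FT \<phi> t)"
  have mixed: "?e1 = (LINT u|lborel. \<phi> u * G u)"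
  proof -
    have "?e1 = Re (LINT t|lborel. of_real (g t) * FT \<phi> t)"
      by (rule integral_Re[OF i2])
    also have "(LINT t|lborel. of_real (g t) * FT \<phi> t) = (LINT u|lborel. of_real (\<phi> u * G u))"
      unfolding integral_mult_FT_swap[OF g(1) \<phi>(1)] G by simp
    also have "\<dots> = of_real (LINT u|lborel. \<phi> u * G u)" by (rule integral_complex_of_real)
    finally show ?thesis by simp
  qed
  show "integrable lborel (\<lambda>t. (norm (FT \<phi> t / (2 * pi) - g t))\<^sup>2)"
    unfolding expand using i1 i2' i3 by (intro Bochner_Integration.integrable_add Bochner_Integration.integrable_diff integrable_mult_right)
  have exp2: "(\<phi> u - G u)\<^sup>2 = (\<phi> u)\<^sup>2 - 2 * (\<phi> u * G u) + (G u)\<^sup>2" for u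
    by (simp add: power2_diff)
  show "integrable lborel (\<lambda>u. (\<phi> u - G u)\<^sup>2)"
    unfolding exp2 using j1 j2 j3 by (intro Bochner_Integration.integrable_add Bochner_Integration.integrable_diff integrable_mult_right)
  have "(LINT t|lborel. (norm (FT \<phi> t / (2 * pi) - g t))\<^sup>2) =
      1 / (4 * pi\<^sup>2) * (LINT t|lborel. (norm (FT \<phi> t))\<^sup>2) - 1 / pi * ?e1 + (LINT t|lborel. (g t)\<^sup>2)"
    unfolding expand by (rule integral_linear_combination[OF i1 i2' i3])
  also have "(LINT t|lborel. (norm (FT \<phi> t))\<^sup>2) = 2 * pi * (LINT x|lborel. (\<phi> x)\<^sup>2)"
    by (rule FT_square_integral(2)[OF \<phi>])
  also have "(LINT t|lborel. (g t)\<^sup>2) = 1 / (2 * pi) * (LINT u|lborel. (G u)\<^sup>2)"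
    using FT_square_integral(2)[OF g] unfolding norm_G by simp
  also have "1 / (4 * pi\<^sup>2) * (2 * pi * (LINT x|lborel. (\<phi> x)\<^sup>2)) - 1 / pi * ?e1
      + 1 / (2 * pi) * (LINT u|lborel. (G u)\<^sup>2) =
      1 / (2 * pi) * ((LINT x|lborel. (\<phi> x)\<^sup>2) - 2 * (LINT u|lborel. \<phi> u * G u) + (LINT u|lborel. (G u)\<^sup>2))"
    unfolding mixed by (simp add: power2_eq_square field_simps)
  also have "(LINT x|lborel. (\<phi> x)\<^sup>2) - 2 * (LINT u|lborel. \<phi> u * G u) + (LINT u|lborel. (G u)\<^sup>2) = (LINT u|lborel. (\<phi> u - G u)\<^sup>2)"
    unfolding exp2 using j1 j2 j3 by simp
  finally show "(LINT t|lborel. (norm (FT \<phi> t / (2 * pi) - g t))\<^sup>2) = 1 / (2 * pi) * (LINT u|lborel. (\<phi> u - G u)\<^sup>2)" .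
qed

section \<open>Approximation of the moving average by sums over a grid\<close>

lemma norm_sum_square_eq:
  fixes c :: "'i \<Rightarrow> complex" and y :: "'i \<Rightarrow> real"
  shows "(norm (\<Sum>i\<in>I. of_real (y i) * c i))\<^sup>2 = (\<Sum>i\<in>I. \<Sum>j\<in>I. Re (c i * cnj (c j)) * y i * y j)"
proof -
  let ?z = "\<Sum>i\<in>I. of_real (y i) * c i"
  have "(norm ?z)\<^sup>2 = Re (?z * cnj ?z)"
    by (simp only: complex_norm_square[symmetric] Re_complex_of_real)
  also have "?z * cnj ?z = (\<Sum>i\<in>I. \<Sum>j\<in>I. of_real (y i * y j) * (c i * cnj (c j)))"
    by (simp add: sum_product mult_ac)
  also have "Re \<dots> = (\<Sum>i\<in>I. \<Sum>j\<in>I. Re (c i * cnj (c j)) * y i * y j)"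
    unfolding Re_sum by (intro sum.cong refl) (simp only: Re_complex_of_real times_complex.sel Im_complex_of_real, simp add: mult_ac)
  finally show ?thesis .
qed

text \<open>Covers both error forms: integrals over a frequency band with the smoothing weights, and
  sums over observation times, regarded as integrals over a space with one point. Complex
  coefficients still give a real form because only squared moduli occur.\<close>

locale integral_form = finite_measure \<mu> for \<mu> :: "'t measure" +
  fixes I :: "'i set" and S :: "'k set" and v :: "'k \<Rightarrow> real" and c :: "'i \<Rightarrow> 'k \<Rightarrow> 't \<Rightarrow> complex" and B :: real
  assumes fin: "finite I" "finite S" and v: "\<And>k. k \<in> S \<Longrightarrow> v k \<ge> 0"
    and c_meas: "\<And>i k. i \<in> I \<Longrightarrow> k \<in> S \<Longrightarrow> c i k \<in> borel_measurable \<mu>"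
    and c_bound: "\<And>i k u. i \<in> I \<Longrightarrow> k \<in> S \<Longrightarrow> norm (c i k u) \<le> B"
begin

definition Kmat :: "'i \<Rightarrow> 'i \<Rightarrow> real" where
  "Kmat i j = (LINT u|\<mu>. (\<Sum>k\<in>S. v k * Re (c i k u * cnj (c j k u))))"

definition form :: "('i \<Rightarrow> real) \<Rightarrow> real" where
  "form y = (LINT u|\<mu>. (\<Sum>k\<in>S. v k * (norm (\<Sum>i\<in>I. of_real (y i) * c i k u))\<^sup>2))"

lemma form_eq: "form y = (\<Sum>i\<in>I. \<Sum>j\<in>I. Kmat i j * y i * y j)"
proof -
  have int: "integrable \<mu> (\<lambda>u. \<Sum>k\<in>S. v k * Re (c i k u * cnj (c j k u)))" if "i \<in> I" "j \<in> I" for i j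
  proof (intro Bochner_Integration.integrable_sum integrable_mult_right)
    fix k assume k: "k \<in> S"
    note [measurable] = c_meas[OF that(1) k] c_meas[OF that(2) k]
    show "integrable \<mu> (\<lambda>u. Re (c i k u * cnj (c j k u)))"
    proof (rule integrable_const_bound[where B = "B * B"])
      show "AE u in \<mu>. norm (Re (c i k u * cnj (c j k u))) \<le> B * B"
      proof (rule AE_I2)
        fix u
        have "norm (Re (c i k u * cnj (c j k u))) \<le> norm (c i k u) * norm (c j k u)"
          using abs_Re_le_cmod[of "c i k u * cnj (c j k u)"] by (simp only: norm_mult complex_mod_cnj real_norm_def)
        also have "\<dots> \<le> B * B"
          using c_bound[OF that(1) k, of u] c_bound[OF that(2) k, of u]
          by (intro mult_mono) (auto intro: order.trans[OF norm_ge_zero])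
        finally show "norm (Re (c i k u * cnj (c j k u))) \<le> B * B" .
      qed
      show "(\<lambda>u. Re (c i k u * cnj (c j k u))) \<in> borel_measurable \<mu>"
        unfolding times_complex.sel complex_cnj by simp measurable
    qed
  qed
  let ?e1 = "\<lambda>i u j. \<Sum>k\<in>S. v k * Re (c i k u * cnj (c j k u))"
  have "form y = (LINT u|\<mu>. (\<Sum>i\<in>I. \<Sum>j\<in>I. (?e1 i u j) * (y i * y j)))"
    unfolding form_def
  proof (intro Bochner_Integration.integral_cong refl)
    fix u
    have "(\<Sum>k\<in>S. v k * (norm (\<Sum>i\<in>I. of_real (y i) * c i k u))\<^sup>2) =
       (\<Sum>k\<in>S. \<Sum>i\<in>I. \<Sum>j\<in>I. v k * Re (c i k u * cnj (c j k u)) * (y i * y j))"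
      unfolding norm_sum_square_eq by (simp only: sum_distrib_left mult.assoc)
    also have "\<dots> = (\<Sum>i\<in>I. \<Sum>k\<in>S. \<Sum>j\<in>I. v k * Re (c i k u * cnj (c j k u)) * (y i * y j))"
      by (rule sum.swap)
    also have "\<dots> = (\<Sum>i\<in>I. \<Sum>j\<in>I. \<Sum>k\<in>S. v k * Re (c i k u * cnj (c j k u)) * (y i * y j))"
      by (intro sum.cong refl sum.swap)
    finally show "(\<Sum>k\<in>S. v k * (norm (\<Sum>i\<in>I. of_real (y i) * c i k u))\<^sup>2) =
       (\<Sum>i\<in>I. \<Sum>j\<in>I. (?e1 i u j) * (y i * y j))"
      by (simp only: sum_distrib_right)
  qed
  also have "\<dots> = (\<Sum>i\<in>I. \<Sum>j\<in>I. LINT u|\<mu>. (?e1 i u j) * (y i * y j))"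
  proof -
    have 1: "integrable \<mu> (\<lambda>u. (?e1 i u j) * (y i * y j))" if "i \<in> I" "j \<in> I" for i j
      by (intro integrable_mult_left int that)
    have "(LINT u|\<mu>. (\<Sum>i\<in>I. \<Sum>j\<in>I. (?e1 i u j) * (y i * y j)))
        = (\<Sum>i\<in>I. LINT u|\<mu>. (\<Sum>j\<in>I. (?e1 i u j) * (y i * y j)))"
      by (rule Bochner_Integration.integral_sum) (intro Bochner_Integration.integrable_sum 1)
    also have "\<dots> = (\<Sum>i\<in>I. \<Sum>j\<in>I. LINT u|\<mu>. (?e1 i u j) * (y i * y j))"
      by (intro sum.cong refl Bochner_Integration.integral_sum 1)
    finally show ?thesis .
  qed
  also have "\<dots> = (\<Sum>i\<in>I. \<Sum>j\<in>I. Kmat i j * y i * y j)"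
    unfolding Kmat_def by (simp only: integral_mult_left_zero mult.assoc)
  finally show ?thesis .
qed

sublocale psd_form I Kmat
proof
  show "finite I" by (rule fin)
  show "0 \<le> (\<Sum>i\<in>I. \<Sum>j\<in>I. Kmat i j * y i * y j)" for y
    unfolding form_eq[symmetric] form_def
    using v by (intro integral_nonneg_AE AE_I2 sum_nonneg mult_nonneg_nonneg) auto
qed

lemma Q_eq_form: "Q y = form y"
  by (simp add: Q_def Bil_def form_eq)

end

lemma envelope_powr:
  "envelope p x powr q = envelope (p * q) x"
  by (simp add: envelope_def powr_powr)

lemma envelope_edge_le: "envelope p (edge_dist N s) \<le> envelope p s + envelope p (s - N)"
  by (auto simp: edge_dist_def min_def envelope_def)

lemma nn_integral_envelope_edge:
  assumes "p > 1"
  shows "(\<integral>\<^sup>+ s. ennreal (envelope p (edge_dist N s)) \<partial>lborel) \<le> ennreal (4 / (p - 1))"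
proof -
  let ?e1 = "\<integral>\<^sup>+ s. ennreal (envelope p s) \<partial>lborel"
  have "(\<integral>\<^sup>+ s. ennreal (envelope p (edge_dist N s)) \<partial>lborel) \<le> (\<integral>\<^sup>+ s. ennreal (envelope p s) + ennreal (envelope p (s - N)) \<partial>lborel)"
    using envelope_edge_le by (intro nn_integral_mono) (simp add: ennreal_plus[symmetric] del: ennreal_plus)
  also have "\<dots> = ?e1 + (\<integral>\<^sup>+ s. ennreal (envelope p (s - N)) \<partial>lborel)"
    by (rule nn_integral_add) measurable
  also have "(\<integral>\<^sup>+ s. ennreal (envelope p (s - N)) \<partial>lborel) = ?e1"
    by (rule nn_integral_shift) measurable
  also have "?e1 + ?e1 \<le> ennreal (2 / (p - 1)) + ennreal (2 / (p - 1))"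
    using assms by (intro add_mono nn_integral_envelope)
  also have "\<dots> = ennreal (4 / (p - 1))" using assms by (subst ennreal_plus[symmetric]) auto
  finally show ?thesis .
qed

text \<open>Puts the noise cells on the same footing as the observations. For the empty set the
  simple integral is 0 while \<open>\<Lambda> {}\<close> is 0 only almost surely, which convergence
  in probability does not distinguish.\<close>

lemma is_stochastic_integral_indicator:
  assumes "stable_random_measure M \<alpha> \<Lambda>" "B \<in> sets borel" "bounded B"
  shows "is_stochastic_integral M \<alpha> \<Lambda> (indicat_real B) (\<Lambda> B)"
proof -
  interpret stable_random_measure M \<alpha> \<Lambda> by fact
  have sf: "simple_function borel (indicat_real B)" using assms by (intro simple_function_indicator) auto
  have eq: "simple_stochastic_integral \<Lambda> (indicat_real B) = (\<lambda>w. if B = {} then 0 else \<Lambda> B w)"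
  proof (cases "B = {}")
    case False
    then have "range (indicat_real B) - {0} = {1}" by (auto simp: indicator_def image_iff)
    moreover have "indicat_real B -` {1} = B" by (auto simp: indicator_def)
    ultimately show ?thesis using False by (auto simp: simple_stochastic_integral_def fun_eq_iff)
  next
    case True
    then have "range (indicat_real B) - {0} = {}" by auto
    then show ?thesis using True by (auto simp: simple_stochastic_integral_def fun_eq_iff)
  qed
  have "converges_in_probability M (\<lambda>k. simple_stochastic_integral \<Lambda> (indicat_real B)) (\<Lambda> B)"
    unfolding converges_in_probability_def
  proof (intro conjI allI impI)
    show "\<forall>\<^sub>F n in sequentially. simple_stochastic_integral \<Lambda> (indicat_real B) \<in> borel_measurable M"
      unfolding eq using assms by (cases "B = {}") auto
    show "\<Lambda> B \<in> borel_measurable M" using assms by simp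
    fix e :: real assume e: "e > 0"
    have "AE w in M. \<not> \<bar>simple_stochastic_integral \<Lambda> (indicat_real B) w - \<Lambda> B w\<bar> > e"
      using Lambda_empty by eventually_elim (use e in \<open>auto simp: eq\<close>)
    then have "prob {w \<in> space M. \<bar>simple_stochastic_integral \<Lambda> (indicat_real B) w - \<Lambda> B w\<bar> > e} = 0"
      by (intro prob_eq_0_AE) auto
    then show "(\<lambda>k. prob {w \<in> space M. \<bar>simple_stochastic_integral \<Lambda> (indicat_real B) w - \<Lambda> B w\<bar> > e}) \<longlonglongrightarrow> 0"
      by simp
  qed
  moreover have "bounded {s. indicat_real B s \<noteq> 0}"
    by (rule bounded_subset[OF assms(3)]) (auto simp: indicator_def)
  ultimately show ?thesis
    unfolding is_stochastic_integral_def using sf by (intro exI[of _ "\<lambda>_. indicat_real B"]) auto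
qed

context stable_random_measure
begin

text \<open>The pointwise bound is raised to the power \<alpha>/2 and integrated. The interior
  contributes its length N; the edge term leads to an envelope of exponent \<kappa> \<alpha>, which
  has to exceed 1 for the integral to converge.\<close>

lemma integral_form_tail:
  assumes form: "integral_form \<mu> I S v c B"
    and h: "\<And>i. i \<in> I \<Longrightarrow> h i \<in> borel_measurable borel"
    and Y: "\<And>i. i \<in> I \<Longrightarrow> is_stochastic_integral M \<alpha> \<Lambda> (h i) (Y i)"
    and x: "x > 0" and N: "N \<ge> 0" and AE: "A \<ge> 0" "E \<ge> 0" and \<kappa>: "\<kappa> * \<alpha> > 1"
    and bound: "\<And>s. integral_form.form \<mu> I S v c (\<lambda>i. h i s) \<le> A * indicator {0<..N} s + E * (envelope \<kappa> (edge_dist N s))\<^sup>2"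
  shows "prob {w\<in>space M. integral_form.form \<mu> I S v c (\<lambda>i. Y i w) > x\<^sup>2}
    \<le> 48 * (N * A powr (\<alpha>/2) + 4 / (\<kappa> * \<alpha> - 1) * E powr (\<alpha>/2)) / x powr \<alpha>"
proof -
  interpret F: integral_form \<mu> I S v c B by fact
  interpret stable_psd_form M \<alpha> \<Lambda> I F.Kmat ..
  let ?b = "N * A powr (\<alpha>/2) + 4 / (\<kappa> * \<alpha> - 1) * E powr (\<alpha>/2)"
  have "(\<integral>\<^sup>+ s. ennreal (F.Q (\<lambda>i. h i s) powr (\<alpha>/2)) \<partial>lborel) \<le>
     (\<integral>\<^sup>+ s. ennreal (A powr (\<alpha>/2)) * indicator {0<..N} s + ennreal (E powr (\<alpha>/2)) * ennreal (envelope (\<kappa> * \<alpha>) (edge_dist N s)) \<partial>lborel)"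
  proof (rule nn_integral_mono)
    fix s
    have "F.Q (\<lambda>i. h i s) powr (\<alpha>/2) \<le> (A * indicator {0<..N} s + E * (envelope \<kappa> (edge_dist N s))\<^sup>2) powr (\<alpha>/2)"
      using bound[of s] F.Q_nonneg alpha unfolding F.Q_eq_form[symmetric] by (intro powr_mono2) auto
    also have "\<dots> \<le> (A * indicator {0<..N} s) powr (\<alpha>/2) + (E * (envelope \<kappa> (edge_dist N s))\<^sup>2) powr (\<alpha>/2)"
      using alpha AE by (intro powr_add_le) (auto intro: mult_nonneg_nonneg)
    also have "(A * indicator {0<..N} s) powr (\<alpha>/2) = A powr (\<alpha>/2) * indicator {0<..N} s"
      by (auto simp: indicator_def)
    also have "(E * (envelope \<kappa> (edge_dist N s))\<^sup>2) powr (\<alpha>/2) = E powr (\<alpha>/2) * envelope (\<kappa> * \<alpha>) (edge_dist N s)"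
    proof -
      have "(envelope \<kappa> (edge_dist N s))\<^sup>2 = envelope (\<kappa> * 2) (edge_dist N s)"
        using envelope_powr[of \<kappa> "edge_dist N s" 2] by simp
      then show ?thesis by (simp add: powr_mult envelope_powr)
    qed
    finally have "ennreal (F.Q (\<lambda>i. h i s) powr (\<alpha>/2)) \<le> ennreal (A powr (\<alpha>/2) * indicator {0<..N} s + E powr (\<alpha>/2) * envelope (\<kappa> * \<alpha>) (edge_dist N s))"
      by (rule ennreal_leI)
    also have "\<dots> = ennreal (A powr (\<alpha>/2)) * indicator {0<..N} s + ennreal (E powr (\<alpha>/2)) * ennreal (envelope (\<kappa> * \<alpha>) (edge_dist N s))"
      by (subst ennreal_plus) (auto simp: ennreal_mult indicator_def)
    finally show "ennreal (F.Q (\<lambda>i. h i s) powr (\<alpha>/2)) \<le> \<dots>" .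
  qed
  also have "\<dots> = ennreal (A powr (\<alpha>/2)) * ennreal N + ennreal (E powr (\<alpha>/2)) * (\<integral>\<^sup>+ s. ennreal (envelope (\<kappa> * \<alpha>) (edge_dist N s)) \<partial>lborel)"
  proof -
    have [measurable]: "edge_dist N \<in> borel_measurable borel" unfolding edge_dist_def by measurable
    show ?thesis using N by (subst nn_integral_add) (auto simp: nn_integral_cmult nn_integral_cmult_indicator)
  qed
  also have "\<dots> \<le> ennreal (A powr (\<alpha>/2)) * ennreal N + ennreal (E powr (\<alpha>/2)) * ennreal (4 / (\<kappa> * \<alpha> - 1))"
    by (intro add_left_mono mult_left_mono nn_integral_envelope_edge \<kappa>) auto
  also have "\<dots> = ennreal ?b"
  proof -
    have "ennreal (A powr (\<alpha>/2)) * ennreal N = ennreal (N * A powr (\<alpha>/2))"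
      using N by (subst ennreal_mult[symmetric]) (auto simp: mult.commute)
    moreover have "ennreal (E powr (\<alpha>/2)) * ennreal (4 / (\<kappa> * \<alpha> - 1)) = ennreal (4 / (\<kappa> * \<alpha> - 1) * E powr (\<alpha>/2))"
      using \<kappa> by (subst ennreal_mult[symmetric]) (auto simp: mult.commute)
    ultimately show ?thesis using N \<kappa> by (subst ennreal_plus) auto
  qed
  finally have le: "(\<integral>\<^sup>+ s. ennreal (F.Q (\<lambda>i. h i s) powr (\<alpha>/2)) \<partial>lborel) \<le> ennreal ?b" .
  have "prob {w\<in>space M. F.Q (\<lambda>i. Y i w) > x\<^sup>2} \<le> 48 * ?b / x powr \<alpha>"
    by (rule Q_weak_type[OF h Y x _ le]) (use N \<kappa> in auto)
  then show ?thesis unfolding F.Q_eq_form .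
qed

lemma integral_form_measurable:
  assumes form: "integral_form \<mu> I S v c B"
    and Y: "\<And>i. i \<in> I \<Longrightarrow> Y i \<in> borel_measurable M"
  shows "(\<lambda>w. integral_form.form \<mu> I S v c (\<lambda>i. Y i w)) \<in> borel_measurable M"
proof -
  interpret F: integral_form \<mu> I S v c B by fact
  note Y[measurable]
  show ?thesis unfolding F.form_eq by measurable
qed

end

lemma sum_indicator_grid:
  fixes \<phi> :: "real \<Rightarrow> 'b::real_vector"
  assumes dt: "dt > 0"
  shows "(\<Sum>k=1..n. indicat_real {real (k - 1) * dt<..real k * dt} s *\<^sub>R \<phi> (real k * dt)) =
    indicat_real {0<..real n * dt} s *\<^sub>R \<phi> (grid dt s)"
proof (induction n)
  case (Suc n)
  let ?A = "{real n * dt<..real (Suc n) * dt}"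
  have "(\<Sum>k=1..Suc n. indicat_real {real (k - 1) * dt<..real k * dt} s *\<^sub>R \<phi> (real k * dt)) =
     indicat_real {0<..real n * dt} s *\<^sub>R \<phi> (grid dt s) + indicat_real ?A s *\<^sub>R \<phi> (real (Suc n) * dt)"
    using Suc by simp
  also have "\<dots> = indicat_real {0<..real (Suc n) * dt} s *\<^sub>R \<phi> (grid dt s)"
  proof (cases "s \<in> ?A")
    case True
    then have "s \<notin> {0<..real n * dt}" "s \<in> {0<..real (Suc n) * dt}"
      using dt by (auto intro: order.strict_trans1[of 0 "real n * dt"])
    then show ?thesis using True grid_eq[OF dt True] by simp
  next
    case False
    then have "s \<in> {0<..real n * dt} \<longleftrightarrow> s \<in> {0<..real (Suc n) * dt}"
      using dt by (auto simp: algebra_simps)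
    then show ?thesis using False by (simp add: indicator_def)
  qed
  finally show ?case .
qed simp

lemma (in finite_measure) integral_le_const:
  fixes f :: "'a \<Rightarrow> real"
  assumes "\<And>x. x \<in> space M \<Longrightarrow> f x \<le> b" "b \<ge> 0"
  shows "integral\<^sup>L M f \<le> b * measure M (space M)"
proof (cases "integrable M f")
  case True
  have "integral\<^sup>L M f \<le> (LINT x|M. b)"
    using True assms by (intro integral_mono) auto
  then show ?thesis by (simp add: mult.commute)
next
  case False
  then show ?thesis using assms by (simp add: not_integrable_integral_eq)
qed

lemma square_sum3_le: "(x + y + z)\<^sup>2 \<le> 3 * (x\<^sup>2 + y\<^sup>2 + z\<^sup>2)" for x y z :: real
  using zero_le_power2[of "x - y"] zero_le_power2[of "y - z"] zero_le_power2[of "x - z"]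
  by (simp add: power2_eq_square algebra_simps)

abbreviation band :: "real \<Rightarrow> real measure" where
  "band a \<equiv> restrict_space lborel {-a..a}"

lemma finite_measure_band: "finite_measure (band a)"
  by (rule finite_measureI) (simp add: emeasure_restrict_space emeasure_lborel_Icc_eq)

lemma measure_band: "a \<ge> 0 \<Longrightarrow> measure (band a) (space (band a)) = 2 * a"
  by (simp add: measure_restrict_space)

lemma restrict_measurable_band [measurable (raw)]:
  "g \<in> borel_measurable borel \<Longrightarrow> g \<in> borel_measurable (band a)"
  by (rule measurable_restrict_space1) simp

section \<open>Error forms in observations and noise cells\<close>

locale window = stable_random_measure M \<alpha> \<Lambda> + decaying f C r
  for M :: "'w measure" and \<alpha> :: real and \<Lambda> :: "real set \<Rightarrow> 'w \<Rightarrow> real" and f :: "real \<Rightarrow> real" and C r :: real +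
  fixes X :: "real \<Rightarrow> 'w \<Rightarrow> real" and n :: nat and dt :: real and m :: nat and W :: "int \<Rightarrow> real" and \<omega> :: real and a :: real
  assumes X: "\<And>t. is_stochastic_integral M \<alpha> \<Lambda> (\<lambda>s. f (t - s)) (X t)"
    and Delta: "0 < dt" "dt \<le> 1" and N_ge_1: "real n * dt \<ge> 1" and n_ge_2: "n \<ge> 2" and m: "2 * m \<le> n"
    and W: "\<And>k. k \<in> {- int m..int m} \<Longrightarrow> W k \<ge> 0" and sum_W: "(\<Sum>k=- int m..int m. W k) = 1"
    and \<omega>: "\<omega> \<ge> 0" "\<And>x y. \<bar>x - y\<bar> < dt \<Longrightarrow> \<bar>f x - f y\<bar> \<le> \<omega>"
    and a: "a > 0"
begin

definition N :: real where "N = real n * dt"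

definition xi :: "nat \<Rightarrow> 'w \<Rightarrow> real" where
  "xi k = \<Lambda> {real (k - 1) * dt<..real k * dt}"

definition freq :: "real \<Rightarrow> int \<Rightarrow> real" where
  "freq u k = u + of_int k / (real n * dt)"

definition V :: "real \<Rightarrow> 'w \<Rightarrow> complex" where
  "V u w = (\<Sum>j=1..n. of_real (X (real j * dt) w) * cis (real j * dt * u))"

definition Sxi :: "real \<Rightarrow> 'w \<Rightarrow> complex" where
  "Sxi u w = (\<Sum>k=1..n. of_real (xi k w) * cis (real k * dt * u))"

definition W2 :: real where "W2 = weight_second_moment m W"

definition R0 :: real where "R0 = riemann_const C r"

text \<open>\<open>Inl j\<close> stands for the j-th observation and \<open>Inr k\<close> for the
  noise on the k-th cell, so that one form can mix both.\<close>

definition noise_index :: "(nat + nat) set" where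
  "noise_index = Inl ` {1..n} \<union> Inr ` {1..n}"

definition kernel_of :: "nat + nat \<Rightarrow> real \<Rightarrow> real" where
  "kernel_of i = (case i of Inl j \<Rightarrow> (\<lambda>s. f (real j * dt - s)) | Inr k \<Rightarrow> indicat_real {real (k - 1) * dt<..real k * dt})"

definition var_of :: "nat + nat \<Rightarrow> 'w \<Rightarrow> real" where
  "var_of i = (case i of Inl j \<Rightarrow> X (real j * dt) | Inr k \<Rightarrow> xi k)"

lemma sum_noise_index:
  fixes g :: "nat + nat \<Rightarrow> 'b::comm_monoid_add"
  shows "(\<Sum>i\<in>noise_index. g i) = (\<Sum>j=1..n. g (Inl j)) + (\<Sum>k=1..n. g (Inr k))"
  unfolding noise_index_def by (subst sum.union_disjoint) (auto simp: sum.reindex)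

lemma N_pos: "N > 0" "N \<ge> 1" using N_ge_1 unfolding N_def by auto

lemma X_measurable [measurable]: "X t \<in> borel_measurable M"
  using X[of t] by (auto simp: is_stochastic_integral_def converges_in_probability_def)

lemma xi_measurable [measurable]: "xi k \<in> borel_measurable M"
  unfolding xi_def by simp

lemma kernel_of_measurable: "i \<in> noise_index \<Longrightarrow> kernel_of i \<in> borel_measurable borel"
  by (auto simp: kernel_of_def noise_index_def)

lemma var_of_integral: "i \<in> noise_index \<Longrightarrow> is_stochastic_integral M \<alpha> \<Lambda> (kernel_of i) (var_of i)"
  using X is_stochastic_integral_indicator[OF stable_random_measure_axioms]
  by (auto simp: kernel_of_def var_of_def noise_index_def xi_def)

lemma var_of_measurable: "var_of i \<in> borel_measurable M"
  by (cases i) (auto simp: var_of_def)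

lemma R0_nonneg: "R0 \<ge> 0"
  unfolding R0_def riemann_const_def using C_nonneg r by (intro add_nonneg_nonneg mult_nonneg_nonneg) auto

lemma W2_nonneg: "W2 \<ge> 0"
  unfolding W2_def weight_second_moment_def using W by (intro sum_nonneg mult_nonneg_nonneg) auto

lemma sum_weighted_freq_square:
  assumes "\<bar>u\<bar> \<le> a"
  shows "(\<Sum>k=- int m..int m. W k * (freq u k)\<^sup>2) \<le> 2 * (a\<^sup>2 + W2 / N\<^sup>2)"
proof -
  have "(\<Sum>k=- int m..int m. W k * (freq u k)\<^sup>2) \<le> (\<Sum>k=- int m..int m. 2 * a\<^sup>2 * W k + 2 / N\<^sup>2 * ((of_int k)\<^sup>2 * W k))"
  proof (rule sum_mono)
    fix k assume k: "k \<in> {- int m..int m}"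
    have "(freq u k)\<^sup>2 \<le> 2 * (u\<^sup>2 + (of_int k / N)\<^sup>2)"
      unfolding freq_def N_def[symmetric] using zero_le_power2[of "u - of_int k / N"] by (simp add: power2_sum power2_diff)
    also have "\<dots> \<le> 2 * (a\<^sup>2 + (of_int k / N)\<^sup>2)"
      using power_mono[OF assms, of 2] by simp
    finally have "W k * (freq u k)\<^sup>2 \<le> W k * (2 * (a\<^sup>2 + (of_int k / N)\<^sup>2))"
      using W[OF k] by (rule mult_left_mono)
    also have "\<dots> = 2 * a\<^sup>2 * W k + 2 / N\<^sup>2 * ((of_int k)\<^sup>2 * W k)"
      by (simp add: power_divide algebra_simps)
    finally show "W k * (freq u k)\<^sup>2 \<le> 2 * a\<^sup>2 * W k + 2 / N\<^sup>2 * ((of_int k)\<^sup>2 * W k)" .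
  qed
  also have "\<dots> = 2 * a\<^sup>2 * (\<Sum>k=- int m..int m. W k) + 2 / N\<^sup>2 * (\<Sum>k=- int m..int m. (of_int k)\<^sup>2 * W k)"
    by (simp only: sum.distrib sum_distrib_left)
  also have "\<dots> = 2 * (a\<^sup>2 + W2 / N\<^sup>2)"
    unfolding sum_W W2_def weight_second_moment_def by simp
  finally show ?thesis .
qed

text \<open>Chosen so that the combination of the variables is dt V - FT f Sxi at the shifted
  frequency: the defect of the rule that a moving average multiplies the transform of the noise by
  FT f.\<close>

definition coef1 :: "nat + nat \<Rightarrow> int \<Rightarrow> real \<Rightarrow> complex" where
  "coef1 i k u = (case i of Inl j \<Rightarrow> of_real dt * cis (real j * dt * freq u k)
    | Inr l \<Rightarrow> - (FT f (freq u k) * cis (real l * dt * freq u k)))"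

definition Q1 :: "'w \<Rightarrow> real" where
  "Q1 w = (LINT u|band a. (\<Sum>k=- int m..int m. W k * (norm (of_real dt * V (freq u k) w - FT f (freq u k) * Sxi (freq u k) w))\<^sup>2))"

lemma freq_measurable [measurable]: "(\<lambda>u. freq u k) \<in> borel_measurable borel"
  unfolding freq_def by measurable

lemma FT_f_measurable [measurable]: "FT f \<in> borel_measurable borel"
  unfolding FT_def by measurable

lemma form1: "integral_form (band a) noise_index {- int m..int m} W coef1 (1 + 2 * C / (r - 1))"
proof -
  interpret finite_measure "band a" by (rule finite_measure_band)
  show ?thesis
  proof
    show "finite noise_index" by (simp add: noise_index_def)
    show "coef1 i k \<in> borel_measurable (band a)" for i k
      by (rule restrict_measurable_band, cases i) (unfold coef1_def, simp_all, measurable)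
    show "norm (coef1 i k u) \<le> 1 + 2 * C / (r - 1)" for i k u
      using norm_FT_le[of "freq u k"] Delta C_nonneg r by (cases i) (auto simp: coef1_def norm_mult intro: add_increasing add_increasing2)
  qed (use W in auto)
qed

lemma form1_var_of: "integral_form.form (band a) noise_index {- int m..int m} W coef1 (\<lambda>i. var_of i w) = Q1 w"
proof -
  have "(\<Sum>i\<in>noise_index. of_real (var_of i w) * coef1 i k u) = of_real dt * V (freq u k) w - FT f (freq u k) * Sxi (freq u k) w" for k u
    unfolding sum_noise_index var_of_def coef1_def V_def Sxi_def
    by (simp add: sum_distrib_left sum_negf mult_ac)
  then show ?thesis unfolding integral_form.form_def[OF form1] Q1_def by simp
qed

text \<open>With kernels in place of the variables the combination is the Riemann sum error at s.
  Its three parts are squared separately, with factor 3, and integrated over a band of length 2 a;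
  hence the 6.\<close>

lemma form1_kernel_of:
  assumes \<theta>: "0 \<le> \<theta>" "\<theta> \<le> 1"
  shows "integral_form.form (band a) noise_index {- int m..int m} W coef1 (\<lambda>i. kernel_of i s) \<le>
    (6 * R0\<^sup>2 * a * (\<omega> powr (2 - 2/r) + 2 * dt\<^sup>2 * (a\<^sup>2 + W2 / N\<^sup>2))) * indicator {0<..N} s +
    (6 * R0\<^sup>2 * a * N powr (2 * \<theta>)) * (envelope (r - 1 + \<theta>) (edge_dist N s))\<^sup>2"
proof -
  interpret finite_measure "band a" by (rule finite_measure_band)
  let ?K = "{- int m..int m}"
  let ?i = "indicat_real {0<..N} s"
  let ?e = "envelope (r - 1 + \<theta>) (edge_dist N s)"
  have eq: "(\<Sum>i\<in>noise_index. of_real (kernel_of i s) * coef1 i k u) =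
      of_real dt * (\<Sum>j=1..n. of_real (f (real j * dt - s)) * cis (real j * dt * freq u k)) -
      ?i *\<^sub>R (FT f (freq u k) * cis (grid dt s * freq u k))" for k u
  proof -
    have "(\<Sum>i\<in>noise_index. of_real (kernel_of i s) * coef1 i k u) =
      of_real dt * (\<Sum>j=1..n. of_real (f (real j * dt - s)) * cis (real j * dt * freq u k)) -
      (\<Sum>l=1..n. indicat_real {real (l - 1) * dt<..real l * dt} s *\<^sub>R (FT f (freq u k) * cis (real l * dt * freq u k)))"
      unfolding sum_noise_index kernel_of_def coef1_def
      by (simp add: sum_distrib_left sum_negf scaleR_conv_of_real mult_ac)
    also have "(\<Sum>l=1..n. indicat_real {real (l - 1) * dt<..real l * dt} s *\<^sub>R (FT f (freq u k) * cis (real l * dt * freq u k))) =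
       ?i *\<^sub>R (FT f (freq u k) * cis (grid dt s * freq u k))"
      unfolding N_def by (rule sum_indicator_grid[OF Delta(1), where \<phi> = "\<lambda>t. FT f (freq u k) * cis (t * freq u k)"])
    finally show ?thesis .
  qed
  let ?b = "3 * R0\<^sup>2 * (?i * \<omega> powr (2 - 2/r) + ?i * (2 * dt\<^sup>2 * (a\<^sup>2 + W2 / N\<^sup>2)) + N powr (2 * \<theta>) * ?e\<^sup>2)"
  let ?e1 = "?i * \<omega> powr (2 - 2/r) + N powr (2 * \<theta>) * ?e\<^sup>2"
  have "integral_form.form (band a) noise_index ?K W coef1 (\<lambda>i. kernel_of i s) \<le> ?b * measure (band a) (space (band a))"
    unfolding integral_form.form_def[OF form1]
  proof (rule integral_le_const)
    show "?b \<ge> 0" using W2_nonneg by (intro mult_nonneg_nonneg add_nonneg_nonneg) auto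
    fix u assume "u \<in> space (band a)"
    then have u: "\<bar>u\<bar> \<le> a" by (auto simp: space_restrict_space)
    have "(\<Sum>k\<in>?K. W k * (norm (\<Sum>i\<in>noise_index. of_real (kernel_of i s) * coef1 i k u))\<^sup>2) \<le>
       (\<Sum>k\<in>?K. 3 * R0\<^sup>2 * ?e1 * W k + 3 * R0\<^sup>2 * ?i * dt\<^sup>2 * (W k * (freq u k)\<^sup>2))"
    proof (rule sum_mono)
      fix k assume k: "k \<in> ?K"
      have sq: "(\<omega> powr (1 - 1/r))\<^sup>2 = \<omega> powr (2 - 2/r)" "(N powr \<theta>)\<^sup>2 = N powr (2 * \<theta>)"
        by (simp_all add: power2_eq_square powr_add[symmetric])
      have "norm (\<Sum>i\<in>noise_index. of_real (kernel_of i s) * coef1 i k u) \<le>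
         R0 * (?i * (\<omega> powr (1 - 1/r) + dt * \<bar>freq u k\<bar>) + N powr \<theta> * ?e)"
        unfolding eq R0_def N_def
        by (rule riemann_sum[OF Delta \<omega> N_ge_1 \<theta>])
      then have "(norm (\<Sum>i\<in>noise_index. of_real (kernel_of i s) * coef1 i k u))\<^sup>2 \<le>
         (R0 * (?i * (\<omega> powr (1 - 1/r) + dt * \<bar>freq u k\<bar>) + N powr \<theta> * ?e))\<^sup>2"
        by (intro power_mono) auto
      also have "\<dots> = R0\<^sup>2 * (?i * \<omega> powr (1 - 1/r) + ?i * (dt * \<bar>freq u k\<bar>) + N powr \<theta> * ?e)\<^sup>2"
        by (simp only: power_mult_distrib distrib_left[of "?i"])
      also have "\<dots> \<le> R0\<^sup>2 * (3 * ((?i * \<omega> powr (1 - 1/r))\<^sup>2 + (?i * (dt * \<bar>freq u k\<bar>))\<^sup>2 + (N powr \<theta> * ?e)\<^sup>2))"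
        by (intro mult_left_mono square_sum3_le) auto
      also have "\<dots> = 3 * R0\<^sup>2 * (?i * \<omega> powr (2 - 2/r) + ?i * (dt\<^sup>2 * (freq u k)\<^sup>2) + N powr (2 * \<theta>) * ?e\<^sup>2)"
        by (simp add: power_mult_distrib sq indicator_def)
      finally have "W k * (norm (\<Sum>i\<in>noise_index. of_real (kernel_of i s) * coef1 i k u))\<^sup>2 \<le>
         W k * (3 * R0\<^sup>2 * (?i * \<omega> powr (2 - 2/r) + ?i * (dt\<^sup>2 * (freq u k)\<^sup>2) + N powr (2 * \<theta>) * ?e\<^sup>2))"
        using W[OF k] by (rule mult_left_mono)
      then show "W k * (norm (\<Sum>i\<in>noise_index. of_real (kernel_of i s) * coef1 i k u))\<^sup>2 \<le>
        3 * R0\<^sup>2 * ?e1 * W k + 3 * R0\<^sup>2 * ?i * dt\<^sup>2 * (W k * (freq u k)\<^sup>2)"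
        by (simp add: algebra_simps)
    qed
    also have "\<dots> = 3 * R0\<^sup>2 * ?e1 + 3 * R0\<^sup>2 * ?i * dt\<^sup>2 * (\<Sum>k\<in>?K. W k * (freq u k)\<^sup>2)"
      using sum_W by (simp only: sum.distrib sum_distrib_left[symmetric] mult_1_right)
    also have "\<dots> \<le> 3 * R0\<^sup>2 * ?e1 + 3 * R0\<^sup>2 * ?i * dt\<^sup>2 * (2 * (a\<^sup>2 + W2 / N\<^sup>2))"
      by (intro add_left_mono mult_left_mono sum_weighted_freq_square u) auto
    also have "\<dots> = ?b" by (simp add: algebra_simps)
    finally show "(\<Sum>k\<in>?K. W k * (norm (\<Sum>i\<in>noise_index. of_real (kernel_of i s) * coef1 i k u))\<^sup>2) \<le> ?b" .
  qed
  also have "\<dots> = (6 * R0\<^sup>2 * a * (\<omega> powr (2 - 2/r) + 2 * dt\<^sup>2 * (a\<^sup>2 + W2 / N\<^sup>2))) * ?i + (6 * R0\<^sup>2 * a * N powr (2 * \<theta>)) * ?e\<^sup>2"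
    unfolding measure_band[OF less_imp_le[OF a]] by (simp add: algebra_simps)
  finally show ?thesis .
qed

lemma Q1_measurable [measurable]: "Q1 \<in> borel_measurable M"
proof -
  have "(\<lambda>w. integral_form.form (band a) noise_index {- int m..int m} W coef1 (\<lambda>i. var_of i w)) \<in> borel_measurable M"
    by (rule integral_form_measurable[OF form1]) (rule var_of_measurable)
  then show ?thesis unfolding form1_var_of .
qed

lemma Q1_nonneg: "Q1 w \<ge> 0"
  unfolding Q1_def using W by (intro integral_nonneg_AE AE_I2 sum_nonneg mult_nonneg_nonneg) auto

lemma Q1_tail:
  assumes \<theta>: "0 \<le> \<theta>" "\<theta> \<le> 1" "(r - 1 + \<theta>) * \<alpha> > 1" and x: "x > 0"
  shows "prob {w\<in>space M. Q1 w > x\<^sup>2} \<le>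
    48 * (N * (6 * R0\<^sup>2 * a * (\<omega> powr (2 - 2/r) + 2 * dt\<^sup>2 * (a\<^sup>2 + W2 / N\<^sup>2))) powr (\<alpha>/2) +
      4 / ((r - 1 + \<theta>) * \<alpha> - 1) * (6 * R0\<^sup>2 * a * N powr (2 * \<theta>)) powr (\<alpha>/2)) / x powr \<alpha>"
  unfolding form1_var_of[symmetric]
proof (rule integral_form_tail[OF form1 kernel_of_measurable var_of_integral x _ _ _ \<theta>(3) form1_kernel_of[OF \<theta>(1,2)]])
  show "0 \<le> N" using N_pos by simp
  show "0 \<le> 6 * R0\<^sup>2 * a * (\<omega> powr (2 - 2/r) + 2 * dt\<^sup>2 * (a\<^sup>2 + W2 / N\<^sup>2))"
    using a W2_nonneg by (intro mult_nonneg_nonneg add_nonneg_nonneg) auto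
  show "0 \<le> 6 * R0\<^sup>2 * a * N powr (2 * \<theta>)" using a by simp
qed

text \<open>In the time domain the defect is X - Xd at each observation time; the unit argument
  provides the space with one point.\<close>

definition coef2 :: "nat + nat \<Rightarrow> nat \<Rightarrow> unit \<Rightarrow> complex" where
  "coef2 i l t = (case i of Inl j \<Rightarrow> (if j = l then 1 else 0) | Inr k \<Rightarrow> - of_real (f (real l * dt - real k * dt)))"

text \<open>The moving average with its kernel frozen on each noise cell at the value for the right
  end point.\<close>

definition Xd :: "nat \<Rightarrow> 'w \<Rightarrow> real" where
  "Xd l w = (\<Sum>k=1..n. xi k w * f (real l * dt - real k * dt))"

definition Q2 :: "'w \<Rightarrow> real" where
  "Q2 w = dt * (\<Sum>l=1..n. (X (real l * dt) w - Xd l w)\<^sup>2)"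

lemma abs_f_le_C: "\<bar>f x\<bar> \<le> C"
proof -
  have "envelope r x \<le> 1" unfolding envelope_def using r powr_mono2'[of "- r" 1 "1 + \<bar>x\<bar>"] by simp
  then have "C * envelope r x \<le> C * 1" using C_nonneg by (intro mult_left_mono) auto
  then show ?thesis using decay[of x] by linarith
qed

lemma form2: "integral_form (count_space {()}) noise_index {1..n} (\<lambda>_. dt) coef2 (1 + C)"
proof -
  interpret finite_measure "count_space {()}" by (rule finite_measure_count_space) simp
  show ?thesis
  proof
    show "finite noise_index" by (simp add: noise_index_def)
    show "norm (coef2 i k u) \<le> 1 + C" for i k u
      using abs_f_le_C[of "real k * dt - _"] C_nonneg
      by (cases i) (auto simp: coef2_def intro: add_increasing order.trans[OF abs_f_le_C])
  qed (use Delta in auto)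
qed

lemma form2_eq:
  "integral_form.form (count_space {()}) noise_index {1..n} (\<lambda>_. dt) coef2 y =
    dt * (\<Sum>l=1..n. (y (Inl l) - (\<Sum>k=1..n. y (Inr k) * f (real l * dt - real k * dt)))\<^sup>2)"
proof -
  have "(\<Sum>i\<in>noise_index. of_real (y i) * coef2 i l t) = of_real (y (Inl l) - (\<Sum>k=1..n. y (Inr k) * f (real l * dt - real k * dt)))"
    if "l \<in> {1..n}" for l t
    unfolding sum_noise_index coef2_def using that by (simp add: sum_negf if_distrib cong: if_cong)
  then have "(\<Sum>l\<in>{1..n}. dt * (norm (\<Sum>i\<in>noise_index. of_real (y i) * coef2 i l t))\<^sup>2) =
     (\<Sum>l\<in>{1..n}. dt * (y (Inl l) - (\<Sum>k=1..n. y (Inr k) * f (real l * dt - real k * dt)))\<^sup>2)" for t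
    by (intro sum.cong refl) (simp only: norm_of_real power2_abs)
  then show ?thesis
    unfolding integral_form.form_def[OF form2]
    by (simp add: lebesgue_integral_count_space_finite sum_distrib_left)
qed

lemma form2_var_of: "integral_form.form (count_space {()}) noise_index {1..n} (\<lambda>_. dt) coef2 (\<lambda>i. var_of i w) = Q2 w"
  unfolding form2_eq Q2_def Xd_def var_of_def by simp

text \<open>Inside the interval one factor of each square is bounded by \<omega> and the other by
  two values of |f|, whose Riemann sums are at most R0. Outside, every grid point is at least as far
  from s as the nearer end point, and the decay of f suffices.\<close>

lemma form2_kernel_of:
  "integral_form.form (count_space {()}) noise_index {1..n} (\<lambda>_. dt) coef2 (\<lambda>i. kernel_of i s) \<le>
    (2 * R0 * \<omega>) * indicator {0<..N} s + (N * C\<^sup>2) * (envelope r (edge_dist N s))\<^sup>2"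
proof -
  have eq: "integral_form.form (count_space {()}) noise_index {1..n} (\<lambda>_. dt) coef2 (\<lambda>i. kernel_of i s) =
      dt * (\<Sum>l=1..n. (f (real l * dt - s) - indicator {0<..N} s * f (real l * dt - grid dt s))\<^sup>2)"
  proof -
    have "(\<Sum>k=1..n. indicat_real {real (k - 1) * dt<..real k * dt} s * f (real l * dt - real k * dt)) =
        indicator {0<..N} s * f (real l * dt - grid dt s)" for l
      using sum_indicator_grid[OF Delta(1), where \<phi> = "\<lambda>t. f (real l * dt - t)" and n = n and s = s]
      unfolding N_def real_scaleR_def .
    then show ?thesis unfolding form2_eq kernel_of_def by simp
  qed
  show ?thesis
  proof (cases "s \<in> {0<..N}")
    case True
    have "dt * (\<Sum>l=1..n. (f (real l * dt - s) - f (real l * dt - grid dt s))\<^sup>2) \<le>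
        dt * (\<Sum>l=1..n. \<omega> * (\<bar>f (real l * dt - s)\<bar> + \<bar>f (real l * dt - grid dt s)\<bar>))"
    proof (intro mult_left_mono sum_mono)
      fix l
      have "\<bar>(real l * dt - s) - (real l * dt - grid dt s)\<bar> < dt"
        using grid_bounds[OF Delta(1), of s] by auto
      then have "\<bar>f (real l * dt - s) - f (real l * dt - grid dt s)\<bar> \<le> \<omega>" by (rule \<omega>(2))
      then have "\<bar>f (real l * dt - s) - f (real l * dt - grid dt s)\<bar> * \<bar>f (real l * dt - s) - f (real l * dt - grid dt s)\<bar> \<le>
          \<omega> * (\<bar>f (real l * dt - s)\<bar> + \<bar>f (real l * dt - grid dt s)\<bar>)"
        using \<omega>(1) by (intro mult_mono) auto
      then show "(f (real l * dt - s) - f (real l * dt - grid dt s))\<^sup>2 \<le> \<omega> * (\<bar>f (real l * dt - s)\<bar> + \<bar>f (real l * dt - grid dt s)\<bar>)"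
        by (simp add: power2_eq_square)
    qed (use Delta in auto)
    also have "\<dots> = \<omega> * (dt * (\<Sum>l=1..n. \<bar>f (real l * dt - s)\<bar>) + dt * (\<Sum>l=1..n. \<bar>f (real l * dt - grid dt s)\<bar>))"
      by (simp add: sum_distrib_left[symmetric] sum.distrib algebra_simps)
    also have "\<dots> \<le> \<omega> * (R0 + R0)"
      unfolding R0_def using \<omega>(1) by (intro mult_left_mono add_mono sum_abs_bounded Delta) auto
    finally have "integral_form.form (count_space {()}) noise_index {1..n} (\<lambda>_. dt) coef2 (\<lambda>i. kernel_of i s) \<le> 2 * R0 * \<omega>"
      unfolding eq using True by (simp add: mult.commute)
    also have "\<dots> \<le> (2 * R0 * \<omega>) * indicator {0<..N} s + (N * C\<^sup>2) * (envelope r (edge_dist N s))\<^sup>2"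
      using True N_pos by simp
    finally show ?thesis .
  next
    case False
    have "dt * (\<Sum>l=1..n. (f (real l * dt - s))\<^sup>2) \<le> dt * (\<Sum>l=1..n. (C * envelope r (edge_dist N s))\<^sup>2)"
    proof (intro mult_left_mono sum_mono)
      fix l assume l: "l \<in> {1..n}"
      have lN: "0 < real l * dt" "real l * dt \<le> N" using l Delta unfolding N_def by auto
      then have "\<bar>edge_dist N s\<bar> \<le> \<bar>real l * dt - s\<bar>" using False by (auto simp: edge_dist_def)
      then have "\<bar>f (real l * dt - s)\<bar> \<le> C * envelope r (edge_dist N s)"
        using C_nonneg r by (intro order.trans[OF decay mult_left_mono[OF envelope_antimono]]) auto
      then have "\<bar>f (real l * dt - s)\<bar>\<^sup>2 \<le> (C * envelope r (edge_dist N s))\<^sup>2" by (intro power_mono) auto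
      then show "(f (real l * dt - s))\<^sup>2 \<le> (C * envelope r (edge_dist N s))\<^sup>2" by simp
    qed (use Delta in auto)
    also have "\<dots> = (N * C\<^sup>2) * (envelope r (edge_dist N s))\<^sup>2"
      by (simp add: N_def power_mult_distrib)
    finally show ?thesis unfolding eq using False by simp
  qed
qed

lemma Q2_measurable [measurable]: "Q2 \<in> borel_measurable M"
proof -
  have "(\<lambda>w. integral_form.form (count_space {()}) noise_index {1..n} (\<lambda>_. dt) coef2 (\<lambda>i. var_of i w)) \<in> borel_measurable M"
    by (rule integral_form_measurable[OF form2]) (rule var_of_measurable)
  then show ?thesis unfolding form2_var_of .
qed

lemma Q2_nonneg: "Q2 w \<ge> 0"
  unfolding Q2_def using Delta by (intro mult_nonneg_nonneg sum_nonneg) auto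

lemma Q2_tail:
  assumes r\<alpha>: "r * \<alpha> > 1" and x: "x > 0"
  shows "prob {w\<in>space M. Q2 w > x\<^sup>2} \<le>
    48 * (N * (2 * R0 * \<omega>) powr (\<alpha>/2) + 4 / (r * \<alpha> - 1) * (N * C\<^sup>2) powr (\<alpha>/2)) / x powr \<alpha>"
  unfolding form2_var_of[symmetric]
proof (rule integral_form_tail[OF form2 kernel_of_measurable var_of_integral x _ _ _ r\<alpha> form2_kernel_of])
  show "0 \<le> N" using N_pos by simp
  show "0 \<le> 2 * R0 * \<omega>" using R0_nonneg \<omega> by simp
  show "0 \<le> N * C\<^sup>2" using N_pos by simp
qed

end

section \<open>Error terms for a fixed number of observations\<close>

text \<open>The transform has a bounded derivative because |x| |h x| decays at the rate r - 1 >
  1.\<close>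

lemma (in decaying) FT_lipschitz:
  assumes r2: "r > 2"
  shows "norm (FT h u - FT h v) \<le> 2 * C / (r - 2) * \<bar>u - v\<bar>"
proof -
  have int: "integrable lborel (\<lambda>x. of_real (h x) * cis (x * u) - of_real (h x) * cis (x * v))"
    using integrable_FT by (intro Bochner_Integration.integrable_diff)
  let ?e1 = "\<lambda>x. of_real (h x) * cis (x * u) - of_real (h x) * cis (x * v)"
  have "FT h u - FT h v = (LINT x|lborel. of_real (h x) * cis (x * u) - of_real (h x) * cis (x * v))"
    unfolding FT_def using integrable_FT by (intro Bochner_Integration.integral_diff[symmetric])
  then have "ennreal (norm (FT h u - FT h v)) \<le> (\<integral>\<^sup>+ x. norm (?e1 x) \<partial>lborel)"
    using integral_norm_bound_ennreal[OF int] by simp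
  also have "\<dots> \<le> (\<integral>\<^sup>+ x. ennreal (C * \<bar>u - v\<bar>) * ennreal (envelope (r - 1) x) \<partial>lborel)"
  proof (rule nn_integral_mono)
    fix x
    have "norm (?e1 x) = \<bar>h x\<bar> * norm (cis (x * u) - cis (x * v))"
      by (simp add: norm_mult right_diff_distrib[symmetric])
    also have "\<dots> \<le> (C * envelope r x) * \<bar>x * u - x * v\<bar>"
      using decay[of x] by (intro mult_mono norm_cis_diff_le) auto
    also have "\<dots> = C * \<bar>u - v\<bar> * (envelope r x * \<bar>x\<bar>)"
      by (simp add: abs_mult right_diff_distrib[symmetric])
    also have "\<dots> \<le> C * \<bar>u - v\<bar> * envelope (r - 1) x"
    proof (intro mult_left_mono)
      have "envelope r x * \<bar>x\<bar> \<le> envelope r x * (1 + \<bar>x\<bar>)" by (intro mult_left_mono) auto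
      also have "\<dots> = envelope (r - 1) x"
        unfolding envelope_def using powr_mult_base[of "1 + \<bar>x\<bar>" "- r"] by (simp add: mult.commute)
      finally show "envelope r x * \<bar>x\<bar> \<le> envelope (r - 1) x" .
    qed (use C_nonneg in auto)
    finally have "ennreal (norm (?e1 x)) \<le> ennreal (C * \<bar>u - v\<bar> * envelope (r - 1) x)"
      by (rule ennreal_leI)
    also have "\<dots> = ennreal (C * \<bar>u - v\<bar>) * ennreal (envelope (r - 1) x)"
      using C_nonneg by (intro ennreal_mult) auto
    finally show "ennreal (norm (?e1 x)) \<le> ennreal (C * \<bar>u - v\<bar>) * ennreal (envelope (r - 1) x)" .
  qed
  also have "\<dots> = ennreal (C * \<bar>u - v\<bar>) * (\<integral>\<^sup>+ x. ennreal (envelope (r - 1) x) \<partial>lborel)"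
    by (rule nn_integral_cmult) measurable
  also have "\<dots> \<le> ennreal (C * \<bar>u - v\<bar>) * ennreal (2 / (r - 1 - 1))"
    using r2 by (intro mult_left_mono nn_integral_envelope) auto
  also have "\<dots> = ennreal (2 * C / (r - 2) * \<bar>u - v\<bar>)"
    using C_nonneg r2 by (subst ennreal_mult[symmetric]) (auto simp: mult_ac)
  finally show ?thesis using C_nonneg r2 by (subst (asm) ennreal_le_iff) auto
qed

text \<open>Tonelli's theorem. A non-integrable inner function has Bochner integral 0, which agrees
  with the direction of the inequality.\<close>

lemma (in prob_space) nn_integral_LINT_le:
  fixes g :: "'a \<Rightarrow> 'b \<Rightarrow> real"
  assumes \<mu>: "finite_measure \<mu>" and g: "(\<lambda>(w, \<theta>). g w \<theta>) \<in> borel_measurable (M \<Otimes>\<^sub>M \<mu>)"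
    and nonneg: "\<And>w \<theta>. g w \<theta> \<ge> 0"
    and le: "\<And>\<theta>. \<theta> \<in> space \<mu> \<Longrightarrow> (\<integral>\<^sup>+ w. ennreal (g w \<theta>) \<partial>M) \<le> b \<theta>"
  shows "(\<integral>\<^sup>+ w. ennreal (LINT \<theta>|\<mu>. g w \<theta>) \<partial>M) \<le> (\<integral>\<^sup>+ \<theta>. b \<theta> \<partial>\<mu>)"
proof -
  interpret \<mu>: finite_measure \<mu> by fact
  interpret P: pair_sigma_finite M \<mu> ..
  note [measurable] = g
  have "ennreal (LINT \<theta>|\<mu>. g w \<theta>) \<le> (\<integral>\<^sup>+ \<theta>. ennreal (g w \<theta>) \<partial>\<mu>)" if "w \<in> space M" for w
  proof -
    have "(LINT \<theta>|\<mu>. g w \<theta>) = enn2real (\<integral>\<^sup>+ \<theta>. ennreal (g w \<theta>) \<partial>\<mu>)"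
      using that nonneg by (intro integral_eq_nn_integral) auto
    then show ?thesis by (simp add: ennreal_enn2real_if)
  qed
  then have "(\<integral>\<^sup>+ w. ennreal (LINT \<theta>|\<mu>. g w \<theta>) \<partial>M) \<le> (\<integral>\<^sup>+ w. (\<integral>\<^sup>+ \<theta>. ennreal (g w \<theta>) \<partial>\<mu>) \<partial>M)"
    by (rule nn_integral_mono)
  also have "\<dots> = (\<integral>\<^sup>+ \<theta>. (\<integral>\<^sup>+ w. ennreal (g w \<theta>) \<partial>M) \<partial>\<mu>)"
    by (rule P.Fubini'[symmetric]) measurable
  also have "\<dots> \<le> (\<integral>\<^sup>+ \<theta>. b \<theta> \<partial>\<mu>)" by (rule nn_integral_mono[OF le])
  finally show ?thesis .
qed

lemma snd_band_measurable [measurable]: "snd \<in> borel_measurable (M \<Otimes>\<^sub>M band a)"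
  by (rule measurable_compose[OF measurable_snd]) measurable

locale estimator_window = window M \<alpha> \<Lambda> f C r X n dt m W \<omega> a
  for M :: "'w measure" and \<alpha> \<Lambda> f C r X n dt m W \<omega> a +
  fixes wm :: real
  assumes even: "\<And>x. f (- x) = f x" and r2: "r > 2" and w_max: "\<And>k. k \<in> {- int m..int m} \<Longrightarrow> W k \<le> wm"
begin

section \<open>Noise periodogram and mean values of the error terms\<close>

sublocale noise: iid_SaS_seq M \<alpha> dt n xi
proof
  let ?B = "\<lambda>k. {real (k - 1) * dt<..real k * dt}"
  show "finite {1..n}" by simp
  have disj: "disjoint_family_on ?B {1..n}"
  proof (unfold disjoint_family_on_def, intro ballI impI)
    fix k l assume "k \<in> {1..n}" "l \<in> {1..n}" "k \<noteq> l"
    then have "real k \<le> real (l - 1) \<or> real l \<le> real (k - 1)" by auto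
    then have "real k * dt \<le> real (l - 1) * dt \<or> real l * dt \<le> real (k - 1) * dt" using Delta by auto
    then show "?B k \<inter> ?B l = {}" by auto
  qed
  show "indep_vars (\<lambda>_. borel) xi {1..n}"
    unfolding xi_def[abs_def] by (rule Lambda_indep) (use disj in auto)
  show "SaS_var M \<alpha> dt (xi k)" if "k \<in> {1..n}" for k
  proof -
    have "measure lborel (?B k) = dt"
      using Delta that by (simp add: of_nat_diff algebra_simps)
    then show ?thesis using Lambda_var[of "?B k"] unfolding xi_def by simp
  qed
  show "2 \<le> n" by (rule n_ge_2)
qed

definition D2 :: "'w \<Rightarrow> real" where "D2 w = (\<Sum>k=1..n. (xi k w)\<^sup>2)"

definition per :: "real \<Rightarrow> 'w \<Rightarrow> real" where
  "per u w = periodogram dt n (\<lambda>k. xi k w) u"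

definition Js :: "real \<Rightarrow> 'w \<Rightarrow> real" where
  "Js u w = smoothed_periodogram dt n m W (\<lambda>k. xi k w) u"

text \<open>\<open>Q3\<close> is the bias of smoothing, from moving FT f from the shifted frequency
  to u. \<open>Q4\<close> is the fluctuation of the smoothed noise periodogram, weighted by the
  power of the transform.\<close>

definition Q3 :: "'w \<Rightarrow> real" where
  "Q3 w = (LINT u|band a. (\<Sum>k=- int m..int m. W k * ((norm (FT f (freq u k) - FT f u))\<^sup>2 * per (freq u k) w)))"

definition Q4 :: "'w \<Rightarrow> real" where
  "Q4 w = (LINT u|band a. (norm (FT f u))\<^sup>2 * (Js u w - (\<Sum>j=1..n. (noise.r j w)\<^sup>2))\<^sup>2)"

lemma D2_measurable [measurable]: "D2 \<in> borel_measurable M"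
  unfolding D2_def by measurable

lemma D2_nonneg: "D2 w \<ge> 0"
  unfolding D2_def by (intro sum_nonneg) auto

lemma per_eq: "per u w = (norm (Sxi u w))\<^sup>2 / D2 w"
  unfolding per_def periodogram_def Sxi_def D2_def cis_conv_exp ..

lemma Js_eq: "Js u w = (\<Sum>k=- int m..int m. W k * per (freq u k) w)"
  unfolding Js_def smoothed_periodogram_def per_def freq_def ..

lemma per_nonneg: "per u w \<ge> 0"
  unfolding per_eq using D2_nonneg by simp

lemma per_measurable [measurable (raw)]:
  assumes [measurable]: "g \<in> borel_measurable L" "h \<in> measurable L M"
  shows "(\<lambda>x. per (g x) (h x)) \<in> borel_measurable L"
  unfolding per_eq Sxi_def by measurable

lemma Js_measurable [measurable (raw)]:
  assumes [measurable]: "g \<in> borel_measurable L" "h \<in> measurable L M"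
  shows "(\<lambda>x. Js (g x) (h x)) \<in> borel_measurable L"
  unfolding Js_eq freq_def by measurable

lemma integrable_per: "integrable M (\<lambda>w. per u w)"
proof (rule integrable_const_bound[where B = "(\<Sum>p=1..n. \<Sum>q=1..n. 1)"])
  show "AE w in M. norm (per u w) \<le> (\<Sum>p=1..n. \<Sum>q=1..n. 1)"
  proof (rule AE_I2)
    fix w
    have "per u w = (\<Sum>p=1..n. \<Sum>q=1..n. noise.r p w * noise.r q w * cos ((real p - real q) * (dt * u)))"
      unfolding per_def periodogram_eq_self_norm noise.r_def ..
    also have "\<dots> \<le> (\<Sum>p=1..n. \<Sum>q=1..n. 1)"
    proof (intro sum_mono)
      fix p q assume "p \<in> {1..n}" "q \<in> {1..n}"
      then have "\<bar>noise.r p w * noise.r q w\<bar> * \<bar>cos ((real p - real q) * (dt * u))\<bar> \<le> 1 * 1"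
        by (intro mult_mono noise.abs_rr_le_1 abs_cos_le_one) auto
      then show "noise.r p w * noise.r q w * cos ((real p - real q) * (dt * u)) \<le> 1"
        by (simp add: abs_mult[symmetric] abs_le_iff)
    qed
    finally show "norm (per u w) \<le> (\<Sum>p=1..n. \<Sum>q=1..n. 1)" using per_nonneg[of u w] by simp
  qed
qed measurable

lemma nn_integral_per: "(\<integral>\<^sup>+ w. ennreal (per u w) \<partial>M) \<le> 1"
proof -
  have "(\<integral>\<^sup>+ w. ennreal (per u w) \<partial>M) = ennreal (expectation (\<lambda>w. per u w))"
    using per_nonneg by (intro nn_integral_eq_integral integrable_per) auto
  also have "\<dots> \<le> ennreal 1"
    unfolding per_def by (intro ennreal_leI noise.expectation_periodogram_le)
  finally show ?thesis by simp
qed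

lemma Q3_nonneg: "Q3 w \<ge> 0"
  unfolding Q3_def using W per_nonneg by (intro integral_nonneg_AE AE_I2 sum_nonneg mult_nonneg_nonneg) auto

lemma Q4_nonneg: "Q4 w \<ge> 0"
  unfolding Q4_def by (intro integral_nonneg_AE AE_I2 mult_nonneg_nonneg) auto

lemma Q3_joint: "(\<lambda>(w, u). \<Sum>k=- int m..int m. W k * ((norm (FT f (freq u k) - FT f u))\<^sup>2 * per (freq u k) w)) \<in> borel_measurable (M \<Otimes>\<^sub>M band a)"
  unfolding freq_def case_prod_beta' by measurable

lemma Q4_joint: "(\<lambda>(w, u). (norm (FT f u))\<^sup>2 * (Js u w - (\<Sum>j=1..n. (noise.r j w)\<^sup>2))\<^sup>2) \<in> borel_measurable (M \<Otimes>\<^sub>M band a)"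
  unfolding case_prod_beta' by measurable

lemma Q3_measurable [measurable]: "Q3 \<in> borel_measurable M"
proof -
  interpret finite_measure "band a" by (rule finite_measure_band)
  show ?thesis unfolding Q3_def by (rule borel_measurable_lebesgue_integral[OF Q3_joint])
qed

lemma Q4_measurable [measurable]: "Q4 \<in> borel_measurable M"
proof -
  interpret finite_measure "band a" by (rule finite_measure_band)
  show ?thesis unfolding Q4_def by (rule borel_measurable_lebesgue_integral[OF Q4_joint])
qed

text \<open>Each noise periodogram has mean at most 1, so only the Lipschitz bound for a shift by
  |k| / N enters; averaging its square over the weights produces W2.\<close>

lemma nn_integral_Q3:
  "(\<integral>\<^sup>+ w. ennreal (Q3 w) \<partial>M) \<le> ennreal (2 * a * (2 * C / (r - 2))\<^sup>2 * (W2 / N\<^sup>2))"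
proof -
  let ?K = "{- int m..int m}" and ?L = "2 * C / (r - 2)"
  have L: "?L \<ge> 0" using C_nonneg r2 by simp
  let ?e1 = "\<lambda>u k. norm (FT f (freq u k) - FT f u)"
  let ?e2 = "\<lambda>u w. \<Sum>k\<in>?K. W k * ((?e1 u k)\<^sup>2 * per (freq u k) w)"
  have "(\<integral>\<^sup>+ w. ennreal (Q3 w) \<partial>M) \<le> (\<integral>\<^sup>+ u. ennreal (?L\<^sup>2 * (W2 / N\<^sup>2)) \<partial>band a)"
    unfolding Q3_def
  proof (rule nn_integral_LINT_le[OF finite_measure_band Q3_joint])
    show "0 \<le> (?e2 u w)" for w u
      using W per_nonneg by (intro sum_nonneg mult_nonneg_nonneg) auto
    fix u
    have "(\<integral>\<^sup>+ w. ennreal (?e2 u w) \<partial>M) =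
       (\<integral>\<^sup>+ w. (\<Sum>k\<in>?K. ennreal (W k * (?e1 u k)\<^sup>2) * ennreal (per (freq u k) w)) \<partial>M)"
    proof (intro nn_integral_cong)
      fix w
      have "ennreal (?e2 u w) =
          (\<Sum>k\<in>?K. ennreal (W k * ((?e1 u k)\<^sup>2 * per (freq u k) w)))"
        using W per_nonneg by (intro sum_ennreal[symmetric] mult_nonneg_nonneg) auto
      also have "\<dots> = (\<Sum>k\<in>?K. ennreal (W k * (?e1 u k)\<^sup>2) * ennreal (per (freq u k) w))"
        using W per_nonneg by (intro sum.cong refl) (simp add: ennreal_mult[symmetric] mult.assoc)
      finally show "ennreal (?e2 u w) =
          (\<Sum>k\<in>?K. ennreal (W k * (?e1 u k)\<^sup>2) * ennreal (per (freq u k) w))" .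
    qed
    also have "\<dots> = (\<Sum>k\<in>?K. ennreal (W k * (?e1 u k)\<^sup>2) * (\<integral>\<^sup>+ w. ennreal (per (freq u k) w) \<partial>M))"
      by (subst nn_integral_sum) (auto simp: nn_integral_cmult)
    also have "\<dots> \<le> (\<Sum>k\<in>?K. ennreal (?L\<^sup>2 / N\<^sup>2 * ((of_int k)\<^sup>2 * W k)) * 1)"
    proof (rule sum_mono)
      fix k assume k: "k \<in> ?K"
      have "norm (FT f (freq u k) - FT f u) \<le> ?L * \<bar>freq u k - u\<bar>" by (rule FT_lipschitz[OF r2])
      also have "freq u k - u = of_int k / N" by (simp add: freq_def N_def)
      finally have "(?e1 u k)\<^sup>2 \<le> (?L * \<bar>of_int k / N\<bar>)\<^sup>2" by (intro power_mono) auto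
      also have "\<dots> = ?L\<^sup>2 / N\<^sup>2 * (of_int k)\<^sup>2" by (simp add: power_mult_distrib power_divide)
      finally have "W k * (?e1 u k)\<^sup>2 \<le> W k * (?L\<^sup>2 / N\<^sup>2 * (of_int k)\<^sup>2)"
        using W[OF k] by (rule mult_left_mono)
      then have le: "W k * (?e1 u k)\<^sup>2 \<le> ?L\<^sup>2 / N\<^sup>2 * ((of_int k)\<^sup>2 * W k)"
        by (simp add: mult_ac)
      show "ennreal (W k * (?e1 u k)\<^sup>2) * (\<integral>\<^sup>+ w. ennreal (per (freq u k) w) \<partial>M)
          \<le> ennreal (?L\<^sup>2 / N\<^sup>2 * ((of_int k)\<^sup>2 * W k)) * 1"
        by (rule mult_mono[OF ennreal_leI[OF le] nn_integral_per]) auto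
    qed
    also have "\<dots> = ennreal (\<Sum>k\<in>?K. ?L\<^sup>2 / N\<^sup>2 * ((of_int k)\<^sup>2 * W k))"
      unfolding mult_1_right using W by (intro sum_ennreal mult_nonneg_nonneg) auto
    also have "\<dots> = ennreal (?L\<^sup>2 * (W2 / N\<^sup>2))"
      unfolding W2_def weight_second_moment_def by (simp only: sum_distrib_left[symmetric]) simp
    finally show "(\<integral>\<^sup>+ w. ennreal (?e2 u w) \<partial>M) \<le> ennreal (?L\<^sup>2 * (W2 / N\<^sup>2))" .
  qed
  also have "\<dots> = ennreal (?L\<^sup>2 * (W2 / N\<^sup>2)) * ennreal (2 * a)"
    using a by (simp add: emeasure_restrict_space)
  also have "\<dots> = ennreal (2 * a * ?L\<^sup>2 * (W2 / N\<^sup>2))"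
    using a W2_nonneg by (subst ennreal_mult[symmetric]) (auto simp: mult_ac)
  finally show ?thesis .
qed

text \<open>The variance bound is uniform in u, so |FT f|^2 is integrated over the whole line, and
  the band length does not appear in the bound.\<close>

lemma nn_integral_Q4:
  assumes F2: "integrable lborel (\<lambda>u. (norm (FT f u))\<^sup>2)"
  shows "(\<integral>\<^sup>+ w. ennreal (Q4 w) \<partial>M) \<le> ennreal (260 * wm * (LINT u|lborel. (norm (FT f u))\<^sup>2))"
proof -
  let ?R = "\<lambda>w. \<Sum>j=1..n. (noise.r j w)\<^sup>2"
  have wm: "wm \<ge> 0" using w_max[of 0] W[of 0] by simp
  let ?e1 = "\<lambda>u. \<integral>\<^sup>+ w. ennreal ((Js u w - ?R w)\<^sup>2) \<partial>M"
  let ?e2 = "\<lambda>u. \<integral>\<^sup>+ w. ennreal ((norm (FT f u))\<^sup>2 * (Js u w - ?R w)\<^sup>2) \<partial>M"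
  have "(\<integral>\<^sup>+ w. ennreal (Q4 w) \<partial>M) \<le> (\<integral>\<^sup>+ u. ennreal (260 * wm) * ennreal ((norm (FT f u))\<^sup>2) \<partial>band a)"
    unfolding Q4_def
  proof (rule nn_integral_LINT_le[OF finite_measure_band Q4_joint])
    fix u
    \<comment> \<open>A crude bound, for integrability only.\<close>
    have bnd: "\<bar>Js u w - ?R w\<bar> \<le> real n * real n + 1" for w
    proof -
      have le: "per v w \<le> real n * real n" for v
      proof -
        have "per v w = (\<Sum>p=1..n. \<Sum>q=1..n. noise.r p w * noise.r q w * cos ((real p - real q) * (dt * v)))"
          unfolding per_def periodogram_eq_self_norm noise.r_def ..
        also have "\<dots> \<le> (\<Sum>p=1..n. \<Sum>q=1..n. 1)"
        proof (intro sum_mono)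
          fix p q assume "p \<in> {1..n}" "q \<in> {1..n}"
          then have "\<bar>noise.r p w * noise.r q w\<bar> * \<bar>cos ((real p - real q) * (dt * v))\<bar> \<le> 1 * 1"
            by (intro mult_mono noise.abs_rr_le_1 abs_cos_le_one) auto
          then show "noise.r p w * noise.r q w * cos ((real p - real q) * (dt * v)) \<le> 1"
            by (simp add: abs_mult[symmetric] abs_le_iff)
        qed
        finally show ?thesis by simp
      qed
      have "Js u w \<le> (\<Sum>k=- int m..int m. W k * (real n * real n))"
        unfolding Js_eq using W le by (intro sum_mono mult_left_mono) auto
      also have "\<dots> = real n * real n" using sum_W by (simp add: sum_distrib_right[symmetric])
      finally have "Js u w \<le> real n * real n" .
      moreover have "Js u w \<ge> 0" unfolding Js_eq using W per_nonneg by (intro sum_nonneg mult_nonneg_nonneg) auto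
      moreover have "?R w \<ge> 0" by (intro sum_nonneg) auto
      moreover have "?R w \<le> 1" by (rule noise.sum_r_squares(1))
      moreover have "real n * real n \<ge> 0" by simp
      ultimately show ?thesis unfolding abs_le_iff by linarith
    qed
    have int: "integrable M (\<lambda>w. (Js u w - ?R w)\<^sup>2)"
    proof (rule integrable_const_bound[where B = "(real n * real n + 1)\<^sup>2"])
      show "AE w in M. norm ((Js u w - ?R w)\<^sup>2) \<le> (real n * real n + 1)\<^sup>2"
        using bnd by (intro AE_I2) (simp only: real_norm_def power_abs, rule power_mono, auto)
    qed measurable
    have "(?e2 u) =
       ennreal ((norm (FT f u))\<^sup>2) * (?e1 u)"
    proof -
      have [measurable]: "(\<lambda>w. (Js u w - ?R w)\<^sup>2) \<in> borel_measurable M" using int by (rule borel_measurable_integrable)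
      have "(?e2 u) =
         (\<integral>\<^sup>+ w. ennreal ((norm (FT f u))\<^sup>2) * ennreal ((Js u w - ?R w)\<^sup>2) \<partial>M)"
        by (intro nn_integral_cong ennreal_mult) auto
      also have "\<dots> = ennreal ((norm (FT f u))\<^sup>2) * (?e1 u)"
        by (rule nn_integral_cmult) measurable
      finally show ?thesis .
    qed
    also have "\<dots> \<le> ennreal ((norm (FT f u))\<^sup>2) * ennreal (260 * wm)"
    proof (rule mult_left_mono)
      have "(?e1 u) = ennreal (expectation (\<lambda>w. (Js u w - ?R w)\<^sup>2))"
        using int by (intro nn_integral_eq_integral) auto
      also have "\<dots> \<le> ennreal (260 * wm)"
        unfolding Js_def
        by (intro ennreal_leI noise.expectation_smoothed_periodogram) (use W w_max sum_W m Delta in auto)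
      finally show "(?e1 u) \<le> ennreal (260 * wm)" .
    qed simp
    finally show "(?e2 u) \<le> ennreal (260 * wm) * ennreal ((norm (FT f u))\<^sup>2)"
      by (simp add: mult.commute)
  qed auto
  also have "\<dots> = (\<integral>\<^sup>+ u. ennreal (260 * wm) * ennreal ((norm (FT f u))\<^sup>2) * indicator {-a..a} u \<partial>lborel)"
    by (subst nn_integral_restrict_space) auto
  also have "\<dots> \<le> (\<integral>\<^sup>+ u. ennreal (260 * wm) * ennreal ((norm (FT f u))\<^sup>2) \<partial>lborel)"
    by (intro nn_integral_mono) (auto simp: indicator_def)
  also have "\<dots> = ennreal (260 * wm) * (\<integral>\<^sup>+ u. ennreal ((norm (FT f u))\<^sup>2) \<partial>lborel)"
    by (rule nn_integral_cmult) measurable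
  also have "(\<integral>\<^sup>+ u. ennreal ((norm (FT f u))\<^sup>2) \<partial>lborel) = ennreal (LINT u|lborel. (norm (FT f u))\<^sup>2)"
    using F2 by (intro nn_integral_eq_integral) auto
  also have "ennreal (260 * wm) * ennreal (LINT u|lborel. (norm (FT f u))\<^sup>2) = ennreal (260 * wm * (LINT u|lborel. (norm (FT f u))\<^sup>2))"
    using wm by (intro ennreal_mult[symmetric]) auto
  finally show ?thesis .
qed

end

text \<open>Near the ends of the interval a single Riemann sum may be far from the transform. The
  edge terms are values of an envelope of exponent r - 1 > 1 on the grid, so their average over p is
  of order 1 / (n dt).\<close>

lemma (in decaying) grid_average:
  assumes r2: "r > 2" and dt: "0 < dt" "dt \<le> 1" and w: "w \<ge> 0" "\<And>x y. \<bar>x - y\<bar> < dt \<Longrightarrow> \<bar>h x - h y\<bar> \<le> w"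
    and N: "real n * dt \<ge> 1"
  shows "(\<Sum>p=1..n. norm (of_real dt * (\<Sum>j=1..n. of_real (h (real j * dt - real p * dt)) * cis ((real j * dt - real p * dt) * u)) - FT h u)) / n
    \<le> riemann_const C r * (w powr (1 - 1/r) + dt * \<bar>u\<bar> + 2 * riemann_const 1 (r - 1) / (real n * dt))"
proof -
  interpret env: decaying "envelope (r - 1)" 1 "r - 1"
    by unfold_locales (use r2 in auto)
  have n: "n > 0" using N by (cases n) auto
  let ?R = "riemann_const C r" and ?N = "real n * dt" and ?R1 = "riemann_const 1 (r - 1)"
  have R: "?R \<ge> 0" unfolding riemann_const_def using C_nonneg r by (intro add_nonneg_nonneg mult_nonneg_nonneg) auto
  have each: "norm (of_real dt * (\<Sum>j=1..n. of_real (h (real j * dt - real p * dt)) * cis ((real j * dt - real p * dt) * u)) - FT h u)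
     \<le> ?R * (w powr (1 - 1/r) + dt * \<bar>u\<bar> + (\<bar>envelope (r - 1) (real p * dt - 0)\<bar> + \<bar>envelope (r - 1) (real p * dt - ?N)\<bar>))"
    if p: "p \<in> {1..n}" for p
  proof -
    let ?s = "real p * dt"
    have s: "?s \<in> {0<..?N}" using p dt by auto
    have g: "grid dt ?s = ?s" using p grid_eq[OF dt(1), of ?s "p - 1"] dt by (auto simp: of_nat_diff)
    have "norm (of_real dt * (\<Sum>j=1..n. of_real (h (real j * dt - ?s)) * cis ((real j * dt - ?s) * u)) - FT h u) =
       norm (cis (- (?s * u)) * (of_real dt * (\<Sum>j=1..n. of_real (h (real j * dt - ?s)) * cis (real j * dt * u)) - FT h u * cis (?s * u)))"
    proof -
      let ?Z = "cis (- (?s * u))"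
      have "cis ((real j * dt - ?s) * u) = ?Z * cis (real j * dt * u)" for j
        by (simp add: cis_mult algebra_simps)
      then have 1: "(\<Sum>j=1..n. of_real (h (real j * dt - ?s)) * cis ((real j * dt - ?s) * u)) =
          ?Z * (\<Sum>j=1..n. of_real (h (real j * dt - ?s)) * cis (real j * dt * u))"
        unfolding sum_distrib_left by (intro sum.cong refl) (simp only: mult.left_commute)
      have "?Z * cis (?s * u) = 1" by (simp add: cis_mult)
      then have 2: "?Z * (FT h u * cis (?s * u)) = FT h u" by (simp only: mult.left_commute[of ?Z] mult_1_right)
      show ?thesis unfolding 1 right_diff_distrib 2 mult.left_commute[of "of_real dt" ?Z] ..
    qed
    also have "\<dots> = norm (of_real dt * (\<Sum>j=1..n. of_real (h (real j * dt - ?s)) * cis (real j * dt * u)) - FT h u * cis (?s * u))"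
      by (simp add: norm_mult)
    also have "\<dots> \<le> ?R * (w powr (1 - 1/r) + dt * \<bar>u\<bar> + envelope (r - 1) (edge_dist ?N ?s))"
      using riemann_sum[OF dt w N, of 0 ?s u] s g n dt by simp
    also have "\<dots> \<le> ?R * (w powr (1 - 1/r) + dt * \<bar>u\<bar> + (\<bar>envelope (r - 1) (?s - 0)\<bar> + \<bar>envelope (r - 1) (?s - ?N)\<bar>))"
      using R envelope_edge_le[of "r - 1" ?N ?s] by (intro mult_left_mono add_left_mono) auto
    finally show ?thesis .
  qed
  have "(\<Sum>p=1..n. norm (of_real dt * (\<Sum>j=1..n. of_real (h (real j * dt - real p * dt)) * cis ((real j * dt - real p * dt) * u)) - FT h u))
     \<le> (\<Sum>p=1..n. ?R * (w powr (1 - 1/r) + dt * \<bar>u\<bar> + (\<bar>envelope (r - 1) (real p * dt - 0)\<bar> + \<bar>envelope (r - 1) (real p * dt - ?N)\<bar>)))"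
    by (rule sum_mono[OF each])
  also have "\<dots> = ?R * (n * (w powr (1 - 1/r) + dt * \<bar>u\<bar>) + ((\<Sum>p=1..n. \<bar>envelope (r - 1) (real p * dt - 0)\<bar>) + (\<Sum>p=1..n. \<bar>envelope (r - 1) (real p * dt - ?N)\<bar>)))"
    by (simp only: sum_distrib_left[symmetric] sum.distrib sum_constant) (simp add: algebra_simps)
  also have "\<dots> \<le> ?R * (n * (w powr (1 - 1/r) + dt * \<bar>u\<bar>) + (?R1 / dt + ?R1 / dt))"
  proof -
    have bnd: "(\<Sum>p=1..n. \<bar>envelope (r - 1) (real p * dt - s)\<bar>) \<le> ?R1 / dt" for s
      using env.sum_abs_bounded[OF dt, where n = n and s = s] dt by (simp add: pos_le_divide_eq mult.commute)
    show ?thesis by (intro mult_left_mono add_left_mono add_mono bnd R)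
  qed
  finally have "(\<Sum>p=1..n. norm (of_real dt * (\<Sum>j=1..n. of_real (h (real j * dt - real p * dt)) * cis ((real j * dt - real p * dt) * u)) - FT h u)) / n
     \<le> ?R * (n * (w powr (1 - 1/r) + dt * \<bar>u\<bar>) + (?R1 / dt + ?R1 / dt)) / n"
    by (rule divide_right_mono) simp
  also have "\<dots> = ?R * (w powr (1 - 1/r) + dt * \<bar>u\<bar> + 2 * ?R1 / ?N)"
    using n dt by (simp add: field_simps)
  finally show ?thesis .
qed

text \<open>The reverse triangle inequality of a weighted l2 norm, with the roots of the weights
  absorbed into the vectors.\<close>

lemma weighted_l2_diff_le:
  fixes x y :: "'k \<Rightarrow> complex"
  assumes W: "\<And>k. k \<in> K \<Longrightarrow> W k \<ge> 0"
  shows "\<bar>sqrt (\<Sum>k\<in>K. W k * (norm (x k))\<^sup>2) - sqrt (\<Sum>k\<in>K. W k * (norm (y k))\<^sup>2)\<bar> \<le> sqrt (\<Sum>k\<in>K. W k * (norm (x k - y k))\<^sup>2)"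
proof -
  have eq: "sqrt (\<Sum>k\<in>K. W k * (norm (z k))\<^sup>2) = L2_set (\<lambda>k. sqrt (W k) * norm (z k)) K" for z :: "'k \<Rightarrow> complex"
    unfolding L2_set_def using W by (intro arg_cong[where f = sqrt] sum.cong refl) (simp add: power_mult_distrib)
  have tri: "L2_set (\<lambda>k. sqrt (W k) * norm (x k)) K \<le> L2_set (\<lambda>k. sqrt (W k) * norm (y k)) K + L2_set (\<lambda>k. sqrt (W k) * norm (x k - y k)) K"
    for x y :: "'k \<Rightarrow> complex"
  proof -
    have "L2_set (\<lambda>k. sqrt (W k) * norm (x k)) K \<le> L2_set (\<lambda>k. sqrt (W k) * norm (y k) + sqrt (W k) * norm (x k - y k)) K"
    proof (rule L2_set_mono)
      fix k assume "k \<in> K"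
      have "norm (x k) \<le> norm (y k) + norm (x k - y k)" by (metis add.commute norm_triangle_sub)
      then have "sqrt (W k) * norm (x k) \<le> sqrt (W k) * (norm (y k) + norm (x k - y k))"
        using W[OF \<open>k \<in> K\<close>] by (intro mult_left_mono) auto
      then show "sqrt (W k) * norm (x k) \<le> sqrt (W k) * norm (y k) + sqrt (W k) * norm (x k - y k)"
        by (simp add: distrib_left)
    qed (use W in auto)
    also have "\<dots> \<le> L2_set (\<lambda>k. sqrt (W k) * norm (y k)) K + L2_set (\<lambda>k. sqrt (W k) * norm (x k - y k)) K"
      by (rule L2_set_triangle_ineq)
    finally show ?thesis .
  qed
  show ?thesis unfolding eq using tri[of x y] tri[of y x] by (simp add: norm_minus_commute abs_le_iff)
qed

lemma integrable_band_continuous: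
  fixes g :: "real \<Rightarrow> real"
  assumes "continuous_on UNIV g"
  shows "integrable (band a) g"
proof -
  have "set_integrable lborel {-a..a} g"
    using assms by (intro borel_integrable_atLeastAtMost' continuous_on_subset[OF assms]) auto
  then show ?thesis
    by (subst integrable_restrict_space) (auto simp: set_integrable_def)
qed

section \<open>The normalized sum of squared observations and the error on the band\<close>

context estimator_window
begin

text \<open>The Gram matrix of the shifted and sampled kernels; its diagonal entries approximate the
  integral of f^2 away from the ends of the interval.\<close>

definition G :: "nat \<Rightarrow> nat \<Rightarrow> real" where
  "G p q = dt * (\<Sum>l=1..n. f (real l * dt - real p * dt) * f (real l * dt - real q * dt))"

definition L2f :: real where "L2f = (LINT x|lborel. (f x)\<^sup>2)"

definition T1 :: "'w \<Rightarrow> real" where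
  "T1 w = (\<Sum>p=1..n. (noise.r p w)\<^sup>2 * (G p p - L2f))"

definition T2 :: "'w \<Rightarrow> real" where
  "T2 w = (\<Sum>p\<in>noise.offdiag. G (fst p) (snd p) * (noise.r (fst p) w * noise.r (snd p) w))"

lemma r_eq: "noise.r p w = xi p w / sqrt (D2 w)"
  unfolding noise.r_def self_norm_def D2_def ..

text \<open>Expanding the squares of Xd gives a quadratic form in the self-normalized noise. The
  squared ratios sum to 1 here, so the constant L2f can be split off the diagonal.\<close>

lemma denominator_eq:
  assumes D: "D2 w > 0"
  shows "dt * (\<Sum>l=1..n. (Xd l w)\<^sup>2) / D2 w = L2f + T1 w + T2 w"
proof -
  have "dt * (\<Sum>l=1..n. (Xd l w)\<^sup>2) = (\<Sum>l=1..n. \<Sum>p=1..n. \<Sum>q=1..n. xi p w * xi q w * (dt * (f (real l * dt - real p * dt) * f (real l * dt - real q * dt))))"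
    by (simp add: Xd_def power2_eq_square sum_product sum_distrib_left mult_ac)
  also have "\<dots> = (\<Sum>p=1..n. \<Sum>l=1..n. \<Sum>q=1..n. xi p w * xi q w * (dt * (f (real l * dt - real p * dt) * f (real l * dt - real q * dt))))"
    by (rule sum.swap)
  also have "\<dots> = (\<Sum>p=1..n. \<Sum>q=1..n. \<Sum>l=1..n. xi p w * xi q w * (dt * (f (real l * dt - real p * dt) * f (real l * dt - real q * dt))))"
    by (intro sum.cong refl sum.swap)
  also have "\<dots> = (\<Sum>p=1..n. \<Sum>q=1..n. xi p w * xi q w * G p q)"
    by (simp only: G_def sum_distrib_left)
  finally have "dt * (\<Sum>l=1..n. (Xd l w)\<^sup>2) / D2 w = (\<Sum>p=1..n. \<Sum>q=1..n. xi p w * xi q w * G p q / D2 w)"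
    by (simp only: sum_divide_distrib)
  also have "\<dots> = (\<Sum>p=1..n. \<Sum>q=1..n. G p q * (noise.r p w * noise.r q w))"
    unfolding r_eq using D by (intro sum.cong refl) (simp add: field_simps)
  also have "\<dots> = (\<Sum>p=1..n. G p p * (noise.r p w * noise.r p w)) + T2 w"
    unfolding T2_def by (rule noise.sum_split_offdiag)
  also have "(\<Sum>p=1..n. G p p * (noise.r p w * noise.r p w)) = T1 w + L2f * (\<Sum>p=1..n. (noise.r p w)\<^sup>2)"
    unfolding T1_def sum_distrib_left sum.distrib[symmetric]
    by (intro sum.cong refl) (simp add: power2_eq_square algebra_simps)
  also have "(\<Sum>p=1..n. (noise.r p w)\<^sup>2) = 1"
    using noise.sum_r_squares(2) D unfolding D2_def by blast
  finally show ?thesis by simp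
qed

lemma T1_measurable [measurable]: "T1 \<in> borel_measurable M"
  unfolding T1_def using noise.r_measurable by measurable

lemma T2_measurable [measurable]: "T2 \<in> borel_measurable M"
proof -
  have [measurable]: "noise.r (fst p) \<in> borel_measurable M" "noise.r (snd p) \<in> borel_measurable M" if "p \<in> noise.offdiag" for p
    using that noise.r_measurable unfolding noise.offdiag_def by auto
  show ?thesis unfolding T2_def by measurable
qed

text \<open>The squared ratios have mean at most 1/n, so T1 is dominated by the grid average of the
  Riemann sum errors of f^2 at frequency 0. The oscillation of f^2 within a cell is at most 2 C
  \<omega>.\<close>

lemma nn_integral_T1:
  "(\<integral>\<^sup>+ w. ennreal \<bar>T1 w\<bar> \<partial>M) \<le> ennreal (riemann_const (C\<^sup>2) r * ((2 * C * \<omega>) powr (1 - 1/r) + 2 * riemann_const 1 (r - 1) / N))"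
proof -
  interpret f2: decaying "\<lambda>x. (f x)\<^sup>2" "C\<^sup>2" r
  proof
    show "\<bar>(f x)\<^sup>2\<bar> \<le> C\<^sup>2 * envelope r x" for x
      using mult_mono[OF abs_f_le_C[of x] decay[of x]] C_nonneg by (simp add: power2_eq_square mult.assoc abs_mult)
  qed (use r in auto)
  have mod: "\<bar>(f x)\<^sup>2 - (f y)\<^sup>2\<bar> \<le> 2 * C * \<omega>" if "\<bar>x - y\<bar> < dt" for x y
  proof -
    have "\<bar>(f x)\<^sup>2 - (f y)\<^sup>2\<bar> = \<bar>f x - f y\<bar> * \<bar>f x + f y\<bar>"
      by (simp add: abs_mult[symmetric] power2_eq_square algebra_simps)
    also have "\<dots> \<le> \<omega> * (2 * C)"
      using \<omega>(2)[OF that] abs_f_le_C[of x] abs_f_le_C[of y] \<omega>(1) by (intro mult_mono) auto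
    finally show ?thesis by (simp add: mult_ac)
  qed
  have int: "integrable M (\<lambda>w. (noise.r p w)\<^sup>2 * \<bar>G p p - L2f\<bar>)" if "p \<in> {1..n}" for p
    using noise.integrable_rr[OF that that] by (simp add: power2_eq_square)
  have FT0: "FT (\<lambda>x. (f x)\<^sup>2) 0 = of_real L2f"
    unfolding FT_def L2f_def by (simp add: integral_complex_of_real[symmetric] del: integral_complex_of_real)
  have "(\<integral>\<^sup>+ w. ennreal \<bar>T1 w\<bar> \<partial>M) \<le> (\<integral>\<^sup>+ w. ennreal (\<Sum>p=1..n. (noise.r p w)\<^sup>2 * \<bar>G p p - L2f\<bar>) \<partial>M)"
    unfolding T1_def by (intro nn_integral_mono ennreal_leI order.trans[OF sum_abs]) (simp add: abs_mult)
  also have "\<dots> = ennreal (expectation (\<lambda>w. \<Sum>p=1..n. (noise.r p w)\<^sup>2 * \<bar>G p p - L2f\<bar>))"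
    using int by (intro nn_integral_eq_integral Bochner_Integration.integrable_sum AE_I2 sum_nonneg) auto
  also have "expectation (\<lambda>w. \<Sum>p=1..n. (noise.r p w)\<^sup>2 * \<bar>G p p - L2f\<bar>) = (\<Sum>p=1..n. expectation (\<lambda>w. (noise.r p w)\<^sup>2) * \<bar>G p p - L2f\<bar>)"
    using int by (simp add: Bochner_Integration.integral_sum)
  also have "\<dots> \<le> (\<Sum>p=1..n. 1 / card {1..n} * \<bar>G p p - L2f\<bar>)"
    by (intro sum_mono mult_right_mono noise.expectation_r_square) auto
  also have "\<dots> = (\<Sum>p=1..n. \<bar>G p p - L2f\<bar>) / n"
    by (simp add: sum_divide_distrib)
  also have "(\<Sum>p=1..n. \<bar>G p p - L2f\<bar>) = (\<Sum>p=1..n. norm (of_real dt * (\<Sum>j=1..n. of_real ((f (real j * dt - real p * dt))\<^sup>2) * cis ((real j * dt - real p * dt) * 0)) - FT (\<lambda>x. (f x)\<^sup>2) 0))"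
  proof (intro sum.cong refl)
    fix p
    have "of_real dt * (\<Sum>j=1..n. of_real ((f (real j * dt - real p * dt))\<^sup>2) * cis ((real j * dt - real p * dt) * 0)) - FT (\<lambda>x. (f x)\<^sup>2) 0
       = complex_of_real (G p p - L2f)"
      unfolding FT0 G_def by (simp add: power2_eq_square)
    then show "\<bar>G p p - L2f\<bar> = norm (of_real dt * (\<Sum>j=1..n. of_real ((f (real j * dt - real p * dt))\<^sup>2) * cis ((real j * dt - real p * dt) * 0)) - FT (\<lambda>x. (f x)\<^sup>2) 0)"
      by (simp only: norm_of_real)
  qed
  also have "\<dots> / n \<le> riemann_const (C\<^sup>2) r * ((2 * C * \<omega>) powr (1 - 1/r) + dt * \<bar>0\<bar> + 2 * riemann_const 1 (r - 1) / (real n * dt))"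
    by (rule f2.grid_average[OF r2 Delta _ mod N_ge_1]) (use C_nonneg \<omega> in auto)
  finally show ?thesis by (simp add: N_def ennreal_leI)
qed

text \<open>The squares of the entries of G in a row sum to at most the uniform bound C R0 times a
  row sum of |G|. Row sums are at most R0^2 / dt, by evenness of f and two uses of the bound for
  Riemann sums of |f|. The number of pairs in the variance bound then leaves the order 1/N.\<close>

lemma nn_integral_T2:
  "(\<integral>\<^sup>+ w. ennreal ((T2 w)\<^sup>2) \<partial>M) \<le> ennreal (4 * C * R0 ^ 3 / N)"
proof -
  have Gsym: "G p q = G q p" for p q by (simp add: G_def mult.commute)
  have G1: "\<bar>G p q\<bar> \<le> dt * (\<Sum>l=1..n. \<bar>f (real l * dt - real p * dt)\<bar> * \<bar>f (real l * dt - real q * dt)\<bar>)" for p q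
    unfolding G_def abs_mult using Delta by (intro mult_mono order.trans[OF sum_abs]) (auto simp: abs_mult)
  have Gb: "\<bar>G p q\<bar> \<le> C * R0" for p q
  proof -
    have "\<bar>G p q\<bar> \<le> dt * (\<Sum>l=1..n. \<bar>f (real l * dt - real p * dt)\<bar> * C)"
      using Delta abs_f_le_C by (intro order.trans[OF G1] mult_left_mono sum_mono) auto
    also have "\<dots> = (dt * (\<Sum>l=1..n. \<bar>f (real l * dt - real p * dt)\<bar>)) * C" by (simp add: sum_distrib_right)
    also have "\<dots> \<le> R0 * C" unfolding R0_def using C_nonneg by (intro mult_right_mono sum_abs_bounded Delta)
    finally show ?thesis by (simp add: mult.commute)
  qed
  have Gs: "(\<Sum>q=1..n. \<bar>G p q\<bar>) \<le> R0 * (R0 / dt)" for p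
  proof -
    have "(\<Sum>q=1..n. \<bar>G p q\<bar>) \<le> (\<Sum>q=1..n. dt * (\<Sum>l=1..n. \<bar>f (real l * dt - real p * dt)\<bar> * \<bar>f (real l * dt - real q * dt)\<bar>))"
      by (intro sum_mono G1)
    also have "\<dots> = dt * (\<Sum>q=1..n. \<Sum>l=1..n. \<bar>f (real l * dt - real p * dt)\<bar> * \<bar>f (real l * dt - real q * dt)\<bar>)"
      by (rule sum_distrib_left[symmetric])
    also have "\<dots> = dt * (\<Sum>l=1..n. \<Sum>q=1..n. \<bar>f (real l * dt - real p * dt)\<bar> * \<bar>f (real l * dt - real q * dt)\<bar>)"
      by (subst sum.swap) (rule refl)
    also have "\<dots> = dt * (\<Sum>l=1..n. \<bar>f (real l * dt - real p * dt)\<bar> * (\<Sum>q=1..n. \<bar>f (real q * dt - real l * dt)\<bar>))"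
    proof -
      have "f (real l * dt - real q * dt) = f (real q * dt - real l * dt)" for l q
        using even[of "real q * dt - real l * dt"] by simp
      then show ?thesis by (simp only: sum_distrib_left)
    qed
    also have "\<dots> \<le> dt * (\<Sum>l=1..n. \<bar>f (real l * dt - real p * dt)\<bar> * (R0 / dt))"
    proof (intro mult_left_mono sum_mono)
      fix l
      show "(\<Sum>q=1..n. \<bar>f (real q * dt - real l * dt)\<bar>) \<le> R0 / dt"
        using sum_abs_bounded[OF Delta, where n = n and s = "real l * dt"] Delta unfolding R0_def by (simp add: pos_le_divide_eq mult.commute)
    qed (use Delta in auto)
    also have "\<dots> = (dt * (\<Sum>l=1..n. \<bar>f (real l * dt - real p * dt)\<bar>)) * (R0 / dt)"
      by (simp only: sum_distrib_right[symmetric] mult.assoc)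
    also have "\<dots> \<le> R0 * (R0 / dt)"
      using sum_abs_bounded[OF Delta, where n = n and s = "real p * dt"] R0_nonneg Delta unfolding R0_def by (intro mult_right_mono) auto
    finally show ?thesis .
  qed
  have sumG: "(\<Sum>p\<in>noise.offdiag. (G (fst p) (snd p))\<^sup>2) \<le> n * (C * R0 * (R0 * (R0 / dt)))"
  proof -
    have "(\<Sum>p\<in>noise.offdiag. (G (fst p) (snd p))\<^sup>2) \<le> (\<Sum>p\<in>{1..n}\<times>{1..n}. (G (fst p) (snd p))\<^sup>2)"
      unfolding noise.offdiag_def by (intro sum_mono2) auto
    also have "\<dots> = (\<Sum>p=1..n. \<Sum>q=1..n. (G p q)\<^sup>2)"
      by (simp add: sum.cartesian_product case_prod_unfold)
    also have "\<dots> \<le> (\<Sum>p=1..n. \<Sum>q=1..n. (C * R0) * \<bar>G p q\<bar>)"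
    proof (intro sum_mono)
      fix p q show "(G p q)\<^sup>2 \<le> (C * R0) * \<bar>G p q\<bar>"
        using mult_right_mono[OF Gb[of p q], of "\<bar>G p q\<bar>"] by (simp add: power2_eq_square abs_mult_self)
    qed
    also have "\<dots> \<le> (\<Sum>p=1..n. (C * R0) * (R0 * (R0 / dt)))"
    proof (rule sum_mono)
      fix p
      have "(\<Sum>q=1..n. (C * R0) * \<bar>G p q\<bar>) = (C * R0) * (\<Sum>q=1..n. \<bar>G p q\<bar>)" by (rule sum_distrib_left[symmetric])
      also have "\<dots> \<le> (C * R0) * (R0 * (R0 / dt))" using C_nonneg R0_nonneg by (intro mult_left_mono Gs) auto
      finally show "(\<Sum>q=1..n. (C * R0) * \<bar>G p q\<bar>) \<le> (C * R0) * (R0 * (R0 / dt))" .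
    qed
    finally show ?thesis by simp
  qed
  have "integrable M (\<lambda>w. (T2 w)\<^sup>2)"
  proof -
    have mem: "fst q \<in> {1..n}" "snd q \<in> {1..n}" if "q \<in> noise.offdiag" for q
      using that unfolding noise.offdiag_def by auto
    have "(T2 w)\<^sup>2 = (\<Sum>p\<in>noise.offdiag. \<Sum>q\<in>noise.offdiag. (G (fst p) (snd p) * G (fst q) (snd q)) *
        ((noise.r (fst p) w * noise.r (snd p) w) * (noise.r (fst q) w * noise.r (snd q) w)))" for w
      unfolding T2_def power2_eq_square sum_product by (intro sum.cong refl) (simp add: mult_ac)
    then show ?thesis
      using noise.integrable_rrrr mem by (auto intro!: Bochner_Integration.integrable_sum integrable_mult_right)
  qed
  then have "(\<integral>\<^sup>+ w. ennreal ((T2 w)\<^sup>2) \<partial>M) = ennreal (expectation (\<lambda>w. (T2 w)\<^sup>2))"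
    by (intro nn_integral_eq_integral) auto
  also have "\<dots> \<le> ennreal (4 * C * R0 ^ 3 / N)"
  proof (rule ennreal_leI)
    have "expectation (\<lambda>w. (T2 w)\<^sup>2) \<le> 2 / (card {1..n} * (card {1..n} - 1)) * (\<Sum>p\<in>noise.offdiag. (G (fst p) (snd p))\<^sup>2)"
      unfolding T2_def by (rule noise.expectation_offdiag_form[of "\<lambda>p. G (fst p) (snd p)"]) (simp add: Gsym)
    also have "\<dots> \<le> 2 / (card {1..n} * (card {1..n} - 1)) * (n * (C * R0 * (R0 * (R0 / dt))))"
      by (intro mult_left_mono sumG) auto
    also have "\<dots> = 2 * C * R0 ^ 3 / (real (n - 1) * dt)"
      using n_ge_2 by (simp add: power3_eq_cube)
    also have "\<dots> \<le> 2 * C * R0 ^ 3 / (N / 2)"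
    proof (rule divide_left_mono)
      show "N / 2 \<le> real (n - 1) * dt"
        unfolding N_def using n_ge_2 Delta mult_right_mono[of "real n" "2 * real (n - 1)" dt] by (simp add: of_nat_diff)
      show "0 \<le> 2 * C * R0 ^ 3" using C_nonneg R0_nonneg by simp
      show "0 < real (n - 1) * dt * (N / 2)" using n_ge_2 Delta N_pos by simp
    qed
    finally show "expectation (\<lambda>w. (T2 w)\<^sup>2) \<le> 4 * C * R0 ^ 3 / N" by simp
  qed
  finally show ?thesis .
qed

lemma sqrt_denominator_diff:
  "\<bar>sqrt (dt * (\<Sum>l=1..n. (X (real l * dt) w)\<^sup>2)) - sqrt (dt * (\<Sum>l=1..n. (Xd l w)\<^sup>2))\<bar> \<le> sqrt (Q2 w)"
  using weighted_l2_diff_le[where K = "{1..n}" and W = "\<lambda>_. dt" and x = "\<lambda>l. complex_of_real (X (real l * dt) w)"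
    and y = "\<lambda>l. complex_of_real (Xd l w)"] Delta
  unfolding Q2_def sum_distrib_left of_real_diff[symmetric] norm_of_real power2_abs by simp

text \<open>This is \<kappa> times the root of dt times the smoothed periodogram, as
  \<open>P_eq_smoothed\<close> shows: the observations are normalized by the noise.\<close>

definition P :: "real \<Rightarrow> 'w \<Rightarrow> real" where
  "P u w = sqrt (\<Sum>k=- int m..int m. W k * (norm (of_real dt * V (freq u k) w))\<^sup>2) / sqrt (D2 w)"

lemma FT_f_continuous: "continuous_on UNIV (FT f)"
  unfolding continuous_on_iff
proof (intro ballI allI impI)
  fix x e :: real assume e: "e > 0"
  let ?L = "2 * C / (r - 2)"
  have L: "?L \<ge> 0" using C_nonneg r2 by simp
  show "\<exists>d>0. \<forall>x'\<in>UNIV. dist x' x < d \<longrightarrow> dist (FT f x') (FT f x) < e"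
  proof (intro exI[of _ "e / (?L + 1)"] conjI ballI impI)
    show "0 < e / (?L + 1)" using e L by simp
    fix x' assume d: "dist x' x < e / (?L + 1)"
    have "norm (FT f x' - FT f x) \<le> ?L * \<bar>x' - x\<bar>" by (rule FT_lipschitz[OF r2])
    also have "\<dots> \<le> (?L + 1) * \<bar>x' - x\<bar>" by (intro mult_right_mono) auto
    also have "\<dots> < e" using d L by (simp add: dist_real_def pos_less_divide_eq mult.commute)
    finally show "dist (FT f x') (FT f x) < e" by (simp add: dist_norm)
  qed
qed

lemma continuous_FT_compose [continuous_intros]:
  "continuous_on A g \<Longrightarrow> continuous_on A (\<lambda>u. FT f (g u))"
  by (rule continuous_on_compose2[OF FT_f_continuous]) auto

lemma continuous_freq [continuous_intros]: "continuous_on A (\<lambda>u. freq u k)"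
  unfolding freq_def by (intro continuous_intros)

lemma continuous_V [continuous_intros]: "continuous_on A (\<lambda>u. V (freq u k) w)"
  unfolding V_def by (intro continuous_intros)

lemma continuous_Sxi [continuous_intros]: "continuous_on A (\<lambda>u. Sxi (freq u k) w)"
  unfolding Sxi_def by (intro continuous_intros)

lemma continuous_per [continuous_intros]: "D2 w > 0 \<Longrightarrow> continuous_on A (\<lambda>u. per (freq u k) w)"
  unfolding per_eq by (intro continuous_intros) auto

lemma P_continuous: "continuous_on A (\<lambda>u. P u w)"
proof (cases "D2 w = 0")
  case False
  then show ?thesis unfolding P_def by (intro continuous_intros) auto
qed (simp add: P_def)

text \<open>Three replacements in a weighted l2 norm: the transform of the observations by FT f
  times that of the noise, then FT f at the shifted frequency by FT f at u, and finally the root of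
  the smoothed noise periodogram by 1. The last one uses |sqrt J - 1| \<le> |J - 1| for J \<ge>
  0.\<close>

lemma pointwise_error:
  assumes D: "D2 w > 0"
  shows "(P u w - norm (FT f u))\<^sup>2 \<le>
    3 * ((\<Sum>k=- int m..int m. W k * (norm (of_real dt * V (freq u k) w - FT f (freq u k) * Sxi (freq u k) w))\<^sup>2) / D2 w +
      (\<Sum>k=- int m..int m. W k * ((norm (FT f (freq u k) - FT f u))\<^sup>2 * per (freq u k) w)) +
      (norm (FT f u))\<^sup>2 * (Js u w - (\<Sum>j=1..n. (noise.r j w)\<^sup>2))\<^sup>2)"
proof -
  let ?K = "{- int m..int m}"
  let ?d = "sqrt (D2 w)"
  let ?A = "sqrt (\<Sum>k\<in>?K. W k * (norm (of_real dt * V (freq u k) w))\<^sup>2)"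
  let ?B = "sqrt (\<Sum>k\<in>?K. W k * (norm (FT f (freq u k) * Sxi (freq u k) w))\<^sup>2)"
  let ?C = "sqrt (\<Sum>k\<in>?K. W k * (norm (FT f u * Sxi (freq u k) w))\<^sup>2)"
  let ?e1 = "\<Sum>k\<in>?K. W k * (norm (of_real dt * V (freq u k) w - FT f (freq u k) * Sxi (freq u k) w))\<^sup>2"
  let ?e2 = "\<Sum>k\<in>?K. W k * (norm (FT f (freq u k) * Sxi (freq u k) w - FT f u * Sxi (freq u k) w))\<^sup>2"
  have d: "?d > 0" "?d\<^sup>2 = D2 w" using D by auto
  have AB: "\<bar>?A - ?B\<bar> \<le> sqrt ?e1" by (rule weighted_l2_diff_le) (use W in auto)
  have BC: "\<bar>?B - ?C\<bar> \<le> sqrt ?e2" by (rule weighted_l2_diff_le) (use W in auto)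
  have e1: "?e1 \<ge> 0" and e2: "?e2 \<ge> 0" using W by (auto intro!: sum_nonneg mult_nonneg_nonneg)
  have Js0: "Js u w \<ge> 0" unfolding Js_eq using W per_nonneg by (intro sum_nonneg mult_nonneg_nonneg) auto
  have one: "(\<Sum>j=1..n. (noise.r j w)\<^sup>2) = 1" using noise.sum_r_squares(2) D unfolding D2_def by blast
  have "(\<Sum>k\<in>?K. W k * (norm (FT f u * Sxi (freq u k) w))\<^sup>2) = (norm (FT f u))\<^sup>2 * D2 w * Js u w"
    unfolding Js_eq per_eq sum_distrib_left
    using D by (intro sum.cong refl) (simp add: norm_mult power_mult_distrib)
  then have Ceq: "?C = norm (FT f u) * ?d * sqrt (Js u w)"
    using D Js0 by (simp add: real_sqrt_mult)
  have eq: "P u w - norm (FT f u) = (?A - ?B) / ?d + (?B - ?C) / ?d + norm (FT f u) * (sqrt (Js u w) - 1)"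
  proof -
    have "?C / ?d = norm (FT f u) * sqrt (Js u w)" unfolding Ceq using d by simp
    then show ?thesis unfolding P_def by (simp add: diff_divide_distrib algebra_simps)
  qed
  have "(P u w - norm (FT f u))\<^sup>2 \<le> 3 * (((?A - ?B) / ?d)\<^sup>2 + ((?B - ?C) / ?d)\<^sup>2 + (norm (FT f u) * (sqrt (Js u w) - 1))\<^sup>2)"
    unfolding eq by (rule square_sum3_le)
  also have "\<dots> \<le> 3 * (?e1 / D2 w + ?e2 / D2 w + (norm (FT f u))\<^sup>2 * (Js u w - 1)\<^sup>2)"
  proof (intro mult_left_mono add_mono)
    have "\<bar>?A - ?B\<bar>\<^sup>2 \<le> (sqrt ?e1)\<^sup>2" by (rule power_mono[OF AB]) simp
    then show "((?A - ?B) / ?d)\<^sup>2 \<le> ?e1 / D2 w" unfolding power_divide d(2) using D e1 by (simp add: divide_right_mono)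
    have "\<bar>?B - ?C\<bar>\<^sup>2 \<le> (sqrt ?e2)\<^sup>2" by (rule power_mono[OF BC]) simp
    then show "((?B - ?C) / ?d)\<^sup>2 \<le> ?e2 / D2 w" unfolding power_divide d(2) using D e2 by (simp add: divide_right_mono)
    have "\<bar>sqrt (Js u w) - 1\<bar> \<le> \<bar>Js u w - 1\<bar>"
    proof -
      have "Js u w - 1 = (sqrt (Js u w) - 1) * (sqrt (Js u w) + 1)" using Js0 by (simp add: algebra_simps)
      then have "\<bar>Js u w - 1\<bar> = \<bar>sqrt (Js u w) - 1\<bar> * (sqrt (Js u w) + 1)" using Js0 by (simp add: abs_mult)
      moreover have "\<bar>sqrt (Js u w) - 1\<bar> * 1 \<le> \<bar>sqrt (Js u w) - 1\<bar> * (sqrt (Js u w) + 1)"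
        using Js0 by (intro mult_left_mono) auto
      ultimately show ?thesis by simp
    qed
    then have "(sqrt (Js u w) - 1)\<^sup>2 \<le> (Js u w - 1)\<^sup>2" by (simp add: abs_le_square_iff)
    then show "(norm (FT f u) * (sqrt (Js u w) - 1))\<^sup>2 \<le> (norm (FT f u))\<^sup>2 * (Js u w - 1)\<^sup>2"
      unfolding power_mult_distrib by (intro mult_left_mono) auto
  qed simp
  also have "?e2 / D2 w = (\<Sum>k\<in>?K. W k * ((norm (FT f (freq u k) - FT f u))\<^sup>2 * per (freq u k) w))"
    unfolding per_eq sum_divide_distrib
    by (intro sum.cong refl) (simp add: left_diff_distrib[symmetric] norm_mult power_mult_distrib)
  finally show ?thesis unfolding one .
qed

lemma band_error_le:
  assumes D: "D2 w > 0"
  shows "(LINT u|band a. (P u w - norm (FT f u))\<^sup>2) \<le> 3 * (Q1 w / D2 w + Q3 w + Q4 w)"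
proof -
  let ?g1 = "\<lambda>u. \<Sum>k=- int m..int m. W k * (norm (of_real dt * V (freq u k) w - FT f (freq u k) * Sxi (freq u k) w))\<^sup>2"
  let ?g3 = "\<lambda>u. \<Sum>k=- int m..int m. W k * ((norm (FT f (freq u k) - FT f u))\<^sup>2 * per (freq u k) w)"
  let ?g4 = "\<lambda>u. (norm (FT f u))\<^sup>2 * (Js u w - (\<Sum>j=1..n. (noise.r j w)\<^sup>2))\<^sup>2"
  have i1: "integrable (band a) ?g1" by (intro integrable_band_continuous continuous_intros)
  have i3: "integrable (band a) ?g3" by (intro integrable_band_continuous continuous_intros D)
  have i4: "integrable (band a) ?g4" unfolding Js_eq by (intro integrable_band_continuous continuous_intros D)
  have "(LINT u|band a. (P u w - norm (FT f u))\<^sup>2) \<le> (LINT u|band a. 3 * (?g1 u / D2 w + ?g3 u + ?g4 u))"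
  proof (rule integral_mono)
    show "integrable (band a) (\<lambda>u. (P u w - norm (FT f u))\<^sup>2)"
      by (intro integrable_band_continuous continuous_intros P_continuous)
    show "integrable (band a) (\<lambda>u. 3 * (?g1 u / D2 w + ?g3 u + ?g4 u))"
      by (intro integrable_mult_right Bochner_Integration.integrable_add integrable_divide i1 i3 i4)
  qed (rule pointwise_error[OF D])
  also have "\<dots> = 3 * (LINT u|band a. ?g1 u / D2 w + ?g3 u + ?g4 u)"
    by (rule integral_mult_right_zero)
  also have "(LINT u|band a. ?g1 u / D2 w + ?g3 u + ?g4 u) = Q1 w / D2 w + Q3 w + Q4 w"
  proof -
    have "(LINT u|band a. ?g1 u / D2 w + ?g3 u + ?g4 u) = (LINT u|band a. ?g1 u / D2 w + ?g3 u) + (LINT u|band a. ?g4 u)"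
      by (rule Bochner_Integration.integral_add[OF Bochner_Integration.integrable_add[OF integrable_divide[OF i1] i3] i4])
    also have "(LINT u|band a. ?g1 u / D2 w + ?g3 u) = (LINT u|band a. ?g1 u / D2 w) + (LINT u|band a. ?g3 u)"
      by (rule Bochner_Integration.integral_add[OF integrable_divide[OF i1] i3])
    also have "(LINT u|band a. ?g1 u / D2 w) = (LINT u|band a. ?g1 u) / D2 w"
      by (rule integral_divide_zero)
    finally show ?thesis unfolding Q1_def Q3_def Q4_def .
  qed
  finally show ?thesis .
qed

end

context estimator_window
begin

lemma P_eq_smoothed:
  "sqrt (dt * (\<Sum>j=1..n. (X (real j * dt) w)\<^sup>2) / D2 w) * sqrt (dt * smoothed_periodogram dt n m W (\<lambda>j. X (real j * dt) w) u) = P u w"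
proof -
  let ?Den = "\<Sum>j=1..n. (X (real j * dt) w)\<^sup>2"
  let ?S = "\<Sum>k=- int m..int m. W k * (norm (V (freq u k) w))\<^sup>2"
  have Den: "?Den \<ge> 0" by (intro sum_nonneg) auto
  have sm: "smoothed_periodogram dt n m W (\<lambda>j. X (real j * dt) w) u = ?S / ?Den"
    unfolding smoothed_periodogram_def periodogram_def V_def freq_def cis_conv_exp sum_divide_distrib
    by (simp add: mult_ac)
  have PS: "P u w = sqrt (dt\<^sup>2 * ?S) / sqrt (D2 w)"
    unfolding P_def using Delta
    by (simp add: norm_mult power_mult_distrib sum_distrib_left mult.left_commute)
  show ?thesis
  proof (cases "?Den = 0")
    \<comment> \<open>If all observations vanish, the periodogram is 0 by default and V is 0 as
      well.\<close>
    case True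
    then have "X (real j * dt) w = 0" if "j \<in> {1..n}" for j
      using that by (subst (asm) sum_nonneg_eq_0_iff) auto
    then have "V v w = 0" for v unfolding V_def by (intro sum.neutral) auto
    then show ?thesis using True by (simp add: PS)
  next
    case False
    have "dt * ?Den / D2 w * (dt * (?S / ?Den)) = dt\<^sup>2 * ?S / D2 w"
      using False by (simp add: power2_eq_square field_simps)
    then show ?thesis unfolding PS sm real_sqrt_mult[symmetric] real_sqrt_divide[symmetric] by simp
  qed
qed

lemma D2_lower_tail:
  assumes "K > 0" "K powr (\<alpha>/2) \<le> n"
  shows "prob {w\<in>space M. D2 w / N powr (2/\<alpha>) \<le> 1 / K} \<le> 2 * exp (- (K powr (\<alpha>/2) / 8))"
  unfolding D2_def N_def
  by (rule SaS_sum_squares_lower_tail[OF noise.indep]) (use noise.var n_ge_2 Delta alpha assms in auto)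

end

section \<open>Asymptotics of the smoothed periodogram\<close>

lemma (in prob_space) eventually_prob_filter_fst:
  "eventually P sequentially \<Longrightarrow> \<forall>\<^sub>F q in prob_filter M. P (fst q)"
  by (rule eventually_prob_filter_sequentially) (auto elim: eventually_mono)

lemma tendsto_powr_zero:
  fixes y :: "'b \<Rightarrow> real"
  assumes "(y \<longlongrightarrow> 0) F" "\<forall>\<^sub>F x in F. y x \<ge> 0" "p > 0"
  shows "((\<lambda>x. y x powr p) \<longlongrightarrow> 0) F"
  using tendsto_powr2[OF assms(1) tendsto_const assms(2), of p] assms(3) by simp

text \<open>\<open>\<beta>\<close> is the weight under which the squared error on the band has to
  vanish, and \<open>\<theta>\<close> is the exponent traded at the edges. The rate assumptions are
  the common core of the two cases of the theorem.\<close>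

locale estimation = stable_random_measure M \<alpha> \<Lambda> + decaying f C r
  for M :: "'w measure" and \<alpha> :: real and \<Lambda> :: "real set \<Rightarrow> 'w \<Rightarrow> real" and f :: "real \<Rightarrow> real" and C r :: real +
  fixes X :: "real \<Rightarrow> 'w \<Rightarrow> real" and \<Delta> a \<omega> \<beta> Wmax :: "nat \<Rightarrow> real" and m :: "nat \<Rightarrow> nat" and W :: "nat \<Rightarrow> int \<Rightarrow> real" and \<theta> :: real
  assumes X: "\<And>t. is_stochastic_integral M \<alpha> \<Lambda> (\<lambda>s. f (t - s)) (X t)"
    and even: "\<And>x. f (- x) = f x" and r2: "r > 2" and r\<alpha>: "r * \<alpha> > 1"
    and \<Delta>: "\<And>n. n \<ge> 1 \<Longrightarrow> \<Delta> n > 0" "\<Delta> \<longlonglongrightarrow> 0" "filterlim (\<lambda>n. real n * \<Delta> n) at_top sequentially"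
    and m: "(\<lambda>n. real (m n)) \<in> o(\<lambda>n. real n)"
    and W: "\<And>n k. n \<ge> 1 \<Longrightarrow> k \<in> {- int (m n)..int (m n)} \<Longrightarrow> W n k \<ge> 0 \<and> W n k \<le> Wmax n"
    and sum_W: "\<And>n. n \<ge> 1 \<Longrightarrow> (\<Sum>k=- int (m n)..int (m n). W n k) = 1"
    and a: "\<And>n. n \<ge> 1 \<Longrightarrow> a n > 0"
    and \<omega>: "\<forall>\<^sub>F n in sequentially. \<omega> n \<ge> 0 \<and> (\<forall>x y. \<bar>x - y\<bar> < \<Delta> n \<longrightarrow> \<bar>f x - f y\<bar> \<le> \<omega> n)" "\<omega> \<longlonglongrightarrow> 0"
    and \<theta>: "0 \<le> \<theta>" "\<theta> \<le> 1" "(r - 1 + \<theta>) * \<alpha> > 1"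
    and \<beta>: "\<forall>\<^sub>F n in sequentially. \<beta> n > 0"
    and rate_\<omega>: "(\<lambda>n. \<beta> n * a n * \<omega> n powr (2 - 2/r)) \<longlonglongrightarrow> 0"
    and rate_\<Delta>: "(\<lambda>n. \<beta> n * a n ^ 3 * (\<Delta> n)\<^sup>2) \<longlonglongrightarrow> 0"
    and rate_W2: "(\<lambda>n. \<beta> n * a n * (weight_second_moment (m n) (W n) / (real n * \<Delta> n)\<^sup>2)) \<longlonglongrightarrow> 0"
    and rate_Wmax: "(\<lambda>n. \<beta> n * Wmax n) \<longlonglongrightarrow> 0"
    and rate_edge: "(\<lambda>n. \<beta> n * a n * (real n * \<Delta> n) powr (2 * \<theta> - 2/\<alpha>)) \<longlonglongrightarrow> 0"
begin

definition N :: "nat \<Rightarrow> real" where "N n = real n * \<Delta> n"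

abbreviation "D2 n \<equiv> estimator_window.D2 \<Lambda> n (\<Delta> n)"
abbreviation "Q1 n \<equiv> window.Q1 \<Lambda> f X n (\<Delta> n) (m n) (W n) (a n)"
abbreviation "Q2 n \<equiv> window.Q2 \<Lambda> f X n (\<Delta> n)"
abbreviation "Q3 n \<equiv> estimator_window.Q3 \<Lambda> f n (\<Delta> n) (m n) (W n) (a n)"
abbreviation "Q4 n \<equiv> estimator_window.Q4 \<Lambda> f n (\<Delta> n) (m n) (W n) (a n)"
abbreviation "T1 n \<equiv> estimator_window.T1 \<Lambda> f n (\<Delta> n)"
abbreviation "T2 n \<equiv> estimator_window.T2 \<Lambda> f n (\<Delta> n)"
abbreviation "Pn n \<equiv> estimator_window.P \<Lambda> X n (\<Delta> n) (m n) (W n)"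
abbreviation "Xd n \<equiv> window.Xd \<Lambda> f n (\<Delta> n)"
abbreviation "Rc \<equiv> riemann_const C r"
abbreviation "PF \<equiv> prob_filter M"
abbreviation "W2 n \<equiv> weight_second_moment (m n) (W n)"

lemma eventually_window:
  \<comment> \<open>The conditions \<Delta> n \<le> 1, N n \<ge> 1 and 2 m n \<le> n hold for large
    n only, so the results for a fixed number of observations become available eventually.\<close>
  "\<forall>\<^sub>F n in sequentially. estimator_window M \<alpha> \<Lambda> f C r X n (\<Delta> n) (m n) (W n) (\<omega> n) (a n) (Wmax n)"
proof -
  have "\<forall>\<^sub>F n in sequentially. \<Delta> n < 1" using \<Delta>(2) by (rule order_tendstoD(2)) simp
  moreover have "\<forall>\<^sub>F n in sequentially. 1 \<le> real n * \<Delta> n" using \<Delta>(3) by (simp add: filterlim_at_top)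
  moreover have "\<forall>\<^sub>F n in sequentially. norm (real (m n)) \<le> 1/2 * norm (real n)" using landau_o.smallD[OF m, of "1/2"] by simp
  ultimately show ?thesis using \<omega>(1) eventually_ge_at_top[of 2]
  proof eventually_elim
    case (elim n)
    have n: "n \<ge> 1" using elim by simp
    have m2: "2 * m n \<le> n" using elim(3) by simp
    show ?case
      by unfold_locales (use X even r2 \<Delta>(1)[OF n] elim m2 W[OF n] sum_W[OF n] a[OF n] in auto)
  qed
qed

lemma eventually_N: "\<forall>\<^sub>F n in sequentially. N n \<ge> 1"
  using \<Delta>(3) by (simp add: filterlim_at_top N_def)

lemma N_eq: "window.N n (\<Delta> n) = N n" if "estimator_window M \<alpha> \<Lambda> f C r X n (\<Delta> n) (m n) (W n) (\<omega> n) (a n) (Wmax n)" for n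
proof -
  interpret E: estimator_window M \<alpha> \<Lambda> f C r X n "\<Delta> n" "m n" "W n" "\<omega> n" "a n" "Wmax n" by fact
  show ?thesis by (simp add: N_def E.N_def)
qed

lemma D2_tight:
  assumes \<eta>: "\<eta> > 0"
  shows "\<exists>\<delta>>0. \<forall>\<^sub>F n in sequentially. prob {w\<in>space M. D2 n w / N n powr (2/\<alpha>) \<le> \<delta>} \<le> \<eta>"
proof -
  \<comment> \<open>With K^(\<alpha>/2) = s the tail bound 2 exp(- s / 8) is at most \<eta>.\<close>
  define s where "s = max 1 (8 * ln (2/\<eta>))"
  define K where "K = s powr (2/\<alpha>)"
  have s: "s > 0" unfolding s_def by simp
  have K: "K > 0" "K powr (\<alpha>/2) = s" unfolding K_def using s alpha by (auto simp: powr_powr)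
  have "2 * exp (- (s / 8)) \<le> 2 * exp (- ln (2/\<eta>))" unfolding s_def by simp
  also have "\<dots> = \<eta>" using \<eta> by (simp add: exp_minus)
  finally have le: "2 * exp (- (K powr (\<alpha>/2) / 8)) \<le> \<eta>" unfolding K .
  have "\<forall>\<^sub>F n in sequentially. s \<le> real n" by (rule eventually_sequentiallyI[of "nat \<lceil>s\<rceil>"]) linarith
  then have "\<forall>\<^sub>F n in sequentially. prob {w\<in>space M. D2 n w / N n powr (2/\<alpha>) \<le> 1 / K} \<le> \<eta>"
    using eventually_window
  proof eventually_elim
    case (elim n)
    then show ?case
      using estimator_window.D2_lower_tail[OF elim(2) K(1)] le K(2) unfolding N_eq[OF elim(2)] by simp
  qed
  then show ?thesis using K by (intro exI[of _ "1/K"]) auto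
qed

lemma D2_normalized_measurable: "\<forall>\<^sub>F n in sequentially. (\<lambda>w. D2 n w / N n powr (2/\<alpha>)) \<in> borel_measurable M"
  using eventually_window
  proof eventually_elim
    case (elim n)
    interpret E: estimator_window M \<alpha> \<Lambda> f C r X n "\<Delta> n" "m n" "W n" "\<omega> n" "a n" "Wmax n" by fact
    show ?case by measurable
  qed

lemma eventually_D2_pos: "\<forall>\<^sub>F q in PF. D2 (fst q) (snd q) > 0"
proof -
  have "\<forall>\<^sub>F q in PF. D2 (fst q) (snd q) / N (fst q) powr (2/\<alpha>) > 0"
    by (rule eventually_prob_filter_pos[OF D2_normalized_measurable D2_tight])
  then show ?thesis by eventually_elim (auto simp: zero_less_divide_iff)
qed

text \<open>Numerator and denominator are both divided by N^(2/\<alpha>), the order of D2. A tail of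
  order x^(-\<alpha>), taken at x^2 = \<epsilon> N^(2/\<alpha>) / b, then amounts to the condition
  on t.\<close>

lemma Q_over_D2_tendsto:
  fixes Q :: "nat \<Rightarrow> 'w \<Rightarrow> real" and b :: "nat \<Rightarrow> real"
  assumes Qm: "\<forall>\<^sub>F n in sequentially. Q n \<in> borel_measurable M" and Q0: "\<forall>\<^sub>F n in sequentially. \<forall>w. Q n w \<ge> 0"
    and b: "\<forall>\<^sub>F n in sequentially. b n > 0"
    and tail: "\<forall>\<^sub>F n in sequentially. \<forall>x>0. prob {w\<in>space M. Q n w > x\<^sup>2} \<le> t n / x powr \<alpha>"
    and t: "(\<lambda>n. t n * b n powr (\<alpha>/2) / N n) \<longlonglongrightarrow> 0"
  shows "((\<lambda>q. b (fst q) * Q (fst q) (snd q) / D2 (fst q) (snd q)) \<longlongrightarrow> 0) PF"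
proof -
  let ?Z = "\<lambda>n w. b n * Q n w / N n powr (2/\<alpha>)"
  have Zm: "\<forall>\<^sub>F n in sequentially. ?Z n \<in> borel_measurable M"
    using Qm
  proof eventually_elim
    case (elim n)
    note [measurable] = elim
    show ?case by measurable
  qed
  have Z: "((\<lambda>q. ?Z (fst q) (snd q)) \<longlongrightarrow> 0) PF"
    unfolding tendsto_prob_filter_iff[OF Zm]
  proof safe
    fix \<epsilon> :: real assume \<epsilon>: "\<epsilon> > 0"
    show "(\<lambda>n. prob {w\<in>space M. \<epsilon> < \<bar>?Z n w - 0\<bar>}) \<longlonglongrightarrow> 0"
    proof (rule tendsto_sandwich[OF _ _ tendsto_const])
      have "(\<lambda>n. t n * b n powr (\<alpha>/2) / N n / \<epsilon> powr (\<alpha>/2)) \<longlonglongrightarrow> 0 / \<epsilon> powr (\<alpha>/2)"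
        using \<epsilon> by (intro tendsto_divide t tendsto_const) auto
      then show "(\<lambda>n. t n * b n powr (\<alpha>/2) / N n / \<epsilon> powr (\<alpha>/2)) \<longlonglongrightarrow> 0" by simp
      show "\<forall>\<^sub>F n in sequentially. prob {w\<in>space M. \<epsilon> < \<bar>?Z n w - 0\<bar>} \<le> t n * b n powr (\<alpha>/2) / N n / \<epsilon> powr (\<alpha>/2)"
        using Q0 b tail eventually_N
      proof eventually_elim
        case (elim n)
        define x where "x = sqrt (\<epsilon> * N n powr (2/\<alpha>) / b n)"
        have pos: "\<epsilon> * N n powr (2/\<alpha>) / b n > 0" using \<epsilon> elim by simp
        have x: "x > 0" "x\<^sup>2 = \<epsilon> * N n powr (2/\<alpha>) / b n" unfolding x_def using pos by auto
        have "x powr \<alpha> = (x\<^sup>2) powr (\<alpha>/2)"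
        proof -
          have "x\<^sup>2 = x powr 2" using x by simp
          then show ?thesis by (simp add: powr_powr)
        qed
        also have "\<dots> = \<epsilon> powr (\<alpha>/2) * N n / b n powr (\<alpha>/2)"
          unfolding x(2) using alpha elim by (simp add: powr_divide powr_mult powr_powr)
        finally have xa: "x powr \<alpha> = \<epsilon> powr (\<alpha>/2) * N n / b n powr (\<alpha>/2)" .
        have "{w\<in>space M. \<epsilon> < \<bar>?Z n w - 0\<bar>} = {w\<in>space M. Q n w > x\<^sup>2}"
          unfolding x(2) using elim \<epsilon> by (auto simp: abs_of_nonneg field_simps)
        then have "prob {w\<in>space M. \<epsilon> < \<bar>?Z n w - 0\<bar>} \<le> t n / x powr \<alpha>"
          using elim(3) x(1) by simp
        also have "\<dots> = t n * b n powr (\<alpha>/2) / N n / \<epsilon> powr (\<alpha>/2)"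
          unfolding xa by simp
        finally show ?case .
      qed
    qed auto
  qed
  have "((\<lambda>q. ?Z (fst q) (snd q) / (D2 (fst q) (snd q) / N (fst q) powr (2/\<alpha>))) \<longlongrightarrow> 0) PF"
  proof (rule tendsto_prob_filter_divide[OF Zm D2_normalized_measurable _ Z D2_tight])
    show "\<forall>\<^sub>F n in sequentially. \<forall>w\<in>space M. 0 \<le> ?Z n w \<and> 0 \<le> D2 n w / N n powr (2/\<alpha>)"
      using Q0 b eventually_window
      by eventually_elim (auto intro!: mult_nonneg_nonneg divide_nonneg_nonneg estimator_window.D2_nonneg)
  qed
  then show ?thesis
  proof (rule Lim_transform_eventually)
    show "\<forall>\<^sub>F q in PF. ?Z (fst q) (snd q) / (D2 (fst q) (snd q) / N (fst q) powr (2/\<alpha>)) = b (fst q) * Q (fst q) (snd q) / D2 (fst q) (snd q)"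
      using eventually_prob_filter_fst[OF eventually_N] by eventually_elim auto
  qed
qed

text \<open>In the interior part the length N cancels against the normalization, and the rates for
  \<omega>, \<Delta> and W2 remain. The edge part keeps the factor N^(2 \<theta> - 2/\<alpha>)
  before the power \<alpha>/2 is taken.\<close>

lemma Q1_tendsto: "((\<lambda>q. \<beta> (fst q) * Q1 (fst q) (snd q) / D2 (fst q) (snd q)) \<longlongrightarrow> 0) PF"
proof (rule Q_over_D2_tendsto)
  let ?A = "\<lambda>n. 6 * Rc\<^sup>2 * a n * (\<omega> n powr (2 - 2/r) + 2 * (\<Delta> n)\<^sup>2 * ((a n)\<^sup>2 + W2 n / (N n)\<^sup>2))"
  let ?E = "\<lambda>n. 6 * Rc\<^sup>2 * a n * N n powr (2 * \<theta>)"
  let ?c = "4 / ((r - 1 + \<theta>) * \<alpha> - 1)"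
  let ?t = "\<lambda>n. 48 * (N n * ?A n powr (\<alpha>/2) + ?c * ?E n powr (\<alpha>/2))"
  show "\<forall>\<^sub>F n in sequentially. Q1 n \<in> borel_measurable M"
      using eventually_window by eventually_elim (rule window.Q1_measurable[OF estimator_window.axioms(1)])
  show "\<forall>\<^sub>F n in sequentially. \<forall>w. 0 \<le> Q1 n w"
      using eventually_window by eventually_elim (rule allI, rule window.Q1_nonneg[OF estimator_window.axioms(1)])
  show "\<forall>\<^sub>F n in sequentially. \<forall>x>0. prob {w\<in>space M. Q1 n w > x\<^sup>2} \<le> ?t n / x powr \<alpha>"
    using eventually_window
  proof eventually_elim
    case (elim n)
    interpret E: estimator_window M \<alpha> \<Lambda> f C r X n "\<Delta> n" "m n" "W n" "\<omega> n" "a n" "Wmax n" by fact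
    show ?case using E.Q1_tail[OF \<theta>] unfolding E.R0_def E.W2_def N_eq[OF elim] by blast
  qed
  show "\<forall>\<^sub>F n in sequentially. 0 < \<beta> n" by (rule \<beta>)
  have lim1: "(\<lambda>n. \<beta> n * ?A n) \<longlonglongrightarrow> 0"
  proof -
    have "(\<lambda>n. 6 * Rc\<^sup>2 * (\<beta> n * a n * \<omega> n powr (2 - 2/r) + 2 * (\<beta> n * a n ^ 3 * (\<Delta> n)\<^sup>2) + 2 * ((\<Delta> n)\<^sup>2 * (\<beta> n * a n * (W2 n / (N n)\<^sup>2)))))
       \<longlonglongrightarrow> 6 * Rc\<^sup>2 * (0 + 2 * 0 + 2 * (0\<^sup>2 * 0))"
      unfolding N_def by (intro tendsto_mult tendsto_add tendsto_const tendsto_power \<Delta>(2) rate_W2 rate_\<omega> rate_\<Delta>)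
    moreover have "6 * Rc\<^sup>2 * (\<beta> n * a n * \<omega> n powr (2 - 2/r) + 2 * (\<beta> n * a n ^ 3 * (\<Delta> n)\<^sup>2) + 2 * ((\<Delta> n)\<^sup>2 * (\<beta> n * a n * (W2 n / (N n)\<^sup>2))))
        = \<beta> n * ?A n" for n
      by (simp add: power3_eq_cube power2_eq_square algebra_simps)
    ultimately show ?thesis by (simp only: mult_zero_right add_0_right power_zero_numeral mult_zero_left)
  qed
  have A0: "\<forall>\<^sub>F n in sequentially. ?A n \<ge> 0"
    using eventually_window eventually_ge_at_top[of 1]
  proof eventually_elim
    case (elim n)
    have "W2 n \<ge> 0" unfolding weight_second_moment_def using W[OF elim(2)] by (intro sum_nonneg mult_nonneg_nonneg) auto
    then show ?case using a[OF elim(2)] by (intro mult_nonneg_nonneg add_nonneg_nonneg) auto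
  qed
  let ?e1 = "\<lambda>n. \<beta> n * a n * N n powr (2 * \<theta> - 2/\<alpha>)"
  have lim2: "(\<lambda>n. 6 * Rc\<^sup>2 * (?e1 n)) \<longlonglongrightarrow> 6 * Rc\<^sup>2 * 0"
    unfolding N_def by (intro tendsto_intros rate_edge)
  let ?e2 = "\<lambda>n. (\<beta> n * ?A n) powr (\<alpha>/2) + ?c * (6 * Rc\<^sup>2 * (?e1 n)) powr (\<alpha>/2)"
  have "(\<lambda>n. 48 * (?e2 n)) \<longlonglongrightarrow> 48 * (0 + ?c * 0)"
  proof (intro tendsto_mult tendsto_add tendsto_const tendsto_powr_zero lim1)
    show "\<forall>\<^sub>F n in sequentially. 0 \<le> \<beta> n * ?A n"
      using A0 \<beta> by eventually_elim simp
    show "\<forall>\<^sub>F n in sequentially. 0 \<le> 6 * Rc\<^sup>2 * (?e1 n)"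
      using \<beta> eventually_ge_at_top[of 1] by eventually_elim (use a in \<open>auto simp: less_imp_le\<close>)
  qed (use alpha lim2 in auto)
  then have lim: "(\<lambda>n. 48 * (?e2 n)) \<longlonglongrightarrow> 0" by simp
  show "(\<lambda>n. ?t n * \<beta> n powr (\<alpha>/2) / N n) \<longlonglongrightarrow> 0"
  proof (rule Lim_transform_eventually[OF lim])
    show "\<forall>\<^sub>F n in sequentially. 48 * (?e2 n) = ?t n * \<beta> n powr (\<alpha>/2) / N n"
      using eventually_N
    proof eventually_elim
      case (elim n)
      have 1: "(\<beta> n * ?A n) powr (\<alpha>/2) = \<beta> n powr (\<alpha>/2) * ?A n powr (\<alpha>/2)" by (rule powr_mult)
      have "6 * Rc\<^sup>2 * (?e1 n) = \<beta> n * ?E n * N n powr (- (2/\<alpha>))"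
        by (simp add: powr_diff powr_minus field_simps)
      then have "(6 * Rc\<^sup>2 * (?e1 n)) powr (\<alpha>/2) = \<beta> n powr (\<alpha>/2) * ?E n powr (\<alpha>/2) * (N n powr (- (2/\<alpha>))) powr (\<alpha>/2)"
        by (simp only: powr_mult)
      also have "(N n powr (- (2/\<alpha>))) powr (\<alpha>/2) = 1 / N n"
      proof -
        have "(N n powr (- (2/\<alpha>))) powr (\<alpha>/2) = N n powr (- 1)"
          unfolding powr_powr using alpha by simp
        then show ?thesis using elim by (simp add: powr_minus_divide)
      qed
      finally have 2: "(6 * Rc\<^sup>2 * (?e1 n)) powr (\<alpha>/2) = \<beta> n powr (\<alpha>/2) * ?E n powr (\<alpha>/2) * (1 / N n)" .
      have alg: "48 * (b * x + c * (b * e * (1 / v))) = 48 * (v * x + c * e) * b / v" if "v \<noteq> 0" for b x c e v :: real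
        using that by (simp add: field_simps)
      show ?case unfolding 1 2 by (rule alg) (use elim in auto)
    qed
  qed
qed

text \<open>The interior vanishes with \<omega>; the edge contributes N^(\<alpha>/2 - 1), which
  tends to 0 because \<alpha> < 2.\<close>

lemma Q2_tendsto: "((\<lambda>q. Q2 (fst q) (snd q) / D2 (fst q) (snd q)) \<longlongrightarrow> 0) PF"
proof -
  let ?c = "4 / (r * \<alpha> - 1)"
  let ?t = "\<lambda>n. 48 * (N n * (2 * Rc * \<omega> n) powr (\<alpha>/2) + ?c * (N n * C\<^sup>2) powr (\<alpha>/2))"
  let ?e1 = "\<lambda>n. (2 * Rc * \<omega> n) powr (\<alpha>/2) + ?c * (C\<^sup>2) powr (\<alpha>/2) * N n powr (\<alpha>/2 - 1)"
  have "((\<lambda>q. 1 * Q2 (fst q) (snd q) / D2 (fst q) (snd q)) \<longlongrightarrow> 0) PF"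
  proof (rule Q_over_D2_tendsto[where b = "\<lambda>_. 1" and t = ?t])
    show "\<forall>\<^sub>F n in sequentially. Q2 n \<in> borel_measurable M"
      using eventually_window by eventually_elim (rule window.Q2_measurable[OF estimator_window.axioms(1)])
    show "\<forall>\<^sub>F n in sequentially. \<forall>w. 0 \<le> Q2 n w"
      using eventually_window by eventually_elim (rule allI, rule window.Q2_nonneg[OF estimator_window.axioms(1)])
    show "\<forall>\<^sub>F n in sequentially. \<forall>x>0. prob {w\<in>space M. Q2 n w > x\<^sup>2} \<le> ?t n / x powr \<alpha>"
      using eventually_window
    proof eventually_elim
      case (elim n)
      interpret E: estimator_window M \<alpha> \<Lambda> f C r X n "\<Delta> n" "m n" "W n" "\<omega> n" "a n" "Wmax n" by fact
      show ?case using E.Q2_tail[OF r\<alpha>] unfolding E.R0_def N_eq[OF elim] by blast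
    qed
    have Rc: "Rc \<ge> 0" unfolding riemann_const_def using C_nonneg r by (intro add_nonneg_nonneg mult_nonneg_nonneg) auto
    have N_inf: "filterlim N at_top sequentially" unfolding N_def[abs_def] by (rule \<Delta>(3))
    have lim_N: "(\<lambda>n. N n powr (\<alpha>/2 - 1)) \<longlonglongrightarrow> 0"
      by (rule tendsto_neg_powr[OF _ N_inf]) (use alpha in auto)
    have lim_\<omega>: "(\<lambda>n. (2 * Rc * \<omega> n) powr (\<alpha>/2)) \<longlonglongrightarrow> 0"
    proof (rule tendsto_powr_zero)
      show "(\<lambda>n. 2 * Rc * \<omega> n) \<longlonglongrightarrow> 0" using tendsto_mult[OF tendsto_const \<omega>(2), of "2 * Rc"] by simp
      show "\<forall>\<^sub>F n in sequentially. 0 \<le> 2 * Rc * \<omega> n" using \<omega>(1) by eventually_elim (use Rc in auto)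
    qed (use alpha in auto)
    have "(\<lambda>n. 48 * (?e1 n)) \<longlonglongrightarrow> 48 * (0 + ?c * (C\<^sup>2) powr (\<alpha>/2) * 0)"
      by (intro tendsto_intros lim_N lim_\<omega>)
    then have lim: "(\<lambda>n. 48 * (?e1 n)) \<longlonglongrightarrow> 0" by simp
    show "(\<lambda>n. ?t n * 1 powr (\<alpha>/2) / N n) \<longlonglongrightarrow> 0"
    proof (rule Lim_transform_eventually[OF lim])
      show "\<forall>\<^sub>F n in sequentially. 48 * (?e1 n) = ?t n * 1 powr (\<alpha>/2) / N n"
        using eventually_N
      proof eventually_elim
        case (elim n)
        have 1: "N n powr (\<alpha>/2 - 1) = N n powr (\<alpha>/2) / N n" using elim by (simp add: powr_diff)
        have alg: "48 * (x + c * e * (y / v)) = 48 * (v * x + c * (y * e)) * 1 / v" if "v \<noteq> 0" for x c e y v :: real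
          using that by (simp add: field_simps)
        show ?case unfolding 1 powr_mult[of "N n"] powr_one_eq_one by (rule alg) (use elim in auto)
      qed
    qed
  qed auto
  then show ?thesis by simp
qed

lemma Q3_tendsto: "((\<lambda>q. \<beta> (fst q) * Q3 (fst q) (snd q)) \<longlongrightarrow> 0) PF"
proof (rule tendsto_prob_filter_Markov)
  let ?L = "2 * C / (r - 2)"
  show "\<forall>\<^sub>F n in sequentially. (\<lambda>w. \<beta> n * Q3 n w) \<in> borel_measurable M"
      using eventually_window by eventually_elim (intro borel_measurable_times borel_measurable_const estimator_window.Q3_measurable)
  show "\<forall>\<^sub>F n in sequentially. \<forall>w\<in>space M. 0 \<le> \<beta> n * Q3 n w"
    using eventually_window \<beta> by eventually_elim (auto intro: mult_nonneg_nonneg estimator_window.Q3_nonneg)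
  show "\<forall>\<^sub>F n in sequentially. (\<integral>\<^sup>+ w. ennreal (\<beta> n * Q3 n w) \<partial>M) \<le> ennreal (2 * ?L\<^sup>2 * (\<beta> n * a n * (W2 n / (real n * \<Delta> n)\<^sup>2)))"
    using eventually_window \<beta>
  proof eventually_elim
    case (elim n)
    interpret E: estimator_window M \<alpha> \<Lambda> f C r X n "\<Delta> n" "m n" "W n" "\<omega> n" "a n" "Wmax n" by fact
    have "(\<integral>\<^sup>+ w. ennreal (\<beta> n * Q3 n w) \<partial>M) = ennreal (\<beta> n) * (\<integral>\<^sup>+ w. ennreal (Q3 n w) \<partial>M)"
      using elim E.Q3_nonneg by (subst nn_integral_cmult[symmetric]) (auto simp: ennreal_mult)
    also have "\<dots> \<le> ennreal (\<beta> n) * ennreal (2 * a n * ?L\<^sup>2 * (E.W2 / E.N\<^sup>2))"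
      by (intro mult_left_mono E.nn_integral_Q3) auto
    also have "\<dots> = ennreal (\<beta> n * (2 * a n * ?L\<^sup>2 * (E.W2 / E.N\<^sup>2)))"
      using elim E.a E.W2_nonneg by (intro ennreal_mult[symmetric]) auto
    finally show ?case unfolding E.W2_def E.N_def by (simp add: mult_ac)
  qed
  show "(\<lambda>n. 2 * ?L\<^sup>2 * (\<beta> n * a n * (W2 n / (real n * \<Delta> n)\<^sup>2))) \<longlonglongrightarrow> 0"
    using tendsto_mult[OF tendsto_const rate_W2, of "2 * ?L\<^sup>2"] by simp
qed

lemma Q4_tendsto:
  assumes F2: "integrable lborel (\<lambda>u. (norm (FT f u))\<^sup>2)"
  shows "((\<lambda>q. \<beta> (fst q) * Q4 (fst q) (snd q)) \<longlongrightarrow> 0) PF"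
proof (rule tendsto_prob_filter_Markov)
  let ?I = "LINT u|lborel. (norm (FT f u))\<^sup>2"
  show "\<forall>\<^sub>F n in sequentially. (\<lambda>w. \<beta> n * Q4 n w) \<in> borel_measurable M"
      using eventually_window by eventually_elim (intro borel_measurable_times borel_measurable_const estimator_window.Q4_measurable)
  show "\<forall>\<^sub>F n in sequentially. \<forall>w\<in>space M. 0 \<le> \<beta> n * Q4 n w"
    using eventually_window \<beta> by eventually_elim (auto intro: mult_nonneg_nonneg estimator_window.Q4_nonneg)
  show "\<forall>\<^sub>F n in sequentially. (\<integral>\<^sup>+ w. ennreal (\<beta> n * Q4 n w) \<partial>M) \<le> ennreal (260 * ?I * (\<beta> n * Wmax n))"
    using eventually_window \<beta>
  proof eventually_elim
    case (elim n)
    interpret E: estimator_window M \<alpha> \<Lambda> f C r X n "\<Delta> n" "m n" "W n" "\<omega> n" "a n" "Wmax n" by fact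
    have wm: "Wmax n \<ge> 0" using E.w_max[of 0] E.W[of 0] by simp
    have "(\<integral>\<^sup>+ w. ennreal (\<beta> n * Q4 n w) \<partial>M) = ennreal (\<beta> n) * (\<integral>\<^sup>+ w. ennreal (Q4 n w) \<partial>M)"
      using elim E.Q4_nonneg by (subst nn_integral_cmult[symmetric]) (auto simp: ennreal_mult)
    also have "\<dots> \<le> ennreal (\<beta> n) * ennreal (260 * Wmax n * ?I)"
      by (intro mult_left_mono E.nn_integral_Q4 F2) auto
    also have "\<dots> = ennreal (\<beta> n * (260 * Wmax n * ?I))"
      using elim wm by (intro ennreal_mult[symmetric] mult_nonneg_nonneg) auto
    finally show ?case by (simp add: mult_ac)
  qed
  show "(\<lambda>n. 260 * ?I * (\<beta> n * Wmax n)) \<longlonglongrightarrow> 0"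
    using tendsto_mult[OF tendsto_const rate_Wmax, of "260 * ?I"] by simp
qed

lemma band_error_tendsto:
  assumes F2: "integrable lborel (\<lambda>u. (norm (FT f u))\<^sup>2)"
  shows "((\<lambda>q. \<beta> (fst q) * (LINT u|band (a (fst q)). (Pn (fst q) u (snd q) - norm (FT f u))\<^sup>2)) \<longlongrightarrow> 0) PF"
proof (rule tendsto_sandwich[OF _ _ tendsto_const])
  show "\<forall>\<^sub>F q in PF. 0 \<le> \<beta> (fst q) * (LINT u|band (a (fst q)). (Pn (fst q) u (snd q) - norm (FT f u))\<^sup>2)"
    using eventually_prob_filter_fst[OF \<beta>] by eventually_elim (auto intro!: mult_nonneg_nonneg integral_nonneg_AE)
  let ?e1 = "\<lambda>q. \<beta> (fst q) * Q1 (fst q) (snd q) / D2 (fst q) (snd q) + \<beta> (fst q) * Q3 (fst q) (snd q) + \<beta> (fst q) * Q4 (fst q) (snd q)"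
  show "\<forall>\<^sub>F q in PF. \<beta> (fst q) * (LINT u|band (a (fst q)). (Pn (fst q) u (snd q) - norm (FT f u))\<^sup>2) \<le>
     3 * (?e1 q)"
    using eventually_prob_filter_fst[OF \<beta>] eventually_prob_filter_fst[OF eventually_window] eventually_D2_pos
  proof eventually_elim
    case (elim q)
    have "\<beta> (fst q) * (LINT u|band (a (fst q)). (Pn (fst q) u (snd q) - norm (FT f u))\<^sup>2) \<le>
       \<beta> (fst q) * (3 * (Q1 (fst q) (snd q) / D2 (fst q) (snd q) + Q3 (fst q) (snd q) + Q4 (fst q) (snd q)))"
      using elim(1) by (intro mult_left_mono estimator_window.band_error_le[OF elim(2,3)]) auto
    then show ?case by (simp add: algebra_simps)
  qed
  have "((\<lambda>q. 3 * (?e1 q)) \<longlongrightarrow> 3 * (0 + 0 + 0)) PF"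
    by (intro tendsto_intros Q1_tendsto Q3_tendsto Q4_tendsto[OF F2])
  then show "((\<lambda>q. 3 * (?e1 q)) \<longlongrightarrow> 0) PF" by simp
qed

lemma T1_tendsto: "((\<lambda>q. T1 (fst q) (snd q)) \<longlongrightarrow> 0) PF"
proof -
  let ?R = "riemann_const (C\<^sup>2) r" and ?R1 = "riemann_const 1 (r - 1)"
  have "((\<lambda>q. \<bar>T1 (fst q) (snd q)\<bar>) \<longlongrightarrow> 0) PF"
  proof (rule tendsto_prob_filter_Markov)
    show "\<forall>\<^sub>F n in sequentially. (\<lambda>w. \<bar>T1 n w\<bar>) \<in> borel_measurable M"
      using eventually_window by eventually_elim (intro borel_measurable_abs estimator_window.T1_measurable)
    show "\<forall>\<^sub>F n in sequentially. (\<integral>\<^sup>+ w. ennreal \<bar>T1 n w\<bar> \<partial>M) \<le> ennreal (?R * ((2 * C * \<omega> n) powr (1 - 1/r) + 2 * ?R1 / N n))"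
      using eventually_window
    proof eventually_elim
      case (elim n)
      interpret E: estimator_window M \<alpha> \<Lambda> f C r X n "\<Delta> n" "m n" "W n" "\<omega> n" "a n" "Wmax n" by fact
      show ?case using E.nn_integral_T1 unfolding N_eq[OF elim] by simp
    qed
    have N_inf: "filterlim N at_top sequentially" unfolding N_def[abs_def] by (rule \<Delta>(3))
    have 1: "(\<lambda>n. 2 * ?R1 / N n) \<longlonglongrightarrow> 0" by (rule real_tendsto_divide_at_top[OF tendsto_const N_inf])
    have 2: "(\<lambda>n. (2 * C * \<omega> n) powr (1 - 1/r)) \<longlonglongrightarrow> 0"
    proof (rule tendsto_powr_zero)
      show "(\<lambda>n. 2 * C * \<omega> n) \<longlonglongrightarrow> 0" using tendsto_mult[OF tendsto_const \<omega>(2), of "2 * C"] by simp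
      show "\<forall>\<^sub>F n in sequentially. 0 \<le> 2 * C * \<omega> n" using \<omega>(1) by eventually_elim (use C_nonneg in auto)
    qed (use r in auto)
    have "(\<lambda>n. ?R * ((2 * C * \<omega> n) powr (1 - 1/r) + 2 * ?R1 / N n)) \<longlonglongrightarrow> ?R * (0 + 0)"
      by (intro tendsto_intros 1 2)
    then show "(\<lambda>n. ?R * ((2 * C * \<omega> n) powr (1 - 1/r) + 2 * ?R1 / N n)) \<longlonglongrightarrow> 0" by simp
  qed auto
  then show ?thesis by (rule tendsto_rabs_zero_cancel)
qed

lemma T2_tendsto: "((\<lambda>q. T2 (fst q) (snd q)) \<longlongrightarrow> 0) PF"
proof -
  have "((\<lambda>q. (T2 (fst q) (snd q))\<^sup>2) \<longlongrightarrow> 0) PF"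
  proof (rule tendsto_prob_filter_Markov[where Y = "\<lambda>n w. (T2 n w)\<^sup>2"])
    show "\<forall>\<^sub>F n in sequentially. (\<lambda>w. (T2 n w)\<^sup>2) \<in> borel_measurable M"
      using eventually_window by eventually_elim (intro borel_measurable_power estimator_window.T2_measurable)
    show "\<forall>\<^sub>F n in sequentially. (\<integral>\<^sup>+ w. ennreal ((T2 n w)\<^sup>2) \<partial>M) \<le> ennreal (4 * C * Rc ^ 3 / N n)"
      using eventually_window
    proof eventually_elim
      case (elim n)
      interpret E: estimator_window M \<alpha> \<Lambda> f C r X n "\<Delta> n" "m n" "W n" "\<omega> n" "a n" "Wmax n" by fact
      show ?case using E.nn_integral_T2 unfolding E.R0_def N_eq[OF elim] by simp
    qed
    have N_inf: "filterlim N at_top sequentially" unfolding N_def[abs_def] by (rule \<Delta>(3))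
    show "(\<lambda>n. 4 * C * Rc ^ 3 / N n) \<longlonglongrightarrow> 0" by (rule real_tendsto_divide_at_top[OF tendsto_const N_inf])
  qed auto
  from tendsto_real_sqrt[OF this] have "((\<lambda>q. \<bar>T2 (fst q) (snd q)\<bar>) \<longlongrightarrow> 0) PF" by simp
  then show ?thesis by (rule tendsto_rabs_zero_cancel)
qed

definition kap :: "nat \<Rightarrow> 'w \<Rightarrow> real" where
  "kap n w = sqrt (\<Delta> n * (\<Sum>j=1..n. (X (real j * \<Delta> n) w)\<^sup>2) / D2 n w)"

text \<open>For the discretized moving average the squared ratio is the integral of f^2 up to T1 and
  T2. Passing to the actual observations costs at most the root of Q2 / D2.\<close>

lemma kap_tendsto: "((\<lambda>q. kap (fst q) (snd q)) \<longlongrightarrow> sqrt (LINT x|lborel. (f x)\<^sup>2)) PF"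
proof -
  let ?I = "LINT x|lborel. (f x)\<^sup>2"
  let ?kd = "\<lambda>n w. sqrt (\<Delta> n * (\<Sum>l=1..n. (Xd n l w)\<^sup>2) / D2 n w)"
  have "((\<lambda>q. sqrt (?I + T1 (fst q) (snd q) + T2 (fst q) (snd q))) \<longlongrightarrow> sqrt (?I + 0 + 0)) PF"
    by (intro tendsto_intros T1_tendsto T2_tendsto)
  then have kd: "((\<lambda>q. ?kd (fst q) (snd q)) \<longlongrightarrow> sqrt (?I + 0 + 0)) PF"
  proof (rule Lim_transform_eventually)
    show "\<forall>\<^sub>F q in PF. sqrt (?I + T1 (fst q) (snd q) + T2 (fst q) (snd q)) = ?kd (fst q) (snd q)"
      using eventually_prob_filter_fst[OF eventually_window] eventually_D2_pos
    proof eventually_elim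
      case (elim q)
      interpret E: estimator_window M \<alpha> \<Lambda> f C r X "fst q" "\<Delta> (fst q)" "m (fst q)" "W (fst q)" "\<omega> (fst q)" "a (fst q)" "Wmax (fst q)" by fact
      show ?case using E.denominator_eq[OF elim(2)] unfolding E.L2f_def by simp
    qed
  qed
  have "((\<lambda>q. kap (fst q) (snd q) - ?kd (fst q) (snd q)) \<longlongrightarrow> 0) PF"
  proof (rule Lim_null_comparison)
    have "((\<lambda>q. sqrt (Q2 (fst q) (snd q) / D2 (fst q) (snd q))) \<longlongrightarrow> sqrt 0) PF"
      by (intro tendsto_intros Q2_tendsto)
    then show "((\<lambda>q. sqrt (Q2 (fst q) (snd q) / D2 (fst q) (snd q))) \<longlongrightarrow> 0) PF" by simp
    show "\<forall>\<^sub>F q in PF. norm (kap (fst q) (snd q) - ?kd (fst q) (snd q)) \<le> sqrt (Q2 (fst q) (snd q) / D2 (fst q) (snd q))"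
      using eventually_prob_filter_fst[OF eventually_window] eventually_D2_pos
    proof eventually_elim
      case (elim q)
      let ?x = "sqrt (\<Delta> (fst q) * (\<Sum>j=1..fst q. (X (real j * \<Delta> (fst q)) (snd q))\<^sup>2))"
      let ?y = "sqrt (\<Delta> (fst q) * (\<Sum>l=1..fst q. (Xd (fst q) l (snd q))\<^sup>2))"
      let ?d = "sqrt (D2 (fst q) (snd q))"
      have "\<bar>?x - ?y\<bar> / ?d \<le> sqrt (Q2 (fst q) (snd q)) / ?d"
        using elim(2) by (intro divide_right_mono estimator_window.sqrt_denominator_diff[OF elim(1)]) auto
      moreover have "norm (kap (fst q) (snd q) - ?kd (fst q) (snd q)) = \<bar>?x - ?y\<bar> / ?d"
        using elim(2) unfolding kap_def real_sqrt_divide by (simp add: diff_divide_distrib[symmetric])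
      ultimately show ?case by (simp add: real_sqrt_divide)
    qed
  qed
  from tendsto_add[OF this kd] show ?thesis by simp
qed

lemma kap_smoothed:
  "\<forall>\<^sub>F n in sequentially. \<forall>u w. kap n w * sqrt (\<Delta> n * smoothed_periodogram (\<Delta> n) n (m n) (W n) (\<lambda>j. X (real j * \<Delta> n) w) u) = Pn n u w"
  using eventually_window
proof eventually_elim
  case (elim n)
  interpret E: estimator_window M \<alpha> \<Lambda> f C r X n "\<Delta> n" "m n" "W n" "\<omega> n" "a n" "Wmax n" by fact
  show ?case unfolding kap_def E.P_eq_smoothed by simp
qed

end

section \<open>Positive semidefinite functions and the sign of the transform\<close>

lemma positive_semidefinite_pair:
  assumes f: "positive_semidefinite f"
  shows "complex_of_real (f 0) * z * cnj z + of_real (f x) * z * cnj y + of_real (f (- x)) * y * cnj z + of_real (f 0) * y * cnj y \<in> \<real>\<^sub>\<ge>\<^sub>0"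
proof -
  let ?t = "\<lambda>i. if i = (0::nat) then x else 0" and ?z = "\<lambda>i. if i = (0::nat) then z else y"
  have "(\<Sum>i<2. \<Sum>j<2. complex_of_real (f (?t i - ?t j)) * ?z i * cnj (?z j)) \<in> \<real>\<^sub>\<ge>\<^sub>0"
    using f[unfolded positive_semidefinite_def, rule_format, of ?t ?z 2] .
  then show ?thesis by (simp add: numeral_2_eq_2 add_ac)
qed

text \<open>For z = 1 and y = i the imaginary part of the double sum is f(-x) - f(x), which has to
  be 0.\<close>

lemma positive_semidefinite_even: "positive_semidefinite f \<Longrightarrow> f (- x) = f x"
  using positive_semidefinite_pair[of f 1 x \<i>] by (simp add: complex_nonneg_Reals_iff)

text \<open>The choices y = 1 and y = -1 show that 2 f(0) + 2 f(x) and 2 f(0) - 2 f(x) are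
  nonnegative.\<close>

lemma positive_semidefinite_bounded: "positive_semidefinite f \<Longrightarrow> \<bar>f x\<bar> \<le> f 0"
  using positive_semidefinite_pair[of f 1 x 1] positive_semidefinite_pair[of f 1 x "-1"] positive_semidefinite_even[of f x]
  by (simp add: complex_nonneg_Reals_iff)

text \<open>With grid points t_j and coefficients cis (t_j u), the double sum of positive
  semidefiniteness is a positive multiple of the average over p of Riemann sums of the transform. By
  \<open>grid_average\<close> these averages converge to FT f u, and the nonnegative reals are
  closed.\<close>

lemma (in estimation) FT_nonneg:
  assumes psd: "positive_semidefinite f"
  shows "FT f u \<in> \<real>\<^sub>\<ge>\<^sub>0"
proof -
  let ?e2 = "\<lambda>j n p. real j * \<Delta> n - real p * \<Delta> n"
  define A where "A n = (\<Sum>p=1..n. of_real (\<Delta> n) * (\<Sum>j=1..n. of_real (f (?e2 j n p)) * cis ((?e2 j n p) * u))) / of_nat n" for n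
  let ?e1 = "\<lambda>n. \<Sum>p=1..n. \<Sum>j=1..n. complex_of_real (f (?e2 j n p)) * cis ((?e2 j n p) * u)"
  have A: "\<forall>\<^sub>F n in sequentially. A n \<in> \<real>\<^sub>\<ge>\<^sub>0"
    using eventually_ge_at_top[of 1]
  proof eventually_elim
    case (elim n)
    let ?t = "\<lambda>i. real (Suc i) * \<Delta> n" and ?z = "\<lambda>i. cis (real (Suc i) * \<Delta> n * u)"
    have "(?e1 n) =
        (\<Sum>p<n. \<Sum>j<n. complex_of_real (f (?t j - ?t p)) * cis ((?t j - ?t p) * u))"
      unfolding One_nat_def sum.atLeast1_atMost_eq ..
    also have "\<dots> = (\<Sum>j<n. \<Sum>p<n. complex_of_real (f (?t j - ?t p)) * cis ((?t j - ?t p) * u))"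
      by (rule sum.swap)
    also have "\<dots> = (\<Sum>j<n. \<Sum>p<n. complex_of_real (f (?t j - ?t p)) * ?z j * cnj (?z p))"
      by (intro sum.cong refl) (simp add: cis_cnj cis_mult left_diff_distrib mult.assoc)
    also have "\<dots> \<in> \<real>\<^sub>\<ge>\<^sub>0" using psd[unfolded positive_semidefinite_def, rule_format, of ?t ?z n] .
    finally have 1: "(?e1 n) \<in> \<real>\<^sub>\<ge>\<^sub>0" .
    have "A n = of_real (\<Delta> n / n) * (?e1 n)"
      unfolding A_def sum_distrib_left[symmetric] by simp
    also have "\<dots> \<in> \<real>\<^sub>\<ge>\<^sub>0"
      using \<Delta>(1)[OF elim] by (intro nonneg_Reals_mult_I 1) (auto intro!: divide_nonneg_nonneg simp: less_imp_le)
    finally show ?case .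
  qed
  have lim: "(\<lambda>n. A n - FT f u) \<longlonglongrightarrow> 0"
  proof (rule Lim_null_comparison)
    let ?R = "riemann_const C r" and ?R1 = "riemann_const 1 (r - 1)"
    show "\<forall>\<^sub>F n in sequentially. norm (A n - FT f u) \<le> ?R * (\<omega> n powr (1 - 1/r) + \<Delta> n * \<bar>u\<bar> + 2 * ?R1 / N n)"
      using eventually_window
    proof eventually_elim
      case (elim n)
      interpret E: estimator_window M \<alpha> \<Lambda> f C r X n "\<Delta> n" "m n" "W n" "\<omega> n" "a n" "Wmax n" by fact
      have n: "n > 0" using E.n_ge_2 by simp
      let ?g = "\<lambda>p. of_real (\<Delta> n) * (\<Sum>j=1..n. of_real (f (?e2 j n p)) * cis ((?e2 j n p) * u))"
      have "A n - FT f u = (\<Sum>p=1..n. ?g p - FT f u) / of_nat n"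
        using n unfolding A_def sum_subtractf by (simp add: field_simps)
      then have "norm (A n - FT f u) = norm (\<Sum>p=1..n. ?g p - FT f u) / n" by (simp only: norm_divide norm_of_nat)
      also have "\<dots> \<le> (\<Sum>p=1..n. norm (?g p - FT f u)) / n"
        by (intro divide_right_mono norm_sum) auto
      also have "\<dots> \<le> ?R * (\<omega> n powr (1 - 1/r) + \<Delta> n * \<bar>u\<bar> + 2 * ?R1 / (real n * \<Delta> n))"
        by (rule grid_average[OF r2 E.Delta E.\<omega> E.N_ge_1])
      finally show ?case unfolding N_def .
    qed
    have N_inf: "filterlim N at_top sequentially" unfolding N_def[abs_def] by (rule \<Delta>(3))
    have 1: "(\<lambda>n. 2 * ?R1 / N n) \<longlonglongrightarrow> 0" by (rule real_tendsto_divide_at_top[OF tendsto_const N_inf])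
    have 2: "(\<lambda>n. \<omega> n powr (1 - 1/r)) \<longlonglongrightarrow> 0"
      by (rule tendsto_powr_zero[OF \<omega>(2)]) (use \<omega>(1) r in \<open>auto elim: eventually_mono\<close>)
    have "(\<lambda>n. ?R * (\<omega> n powr (1 - 1/r) + \<Delta> n * \<bar>u\<bar> + 2 * ?R1 / N n)) \<longlonglongrightarrow> ?R * (0 + 0 * \<bar>u\<bar> + 0)"
      by (intro tendsto_mult tendsto_add tendsto_const 1 2 \<Delta>(2))
    then show "(\<lambda>n. ?R * (\<omega> n powr (1 - 1/r) + \<Delta> n * \<bar>u\<bar> + 2 * ?R1 / N n)) \<longlonglongrightarrow> 0" by simp
  qed
  then have "A \<longlonglongrightarrow> FT f u" by (simp add: LIM_zero_iff)
  then show ?thesis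
    by (rule Lim_in_closed_set[OF _ A sequentially_bot, rotated]) (rule closed_nonneg_Reals_complex)
qed

section \<open>The kernel estimator as a truncated transform, and Hoelder's inequality\<close>

lemma truncated_continuous:
  fixes k :: "real \<Rightarrow> real"
  assumes k: "continuous_on UNIV k"
  shows "integrable lborel (\<lambda>u. indicator {-a..a} u * k u)"
    and "\<exists>B. \<forall>u. \<bar>indicator {-a..a} u * k u\<bar> \<le> B"
    and "AE u in lborel. isCont (\<lambda>u. indicator {-a..a} u * k u) u"
proof -
  let ?e1 = "\<lambda>u. indicator {-a..a} u * k u"
  have "set_integrable lborel {-a..a} k"
    by (intro borel_integrable_atLeastAtMost' continuous_on_subset[OF k]) auto
  then show "integrable lborel ?e1"
    by (simp add: set_integrable_def)
  have "bounded (k ` {-a..a})"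
    by (intro compact_imp_bounded compact_continuous_image continuous_on_subset[OF k]) auto
  then obtain B where "\<forall>y\<in>k ` {-a..a}. \<bar>y\<bar> \<le> B" unfolding bounded_real by blast
  then have "\<forall>u. \<bar>indicator {-a..a} u * k u\<bar> \<le> max B 0" by (auto simp: indicator_def intro: max.coboundedI1)
  then show "\<exists>B. \<forall>u. \<bar>indicator {-a..a} u * k u\<bar> \<le> B" by blast
  \<comment> \<open>The only possible jumps are at the ends of the band, a null set.\<close>
  have "isCont ?e1 u" if "u \<notin> {-a, a}" for u
  proof -
    have c: "isCont k u" using k by (simp add: continuous_on_eq_continuous_at)
    show ?thesis
    proof (cases "u \<in> {-a<..<a}")
      case True
      have "isCont ?e1 u \<longleftrightarrow> isCont k u"
      proof (rule isCont_cong)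
        have "\<forall>\<^sub>F v in nhds u. v \<in> {-a<..<a}" by (rule eventually_nhds_in_open) (use True in auto)
        then show "\<forall>\<^sub>F v in nhds u. indicator {-a..a} v * k v = k v" by eventually_elim (auto simp: indicator_def)
      qed
      then show ?thesis using c by simp
    next
      case False
      then have u: "u \<in> - {-a..a}" using that by auto
      have "isCont ?e1 u \<longleftrightarrow> isCont (\<lambda>_. 0::real) u"
      proof (rule isCont_cong)
        have "\<forall>\<^sub>F v in nhds u. v \<in> - {-a..a}" by (rule eventually_nhds_in_open) (use u in auto)
        then show "\<forall>\<^sub>F v in nhds u. indicator {-a..a} v * k v = 0" by eventually_elim (auto simp: indicator_def)
      qed
      then show ?thesis by simp
    qed
  qed
  moreover have "AE u in lborel. u \<notin> {-a, a}" by (intro AE_not_in) (auto intro: finite_imp_null_set_lborel)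
  ultimately show "AE u in lborel. isCont ?e1 u" by auto
qed

text \<open>Brings the estimator into the form \<phi>-transform over 2 pi to which
  \<open>FT_L2_distance\<close> applies.\<close>

lemma kernel_estimator_FT:
  "kernel_estimator \<Delta> n m W a x t =
     FT (\<lambda>u. indicator {-a..a} u * sqrt (\<Delta> * smoothed_periodogram \<Delta> n m W x u)) t / (2 * pi)"
proof -
  have "(LINT u:{-a..a}|lborel. of_real (sqrt (\<Delta> * smoothed_periodogram \<Delta> n m W x u)) * exp (\<i> * of_real (t * u))) =
     FT (\<lambda>u. indicator {-a..a} u * sqrt (\<Delta> * smoothed_periodogram \<Delta> n m W x u)) t"
    unfolding FT_def set_lebesgue_integral_def
    by (intro Bochner_Integration.integral_cong refl) (auto simp: indicator_def cis_conv_exp mult.commute)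
  then show ?thesis unfolding kernel_estimator_def by simp
qed

lemma smoothed_periodogram_continuous: "continuous_on UNIV (smoothed_periodogram \<Delta> n m W x)"
  unfolding smoothed_periodogram_def[abs_def] periodogram_def divide_inverse
  by (intro continuous_intros)

lemma smoothed_periodogram_measurable [measurable (raw)]:
  assumes [measurable]: "\<And>j. x j \<in> borel_measurable M" "u \<in> borel_measurable M"
  shows "(\<lambda>w. smoothed_periodogram \<Delta> n m W (\<lambda>j. x j w) (u w)) \<in> borel_measurable M"
  unfolding smoothed_periodogram_def periodogram_def cis_conv_exp[symmetric] by measurable

lemma kernel_estimator_measurable:
  assumes [measurable]: "\<And>j. x j \<in> borel_measurable M"
  shows "(\<lambda>(w, t). kernel_estimator \<Delta> n m W a (\<lambda>j. x j w) t) \<in> borel_measurable (M \<Otimes>\<^sub>M lborel)"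
  unfolding kernel_estimator_FT FT_def by measurable

lemma kernel_estimator_L2:
  "(\<lambda>t. kernel_estimator \<Delta> n m W a x t) \<in> borel_measurable borel"
  "integrable lborel (\<lambda>t. (norm (kernel_estimator \<Delta> n m W a x t))\<^sup>2)"
  "\<exists>B. \<forall>t. norm (kernel_estimator \<Delta> n m W a x t) \<le> B"
proof -
  let ?k = "\<lambda>u. sqrt (\<Delta> * smoothed_periodogram \<Delta> n m W x u)"
  have c: "continuous_on UNIV ?k" by (intro continuous_intros smoothed_periodogram_continuous)
  note tc = truncated_continuous[OF c, of a]
  have [measurable]: "(\<lambda>u. indicator {-a..a} u * ?k u) \<in> borel_measurable borel" using tc(1) by auto
  show "(\<lambda>t. kernel_estimator \<Delta> n m W a x t) \<in> borel_measurable borel"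
    unfolding kernel_estimator_FT by (intro borel_measurable_divide FT_measurable) auto
  obtain B where B: "\<And>u. \<bar>indicator {-a..a} u * ?k u\<bar> \<le> B" using tc(2) by blast
  show "integrable lborel (\<lambda>t. (norm (kernel_estimator \<Delta> n m W a x t))\<^sup>2)"
    unfolding kernel_estimator_FT norm_divide power_divide
    by (intro integrable_divide FT_square_integral(1)[OF tc(1) B tc(3)])
  show "\<exists>B. \<forall>t. norm (kernel_estimator \<Delta> n m W a x t) \<le> B"
    unfolding kernel_estimator_FT norm_divide
    by (rule exI, rule allI, rule divide_right_mono[OF norm_FT_le_integral[OF tc(1)] norm_ge_zero])
qed

text \<open>Hoelder's inequality with exponent 2/\<alpha> on an interval of length 2 c, obtained
  from Young's inequality with a free parameter l.\<close>

lemma truncated_powr_integral_le: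
  fixes h :: "real \<Rightarrow> complex"
  assumes [measurable]: "h \<in> borel_measurable borel" and int: "integrable lborel (\<lambda>t. (norm (h t))\<^sup>2)"
    and \<alpha>: "0 < \<alpha>" "\<alpha> < 2" and c: "c \<ge> 0"
  shows "set_integrable lborel {-c..c} (\<lambda>t. norm (h t) powr \<alpha>)"
    and "(LINT t:{-c..c}|lborel. norm (h t) powr \<alpha>) \<le> ((2 * c) powr (2/\<alpha> - 1) * (LINT t|lborel. (norm (h t))\<^sup>2)) powr (\<alpha>/2)"
proof -
  let ?p = "\<alpha>/2" and ?q = "1 - \<alpha>/2" and ?S = "LINT t|lborel. (norm (h t))\<^sup>2"
  let ?I = "indicator {-c..c} :: real \<Rightarrow> real"
  let ?J = "LINT t:{-c..c}|lborel. norm (h t) powr \<alpha>"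
  have Ii: "integrable lborel ?I" by (intro integrable_real_indicator) (auto simp: emeasure_lborel_Icc_eq)
  have young: "norm (h t) powr \<alpha> * l powr ?q \<le> ?p * (norm (h t))\<^sup>2 + ?q * l" if "l > 0" for l t
  proof (cases "h t = 0")
    case False
    have sq: "(norm (h t))\<^sup>2 = norm (h t) powr 2" by simp
    have "norm (h t) powr \<alpha> = ((norm (h t))\<^sup>2) powr ?p"
      unfolding sq powr_powr by simp
    then show ?thesis using Youngs_inequality_0[of ?p ?q "(norm (h t))\<^sup>2" l] \<alpha> that False by simp
  qed (use \<alpha> that in auto)
  show si: "set_integrable lborel {-c..c} (\<lambda>t. norm (h t) powr \<alpha>)"
    unfolding set_integrable_def
  proof (rule Bochner_Integration.integrable_bound)
    show "integrable lborel (\<lambda>t. ?p * (norm (h t))\<^sup>2 + ?q * ?I t)" using int Ii by simp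
    have "norm (?I t *\<^sub>R norm (h t) powr \<alpha>) \<le> norm (?p * (norm (h t))\<^sup>2 + ?q * ?I t)" for t
      using young[of 1 t] \<alpha> by (auto simp: indicator_def)
    then show "AE t in lborel. norm (?I t *\<^sub>R norm (h t) powr \<alpha>) \<le> norm (?p * (norm (h t))\<^sup>2 + ?q * ?I t)" by simp
  qed measurable
  have le: "?J * l powr ?q \<le> ?p * ?S + ?q * (l * (2 * c))" if l: "l > 0" for l
  proof -
    have "?J * l powr ?q = (LINT t|lborel. (?I t *\<^sub>R norm (h t) powr \<alpha>) * l powr ?q)"
      unfolding set_lebesgue_integral_def by simp
    also have "\<dots> \<le> (LINT t|lborel. ?p * (norm (h t))\<^sup>2 + ?q * l * ?I t)"
    proof (rule integral_mono)
      show "integrable lborel (\<lambda>t. (?I t *\<^sub>R norm (h t) powr \<alpha>) * l powr ?q)"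
        using si unfolding set_integrable_def by (rule integrable_mult_left)
      show "integrable lborel (\<lambda>t. ?p * (norm (h t))\<^sup>2 + ?q * l * ?I t)" using int Ii by simp
      show "(?I t *\<^sub>R norm (h t) powr \<alpha>) * l powr ?q \<le> ?p * (norm (h t))\<^sup>2 + ?q * l * ?I t" for t
        using young[OF l, of t] \<alpha> by (auto simp: indicator_def)
    qed
    also have "\<dots> = ?p * ?S + ?q * (l * (2 * c))" using int Ii c by (simp add: mult_ac)
    finally show ?thesis .
  qed
  have S0: "?S \<ge> 0" by (intro integral_nonneg_AE) auto
  show "?J \<le> ((2 * c) powr (2/\<alpha> - 1) * ?S) powr ?p"
  \<comment> \<open>The optimal parameter degenerates if S or c is 0; the integral over the interval
    is then 0.\<close>
  proof (cases "?S = 0 \<or> c = 0")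
    case True
    have "?J \<le> 0"
    proof (cases "c = 0")
      case True
      have "AE t in lborel. t \<notin> {0::real}" by (rule AE_not_in[OF finite_imp_null_set_lborel]) simp
      then have "AE t in lborel. ?I t *\<^sub>R norm (h t) powr \<alpha> = 0"
        by eventually_elim (simp add: True indicator_def)
      then show ?thesis unfolding set_lebesgue_integral_def by (subst integral_cong_AE[where g = "\<lambda>_. 0"]) auto
    next
      case False
      then have "AE t in lborel. (norm (h t))\<^sup>2 = 0"
        using True int by (subst (asm) integral_nonneg_eq_0_iff_AE) auto
      then have "AE t in lborel. ?I t *\<^sub>R norm (h t) powr \<alpha> = 0" by eventually_elim simp
      then show ?thesis unfolding set_lebesgue_integral_def by (subst integral_cong_AE[where g = "\<lambda>_. 0"]) auto
    qed
    then show ?thesis by (meson order.trans powr_ge_zero)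
  next
    case False
    then have S: "?S > 0" using S0 by linarith
    have c: "c > 0" using False c by auto
    \<comment> \<open>The optimal parameter: both terms of the bound become multiples of S and add
      up to S.\<close>
    let ?l = "?S / (2 * c)"
    have l: "?l > 0" using S c by simp
    have "?J * ?l powr ?q \<le> ?S" using le[OF l] c \<alpha> by (simp add: field_simps)
    then have "?J \<le> ?S / ?l powr ?q" using l by (subst pos_le_divide_eq) auto
    also have "\<dots> = ?S powr (1 - ?q) * (2 * c) powr ?q"
    proof -
      have "x / (x / y) powr q = x powr (1 - q) * y powr q" if "x > 0" "y > 0" for x y q :: real
        using that by (simp add: powr_divide powr_diff)
      then show ?thesis using S c by simp
    qed
    also have "\<dots> = ((2 * c) powr (2/\<alpha> - 1) * ?S) powr ?p"
    proof -
      have "(2/\<alpha> - 1) * ?p = ?q" using \<alpha> by (simp add: left_diff_distrib)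
      then show ?thesis unfolding powr_mult powr_powr by (simp only: powr_mult) simp
    qed
    finally show ?thesis .
  qed
qed

section \<open>The plug-in estimators\<close>

lemma FT_cmult: "FT (\<lambda>u. k * h u) t = of_real k * FT h t"
  unfolding FT_def by (simp add: mult.assoc)

lemma (in estimation) f_continuous: "continuous_on UNIV f"
  unfolding continuous_on_iff
proof (intro ballI allI impI)
  fix x e :: real assume "e > 0"
  then have "\<forall>\<^sub>F n in sequentially. \<omega> n < e" by (rule order_tendstoD(2)[OF \<omega>(2)])
  then have "\<forall>\<^sub>F n in sequentially. \<exists>d>0. \<forall>x'\<in>UNIV. dist x' x < d \<longrightarrow> dist (f x') (f x) < e"
    using \<omega>(1) eventually_ge_at_top[of 1]
  proof eventually_elim
    case (elim n)
    then show ?case using \<Delta>(1)[of n] by (intro exI[of _ "\<Delta> n"]) (auto simp: dist_real_def intro: le_less_trans)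
  qed
  then show "\<exists>d>0. \<forall>x'\<in>UNIV. dist x' x < d \<longrightarrow> dist (f x') (f x) < e"
    using eventually_happens[of _ sequentially] by auto
qed

lemma integral_pos_of_continuous:
  fixes h :: "real \<Rightarrow> real"
  assumes h: "continuous_on UNIV h" "\<And>x. h x \<ge> 0" "integrable lborel h" and y: "h y > 0"
  shows "(LINT x|lborel. h x) > 0"
proof (rule ccontr)
  assume "\<not> ?thesis"
  moreover have "(LINT x|lborel. h x) \<ge> 0" using h(2) by (intro integral_nonneg_AE) auto
  ultimately have "(LINT x|lborel. h x) = 0" by linarith
  then have ae: "AE x in lborel. h x = 0" using h by (subst (asm) integral_nonneg_eq_0_iff_AE) auto
  have op: "open {x. h x > 0}" by (rule open_Collect_less[OF continuous_on_const h(1)])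
  then obtain e where e: "e > 0" "ball y e \<subseteq> {x. h x > 0}" using y openE[of "{x. h x > 0}" y] by auto
  from ae have "AE x in lborel. x \<notin> ball y e" by eventually_elim (use e in auto)
  then have "emeasure lborel (ball y e) = 0"
    by (subst (asm) AE_iff_measurable[where N = "ball y e"]) auto
  moreover have "ball y e = {y - e<..<y + e}" by (auto simp: dist_real_def)
  ultimately show False using e(1) by simp
qed

lemma integrable_square_diff:
  fixes x y :: "real \<Rightarrow> complex"
  assumes [measurable]: "x \<in> borel_measurable borel" "y \<in> borel_measurable borel"
    and "integrable lborel (\<lambda>t. (norm (x t))\<^sup>2)" "integrable lborel (\<lambda>t. (norm (y t))\<^sup>2)"
  shows "integrable lborel (\<lambda>t. (norm (x t - y t))\<^sup>2)"
proof (rule Bochner_Integration.integrable_bound)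
  show "integrable lborel (\<lambda>t. 2 * (norm (x t))\<^sup>2 + 2 * (norm (y t))\<^sup>2)" using assms by simp
  have "(norm (x t - y t))\<^sup>2 \<le> 2 * (norm (x t))\<^sup>2 + 2 * (norm (y t))\<^sup>2" for t
  proof -
    have "(norm (x t - y t))\<^sup>2 \<le> (norm (x t) + norm (y t))\<^sup>2" by (intro power_mono norm_triangle_ineq4) auto
    also have "\<dots> \<le> 2 * (norm (x t))\<^sup>2 + 2 * (norm (y t))\<^sup>2"
      using zero_le_power2[of "norm (x t) - norm (y t)"] unfolding power2_sum power2_diff by simp
    finally show ?thesis .
  qed
  then show "AE t in lborel. norm ((norm (x t - y t))\<^sup>2) \<le> norm (2 * (norm (x t))\<^sup>2 + 2 * (norm (y t))\<^sup>2)" by simp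
qed measurable

text \<open>\<open>c\<close> is the half-length of the window on which the \<alpha>-norm is
  computed. The cost (2 c)^(2/\<alpha> - 1) of Hoelder's inequality is bounded by \<open>K\<close>
  \<beta>, which covers a fixed window with \<beta> = 1 as well as a growing one.\<close>

locale plug_in = estimation M \<alpha> \<Lambda> f C r X \<Delta> a \<omega> \<beta> Wmax m W \<theta>
  for M :: "'w measure" and \<alpha> :: real and \<Lambda> :: "real set \<Rightarrow> 'w \<Rightarrow> real" and f :: "real \<Rightarrow> real" and C r :: real
    and X :: "real \<Rightarrow> 'w \<Rightarrow> real" and \<Delta> a \<omega> \<beta> Wmax :: "nat \<Rightarrow> real" and m :: "nat \<Rightarrow> nat" and W :: "nat \<Rightarrow> int \<Rightarrow> real" and \<theta> :: real +
  fixes c :: "nat \<Rightarrow> real" and sig :: "nat \<Rightarrow> 'w \<Rightarrow> real" and K :: real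
  assumes psd: "positive_semidefinite f" and nonzero: "\<exists>x. f x \<noteq> 0"
    and \<beta>_ge_1: "\<forall>\<^sub>F n in sequentially. \<beta> n \<ge> 1"
    and c: "\<forall>\<^sub>F n in sequentially. c n \<ge> 0 \<and> (2 * c n) powr (2/\<alpha> - 1) \<le> K * \<beta> n"
    and tail: "(\<lambda>n. \<beta> n * (LINT u:{u. \<bar>u\<bar> > a n}|lborel. (norm (FT f u))\<^sup>2)) \<longlonglongrightarrow> 0"
    and f_integrable: "integrable lborel (\<lambda>t. \<bar>f t\<bar> powr \<alpha>)"
    and window_norm: "(\<lambda>n. LINT t:{-c n..c n}|lborel. \<bar>f t\<bar> powr \<alpha>) \<longlonglongrightarrow> (LINT t|lborel. \<bar>f t\<bar> powr \<alpha>)"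
    and sig_measurable: "\<forall>\<^sub>F n in sequentially. sig n \<in> borel_measurable M"
    and sig: "((\<lambda>q. sig (fst q) (snd q)) \<longlongrightarrow> (LINT t|lborel. \<bar>f t\<bar> powr \<alpha>) powr (1/\<alpha>)) (prob_filter M)"
begin

definition gest :: "nat \<Rightarrow> 'w \<Rightarrow> real \<Rightarrow> complex" where
  "gest n w = kernel_estimator (\<Delta> n) n (m n) (W n) (a n) (\<lambda>j. X (real j * \<Delta> n) w)"

definition If :: real where "If = (LINT x|lborel. (f x)\<^sup>2)"

definition J :: real where "J = (LINT t|lborel. \<bar>f t\<bar> powr \<alpha>)"

definition err :: "nat \<Rightarrow> 'w \<Rightarrow> real" where
  "err n w = (LINT t|lborel. (norm (of_real (kap n w) * gest n w t - of_real (f t)))\<^sup>2)"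

definition gnorm :: "nat \<Rightarrow> 'w \<Rightarrow> real" where
  "gnorm n w = (LINT t:{-c n..c n}|lborel. norm (gest n w t) powr \<alpha>) powr (1/\<alpha>)"

definition fnorm :: "nat \<Rightarrow> 'w \<Rightarrow> real" where
  "fnorm n w = sig n w / gnorm n w"

definition ferr :: "nat \<Rightarrow> 'w \<Rightarrow> real" where
  "ferr n w = (LINT t|lborel. (norm (of_real (fnorm n w) * gest n w t - of_real (f t)))\<^sup>2)"

lemma f_bounded: "\<bar>f x\<bar> \<le> f 0" by (rule positive_semidefinite_bounded[OF psd])

lemma f_isCont: "AE x in lborel. isCont f x"
  using f_continuous by (auto simp: continuous_on_eq_continuous_at)

lemma FT_f_eq: "FT f u = of_real (norm (FT f u))"
proof -
  obtain x where x: "x \<ge> 0" "FT f u = of_real x"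
    using FT_nonneg[OF psd, of u] by (auto elim: nonneg_Reals_cases)
  show ?thesis unfolding x(2) using x(1) by simp
qed

lemma integrable_f_square: "integrable lborel (\<lambda>x. (f x)\<^sup>2)"
  by (rule integrable_square_of_bounded[OF integrable_h f_bounded])

lemma integrable_FT_square: "integrable lborel (\<lambda>u. (norm (FT f u))\<^sup>2)"
  by (rule FT_square_integral(1)[OF integrable_h f_bounded f_isCont])

lemma If_pos: "If > 0"
proof -
  obtain y where "f y \<noteq> 0" using nonzero by blast
  then show ?thesis unfolding If_def
    by (intro integral_pos_of_continuous[of _ y] integrable_f_square continuous_intros f_continuous) auto
qed

lemma J_pos: "J > 0"
proof -
  obtain y where y: "f y \<noteq> 0" using nonzero by blast
  have "continuous_on UNIV (\<lambda>t. \<bar>f t\<bar> powr \<alpha>)"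
    using f_continuous alpha by (auto intro!: continuous_on_powr' continuous_on_rabs continuous_on_const)
  then show ?thesis unfolding J_def
    by (rule integral_pos_of_continuous[of _ y]) (use y f_integrable in auto)
qed

lemma X_measurable [measurable]: "X t \<in> borel_measurable M"
  using X[of t] unfolding is_stochastic_integral_def converges_in_probability_def by blast

lemma gest_L2: "gest n w \<in> borel_measurable borel" "integrable lborel (\<lambda>t. (norm (gest n w t))\<^sup>2)" "\<exists>B. \<forall>t. norm (gest n w t) \<le> B"
  unfolding gest_def by (rule kernel_estimator_L2)+

lemma gest_joint [measurable]: "(\<lambda>(w, t). gest n w t) \<in> borel_measurable (M \<Otimes>\<^sub>M lborel)"
  unfolding gest_def by (rule kernel_estimator_measurable) measurable

text \<open>\<kappa> times the estimator is the transform of P cut off at the band, divided by 2 pi.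
  By \<open>FT_L2_distance\<close> its distance to f splits into the error on the band and the
  energy of FT f outside it.\<close>

lemma err_eq:
  "\<forall>\<^sub>F n in sequentially. \<forall>w. integrable lborel (\<lambda>t. (norm (of_real (kap n w) * gest n w t - of_real (f t)))\<^sup>2) \<and>
     err n w = 1 / (2 * pi) * ((LINT u|band (a n). (Pn n u w - norm (FT f u))\<^sup>2) + (LINT u:{u. \<bar>u\<bar> > a n}|lborel. (norm (FT f u))\<^sup>2))"
  using kap_smoothed eventually_window
proof eventually_elim
  case (elim n)
  interpret E: estimator_window M \<alpha> \<Lambda> f C r X n "\<Delta> n" "m n" "W n" "\<omega> n" "a n" "Wmax n" by fact
  show ?case
  proof
    fix w
    let ?G = "\<lambda>u. norm (FT f u)" and ?I = "indicator {-a n..a n} :: real \<Rightarrow> real" and ?O = "indicator {u. \<bar>u\<bar> > a n} :: real \<Rightarrow> real"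
    define \<phi> where "\<phi> u = ?I u * Pn n u w" for u
    note tc = truncated_continuous[OF E.P_continuous[of UNIV w], of "a n", folded \<phi>_def]
    obtain B where B: "\<And>u. \<bar>\<phi> u\<bar> \<le> B" using tc(2) by blast
    have eq: "of_real (kap n w) * gest n w t = FT \<phi> t / (2 * pi)" for t
    proof -
      have "\<phi> = (\<lambda>u. kap n w * (?I u * sqrt (\<Delta> n * smoothed_periodogram (\<Delta> n) n (m n) (W n) (\<lambda>j. X (real j * \<Delta> n) w) u)))"
        unfolding \<phi>_def elim(1)[rule_format, symmetric] by (auto simp: mult_ac)
      then show ?thesis unfolding gest_def kernel_estimator_FT by (simp add: FT_cmult)
    qed
    note dist = FT_L2_distance[OF tc(1) B tc(3) integrable_h f_bounded f_isCont FT_f_eq]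
    have split: "(\<phi> u - ?G u)\<^sup>2 = ?I u *\<^sub>R (Pn n u w - ?G u)\<^sup>2 + ?O u *\<^sub>R (?G u)\<^sup>2" for u
      unfolding \<phi>_def by (auto simp: indicator_def)
    have i1: "integrable lborel (\<lambda>u. ?I u *\<^sub>R (Pn n u w - ?G u)\<^sup>2)"
    proof -
      have "integrable lborel (\<lambda>u. ?I u *\<^sub>R (\<phi> u - ?G u)\<^sup>2)" by (intro integrable_mult_indicator dist(2)) auto
      moreover have "?I u *\<^sub>R (\<phi> u - ?G u)\<^sup>2 = ?I u *\<^sub>R (Pn n u w - ?G u)\<^sup>2" for u
        unfolding \<phi>_def by (auto simp: indicator_def)
      ultimately show ?thesis by (simp only:)
    qed
    have i2: "integrable lborel (\<lambda>u. ?O u *\<^sub>R (?G u)\<^sup>2)"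
      by (intro integrable_mult_indicator integrable_FT_square) auto
    have "(LINT u|lborel. (\<phi> u - ?G u)\<^sup>2) = (LINT u|band (a n). (Pn n u w - ?G u)\<^sup>2) + (LINT u:{u. \<bar>u\<bar> > a n}|lborel. (?G u)\<^sup>2)"
      unfolding split Bochner_Integration.integral_add[OF i1 i2] set_lebesgue_integral_def
      by (subst integral_restrict_space) auto
    then show "integrable lborel (\<lambda>t. (norm (of_real (kap n w) * gest n w t - of_real (f t)))\<^sup>2) \<and>
     err n w = 1 / (2 * pi) * ((LINT u|band (a n). (Pn n u w - ?G u)\<^sup>2) + (LINT u:{u. \<bar>u\<bar> > a n}|lborel. (?G u)\<^sup>2))"
      unfolding err_def eq using dist(1,3) by simp
  qed
qed

lemma err_nonneg: "err n w \<ge> 0"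
  unfolding err_def by (intro integral_nonneg_AE) auto

lemma err_weighted: "((\<lambda>q. \<beta> (fst q) * err (fst q) (snd q)) \<longlongrightarrow> 0) PF"
proof -
  let ?e1 = "\<lambda>q. LINT u|band (a (fst q)). (Pn (fst q) u (snd q) - norm (FT f u))\<^sup>2"
  let ?e2 = "\<lambda>q. LINT u:{u. \<bar>u\<bar> > a (fst q)}|lborel. (norm (FT f u))\<^sup>2"
  have "((\<lambda>q. 1 / (2 * pi) * (\<beta> (fst q) * (?e1 q) +
      \<beta> (fst q) * (?e2 q))) \<longlongrightarrow> 1 / (2 * pi) * (0 + 0)) PF"
    by (intro tendsto_mult[OF tendsto_const] tendsto_add band_error_tendsto[OF integrable_FT_square] tendsto_prob_filter_sequentially[OF tail])
  then have lim: "((\<lambda>q. 1 / (2 * pi) * (\<beta> (fst q) * (?e1 q) +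
      \<beta> (fst q) * (?e2 q))) \<longlongrightarrow> 0) PF" by simp
  show ?thesis
  proof (rule Lim_transform_eventually[OF lim])
    show "\<forall>\<^sub>F q in PF. 1 / (2 * pi) * (\<beta> (fst q) * (?e1 q) +
      \<beta> (fst q) * (?e2 q)) = \<beta> (fst q) * err (fst q) (snd q)"
      using eventually_prob_filter_fst[OF err_eq]
    proof eventually_elim
      case (elim q)
      have "\<beta> (fst q) * err (fst q) (snd q) = \<beta> (fst q) * (1 / (2 * pi) * ((?e1 q) + (?e2 q)))"
        using elim by simp
      then show ?case by (simp only: distrib_left mult.left_commute)
    qed
  qed
qed

lemma err_tendsto: "((\<lambda>q. err (fst q) (snd q)) \<longlongrightarrow> 0) PF"
proof (rule tendsto_sandwich[OF _ _ tendsto_const err_weighted])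
  show "\<forall>\<^sub>F q in PF. err (fst q) (snd q) \<le> \<beta> (fst q) * err (fst q) (snd q)"
    using eventually_prob_filter_fst[OF \<beta>_ge_1]
  proof eventually_elim
    case (elim q)
    then show ?case using mult_right_mono[OF elim err_nonneg[of "fst q" "snd q"]] by simp
  qed
qed (simp add: err_nonneg)

lemma kap_pos: "\<forall>\<^sub>F q in PF. kap (fst q) (snd q) > 0"
  using order_tendstoD(1)[OF kap_tendsto, of 0] If_pos unfolding If_def by simp

text \<open>\<open>A\<close>, \<open>B\<close> and \<open>D\<close> are window integrals of the
  \<alpha>-th powers of the scaled estimator, of f and of their difference. Hoelder's inequality
  bounds D by a power of the weighted squared L2 error, and \<open>tendsto_of_near\<close> carries
  the limit of B over to A.\<close>

lemma scaled_gnorm: "((\<lambda>q. kap (fst q) (snd q) * gnorm (fst q) (snd q)) \<longlongrightarrow> J powr (1/\<alpha>)) PF"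
proof -
  define A where "A q = (LINT t:{-c (fst q)..c (fst q)}|lborel. norm (of_real (kap (fst q) (snd q)) * gest (fst q) (snd q) t) powr \<alpha>)" for q
  define B where "B q = (LINT t:{-c (fst q)..c (fst q)}|lborel. norm (complex_of_real (f t)) powr \<alpha>)" for q :: "nat \<times> 'w"
  define D where "D q = (LINT t:{-c (fst q)..c (fst q)}|lborel. norm (of_real (kap (fst q) (snd q)) * gest (fst q) (snd q) t - of_real (f t)) powr \<alpha>)" for q
  have good: "\<forall>\<^sub>F q in PF. c (fst q) \<ge> 0 \<and> (2 * c (fst q)) powr (2/\<alpha> - 1) \<le> K * \<beta> (fst q) \<and>
      integrable lborel (\<lambda>t. (norm (of_real (kap (fst q) (snd q)) * gest (fst q) (snd q) t - of_real (f t)))\<^sup>2)"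
    using eventually_prob_filter_fst[OF c] eventually_prob_filter_fst[OF err_eq]
    by eventually_elim blast
  have D: "(D \<longlongrightarrow> 0) PF"
  proof (rule tendsto_sandwich[OF _ _ tendsto_const])
    show "\<forall>\<^sub>F q in PF. 0 \<le> D q" unfolding D_def set_lebesgue_integral_def by (auto intro!: integral_nonneg_AE)
    show "\<forall>\<^sub>F q in PF. D q \<le> (K * (\<beta> (fst q) * err (fst q) (snd q))) powr (\<alpha>/2)"
      using good
    proof eventually_elim
      case (elim q)
      note [measurable] = gest_L2(1)[of "fst q" "snd q"]
      have "D q \<le> ((2 * c (fst q)) powr (2/\<alpha> - 1) * err (fst q) (snd q)) powr (\<alpha>/2)"
        unfolding D_def err_def by (rule truncated_powr_integral_le(2)) (use elim alpha in auto)
      also have "\<dots> \<le> (K * \<beta> (fst q) * err (fst q) (snd q)) powr (\<alpha>/2)"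
        using elim alpha err_nonneg by (intro powr_mono2 mult_right_mono mult_nonneg_nonneg) auto
      finally show ?case by (simp only: mult.assoc)
    qed
    show "((\<lambda>q. (K * (\<beta> (fst q) * err (fst q) (snd q))) powr (\<alpha>/2)) \<longlongrightarrow> 0) PF"
    proof (rule tendsto_powr_zero)
      show "((\<lambda>q. K * (\<beta> (fst q) * err (fst q) (snd q))) \<longlongrightarrow> 0) PF"
        using tendsto_mult[OF tendsto_const[of K] err_weighted] by simp
      show "\<forall>\<^sub>F q in PF. 0 \<le> K * (\<beta> (fst q) * err (fst q) (snd q))"
        using good
      proof eventually_elim
        case (elim q)
        have "0 \<le> K * \<beta> (fst q)" using elim by (meson order.trans powr_ge_zero)
        then show ?case using err_nonneg[of "fst q" "snd q"] by (simp only: mult.assoc[symmetric]) simp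
      qed
    qed (use alpha in simp)
  qed
  have B: "(B \<longlongrightarrow> J) PF"
    using tendsto_prob_filter_sequentially[OF window_norm] unfolding B_def J_def by simp
  have "(A \<longlongrightarrow> J) PF"
  proof (rule tendsto_of_near[OF _ D B])
    fix \<epsilon> :: real assume \<epsilon>: "\<epsilon> > 0"
    obtain Cn where Cn: "Cn \<ge> 0" "\<And>x y :: complex. norm x powr \<alpha> \<le> (1 + \<epsilon>) * norm y powr \<alpha> + Cn * norm (x - y) powr \<alpha>"
      using norm_powr_le_near[OF alpha(1) \<epsilon>] by blast
    show "\<exists>C\<ge>0. \<forall>\<^sub>F q in PF. A q \<le> (1 + \<epsilon>) * B q + C * D q \<and> B q \<le> (1 + \<epsilon>) * A q + C * D q"
    proof (intro exI[of _ Cn] conjI Cn(1))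
      show "\<forall>\<^sub>F q in PF. A q \<le> (1 + \<epsilon>) * B q + Cn * D q \<and> B q \<le> (1 + \<epsilon>) * A q + Cn * D q"
        using good
      proof eventually_elim
        case (elim q)
        note [measurable] = gest_L2(1)[of "fst q" "snd q"]
        let ?I = "{-c (fst q)..c (fst q)}"
        let ?x = "\<lambda>t. of_real (kap (fst q) (snd q)) * gest (fst q) (snd q) t" and ?y = "\<lambda>t. complex_of_real (f t)"
        have iA: "set_integrable lborel ?I (\<lambda>t. norm (?x t) powr \<alpha>)"
          by (rule truncated_powr_integral_le(1)) (use elim alpha gest_L2(2) in \<open>auto simp: norm_mult power_mult_distrib\<close>)
        have iB: "set_integrable lborel ?I (\<lambda>t. norm (?y t) powr \<alpha>)"
          by (rule truncated_powr_integral_le(1)) (use elim alpha integrable_f_square in auto)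
        have iD: "set_integrable lborel ?I (\<lambda>t. norm (?x t - ?y t) powr \<alpha>)"
          by (rule truncated_powr_integral_le(1)) (use elim alpha in auto)
        have comb: "(LINT t:?I|lborel. u t) \<le> (1 + \<epsilon>) * (LINT t:?I|lborel. v t) + Cn * (LINT t:?I|lborel. d t)"
          if "set_integrable lborel ?I u" "set_integrable lborel ?I v" "set_integrable lborel ?I d" "\<And>t. u t \<le> (1 + \<epsilon>) * v t + Cn * d t" for u v d
        proof -
          have "(LINT t:?I|lborel. u t) \<le> (LINT t:?I|lborel. (1 + \<epsilon>) * v t + Cn * d t)"
            using that by (intro set_integral_mono set_integral_add(1) set_integrable_mult_right) auto
          also have "\<dots> = (1 + \<epsilon>) * (LINT t:?I|lborel. v t) + Cn * (LINT t:?I|lborel. d t)"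
            using that by (simp add: set_integral_add(2) set_integrable_mult_right)
          finally show ?thesis .
        qed
        have "A q \<le> (1 + \<epsilon>) * B q + Cn * D q" unfolding A_def B_def D_def
          by (rule comb[OF iA iB iD Cn(2)])
        moreover have "B q \<le> (1 + \<epsilon>) * A q + Cn * D q" unfolding A_def B_def D_def
          by (rule comb[OF iB iA iD]) (metis Cn(2) norm_minus_commute)
        ultimately show ?case by blast
      qed
    qed
  qed
  then have "((\<lambda>q. A q powr (1/\<alpha>)) \<longlongrightarrow> J powr (1/\<alpha>)) PF"
    using J_pos by (intro tendsto_powr tendsto_const) auto
  then show ?thesis
  proof (rule Lim_transform_eventually)
    show "\<forall>\<^sub>F q in PF. A q powr (1/\<alpha>) = kap (fst q) (snd q) * gnorm (fst q) (snd q)"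
      using kap_pos
    proof eventually_elim
      case (elim q)
      have "A q = kap (fst q) (snd q) powr \<alpha> * (LINT t:{-c (fst q)..c (fst q)}|lborel. norm (gest (fst q) (snd q) t) powr \<alpha>)"
        unfolding A_def using elim by (simp add: norm_mult powr_mult)
      then show ?case unfolding gnorm_def using elim alpha by (simp add: powr_mult powr_powr)
    qed
  qed
qed

text \<open>Dividing by \<kappa> moves it into the denominator, where it rescales the norm of the
  estimator of g; numerator and denominator then have the same positive limit.\<close>

lemma ratio_tendsto: "((\<lambda>q. fnorm (fst q) (snd q) / kap (fst q) (snd q)) \<longlongrightarrow> 1) PF"
proof -
  have "((\<lambda>q. sig (fst q) (snd q) / (kap (fst q) (snd q) * gnorm (fst q) (snd q))) \<longlongrightarrow> J powr (1/\<alpha>) / J powr (1/\<alpha>)) PF"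
    using J_pos by (intro tendsto_divide scaled_gnorm sig[folded J_def]) auto
  then show ?thesis using J_pos by (simp add: fnorm_def mult.commute)
qed

lemma fnorm_tendsto: "((\<lambda>q. fnorm (fst q) (snd q)) \<longlongrightarrow> sqrt If) PF"
proof -
  have "((\<lambda>q. fnorm (fst q) (snd q) / kap (fst q) (snd q) * kap (fst q) (snd q)) \<longlongrightarrow> 1 * sqrt If) PF"
    by (intro tendsto_mult ratio_tendsto kap_tendsto[folded If_def])
  then have "((\<lambda>q. fnorm (fst q) (snd q) / kap (fst q) (snd q) * kap (fst q) (snd q)) \<longlongrightarrow> sqrt If) PF" by simp
  then show ?thesis
    by (rule Lim_transform_eventually) (use kap_pos in \<open>eventually_elim, simp\<close>)
qed

lemma integrable_ferr: "integrable lborel (\<lambda>t. (norm (of_real k * gest n w t - of_real (f t)))\<^sup>2)"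
proof -
  note [measurable] = gest_L2(1)[of n w]
  show ?thesis
    by (rule integrable_square_diff) (use gest_L2(2) integrable_f_square in \<open>auto simp: norm_mult power_mult_distrib\<close>)
qed

lemma ferr_nonneg: "ferr n w \<ge> 0"
  unfolding ferr_def by (intro integral_nonneg_AE) auto

text \<open>With \<rho> = fnorm / \<kappa> the error is \<rho> times the error of the scaled
  estimator plus (\<rho> - 1) f, and \<rho> tends to 1.\<close>

lemma ferr_tendsto: "((\<lambda>q. ferr (fst q) (snd q)) \<longlongrightarrow> 0) PF"
proof (rule tendsto_sandwich[OF _ _ tendsto_const])
  let ?\<rho> = "\<lambda>q. fnorm (fst q) (snd q) / kap (fst q) (snd q)"
  show "\<forall>\<^sub>F q in PF. 0 \<le> ferr (fst q) (snd q)" by (simp add: ferr_nonneg)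
  have "((\<lambda>q. 2 * (?\<rho> q)\<^sup>2 * err (fst q) (snd q) + 2 * (?\<rho> q - 1)\<^sup>2 * If) \<longlongrightarrow> 2 * 1\<^sup>2 * 0 + 2 * (1 - 1)\<^sup>2 * If) PF"
    by (intro tendsto_intros ratio_tendsto err_tendsto)
  then show "((\<lambda>q. 2 * (?\<rho> q)\<^sup>2 * err (fst q) (snd q) + 2 * (?\<rho> q - 1)\<^sup>2 * If) \<longlongrightarrow> 0) PF" by simp
  show "\<forall>\<^sub>F q in PF. ferr (fst q) (snd q) \<le> 2 * (?\<rho> q)\<^sup>2 * err (fst q) (snd q) + 2 * (?\<rho> q - 1)\<^sup>2 * If"
    using kap_pos
  proof eventually_elim
    case (elim q)
    obtain n w where q: "q = (n, w)" by (cases q)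
    have k: "kap n w > 0" using elim q by simp
    define \<rho> where "\<rho> = fnorm n w / kap n w"
    let ?e = "\<lambda>t. of_real (kap n w) * gest n w t - of_real (f t)"
    have pt: "(norm (of_real (fnorm n w) * gest n w t - of_real (f t)))\<^sup>2 \<le> 2 * \<rho>\<^sup>2 * (norm (?e t))\<^sup>2 + 2 * (\<rho> - 1)\<^sup>2 * (f t)\<^sup>2" for t
    proof -
      have "fnorm n w = \<rho> * kap n w" unfolding \<rho>_def using k by simp
      then have "of_real (fnorm n w) * gest n w t - of_real (f t) = of_real \<rho> * ?e t + of_real ((\<rho> - 1) * f t)"
        by (simp add: algebra_simps)
      then have "norm (of_real (fnorm n w) * gest n w t - of_real (f t)) \<le> norm (of_real \<rho> * ?e t) + norm (complex_of_real ((\<rho> - 1) * f t))"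
        using norm_triangle_ineq by metis
      also have "\<dots> = \<bar>\<rho>\<bar> * norm (?e t) + \<bar>(\<rho> - 1) * f t\<bar>" by (simp only: norm_mult norm_of_real)
      finally have "(norm (of_real (fnorm n w) * gest n w t - of_real (f t)))\<^sup>2 \<le> (\<bar>\<rho>\<bar> * norm (?e t) + \<bar>(\<rho> - 1) * f t\<bar>)\<^sup>2"
        by (intro power_mono) auto
      also have "\<dots> \<le> 2 * (\<bar>\<rho>\<bar> * norm (?e t))\<^sup>2 + 2 * \<bar>(\<rho> - 1) * f t\<bar>\<^sup>2"
        using zero_le_power2[of "\<bar>\<rho>\<bar> * norm (?e t) - \<bar>(\<rho> - 1) * f t\<bar>"] unfolding power2_sum power2_diff by simp
      finally show ?thesis by (simp add: power_mult_distrib mult.assoc)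
    qed
    have "ferr n w \<le> (LINT t|lborel. 2 * \<rho>\<^sup>2 * (norm (?e t))\<^sup>2 + 2 * (\<rho> - 1)\<^sup>2 * (f t)\<^sup>2)"
      unfolding ferr_def
      by (intro integral_mono pt integrable_ferr Bochner_Integration.integrable_add integrable_mult_right integrable_f_square)
    also have "\<dots> = 2 * \<rho>\<^sup>2 * err n w + 2 * (\<rho> - 1)\<^sup>2 * If"
      unfolding err_def If_def by (subst Bochner_Integration.integral_add) (auto intro: integrable_ferr integrable_f_square)
    finally show ?case unfolding q \<rho>_def by simp
  qed
qed

lemma fnorm_measurable: "\<forall>\<^sub>F n in sequentially. fnorm n \<in> borel_measurable M"
  using sig_measurable
proof eventually_elim
  case (elim n)
  note [measurable] = elim
  show ?case unfolding fnorm_def gnorm_def set_lebesgue_integral_def by measurable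
qed

lemma ferr_measurable: "\<forall>\<^sub>F n in sequentially. ferr n \<in> borel_measurable M"
  using fnorm_measurable
proof eventually_elim
  case (elim n)
  note [measurable] = elim
  show ?case unfolding ferr_def by measurable
qed

theorem fnorm_consistent: "converges_in_probability M fnorm (\<lambda>_. Lp_norm 2 f)"
proof -
  have "Lp_norm 2 f = sqrt If"
    unfolding Lp_norm_on_def If_def set_lebesgue_integral_def by (simp add: powr_half_sqrt integral_nonneg_AE)
  then show ?thesis unfolding converges_in_probability_const_iff using fnorm_measurable fnorm_tendsto by simp
qed

lemma fest_Lp:
  "in_Lp 2 (\<lambda>t. of_real (fnorm n w) * gest n w t - of_real (f t))"
  "Lp_norm 2 (\<lambda>t. of_real (fnorm n w) * gest n w t - of_real (f t)) = sqrt (ferr n w)"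
proof -
  note [measurable] = gest_L2(1)[of n w]
  show "in_Lp 2 (\<lambda>t. of_real (fnorm n w) * gest n w t - of_real (f t))"
    unfolding in_Lp_def using integrable_ferr by simp
  show "Lp_norm 2 (\<lambda>t. of_real (fnorm n w) * gest n w t - of_real (f t)) = sqrt (ferr n w)"
    unfolding Lp_norm_on_def set_lebesgue_integral_def ferr_def by (simp add: powr_half_sqrt integral_nonneg_AE)
qed

theorem fest_consistent:
  "converges_in_probability M (\<lambda>n w. Lp_norm 2 (\<lambda>t. of_real (fnorm n w) * gest n w t - of_real (f t))) (\<lambda>_. 0)"
  unfolding converges_in_probability_const_iff fest_Lp(2)
proof
  show "\<forall>\<^sub>F n in sequentially. (\<lambda>w. sqrt (ferr n w)) \<in> borel_measurable M"
    using ferr_measurable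
  proof eventually_elim
    case (elim n)
    note [measurable] = elim
    show ?case by measurable
  qed
  show "((\<lambda>q. sqrt (ferr (fst q) (snd q))) \<longlongrightarrow> 0) PF"
    using tendsto_real_sqrt[OF ferr_tendsto] by simp
qed

end

section \<open>From the hypotheses of the theorem to the abstract rates\<close>

lemma modulus_of_continuity_upper:
  assumes B: "\<And>x. \<bar>f x\<bar> \<le> B" and ts: "\<bar>t - s\<bar> < \<delta>"
  shows "\<bar>f t - f s\<bar> \<le> modulus_of_continuity f \<delta>"
  unfolding modulus_of_continuity_def
proof (rule cSup_upper)
  have "\<bar>f t - f s\<bar> \<le> 2 * B" for t s using B[of t] B[of s] by linarith
  then show "bdd_above {\<bar>f t - f s\<bar> |t s. \<bar>t - s\<bar> < \<delta>}" by (intro bdd_aboveI[of _ "2 * B"]) auto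
qed (use ts in auto)

lemma tendsto_zero_le:
  fixes x y :: "'b \<Rightarrow> real"
  assumes "(y \<longlongrightarrow> 0) F" "\<forall>\<^sub>F n in F. 0 \<le> x n \<and> x n \<le> y n"
  shows "(x \<longlongrightarrow> 0) F"
  by (rule tendsto_sandwich[OF _ _ tendsto_const assms(1)]) (use assms(2) in \<open>auto elim: eventually_mono\<close>)

lemma envelope_lower:
  assumes "\<bar>x\<bar> \<le> T" "r \<ge> 0"
  shows "1 \<le> (1 + T) powr r * envelope r x"
proof -
  have "(1 + \<bar>x\<bar>) powr r \<le> (1 + T) powr r" using assms by (intro powr_mono2) auto
  then show ?thesis unfolding envelope_def by (simp add: powr_minus field_simps)
qed

text \<open>Every exponent r > 1 is admissible; the factor (1 + |T|)^r lifts the envelope to at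
  least 1 on the support.\<close>

lemma decaying_compact_support:
  assumes [measurable]: "f \<in> borel_measurable borel" and B: "\<And>x. \<bar>f x\<bar> \<le> B"
    and T: "\<And>t. t \<notin> {-T..T} \<Longrightarrow> f t = 0" and r: "r > 1"
  shows "decaying f (B * (1 + \<bar>T\<bar>) powr r) r"
proof
  fix x
  show "\<bar>f x\<bar> \<le> B * (1 + \<bar>T\<bar>) powr r * envelope r x"
  proof (cases "\<bar>x\<bar> \<le> \<bar>T\<bar>")
    case True
    have "B * 1 \<le> B * ((1 + \<bar>T\<bar>) powr r * envelope r x)"
      using B[of 0] r by (intro mult_left_mono envelope_lower True) auto
    then show ?thesis using B[of x] by (simp add: mult.assoc)
  next
    case False
    then have "f x = 0" by (intro T) auto
    then show ?thesis using B[of 0] by (simp add: envelope_def)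
  qed
qed (use r in auto)

text \<open>Boundedness is used up to T = max R 1. Beyond it (1 + |x|) / 2 \<le> |x|, which changes
  the power of |x| into the envelope at the cost of 2^r.\<close>

lemma decaying_bigo:
  assumes [measurable]: "f \<in> borel_measurable borel" and B: "\<And>x. \<bar>f x\<bar> \<le> B"
    and O: "f \<in> O[at_infinity](\<lambda>t. \<bar>t\<bar> powr (- r))" and r: "r > 1"
  shows "\<exists>C. decaying f C r"
proof -
  from O obtain k where k: "k > 0" "\<forall>\<^sub>F t in at_infinity. \<bar>f t\<bar> \<le> k * \<bar>t\<bar> powr (- r)"
    by (elim landau_o.bigE) auto
  then obtain R where R: "\<And>t. \<bar>t\<bar> \<ge> R \<Longrightarrow> \<bar>f t\<bar> \<le> k * \<bar>t\<bar> powr (- r)"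
    unfolding eventually_at_infinity by auto
  define T where "T = max R 1"
  have B0: "B \<ge> 0" using B[of 0] by linarith
  have "\<bar>f x\<bar> \<le> (B * (1 + T) powr r + k * 2 powr r) * envelope r x" for x
  proof (cases "\<bar>x\<bar> \<le> T")
    case True
    have "B * 1 \<le> B * ((1 + T) powr r * envelope r x)"
      using B0 r by (intro mult_left_mono envelope_lower True) auto
    moreover have "0 \<le> k * 2 powr r * envelope r x" using k by (simp add: envelope_def)
    ultimately show ?thesis using B[of x] by (simp add: algebra_simps)
  next
    case False
    then have x: "\<bar>x\<bar> \<ge> R" "\<bar>x\<bar> \<ge> 1" unfolding T_def by auto
    have "\<bar>x\<bar> powr (- r) \<le> ((1 + \<bar>x\<bar>) / 2) powr (- r)"
      using x r by (intro powr_mono2') auto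
    also have "\<dots> = 2 powr r * envelope r x"
      unfolding envelope_def using x by (simp add: powr_divide powr_minus field_simps)
    finally have "k * \<bar>x\<bar> powr (- r) \<le> k * (2 powr r * envelope r x)" using k by (intro mult_left_mono) auto
    moreover have "0 \<le> B * (1 + T) powr r * envelope r x" using B0 by (simp add: envelope_def)
    ultimately show ?thesis using R[OF x(1)] by (simp add: algebra_simps)
  qed
  then have "decaying f (B * (1 + T) powr r + k * 2 powr r) r" using r by unfold_locales auto
  then show ?thesis ..
qed

lemma set_integral_window_tendsto:
  fixes h :: "real \<Rightarrow> real"
  assumes h: "integrable lborel h" and c: "filterlim c at_top sequentially"
  shows "(\<lambda>n. LINT t:{- c n..c n}|lborel. h t) \<longlonglongrightarrow> (LINT t|lborel. h t)"
  unfolding set_lebesgue_integral_def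
proof (rule integral_dominated_convergence[where w = "\<lambda>t. \<bar>h t\<bar>"])
  have [measurable]: "h \<in> borel_measurable borel" using h by auto
  show "h \<in> borel_measurable lborel" "\<And>n. (\<lambda>t. indicat_real {- c n..c n} t *\<^sub>R h t) \<in> borel_measurable lborel"
    by measurable
  show "AE t in lborel. (\<lambda>n. indicat_real {- c n..c n} t *\<^sub>R h t) \<longlonglongrightarrow> h t"
  proof (rule AE_I2)
    fix t
    have "\<forall>\<^sub>F n in sequentially. \<bar>t\<bar> \<le> c n" using c unfolding filterlim_at_top by blast
    then have "\<forall>\<^sub>F n in sequentially. indicat_real {- c n..c n} t *\<^sub>R h t = h t"
      by eventually_elim (auto simp: indicator_def)
    then show "(\<lambda>n. indicat_real {- c n..c n} t *\<^sub>R h t) \<longlonglongrightarrow> h t" by (rule tendsto_eventually)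
  qed
  show "\<And>n. AE t in lborel. norm (indicat_real {- c n..c n} t *\<^sub>R h t) \<le> \<bar>h t\<bar>"
    by (auto simp: indicator_def)
qed (use h in auto)

lemma set_integral_tail_tendsto:
  fixes h :: "real \<Rightarrow> real"
  assumes h: "integrable lborel h" and a: "filterlim a at_top sequentially"
  shows "(\<lambda>n. LINT t:{t. \<bar>t\<bar> > a n}|lborel. h t) \<longlonglongrightarrow> 0"
proof -
  have "(LINT t:{t. \<bar>t\<bar> > a n}|lborel. h t) = (LINT t|lborel. h t) - (LINT t:{- a n..a n}|lborel. h t)" for n
  proof -
    have "(LINT t:{t. \<bar>t\<bar> > a n}|lborel. h t) = (LINT t|lborel. h t - indicator {- a n..a n} t *\<^sub>R h t)"
      unfolding set_lebesgue_integral_def by (intro Bochner_Integration.integral_cong) (auto simp: indicator_def)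
    also have "\<dots> = (LINT t|lborel. h t) - (LINT t:{- a n..a n}|lborel. h t)"
      unfolding set_lebesgue_integral_def
      by (intro Bochner_Integration.integral_diff integrable_mult_indicator h) auto
    finally show ?thesis .
  qed
  then show ?thesis
    using tendsto_diff[OF tendsto_const set_integral_window_tendsto[OF h a], of "LINT t|lborel. h t"] by simp
qed

lemma fourier_eq_cnj_FT: "fourier g u = cnj (FT g u)"
proof -
  have "cnj (cis x) = exp (- (\<i> * of_real x))" for x
    unfolding cis_cnj by (simp add: cis_conv_exp)
  then have "fourier g u = (LINT t|lborel. cnj (of_real (g t) * cis (t * u)))"
    unfolding fourier_def by (simp add: mult.commute)
  then show ?thesis unfolding FT_def by (simp only: Bochner_Integration.integral_cnj)
qed

text \<open>\<open>c\<close> is the half-length of the window of the \<alpha>-norm, T or b n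
  according to the case; the decay exponent, called a in the informal statement, is r here. The
  measurable maps \<open>S n\<close> express that the scale estimator is based on the observations.
  The second conjunct ensures that the norm in the third is not a default value.\<close>

theorem corollary1:
  fixes M :: "'w measure" and \<Lambda> :: "real set \<Rightarrow> 'w \<Rightarrow> real" and X :: "real \<Rightarrow> 'w \<Rightarrow> real"
    and \<alpha> \<sigma> :: real and f g :: "real \<Rightarrow> real"
    and \<Delta> a c :: "nat \<Rightarrow> real" and m :: "nat \<Rightarrow> nat" and W :: "nat \<Rightarrow> int \<Rightarrow> real"
    and \<omega> :: "real \<Rightarrow> real" and Wmax W2 :: "nat \<Rightarrow> real"
    and S :: "nat \<Rightarrow> (nat \<Rightarrow> real) \<Rightarrow> real" and obs :: "nat \<Rightarrow> 'w \<Rightarrow> nat \<Rightarrow> real"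
    and sigma_est g_norm_est f_norm_est :: "nat \<Rightarrow> 'w \<Rightarrow> real"
    and g_est f_est :: "nat \<Rightarrow> 'w \<Rightarrow> real \<Rightarrow> complex"
  defines "g \<equiv> \<lambda>t. f t / Lp_norm 2 f"
    and "\<omega> \<equiv> modulus_of_continuity f"
    and "Wmax \<equiv> \<lambda>n. max_weight (m n) (W n)"
    and "W2 \<equiv> \<lambda>n. weight_second_moment (m n) (W n)"
    and "obs \<equiv> \<lambda>n w j. X (real j * \<Delta> n) w"
    and "sigma_est \<equiv> \<lambda>n w. S n (\<lambda>j\<in>{1..n}. obs n w j)"
    and "g_est \<equiv> \<lambda>n w. kernel_estimator (\<Delta> n) n (m n) (W n) (a n) (obs n w)"
    and "g_norm_est \<equiv> \<lambda>n w. Lp_norm_on {- c n..c n} \<alpha> (g_est n w)"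
    and "f_norm_est \<equiv> \<lambda>n w. sigma_est n w / g_norm_est n w"
    and "f_est \<equiv> \<lambda>n w t. of_real (f_norm_est n w) * g_est n w t"
  assumes alpha: "0 < \<alpha>" "\<alpha> < 2"
    and f: "in_Lp \<alpha> f" "positive_semidefinite f" "\<exists>t. f t \<noteq> 0"
    and M: "prob_space M"
    and Lambda: "SaS_random_measure M \<alpha> \<Lambda>"
    and X: "\<And>t. is_stochastic_integral M \<alpha> \<Lambda> (\<lambda>s. f (t - s)) (X t)"
    and Delta: "\<forall>n\<ge>1. \<Delta> n > 0" "\<Delta> \<longlonglongrightarrow> 0" "filterlim (\<lambda>n. real n * \<Delta> n) at_top sequentially"
    and m: "\<forall>n\<ge>1. m n > 0" "filterlim m at_top sequentially" "(\<lambda>n. real (m n)) \<in> o(\<lambda>n. real n)"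
    and a_pos: "\<forall>n\<ge>1. a n > 0"
    and weights1: "\<forall>n\<ge>1. \<forall>k\<in>{- int (m n)..int (m n)}. W n k \<ge> 0"
    and weights2: "\<forall>n\<ge>1. (\<Sum>k = - int (m n)..int (m n). W n k) = 1"
    and weights3: "Wmax \<longlonglongrightarrow> 0"
    and weights4: "W2 \<in> o(\<lambda>n. (real n * \<Delta> n)\<^sup>2)"
    and A1: "filterlim a at_top sequentially"
    and A2: "(\<lambda>n. (a n)\<^sup>2 * Wmax n) \<longlonglongrightarrow> 0"
    and A3: "(\<lambda>n. a n powr (3/4)) \<in> o(\<lambda>n. (real n * \<Delta> n) powr (1/\<alpha>))"
    and A4: "(\<lambda>n. (a n)\<^sup>2 * \<Delta> n) \<longlonglongrightarrow> 0"
    and A5: "(\<lambda>n. (a n)\<^sup>2 * W2 n) \<in> o(\<lambda>n. (real n * \<Delta> n)\<^sup>2)"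
    and cases:
      "(\<exists>T. (\<forall>t. t \<notin> {-T..T} \<longrightarrow> f t = 0) \<and>
            (\<lambda>n. a n * \<omega> (\<Delta> n)) \<longlonglongrightarrow> 0 \<and>
            c = (\<lambda>_. T))
       \<or>
       (\<exists>r b. r > max 2 (1/\<alpha>) \<and>
            (\<lambda>n. a n * \<omega> (\<Delta> n) powr (1 - 1/r)) \<longlonglongrightarrow> 0 \<and>
            f \<in> O[at_infinity](\<lambda>t. \<bar>t\<bar> powr (- r)) \<and>
            (\<lambda>n. a n powr (3/4))
              \<in> o(\<lambda>n. \<omega> (\<Delta> n) powr (1 / (r * \<alpha>)) * (real n * \<Delta> n) powr (1/\<alpha>)) \<and>
            (\<forall>n\<ge>1. b n > 0) \<and>
            filterlim b at_top sequentially \<and>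
            (\<lambda>n. b n powr (2/\<alpha> - 1) * (a n)\<^sup>2 * Wmax n) \<longlonglongrightarrow> 0 \<and>
            (\<lambda>n. b n powr (2/\<alpha> - 1) * a n) \<in> o(\<lambda>n. (real n * \<Delta> n) powr (1/\<alpha>)) \<and>
            (\<lambda>n. b n powr (2/\<alpha> - 1) * a n ^ 4 * (\<Delta> n)\<^sup>2) \<longlonglongrightarrow> 0 \<and>
            (\<lambda>n. b n powr (2/\<alpha> - 1) * (a n)\<^sup>2 * W2 n) \<in> o(\<lambda>n. (real n * \<Delta> n)\<^sup>2) \<and>
            (\<lambda>n. b n powr (2/\<alpha> - 1) * (a n)\<^sup>2 * \<omega> (\<Delta> n) powr (2 - 2/r)) \<longlonglongrightarrow> 0 \<and>
            (\<lambda>n. b n powr (2/\<alpha> - 1) * (LINT u:{u. \<bar>u\<bar> > a n}|lborel. (Re (fourier g u))\<^sup>2))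
              \<longlonglongrightarrow> 0 \<and>
            c = b)"
    and sigma: "SaS_scale M \<alpha> (X 0) \<sigma>"
    and S: "\<forall>n\<ge>1. S n \<in> borel_measurable (\<Pi>\<^sub>M j\<in>{1..n}. borel)"
    and consistent: "converges_in_probability M sigma_est (\<lambda>_. \<sigma>)"
  shows "converges_in_probability M f_norm_est (\<lambda>_. Lp_norm 2 f) \<and>
         (\<forall>n\<ge>1. \<forall>w\<in>space M. in_Lp 2 (\<lambda>t. f_est n w t - of_real (f t))) \<and>
         converges_in_probability M
           (\<lambda>n w. Lp_norm 2 (\<lambda>t. f_est n w t - of_real (f t))) (\<lambda>_. 0)"
proof -
  interpret prob_space M by (rule M)
  interpret stable_random_measure M \<alpha> \<Lambda> by unfold_locales (use alpha Lambda in auto)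
  have even: "f (- x) = f x" for x by (rule positive_semidefinite_even[OF f(2)])
  have bnd: "\<bar>f x\<bar> \<le> f 0" for x by (rule positive_semidefinite_bounded[OF f(2)])
  have fm [measurable]: "f \<in> borel_measurable borel" and f_int: "integrable lborel (\<lambda>t. \<bar>f t\<bar> powr \<alpha>)"
    using f(1) by (auto simp: in_Lp_def)
  define w where "w n = \<omega> (\<Delta> n)" for n
  have w: "\<bar>f x - f y\<bar> \<le> w n" if "\<bar>x - y\<bar> < \<Delta> n" for x y n
    unfolding w_def \<omega>_def by (rule modulus_of_continuity_upper[OF bnd that])
  have w0: "w n \<ge> 0" if "n \<ge> 1" for n using w[of 0 0 n] Delta(1) that by auto
  have w_ev: "\<forall>\<^sub>F n in sequentially. w n \<ge> 0 \<and> (\<forall>x y. \<bar>x - y\<bar> < \<Delta> n \<longrightarrow> \<bar>f x - f y\<bar> \<le> w n)"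
    using eventually_ge_at_top[of 1] by eventually_elim (use w w0 in auto)
  have W: "W n k \<ge> 0 \<and> W n k \<le> Wmax n" if "n \<ge> 1" "k \<in> {- int (m n)..int (m n)}" for n k
    using weights1 that unfolding Wmax_def max_weight_def by (auto intro!: Max_ge)
  have Wmax0: "Wmax n \<ge> 0" if "n \<ge> 1" for n using W[OF that, of 0] by auto
  have W20: "W2 n \<ge> 0" if "n \<ge> 1" for n
    unfolding W2_def weight_second_moment_def using W[OF that] by (intro sum_nonneg mult_nonneg_nonneg) auto
  have a1: "\<forall>\<^sub>F n in sequentially. a n \<ge> 1" using A1 unfolding filterlim_at_top by blast
  have N1: "\<forall>\<^sub>F n in sequentially. real n * \<Delta> n \<ge> 1" using Delta(3) unfolding filterlim_at_top by blast
  \<comment> \<open>X 0 is the integral of f(-s), which is f(s) by evenness.\<close>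
  have sigma_eq: "\<sigma> = (LINT t|lborel. \<bar>f t\<bar> powr \<alpha>) powr (1/\<alpha>)"
  proof -
    have "is_stochastic_integral M \<alpha> \<Lambda> f (X 0)" using X[of 0] even by simp
    from SaS_scale_unique[OF SaS_var_stochastic_integral[OF this f(1)] sigma] show ?thesis .
  qed
  have sig: "\<forall>\<^sub>F n in sequentially. sigma_est n \<in> borel_measurable M"
      "((\<lambda>q. sigma_est (fst q) (snd q)) \<longlongrightarrow> (LINT t|lborel. \<bar>f t\<bar> powr \<alpha>) powr (1/\<alpha>)) (prob_filter M)"
    using consistent unfolding converges_in_probability_const_iff sigma_eq by auto

  \<comment> \<open>Everything shared by the two cases is settled here; the decay of f, the choice
    of \<beta> and \<theta>, and the five rates are left to them.\<close>
  have est: "estimation M \<alpha> \<Lambda> f C r X \<Delta> a w \<beta> Wmax m W \<theta>"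
    if "decaying f C r" "r > 2" "r * \<alpha> > 1" "w \<longlonglongrightarrow> 0" "0 \<le> \<theta>" "\<theta> \<le> 1" "(r - 1 + \<theta>) * \<alpha> > 1"
      "\<forall>\<^sub>F n in sequentially. \<beta> n > 0"
      "(\<lambda>n. \<beta> n * a n * w n powr (2 - 2/r)) \<longlonglongrightarrow> 0"
      "(\<lambda>n. \<beta> n * a n ^ 3 * (\<Delta> n)\<^sup>2) \<longlonglongrightarrow> 0"
      "(\<lambda>n. \<beta> n * a n * (W2 n / (real n * \<Delta> n)\<^sup>2)) \<longlonglongrightarrow> 0"
      "(\<lambda>n. \<beta> n * Wmax n) \<longlonglongrightarrow> 0"
      "(\<lambda>n. \<beta> n * a n * (real n * \<Delta> n) powr (2 * \<theta> - 2/\<alpha>)) \<longlonglongrightarrow> 0"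
    for C r \<theta> and \<beta> :: "nat \<Rightarrow> real"
  proof -
    interpret decaying f C r by fact
    show ?thesis
      using X even that(2-) Delta m(3) W weights2 a_pos w_ev unfolding W2_def by unfold_locales auto
  qed

  have conclusion: ?thesis if "plug_in M \<alpha> \<Lambda> f C r X \<Delta> a w \<beta> Wmax m W \<theta> c sigma_est K" for C r \<beta> \<theta> K
  proof -
    interpret plug_in M \<alpha> \<Lambda> f C r X \<Delta> a w \<beta> Wmax m W \<theta> c sigma_est K by fact
    have 1: "g_est = gest" unfolding g_est_def gest_def[abs_def] obs_def ..
    have 2: "f_norm_est = fnorm"
      unfolding f_norm_est_def g_norm_est_def fnorm_def[abs_def] gnorm_def Lp_norm_on_def 1 ..
    show ?thesis unfolding f_est_def 1 2 using fnorm_consistent fest_Lp(1) fest_consistent by blast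
  qed

  from cases show ?thesis
  proof (elim disjE exE conjE)

    \<comment> \<open>Compact support: fixed window, \<beta> = 1, \<theta> = 0\<close>
    fix T
    assume T: "\<forall>t. t \<notin> {-T..T} \<longrightarrow> f t = 0" and aw: "(\<lambda>n. a n * \<omega> (\<Delta> n)) \<longlonglongrightarrow> 0" and c: "c = (\<lambda>_. T)"
    \<comment> \<open>A function of compact support decays at any rate. This one gives (r - 1)
      \<alpha> = 1 + 2 \<alpha> > 1, so that \<theta> = 0 is admissible, and 2 - 2/r \<ge> 1, so
      that the modulus of continuity enters at least to the first power.\<close>
    define r where "r = 3 + 1/\<alpha>"
    define C where "C = f 0 * (1 + \<bar>T\<bar>) powr r"
    have r: "r > 2" "r * \<alpha> > 1" "(r - 1 + 0) * \<alpha> > 1" "2/r \<le> 1"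
      unfolding r_def using alpha by (auto simp: distrib_right left_diff_distrib add_pos_pos intro!: divide_le_eq_1_pos[THEN iffD2])
    have dec: "decaying f C r"
      unfolding C_def by (rule decaying_compact_support) (use bnd T r in auto)
    have w_lim: "w \<longlonglongrightarrow> 0"
    proof (rule tendsto_zero_le[OF aw])
      show "\<forall>\<^sub>F n in sequentially. 0 \<le> w n \<and> w n \<le> a n * \<omega> (\<Delta> n)"
        using a1 eventually_ge_at_top[of 1]
      proof eventually_elim
        case (elim n)
        show ?case using w0[OF elim(2)] mult_right_mono[OF elim(1) w0[OF elim(2)]] by (simp add: w_def)
      qed
    qed
    have est': "estimation M \<alpha> \<Lambda> f C r X \<Delta> a w (\<lambda>_. 1) Wmax m W 0"
    proof (rule est[OF dec r(1,2) w_lim _ _ r(3)])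
      have "\<forall>\<^sub>F n in sequentially. w n \<le> 1" using order_tendstoD(2)[OF w_lim, of 1] by (auto elim: eventually_mono)
      then have "\<forall>\<^sub>F n in sequentially. 0 \<le> 1 * a n * w n powr (2 - 2/r) \<and> 1 * a n * w n powr (2 - 2/r) \<le> a n * \<omega> (\<Delta> n)"
        using a1 eventually_ge_at_top[of 1]
      proof eventually_elim
        case (elim n)
        have "w n powr (2 - 2/r) \<le> w n powr 1" using elim w0[OF elim(3)] r by (intro powr_mono') auto
        also have "\<dots> = w n" using w0[OF elim(3)] by simp
        finally show ?case using elim by (auto simp: w_def intro!: mult_left_mono)
      qed
      then show "(\<lambda>n. 1 * a n * w n powr (2 - 2/r)) \<longlonglongrightarrow> 0" by (rule tendsto_zero_le[OF aw])
      have "(\<lambda>n. ((a n)\<^sup>2 * \<Delta> n)\<^sup>2) \<longlonglongrightarrow> 0" using tendsto_power[OF A4, of 2] by simp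
      then show "(\<lambda>n. 1 * a n ^ 3 * (\<Delta> n)\<^sup>2) \<longlonglongrightarrow> 0"
      proof (rule tendsto_zero_le)
        show "\<forall>\<^sub>F n in sequentially. 0 \<le> 1 * a n ^ 3 * (\<Delta> n)\<^sup>2 \<and> 1 * a n ^ 3 * (\<Delta> n)\<^sup>2 \<le> ((a n)\<^sup>2 * \<Delta> n)\<^sup>2"
          using a1
        proof eventually_elim
          case (elim n)
          have "a n ^ 3 * (\<Delta> n)\<^sup>2 \<le> a n ^ 4 * (\<Delta> n)\<^sup>2" using elim by (intro mult_right_mono power_increasing) auto
          then show ?case using elim by (simp add: power_mult_distrib flip: power_mult)
        qed
      qed
      show "(\<lambda>n. 1 * a n * (W2 n / (real n * \<Delta> n)\<^sup>2)) \<longlonglongrightarrow> 0"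
      proof (rule tendsto_zero_le[OF smalloD_tendsto[OF A5]])
        show "\<forall>\<^sub>F n in sequentially. 0 \<le> 1 * a n * (W2 n / (real n * \<Delta> n)\<^sup>2) \<and> 1 * a n * (W2 n / (real n * \<Delta> n)\<^sup>2) \<le> (a n)\<^sup>2 * W2 n / (real n * \<Delta> n)\<^sup>2"
          using a1 eventually_ge_at_top[of 1]
        proof eventually_elim
          case (elim n)
          have "a n * (W2 n / (real n * \<Delta> n)\<^sup>2) \<le> (a n)\<^sup>2 * (W2 n / (real n * \<Delta> n)\<^sup>2)"
            using elim W20[OF elim(2)] by (intro mult_right_mono) (auto simp: power2_eq_square)
          then show ?case using elim W20[OF elim(2)] by simp
        qed
      qed
      show "(\<lambda>n. 1 * Wmax n) \<longlonglongrightarrow> 0" using weights3 by simp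
      \<comment> \<open>Squaring A3 turns the power 3/4 into 3/2, which dominates the first power of
        a n required at the edges.\<close>
      have "(\<lambda>n. (a n powr (3/4) / (real n * \<Delta> n) powr (1/\<alpha>))\<^sup>2) \<longlonglongrightarrow> 0"
        using tendsto_power[OF smalloD_tendsto[OF A3], of 2] by simp
      then show "(\<lambda>n. 1 * a n * (real n * \<Delta> n) powr (2 * 0 - 2/\<alpha>)) \<longlonglongrightarrow> 0"
      proof (rule tendsto_zero_le)
        show "\<forall>\<^sub>F n in sequentially. 0 \<le> 1 * a n * (real n * \<Delta> n) powr (2 * 0 - 2/\<alpha>) \<and>
            1 * a n * (real n * \<Delta> n) powr (2 * 0 - 2/\<alpha>) \<le> (a n powr (3/4) / (real n * \<Delta> n) powr (1/\<alpha>))\<^sup>2"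
          using a1 N1
        proof eventually_elim
          case (elim n)
          have sq: "(x powr p)\<^sup>2 = x powr (2 * p)" for x p :: real
            unfolding power2_eq_square by (simp flip: powr_add)
          have "(a n powr (3/4) / (real n * \<Delta> n) powr (1/\<alpha>))\<^sup>2 = a n powr (3/2) * (real n * \<Delta> n) powr (2 * 0 - 2/\<alpha>)"
          proof -
            have e: "2 * (3/4) = (3/2::real)" "2 * (1/\<alpha>) = 2/\<alpha>" "2 * 0 - 2/\<alpha> = - (2/\<alpha>)" by auto
            show ?thesis unfolding power_divide sq e powr_minus_divide by simp
          qed
          moreover have "a n powr 1 \<le> a n powr (3/2)" using elim by (intro powr_mono) auto
          ultimately show ?case using elim by (auto intro!: mult_right_mono)
        qed
      qed
    qed auto
    interpret estimation M \<alpha> \<Lambda> f C r X \<Delta> a w "\<lambda>_. 1" Wmax m W 0 by (rule est')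
    \<comment> \<open>For T < 0 the interval is empty and f would vanish identically.\<close>
    have T0: "T \<ge> 0"
    proof (rule ccontr)
      assume "\<not> T \<ge> 0"
      then show False using T f(3) by auto
    qed
    have cont: "AE x in lborel. isCont f x" using f_continuous by (auto simp: continuous_on_eq_continuous_at)
    have FT2: "integrable lborel (\<lambda>u. (norm (FT f u))\<^sup>2)"
      by (rule FT_square_integral(1)[OF integrable_h bnd cont])
    have wn: "(LINT t:{-T..T}|lborel. \<bar>f t\<bar> powr \<alpha>) = (LINT t|lborel. \<bar>f t\<bar> powr \<alpha>)"
      unfolding set_lebesgue_integral_def
      by (intro Bochner_Integration.integral_cong) (use T in \<open>auto simp: indicator_def\<close>)
    have "plug_in M \<alpha> \<Lambda> f C r X \<Delta> a w (\<lambda>_. 1) Wmax m W 0 c sigma_est ((2 * T) powr (2/\<alpha> - 1))"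
      using f(2,3) T0 f_int sig set_integral_tail_tendsto[OF FT2 A1] unfolding c
      by unfold_locales (auto simp: wn)
    then show ?thesis by (rule conclusion)
  next

    \<comment> \<open>Unbounded support: growing window, \<beta> = b^(2/\<alpha> - 1)\<close>
    fix r b
    assume r': "r > max 2 (1/\<alpha>)" and F2: "(\<lambda>n. a n * \<omega> (\<Delta> n) powr (1 - 1/r)) \<longlonglongrightarrow> 0"
      and F3: "f \<in> O[at_infinity](\<lambda>t. \<bar>t\<bar> powr (- r))"
      and b0: "\<forall>n\<ge>1. b n > 0" and B1: "filterlim b at_top sequentially"
      and B2: "(\<lambda>n. b n powr (2/\<alpha> - 1) * (a n)\<^sup>2 * Wmax n) \<longlonglongrightarrow> 0"
      and B3: "(\<lambda>n. b n powr (2/\<alpha> - 1) * a n) \<in> o(\<lambda>n. (real n * \<Delta> n) powr (1/\<alpha>))"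
      and B4: "(\<lambda>n. b n powr (2/\<alpha> - 1) * a n ^ 4 * (\<Delta> n)\<^sup>2) \<longlonglongrightarrow> 0"
      and B5: "(\<lambda>n. b n powr (2/\<alpha> - 1) * (a n)\<^sup>2 * W2 n) \<in> o(\<lambda>n. (real n * \<Delta> n)\<^sup>2)"
      and B6: "(\<lambda>n. b n powr (2/\<alpha> - 1) * (a n)\<^sup>2 * \<omega> (\<Delta> n) powr (2 - 2/r)) \<longlonglongrightarrow> 0"
      and B7: "(\<lambda>n. b n powr (2/\<alpha> - 1) * (LINT u:{u. \<bar>u\<bar> > a n}|lborel. (Re (fourier g u))\<^sup>2)) \<longlonglongrightarrow> 0"
      and c: "c = b"
    define \<beta> where "\<beta> n = b n powr (2/\<alpha> - 1)" for n
    \<comment> \<open>The edge terms require (r - 1 + \<theta>) \<alpha> > 1 and, to match the power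
      in B3, 2 \<theta> - 2/\<alpha> \<le> - 1/\<alpha>. For \<alpha> \<ge> 1/2 the value 1 / (2
      \<alpha>) achieves both because (r - 1) \<alpha> > 1/2; for smaller \<alpha> the value 1 does
      because r \<alpha> > 1.\<close>
    define \<theta> where "\<theta> = min 1 (1 / (2 * \<alpha>))"
    have r: "r > 2" "r * \<alpha> > 1" using r' alpha by (auto simp: divide_less_eq mult.commute)
    have \<theta>: "0 \<le> \<theta>" "\<theta> \<le> 1" "2 * \<theta> - 2/\<alpha> \<le> - (1/\<alpha>)" unfolding \<theta>_def using alpha by (auto simp: min_def field_simps)
    have r\<theta>: "(r - 1 + \<theta>) * \<alpha> > 1"
    proof (cases "\<alpha> \<ge> 1/2")
      case True
      have "\<theta> = 1 / (2 * \<alpha>)" unfolding \<theta>_def using True alpha by (auto simp: min_def field_simps)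
      then have "\<theta> * \<alpha> = 1/2" using alpha by simp
      moreover have "1 * (1/2) < (r - 1) * \<alpha>" using r True by (intro mult_less_le_imp_less) auto
      ultimately show ?thesis by (simp add: distrib_right)
    next
      case False
      then have "\<theta> = 1" unfolding \<theta>_def using alpha by (auto simp: min_def field_simps)
      then show ?thesis using r by simp
    qed
    obtain C where dec: "decaying f C r" using decaying_bigo[OF fm bnd F3] r by auto
    have b1: "\<forall>\<^sub>F n in sequentially. b n \<ge> 1" using B1 unfolding filterlim_at_top by blast
    have \<beta>1: "\<forall>\<^sub>F n in sequentially. \<beta> n \<ge> 1"
      using b1 unfolding \<beta>_def by eventually_elim (use alpha in \<open>auto intro!: ge_one_powr_ge_zero simp: field_simps\<close>)
    have r1: "1 - 1/r > 0" using r by simp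
    \<comment> \<open>Since a n is eventually at least 1, F2 makes a positive power of w vanish;
      that power is then undone.\<close>
    have w_lim: "w \<longlonglongrightarrow> 0"
    proof -
      have "(\<lambda>n. w n powr (1 - 1/r)) \<longlonglongrightarrow> 0"
      proof (rule tendsto_zero_le[OF F2])
        show "\<forall>\<^sub>F n in sequentially. 0 \<le> w n powr (1 - 1/r) \<and> w n powr (1 - 1/r) \<le> a n * \<omega> (\<Delta> n) powr (1 - 1/r)"
          using a1
        proof eventually_elim
          case (elim n)
          show ?case using mult_right_mono[OF elim, of "w n powr (1 - 1/r)"] by (simp add: w_def)
        qed
      qed
      then have lim: "(\<lambda>n. (w n powr (1 - 1/r)) powr (1 / (1 - 1/r))) \<longlonglongrightarrow> 0"
        by (rule tendsto_powr_zero) (use r1 in auto)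
      show ?thesis
      proof (rule Lim_transform_eventually[OF lim])
        show "\<forall>\<^sub>F n in sequentially. (w n powr (1 - 1/r)) powr (1 / (1 - 1/r)) = w n"
          using eventually_ge_at_top[of 1]
        proof eventually_elim
          case (elim n)
          have "x * (1 / x) = 1" if "x > 0" for x :: real using that by simp
          note this[OF r1]
          then show ?case unfolding powr_powr using w0[OF elim] by simp
        qed
      qed
    qed
    \<comment> \<open>The hypotheses on b carry (a n)^2, which eventually dominates a n;
      \<open>y\<close> stands for the remaining factor of each of them.\<close>
    have bound: "(\<lambda>n. \<beta> n * a n * y n) \<longlonglongrightarrow> 0"
      if "(\<lambda>n. b n powr (2/\<alpha> - 1) * (a n)\<^sup>2 * y n) \<longlonglongrightarrow> 0" "\<forall>\<^sub>F n in sequentially. y n \<ge> 0" for y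
    proof (rule tendsto_zero_le[OF that(1)])
      show "\<forall>\<^sub>F n in sequentially. 0 \<le> \<beta> n * a n * y n \<and> \<beta> n * a n * y n \<le> b n powr (2/\<alpha> - 1) * (a n)\<^sup>2 * y n"
        using a1 \<beta>1 that(2)
      proof eventually_elim
        case (elim n)
        have "a n \<le> (a n)\<^sup>2" using elim by (simp add: power2_eq_square)
        then show ?case using elim unfolding \<beta>_def[symmetric] by (auto intro!: mult_right_mono mult_left_mono)
      qed
    qed
    have est': "estimation M \<alpha> \<Lambda> f C r X \<Delta> a w \<beta> Wmax m W \<theta>"
    proof (rule est[OF dec r w_lim \<theta>(1,2) r\<theta>])
      show "\<forall>\<^sub>F n in sequentially. 0 < \<beta> n" using \<beta>1 by eventually_elim auto
      show "(\<lambda>n. \<beta> n * a n * w n powr (2 - 2/r)) \<longlonglongrightarrow> 0"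
        by (rule bound) (use B6 in \<open>simp_all add: w_def\<close>)
      \<comment> \<open>B4 fits the pattern of \<open>bound\<close> after a^4 \<Delta>^2 is written
        as a^2 (a \<Delta>)^2; the result is the rate for a^3 \<Delta>^2.\<close>
      have "(\<lambda>n. \<beta> n * a n * (a n * \<Delta> n)\<^sup>2) \<longlonglongrightarrow> 0"
      proof (rule bound)
        show "(\<lambda>n. b n powr (2/\<alpha> - 1) * (a n)\<^sup>2 * (a n * \<Delta> n)\<^sup>2) \<longlonglongrightarrow> 0"
          using B4 by (simp add: power_mult_distrib mult.assoc power4_eq_xxxx power2_eq_square[of "a _"])
      qed simp
      then show "(\<lambda>n. \<beta> n * a n ^ 3 * (\<Delta> n)\<^sup>2) \<longlonglongrightarrow> 0"
        by (simp add: power3_eq_cube power2_eq_square mult_ac)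
      show "(\<lambda>n. \<beta> n * a n * (W2 n / (real n * \<Delta> n)\<^sup>2)) \<longlonglongrightarrow> 0"
      proof (rule bound)
        show "(\<lambda>n. b n powr (2/\<alpha> - 1) * (a n)\<^sup>2 * (W2 n / (real n * \<Delta> n)\<^sup>2)) \<longlonglongrightarrow> 0"
          using smalloD_tendsto[OF B5] by simp
        show "\<forall>\<^sub>F n in sequentially. 0 \<le> W2 n / (real n * \<Delta> n)\<^sup>2"
          using eventually_ge_at_top[of 1] by eventually_elim (use W20 in auto)
      qed
      show "(\<lambda>n. \<beta> n * Wmax n) \<longlonglongrightarrow> 0"
      proof (rule tendsto_zero_le[OF B2])
        show "\<forall>\<^sub>F n in sequentially. 0 \<le> \<beta> n * Wmax n \<and> \<beta> n * Wmax n \<le> b n powr (2/\<alpha> - 1) * (a n)\<^sup>2 * Wmax n"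
          using a1 \<beta>1 eventually_ge_at_top[of 1]
        proof eventually_elim
          case (elim n)
          have "1 \<le> (a n)\<^sup>2" using elim by simp
          then have "\<beta> n * 1 \<le> \<beta> n * (a n)\<^sup>2" using elim by (intro mult_left_mono) auto
          from mult_right_mono[OF this Wmax0[OF elim(3)]]
          show ?case using elim Wmax0[OF elim(3)] unfolding \<beta>_def[symmetric] by simp
        qed
      qed
      show "(\<lambda>n. \<beta> n * a n * (real n * \<Delta> n) powr (2 * \<theta> - 2/\<alpha>)) \<longlonglongrightarrow> 0"
      proof (rule tendsto_zero_le[OF smalloD_tendsto[OF B3]])
        show "\<forall>\<^sub>F n in sequentially. 0 \<le> \<beta> n * a n * (real n * \<Delta> n) powr (2 * \<theta> - 2/\<alpha>) \<and>
            \<beta> n * a n * (real n * \<Delta> n) powr (2 * \<theta> - 2/\<alpha>) \<le> b n powr (2/\<alpha> - 1) * a n / (real n * \<Delta> n) powr (1/\<alpha>)"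
          using a1 \<beta>1 N1
        proof eventually_elim
          case (elim n)
          have "(real n * \<Delta> n) powr (2 * \<theta> - 2/\<alpha>) \<le> (real n * \<Delta> n) powr (- (1/\<alpha>))"
            using elim \<theta>(3) by (intro powr_mono) auto
          then have "\<beta> n * a n * (real n * \<Delta> n) powr (2 * \<theta> - 2/\<alpha>) \<le> \<beta> n * a n * (real n * \<Delta> n) powr (- (1/\<alpha>))"
            using elim by (intro mult_left_mono) auto
          then show ?case using elim unfolding \<beta>_def[symmetric] by (simp add: powr_minus_divide)
        qed
      qed
    qed
    interpret estimation M \<alpha> \<Lambda> f C r X \<Delta> a w \<beta> Wmax m W \<theta> by (rule est')
    let ?L = "Lp_norm 2 f"
    have L: "?L \<noteq> 0"
    proof -
      obtain y where "f y \<noteq> 0" using f(3) by blast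
      then have "(LINT x|lborel. (f x)\<^sup>2) > 0"
        by (intro integral_pos_of_continuous[of _ y] integrable_square_of_bounded[OF integrable_h bnd] continuous_intros f_continuous) auto
      then show ?thesis unfolding Lp_norm_on_def set_lebesgue_integral_def by simp
    qed
    \<comment> \<open>The transform of f is real and nonnegative, so its squared modulus is the
      square of the real part that occurs in B7, up to the scaling between g and f.\<close>
    have FT_g: "(norm (FT f u))\<^sup>2 = ?L\<^sup>2 * (Re (fourier g u))\<^sup>2" for u
    proof -
      have "f = (\<lambda>t. ?L * g t)" unfolding g_def using L by auto
      then have 1: "FT f u = of_real ?L * FT g u" by (metis FT_cmult)
      obtain x where x: "x \<ge> 0" "FT f u = of_real x"
        using FT_nonneg[OF f(2), of u] by (auto elim: nonneg_Reals_cases)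
      have "Re (FT f u) = ?L * Re (fourier g u)" unfolding 1 fourier_eq_cnj_FT by simp
      then have "x = ?L * Re (fourier g u)" unfolding x(2) by simp
      moreover have "norm (FT f u) = x" unfolding x(2) using x(1) by simp
      ultimately show ?thesis by (simp only: power_mult_distrib)
    qed
    have "(\<lambda>n. ?L\<^sup>2 * (\<beta> n * (LINT u:{u. \<bar>u\<bar> > a n}|lborel. (Re (fourier g u))\<^sup>2))) \<longlonglongrightarrow> ?L\<^sup>2 * 0"
      unfolding \<beta>_def by (intro tendsto_mult tendsto_const B7)
    then have tail: "(\<lambda>n. \<beta> n * (LINT u:{u. \<bar>u\<bar> > a n}|lborel. (norm (FT f u))\<^sup>2)) \<longlonglongrightarrow> 0"
      unfolding FT_g by (simp add: mult.left_commute)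
    have c_ev: "\<forall>\<^sub>F n in sequentially. c n \<ge> 0 \<and> (2 * c n) powr (2/\<alpha> - 1) \<le> 2 powr (2/\<alpha> - 1) * \<beta> n"
      using b1 unfolding c \<beta>_def by eventually_elim (simp add: powr_mult)
    have wn: "(\<lambda>n. LINT t:{-c n..c n}|lborel. \<bar>f t\<bar> powr \<alpha>) \<longlonglongrightarrow> (LINT t|lborel. \<bar>f t\<bar> powr \<alpha>)"
      unfolding c by (rule set_integral_window_tendsto[OF f_int B1])
    have "plug_in M \<alpha> \<Lambda> f C r X \<Delta> a w \<beta> Wmax m W \<theta> c sigma_est (2 powr (2/\<alpha> - 1))"
      using f(2,3) \<beta>1 c_ev tail f_int wn sig by unfold_locales auto
    then show ?thesis by (rule conclusion)
  qed
qed

end
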